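(* Let $x\in\mathcal{T}\mathrm{Gr}(2,n)$ with vanishing set $J=J(x)$, let $ij\notin J$, let $T$ be a tree with $x\in\overline{\mathscr C_T}$, $\preceq$ a partial order on $[n]\smallsetminus\{i,j\}$ with the cherry property on $T$ with respect to $i,j$, and $I$ an index set compatible with $\preceq$ and $J(ij)$. Put $\rho_{kl}=\exp(x_{kl}-x_{ij})$ for $kl\ne ij$, and $$A=K\{\rho_{kl}^{-1}u_{kl},\ \rho_{kl}u_{kl}^{-1}: kl\in I\smallsetminus J\},\qquad B=A\{\rho_{rs}^{-1}f_{rs},\ \rho_{rs}f_{rs}^{-1}: rs\notin I\cup J\cup\{ij\}\},$$ so that $\mathrm{trop}^{-1}(x)=\mathcal M(B)$. Then $\mathrm{trop}^{-1}(x)=\mathcal M(B)$ contains a unique Shilov boundary point (i.e. the Shilov boundary of $B$ consists of exactly one point).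
   Context: $K$ is a field complete with respect to a non-Archimedean absolute value $|\cdot|$ (possibly trivial). Pairs $kl\in\binom{[n]}2$ are unordered. $\mathrm{Gr}(2,n)\subset\mathbb{P}_K^{\binom n2-1}$ is embedded by Plücker coordinates $p_{kl}$ ($p_{lk}=-p_{kl}$); $^{\mathrm{an}}$ is Berkovich analytification. $\overline{\mathbb R}=\mathbb R\cup\{-\infty\}$, $\log0=-\infty$, $\exp(-\infty)=0$. $\mathbb{TP}^{N}=(\overline{\mathbb R}^{N+1}\smallsetminus\{(-\infty,\dots,-\infty)\})/\mathbb R\cdot(1,\dots,1)$. $\mathrm{trop}\colon\mathrm{Gr}(2,n)^{\mathrm{an}}\to\mathbb{TP}^{\binom n2-1}$ sends $\gamma$ over $\{p_{ij}\ne0\}$ to the class of $x$ with $x_{kl}-x_{ij}=\log\gamma(p_{kl}/p_{ij})$; $\mathcal{T}\mathrm{Gr}(2,n)$ is its image; $J(x)=\{kl:x_{kl}=-\infty\}$. $R(ij)=K[u_{kl}:kl\in I(ij)]$ (polynomial ring), $u_{kl}=p_{kl}/p_{ij}$, $I(ij)=\{il,jl:l\ne i,j\}$, is the coordinate ring of $\{p_{ij}\ne0\}\subset\mathrm{Gr}(2,n)$; for $k,l\notin\{i,j\}$, $u_{kl}=u_{ik}u_{jl}-u_{il}u_{jk}\in R(ij)$. Trees: a tree $T$ on $n$ leaves is a finite connected acyclic graph without degree-two vertices whose leaves are labeled bijectively by $[n]$; inner edges are those not ending in a leaf. $\mathscr{C}_T\subset\mathbb R^{\binom n2}/\mathbb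 R\cdot(1,\dots,1)\subset\mathbb{TP}^{\binom n2-1}$ is the set of classes of vectors $x$ for which there is $\omega\colon E(T)\to\mathbb R$, nonnegative on inner edges, with $x_{kl}$ the sum of $\omega(e)$ over the edges $e$ of the path from $k$ to $l$; $\overline{\mathscr C_T}$ is its closure in $\mathbb{TP}^{\binom n2-1}$ (quotient topology, $[-\infty,a)$ being basic neighborhoods of $-\infty$). Given $i\ne j$, let $v_1,\dots,v_m$ be the internal vertices of the path from $i$ to $j$ in $T$, and let $T_a$ be the set of leaves $l\neq i,j$ whose path to the $i$–$j$ path first meets it at $v_a$. A quartet $\{a,b,c,d\}$ of $T$ is the subtree spanned by four leaves (degree-two vertices suppressed); a cherry is a pair of leaves adjacent to the same vertex. A partial order $\preceq$ on $[n]\smallsetminus\{i,j\}$ has the cherry property on $T$ with respect to $i,j$ if: leaves in different $T_a,T_b$ are incomparable; $\preceq$ is total on each $T_a$; and whenever $k\prec l\prec v$, either $\{k,l\}$ or $\{l,v\}$ is a cherry of the quartet $\{i,k,l,v\}$. Put $J(ij)=J\cap I(ij)$. A set $I\subset\binom{[n]}2$ of size $2(n-2)$ with $ij\notin I$ is compatible with $\preceq$ and $J(ij)$ if for each $a$ and each $k\in T_a$ exactly one of the following holds: (i) $ik,jk\in I$, and for all $l\prec k$ we have $il\in J(ij)$ or $jl\in J(ij)$; (ii) $ik\notin I$, $jl\in I$ for all $l\in T_a$, there is $t\prec k$ in $T_a$ with $it,jt\notin J(ij)$, and for the maximal such $t$, $kt\in I$; (iii) the same as (ii) with the roles of $i$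 and $j$ exchanged. Let $H=I\cap I(ij)$. The $u_{kl}$, $kl\in I$, are algebraically independent over $K$, and inside the fraction field of $R(ij)$ there is an inclusion $\mu\colon R(ij)\hookrightarrow K[u_{kl}:kl\in I][u_{kl}^{-1}:kl\in H\smallsetminus J]$. For $rs\notin J\cup\{ij\}$, $f_{rs}\in K[u_{kl}:kl\in I\smallsetminus J][u_{kl}^{-1}:kl\in H\smallsetminus J]$ is obtained from $\mu(u_{rs})$ by setting $u_{kl}=0$ for all $kl\in I\cap J$. The fiber $\mathrm{trop}^{-1}(x)$ lies in $\mathrm{Gr}_J(2,n)^{\mathrm{an}}$ ($\mathrm{Gr}_J(2,n)$ being the locus where exactly the Plücker coordinates in $J$ vanish) and is identified with $\mathcal M(B)$ via $u_{rs}\mapsto f_{rs}$. Affinoid algebras: $K\{r_1^{-1}x_1,r_1x_1^{-1},\dots,r_N^{-1}x_N,r_Nx_N^{-1}\}$ is the Banach algebra of series $\sum_{\alpha\in\mathbb Z^N}c_\alpha x^\alpha$ with $|c_\alpha|r^\alpha\to0$ as $\sum_i|\alpha_i|\to\infty$, with norm $\max_\alpha|c_\alpha|r^\alpha$. For an affinoid algebra $A$, $f,g\in A$, $r,s>0$: $A\{r^{-1}f,sg^{-1}\}=A\{r^{-1}x,sy\}/(x-f,gy-1)$, where $A\{r^{-1}x,sy\}=\{\sum_{m,n\ge0} a_{mn}x^my^n: a_{mn}\in A,\ \|a_{mn}\|r^ms^{-n}\to0\}$; this is iterated for several elements. $\mathcal M(B)$ is the Berkovich spectrum: bounded multiplicative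 seminorms on $B$ with the topology of pointwise convergence. The Shilov boundary is the unique inclusion-minimal closed subset $\Gamma\subset\mathcal M(B)$ such that for every $f\in B$ the function $\gamma\mapsto\gamma(f)$ on $\mathcal M(B)$ attains its maximum on $\Gamma$. *)

theory Defs
  imports
    "HOL-Analysis.Analysis"
    "HOL-Library.Poly_Mapping"
    "HOL-Algebra.QuotRing"
begin

section \<open>Complete non-Archimedean fields\<close>

text \<open>The metric is the one induced by the absolute value, which may be trivial. Nonnegativity
  and definiteness of the absolute value come from the metric.\<close>

class nonarch_field = field + complete_space +
  fixes absval :: "'a \<Rightarrow> real"
  assumes dist_absval: "dist x y = absval (x - y)"
    and absval_mult: "absval (x * y) = absval x * absval y"
    and absval_ultra: "absval (x + y) \<le> max (absval x) (absval y)"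
begin

lemma absval_nonneg: "0 \<le> absval x"
  using dist_absval[of x 0] zero_le_dist[of x 0] by simp

lemma absval_minus: "absval (- x) = absval x"
  using dist_absval[of x 0] dist_absval[of 0 x] dist_commute[of x 0] by simp

lemma absval_add_le: "absval (x + y) \<le> absval x + absval y"
  using absval_ultra[of x y] absval_nonneg[of x] absval_nonneg[of y] by (simp add: max_def split: if_splits)

end

text \<open>With this instance the library theory of \<^const>\<open>infsum\<close> applies to such fields.\<close>

instance nonarch_field \<subseteq> topological_ab_group_add
proof
  fix a b :: 'a
  show "((\<lambda>x. fst x + snd x) \<longlongrightarrow> a + b) (nhds a \<times>\<^sub>F nhds b)"
  proof (rule tendstoI)
    fix e :: real assume "e > 0"
    have "\<forall>\<^sub>F x in nhds a. dist x a < e / 2" "\<forall>\<^sub>F y in nhds b. dist y b < e / 2"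
      using \<open>e > 0\<close> by (auto simp: eventually_nhds_metric intro!: exI[of _ "e / 2"])
    then show "\<forall>\<^sub>F p in nhds a \<times>\<^sub>F nhds b. dist (fst p + snd p) (a + b) < e"
      unfolding eventually_prod_filter
    proof (intro exI conjI allI impI)
      fix x y :: 'a assume *: "dist x a < e / 2" "dist y b < e / 2"
      have "dist (x + y) (a + b) = absval ((x - a) + (y - b))"
        by (simp add: dist_absval algebra_simps)
      also have "\<dots> \<le> absval (x - a) + absval (y - b)" by (rule absval_add_le)
      also have "\<dots> < e" using * by (simp add: dist_absval)
      finally show "dist (fst (x, y) + snd (x, y)) (a + b) < e" by simp
    qed
  qed
  show "(uminus \<longlongrightarrow> - a) (nhds a)"
  proof (rule tendstoI)
    fix e :: real assume "e > 0"
    have "dist (- x) (- a) = dist x a" for x :: 'a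
      using absval_minus[of "x - a"] by (simp add: dist_absval)
    then show "\<forall>\<^sub>F x in nhds a. dist (- x) (- a) < e"
      using \<open>e > 0\<close> by (auto simp: eventually_nhds_metric)
  qed
qed


section \<open>Normed rings and Berkovich spectra\<close>

record 'a normed_ring = "'a ring" +
  nrm :: "'a \<Rightarrow> real"

definition mult_seminorms :: "('a, 'b) ring_scheme \<Rightarrow> ('a \<Rightarrow> real) set" where
  "mult_seminorms R = {\<gamma> \<in> extensional (carrier R).
     (\<forall>f\<in>carrier R. 0 \<le> \<gamma> f) \<and> \<gamma> \<zero>\<^bsub>R\<^esub> = 0 \<and> \<gamma> \<one>\<^bsub>R\<^esub> = 1 \<and>
     (\<forall>f\<in>carrier R. \<forall>g\<in>carrier R.
        \<gamma> (f \<otimes>\<^bsub>R\<^esub> g) = \<gamma> f * \<gamma> g \<and> \<gamma> (f \<oplus>\<^bsub>R\<^esub> g) \<le> \<gamma> f + \<gamma> g)}"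

definition berkovich_spec :: "('a, 'b) normed_ring_scheme \<Rightarrow> ('a \<Rightarrow> real) set" where
  "berkovich_spec B =
     {\<gamma> \<in> mult_seminorms B. \<exists>C. \<forall>f\<in>carrier B. \<gamma> f \<le> C * nrm B f}"

definition berkovich_top :: "('a, 'b) normed_ring_scheme \<Rightarrow> ('a \<Rightarrow> real) topology" where
  "berkovich_top B =
     subtopology (product_topology (\<lambda>_. euclideanreal) (carrier B)) (berkovich_spec B)"

definition max_attaining :: "('a, 'b) normed_ring_scheme \<Rightarrow> ('a \<Rightarrow> real) set \<Rightarrow> bool" where
  "max_attaining B \<Gamma> \<longleftrightarrow> closedin (berkovich_top B) \<Gamma> \<and>
     (\<forall>f\<in>carrier B. \<exists>\<gamma>\<in>\<Gamma>. \<forall>\<gamma>'\<in>berkovich_spec B. \<gamma>' f \<le> \<gamma> f)"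

definition minimal_max_attaining :: "('a, 'b) normed_ring_scheme \<Rightarrow> ('a \<Rightarrow> real) set \<Rightarrow> bool" where
  "minimal_max_attaining B \<Gamma> \<longleftrightarrow> max_attaining B \<Gamma> \<and> (\<forall>\<Delta>\<subset>\<Gamma>. \<not> max_attaining B \<Delta>)"

definition is_shilov_boundary :: "('a, 'b) normed_ring_scheme \<Rightarrow> ('a \<Rightarrow> real) set \<Rightarrow> bool" where
  "is_shilov_boundary B \<Gamma> \<longleftrightarrow>
     minimal_max_attaining B \<Gamma> \<and> (\<forall>\<Delta>. minimal_max_attaining B \<Delta> \<longrightarrow> \<Delta> = \<Gamma>)"


section \<open>Affinoid algebras\<close>

definition laurent_weight :: "('v \<Rightarrow> real) \<Rightarrow> ('v \<Rightarrow>\<^sub>0 int) \<Rightarrow> real" where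
  "laurent_weight r \<alpha> = (\<Prod>v\<in>Poly_Mapping.keys \<alpha>. r v powi Poly_Mapping.lookup \<alpha> v)"

text \<open>The algebra of Laurent series $K\{r_v^{-1} x_v, r_v x_v^{-1} : v \in V\}$, for finite \<open>V\<close>:
  the series with coefficients \<open>c \<alpha>\<close> is the function \<open>c\<close>.\<close>

definition laurent_algebra ::
    "'v set \<Rightarrow> ('v \<Rightarrow> real) \<Rightarrow> (('v \<Rightarrow>\<^sub>0 int) \<Rightarrow> 'k :: nonarch_field) normed_ring" where
  "laurent_algebra V r = \<lparr>
     carrier = {c. (\<forall>\<alpha>. c \<alpha> \<noteq> 0 \<longrightarrow> Poly_Mapping.keys \<alpha> \<subseteq> V) \<and>
       (\<forall>\<epsilon>>0. \<exists>N. \<forall>\<alpha>. Poly_Mapping.keys \<alpha> \<subseteq> V \<and>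
          N \<le> (\<Sum>v\<in>V. \<bar>Poly_Mapping.lookup \<alpha> v\<bar>) \<longrightarrow>
          absval (c \<alpha>) * laurent_weight r \<alpha> < \<epsilon>)},
     monoid.mult = (\<lambda>c d \<alpha>. infsum (\<lambda>\<beta>. c \<beta> * d (\<alpha> - \<beta>)) UNIV),
     one = (\<lambda>\<alpha>. if \<alpha> = 0 then 1 else 0),
     zero = (\<lambda>\<alpha>. 0),
     add = (\<lambda>c d \<alpha>. c \<alpha> + d \<alpha>),
     nrm = (\<lambda>c. SUP \<alpha>. absval (c \<alpha>) * laurent_weight r \<alpha>)\<rparr>"

definition power_weight :: "('v \<Rightarrow> real) \<Rightarrow> ('v \<Rightarrow>\<^sub>0 nat) \<Rightarrow> real" where
  "power_weight r m = (\<Prod>v\<in>Poly_Mapping.keys m. r v ^ Poly_Mapping.lookup m v)"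

text \<open>The algebra $A\{r_v^{-1} z_v : v \in V\}$ of power series over \<open>A\<close>, for finite \<open>V\<close>.\<close>

definition power_series_algebra ::
    "('a, 'b) normed_ring_scheme \<Rightarrow> 'v set \<Rightarrow> ('v \<Rightarrow> real) \<Rightarrow> (('v \<Rightarrow>\<^sub>0 nat) \<Rightarrow> 'a) normed_ring" where
  "power_series_algebra A V r = \<lparr>
     carrier = {h. (\<forall>m. h m \<in> carrier A) \<and> (\<forall>m. h m \<noteq> \<zero>\<^bsub>A\<^esub> \<longrightarrow> Poly_Mapping.keys m \<subseteq> V) \<and>
       (\<forall>\<epsilon>>0. \<exists>N. \<forall>m. Poly_Mapping.keys m \<subseteq> V \<and>
          N \<le> (\<Sum>v\<in>V. Poly_Mapping.lookup m v) \<longrightarrow>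
          nrm A (h m) * power_weight r m < \<epsilon>)},
     monoid.mult = (\<lambda>h g m. \<Oplus>\<^bsub>A\<^esub>p\<in>{p. \<exists>q. p + q = m}. h p \<otimes>\<^bsub>A\<^esub> g (m - p)),
     one = (\<lambda>m. if m = 0 then \<one>\<^bsub>A\<^esub> else \<zero>\<^bsub>A\<^esub>),
     zero = (\<lambda>m. \<zero>\<^bsub>A\<^esub>),
     add = (\<lambda>h g m. h m \<oplus>\<^bsub>A\<^esub> g m),
     nrm = (\<lambda>h. SUP m. nrm A (h m) * power_weight r m)\<rparr>"

definition series_const :: "('a, 'b) ring_scheme \<Rightarrow> 'a \<Rightarrow> ('v \<Rightarrow>\<^sub>0 nat) \<Rightarrow> 'a" where
  "series_const A a = (\<lambda>m. if m = 0 then a else \<zero>\<^bsub>A\<^esub>)"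

definition series_var :: "('a, 'b) ring_scheme \<Rightarrow> 'v \<Rightarrow> ('v \<Rightarrow>\<^sub>0 nat) \<Rightarrow> 'a" where
  "series_var A v = (\<lambda>m. if m = Poly_Mapping.single v 1 then \<one>\<^bsub>A\<^esub> else \<zero>\<^bsub>A\<^esub>)"

definition normed_quotient :: "('a, 'b) normed_ring_scheme \<Rightarrow> 'a set \<Rightarrow> 'a set normed_ring" where
  "normed_quotient R N = \<lparr>
     carrier = carrier (R Quot N), monoid.mult = monoid.mult (R Quot N), one = one (R Quot N),
     zero = zero (R Quot N), add = add (R Quot N), nrm = (\<lambda>X. INF h\<in>X. nrm R h)\<rparr>"

text \<open>$A\{r_s^{-1} f_s,\; t_s g_s^{-1} : s \in S\}$ for finite \<open>S\<close>, with all elements adjoined at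
  once: the variable $x_s$ of radius $r_s$ is \<open>Inl s\<close>, the variable $y_s$ of radius $t_s^{-1}$
  is \<open>Inr s\<close>, and one divides by the ideal of all $x_s - f_s$ and $g_s y_s - 1$.\<close>

definition laurent_domain_algebra ::
    "('a, 'b) normed_ring_scheme \<Rightarrow> 's set \<Rightarrow> ('s \<Rightarrow> real) \<Rightarrow> ('s \<Rightarrow> 'a) \<Rightarrow> ('s \<Rightarrow> real) \<Rightarrow> ('s \<Rightarrow> 'a) \<Rightarrow>
      (('s + 's \<Rightarrow>\<^sub>0 nat) \<Rightarrow> 'a) set normed_ring" where
  "laurent_domain_algebra A S r f t g =
     (let P = power_series_algebra A (S <+> S) (case_sum r (\<lambda>s. 1 / t s))
      in normed_quotient P (genideal P
           ({series_var A (Inl s) \<ominus>\<^bsub>P\<^esub> series_const A (f s) | s. s \<in> S} \<union>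
            {series_const A (g s) \<otimes>\<^bsub>P\<^esub> series_var A (Inr s) \<ominus>\<^bsub>P\<^esub> \<one>\<^bsub>P\<^esub> | s. s \<in> S})))"


section \<open>Tropical projective space\<close>

text \<open>An unordered pair is a two-element set.\<close>

definition pairs :: "nat \<Rightarrow> nat set set" where
  "pairs n = {{k, l} | k l. k \<in> {1..n} \<and> l \<in> {1..n} \<and> k \<noteq> l}"

definition tvecs :: "nat \<Rightarrow> (nat set \<Rightarrow> ereal) set" where
  "tvecs n = {x \<in> pairs n \<rightarrow>\<^sub>E {..<\<infinity>}. \<exists>e\<in>pairs n. x e \<noteq> -\<infinity>}"

definition tp_class :: "nat \<Rightarrow> (nat set \<Rightarrow> ereal) \<Rightarrow> (nat set \<Rightarrow> ereal) set" where
  "tp_class n x = {restrict (\<lambda>e. x e + ereal c) (pairs n) | c. True}"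

definition tvec_top :: "nat \<Rightarrow> (nat set \<Rightarrow> ereal) topology" where
  "tvec_top n =
     subtopology (product_topology (\<lambda>_. top_of_set {..<\<infinity>}) (pairs n)) (tvecs n)"

text \<open>The quotient topology on $\mathbb{TP}^{\binom n2 - 1}$, whose points are the classes
  \<open>tp_class n x\<close> with \<open>x \<in> tvecs n\<close>.\<close>

definition tp_top :: "nat \<Rightarrow> (nat set \<Rightarrow> ereal) set topology" where
  "tp_top n = topology (\<lambda>U. U \<subseteq> tp_class n ` tvecs n \<and>
     openin (tvec_top n) {x \<in> tvecs n. tp_class n x \<in> U})"

definition vanishing_set :: "nat \<Rightarrow> (nat set \<Rightarrow> ereal) \<Rightarrow> nat set set" where
  "vanishing_set n x = {e \<in> pairs n. x e = -\<infinity>}"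

definition trop_log :: "real \<Rightarrow> ereal" where
  "trop_log t = (if t = 0 then -\<infinity> else ereal (ln t))"

definition trop_exp :: "ereal \<Rightarrow> real" where
  "trop_exp z = (if z = -\<infinity> then 0 else exp (real_of_ereal z))"


section \<open>The tropical Grassmannian of planes\<close>

type_synonym 'k lpoly = "(nat set \<Rightarrow>\<^sub>0 int) \<Rightarrow>\<^sub>0 'k"

text \<open>$K[u_e : e \in V][u_e^{-1} : e \in W]$ inside the ring of Laurent polynomials in variables
  indexed by unordered pairs.\<close>

definition lpolys :: "nat set set \<Rightarrow> nat set set \<Rightarrow> 'k :: field lpoly set" where
  "lpolys V W = {P. \<forall>\<alpha>\<in>Poly_Mapping.keys P. Poly_Mapping.keys \<alpha> \<subseteq> V \<and>
     (\<forall>e. Poly_Mapping.lookup \<alpha> e < 0 \<longrightarrow> e \<in> W)}"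

definition lconst :: "'k :: field \<Rightarrow> 'k lpoly" where
  "lconst c = Poly_Mapping.single 0 c"

definition lvar :: "nat set \<Rightarrow> 'k :: field lpoly" where
  "lvar e = Poly_Mapping.single (Poly_Mapping.single e 1) 1"

definition chart_index :: "nat \<Rightarrow> nat \<Rightarrow> nat \<Rightarrow> nat set set" where
  "chart_index n i j = {{i, l} | l. l \<in> {1..n} - {i, j}} \<union> {{j, l} | l. l \<in> {1..n} - {i, j}}"

text \<open>The ring $R(ij)$.\<close>

definition chart_ring :: "nat \<Rightarrow> nat \<Rightarrow> nat \<Rightarrow> 'k :: field lpoly ring" where
  "chart_ring n i j = \<lparr>carrier = lpolys (chart_index n i j) {}, monoid.mult = (*), one = 1,
     zero = 0, add = (+)\<rparr>"

text \<open>The element $u_e = p_e / p_{ij}$ of $R(ij)$. The sign is fixed by writing $i$ or $j$ first if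
  \<open>e\<close> meets \<open>{i, j}\<close> in one point (so that $u_{il} = p_{il}/p_{ij}$ and $u_{jl} = p_{jl}/p_{ij}$ are
  the variables), and the smaller index first if \<open>e\<close> is disjoint from \<open>{i, j}\<close>. Another choice
  replaces some $u_e$ by $-u_e$.\<close>

definition chart_coord :: "nat \<Rightarrow> nat \<Rightarrow> nat \<Rightarrow> nat set \<Rightarrow> 'k :: field lpoly" where
  "chart_coord n i j e =
     (if e = {i, j} then 1
      else if e \<in> chart_index n i j then lvar e
      else (let k = Min e; l = Max e
            in lvar {i, k} * lvar {j, l} - lvar {i, l} * lvar {j, k}))"

text \<open>The analytification of the chart $\{p_{ij} \neq 0\}$; $\mathrm{Gr}(2,n)^{\mathrm{an}}$ is the
  union of these, so the image of trop is the union of the images of the charts.\<close>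

definition chart_an :: "nat \<Rightarrow> nat \<Rightarrow> nat \<Rightarrow> ('k :: nonarch_field lpoly \<Rightarrow> real) set" where
  "chart_an n i j = {\<gamma> \<in> mult_seminorms (chart_ring n i j). \<forall>c. \<gamma> (lconst c) = absval c}"

definition trop :: "nat \<Rightarrow> nat \<Rightarrow> nat \<Rightarrow> ('k :: nonarch_field lpoly \<Rightarrow> real) \<Rightarrow> (nat set \<Rightarrow> ereal) set" where
  "trop n i j \<gamma> = tp_class n (\<lambda>e. trop_log (\<gamma> (chart_coord n i j e)))"

definition trop_Gr :: "'k :: nonarch_field itself \<Rightarrow> nat \<Rightarrow> (nat set \<Rightarrow> ereal) set set" where
  "trop_Gr (_ :: 'k itself) n = {trop n i j \<gamma> | i j (\<gamma> :: 'k lpoly \<Rightarrow> real).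
     i \<in> {1..n} \<and> j \<in> {1..n} \<and> i \<noteq> j \<and> \<gamma> \<in> chart_an n i j}"


section \<open>Trees\<close>

record 'v graph =
  verts :: "'v set"
  edges :: "'v set set"

definition is_path :: "'v graph \<Rightarrow> 'v list \<Rightarrow> bool" where
  "is_path G p \<longleftrightarrow> p \<noteq> [] \<and> distinct p \<and> set p \<subseteq> verts G \<and>
     successively (\<lambda>a b. {a, b} \<in> edges G) p"

definition is_tree :: "'v graph \<Rightarrow> bool" where
  "is_tree G \<longleftrightarrow> finite (verts G) \<and> verts G \<noteq> {} \<and>
     edges G \<subseteq> {{a, b} | a b. a \<in> verts G \<and> b \<in> verts G \<and> a \<noteq> b} \<and>
     (\<forall>a\<in>verts G. \<forall>b\<in>verts G. \<exists>p. is_path G p \<and> hd p = a \<and> last p = b) \<and>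
     \<not> (\<exists>p. is_path G p \<and> 3 \<le> length p \<and> {last p, hd p} \<in> edges G)"

definition vdegree :: "'v graph \<Rightarrow> 'v \<Rightarrow> nat" where
  "vdegree G v = card {e \<in> edges G. v \<in> e}"

definition leaves :: "'v graph \<Rightarrow> 'v set" where
  "leaves G = {v \<in> verts G. vdegree G v = 1}"

definition leaf_labelled_tree :: "nat \<Rightarrow> 'v graph \<Rightarrow> (nat \<Rightarrow> 'v) \<Rightarrow> bool" where
  "leaf_labelled_tree n T lab \<longleftrightarrow>
     is_tree T \<and> (\<forall>v\<in>verts T. vdegree T v \<noteq> 2) \<and> bij_betw lab {1..n} (leaves T)"

definition tree_path :: "'v graph \<Rightarrow> 'v \<Rightarrow> 'v \<Rightarrow> 'v list" where
  "tree_path G a b = (THE p. is_path G p \<and> hd p = a \<and> last p = b)"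

definition path_edges :: "'v list \<Rightarrow> 'v set set" where
  "path_edges p = {{p ! k, p ! Suc k} | k. Suc k < length p}"

definition inner_edges :: "'v graph \<Rightarrow> 'v set set" where
  "inner_edges G = {e \<in> edges G. e \<inter> leaves G = {}}"

text \<open>The cone $\mathscr C_T$.\<close>

definition tree_cone :: "nat \<Rightarrow> 'v graph \<Rightarrow> (nat \<Rightarrow> 'v) \<Rightarrow> (nat set \<Rightarrow> ereal) set set" where
  "tree_cone n T lab = {tp_class n x | x. x \<in> tvecs n \<and>
     (\<exists>\<omega> :: 'v set \<Rightarrow> real. (\<forall>e\<in>inner_edges T. 0 \<le> \<omega> e) \<and>
       (\<forall>k\<in>{1..n}. \<forall>l\<in>{1..n}. k \<noteq> l \<longrightarrow>
          x {k, l} = ereal (\<Sum>e\<in>path_edges (tree_path T (lab k) (lab l)). \<omega> e)))}"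

definition path_interior :: "'v graph \<Rightarrow> (nat \<Rightarrow> 'v) \<Rightarrow> nat \<Rightarrow> nat \<Rightarrow> 'v set" where
  "path_interior T lab i j = set (tree_path T (lab i) (lab j)) - {lab i, lab j}"

definition attach_vertex :: "'v graph \<Rightarrow> (nat \<Rightarrow> 'v) \<Rightarrow> nat \<Rightarrow> nat \<Rightarrow> nat \<Rightarrow> 'v" where
  "attach_vertex T lab i j l =
     hd (filter (\<lambda>v. v \<in> set (tree_path T (lab i) (lab j))) (tree_path T (lab l) (lab i)))"

text \<open>The set $T_a$ of leaves, indexed by the vertex $v_a$ rather than by $a$.\<close>

definition branch :: "nat \<Rightarrow> 'v graph \<Rightarrow> (nat \<Rightarrow> 'v) \<Rightarrow> nat \<Rightarrow> nat \<Rightarrow> 'v \<Rightarrow> nat set" where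
  "branch n T lab i j v = {l \<in> {1..n} - {i, j}. attach_vertex T lab i j l = v}"

definition spanned_subtree :: "'v graph \<Rightarrow> 'v set \<Rightarrow> 'v graph" where
  "spanned_subtree G L = \<lparr>verts = (\<Union>a\<in>L. \<Union>b\<in>L. set (tree_path G a b)),
     edges = (\<Union>a\<in>L. \<Union>b\<in>L. path_edges (tree_path G a b))\<rparr>"

definition suppress_deg2 :: "'v graph \<Rightarrow> 'v graph" where
  "suppress_deg2 G = \<lparr>verts = {v \<in> verts G. vdegree G v \<noteq> 2},
     edges = {{hd p, last p} | p. is_path G p \<and> 2 \<le> length p \<and>
       vdegree G (hd p) \<noteq> 2 \<and> vdegree G (last p) \<noteq> 2 \<and>
       (\<forall>v\<in>set p - {hd p, last p}. vdegree G v = 2)}\<rparr>"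

definition is_cherry :: "'v graph \<Rightarrow> 'v \<Rightarrow> 'v \<Rightarrow> bool" where
  "is_cherry G a b \<longleftrightarrow> a \<noteq> b \<and> a \<in> leaves G \<and> b \<in> leaves G \<and>
     (\<exists>w\<in>verts G. {a, w} \<in> edges G \<and> {b, w} \<in> edges G)"

definition quartet :: "'v graph \<Rightarrow> (nat \<Rightarrow> 'v) \<Rightarrow> nat set \<Rightarrow> 'v graph" where
  "quartet T lab Q = suppress_deg2 (spanned_subtree T (lab ` Q))"

text \<open>Partial orders are relations: \<open>(k, l) \<in> ord\<close> means $k \preceq l$.\<close>

definition strictly_below :: "nat rel \<Rightarrow> nat \<Rightarrow> nat \<Rightarrow> bool" where
  "strictly_below ord k l \<longleftrightarrow> (k, l) \<in> ord \<and> k \<noteq> l"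

definition cherry_property ::
    "nat \<Rightarrow> 'v graph \<Rightarrow> (nat \<Rightarrow> 'v) \<Rightarrow> nat \<Rightarrow> nat \<Rightarrow> nat rel \<Rightarrow> bool" where
  "cherry_property n T lab i j ord \<longleftrightarrow>
     (\<forall>a\<in>path_interior T lab i j. \<forall>b\<in>path_interior T lab i j. a \<noteq> b \<longrightarrow>
        (\<forall>k\<in>branch n T lab i j a. \<forall>l\<in>branch n T lab i j b. (k, l) \<notin> ord)) \<and>
     (\<forall>a\<in>path_interior T lab i j. total_on (branch n T lab i j a) ord) \<and>
     (\<forall>k l v. strictly_below ord k l \<and> strictly_below ord l v \<longrightarrow>
        is_cherry (quartet T lab {i, k, l, v}) (lab k) (lab l) \<or>
        is_cherry (quartet T lab {i, k, l, v}) (lab l) (lab v))"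


section \<open>Compatible index sets\<close>

text \<open>The arguments \<open>L\<close> and \<open>Jij\<close> stand for $T_a$ and $J(ij)$; the third condition is the second
  one with \<open>i\<close> and \<open>j\<close> exchanged.\<close>

definition compat_both :: "nat rel \<Rightarrow> nat set \<Rightarrow> nat set set \<Rightarrow> nat \<Rightarrow> nat \<Rightarrow> nat set set \<Rightarrow> nat \<Rightarrow> bool" where
  "compat_both ord L Jij i j I k \<longleftrightarrow> {i, k} \<in> I \<and> {j, k} \<in> I \<and>
     (\<forall>l\<in>L. strictly_below ord l k \<longrightarrow> {i, l} \<in> Jij \<or> {j, l} \<in> Jij)"

definition compat_one :: "nat rel \<Rightarrow> nat set \<Rightarrow> nat set set \<Rightarrow> nat \<Rightarrow> nat \<Rightarrow> nat set set \<Rightarrow> nat \<Rightarrow> bool" where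
  "compat_one ord L Jij i j I k \<longleftrightarrow> {i, k} \<notin> I \<and> (\<forall>l\<in>L. {j, l} \<in> I) \<and>
     (let C = {t \<in> L. strictly_below ord t k \<and> {i, t} \<notin> Jij \<and> {j, t} \<notin> Jij}
      in \<exists>t\<in>C. (\<forall>s\<in>C. (s, t) \<in> ord) \<and> {k, t} \<in> I)"

definition compatible ::
    "nat \<Rightarrow> 'v graph \<Rightarrow> (nat \<Rightarrow> 'v) \<Rightarrow> nat \<Rightarrow> nat \<Rightarrow> nat rel \<Rightarrow> nat set set \<Rightarrow> nat set set \<Rightarrow> bool" where
  "compatible n T lab i j ord Jij I \<longleftrightarrow>
     I \<subseteq> pairs n \<and> card I = 2 * (n - 2) \<and> {i, j} \<notin> I \<and>
     (\<forall>a\<in>path_interior T lab i j. \<forall>k\<in>branch n T lab i j a.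
        let L = branch n T lab i j a;
            c1 = compat_both ord L Jij i j I k;
            c2 = compat_one ord L Jij i j I k;
            c3 = compat_one ord L Jij j i I k
        in (c1 \<and> \<not> c2 \<and> \<not> c3) \<or> (\<not> c1 \<and> c2 \<and> \<not> c3) \<or> (\<not> c1 \<and> \<not> c2 \<and> c3))"


section \<open>The coordinate functions on a fiber\<close>

text \<open>Substitution of the elements $u_e \in R(ij)$ for the variables. Only variables with
  $e \in I(ij)$, for which $u_e$ is itself a variable of $R(ij)$, are ever inverted, so this
  takes place in $K[u_e^{\pm 1} : e \in I(ij)]$, a subring of the fraction field of $R(ij)$.\<close>

definition coord_power :: "nat \<Rightarrow> nat \<Rightarrow> nat \<Rightarrow> nat set \<Rightarrow> int \<Rightarrow> 'k :: field lpoly" where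
  "coord_power n i j e z =
     (if 0 \<le> z then chart_coord n i j e ^ nat z
      else Poly_Mapping.single (Poly_Mapping.single e z) 1)"

definition coord_subst :: "nat \<Rightarrow> nat \<Rightarrow> nat \<Rightarrow> 'k :: field lpoly \<Rightarrow> 'k lpoly" where
  "coord_subst n i j P =
     (\<Sum>\<alpha>\<in>Poly_Mapping.keys P. lconst (Poly_Mapping.lookup P \<alpha>) *
       (\<Prod>e\<in>Poly_Mapping.keys \<alpha>. coord_power n i j e (Poly_Mapping.lookup \<alpha> e)))"

text \<open>The inclusion $\mu$ of $R(ij)$ into $K[u_e : e \in I][u_e^{-1} : e \in H \smallsetminus J]$:
  $\mu(g)$ is the unique expression of \<open>g\<close> in terms of the algebraically independent elements $u_e$,
  $e \in I$.\<close>

definition chart_incl :: "nat \<Rightarrow> nat \<Rightarrow> nat \<Rightarrow> nat set set \<Rightarrow> nat set set \<Rightarrow> 'k :: field lpoly \<Rightarrow> 'k lpoly" where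
  "chart_incl n i j I J g =
     (THE P. P \<in> lpolys I (I \<inter> chart_index n i j - J) \<and> coord_subst n i j P = g)"

definition set_vars_zero :: "nat set set \<Rightarrow> 'k :: field lpoly \<Rightarrow> 'k lpoly" where
  "set_vars_zero Z P =
     (\<Sum>\<alpha>\<in>{\<alpha> \<in> Poly_Mapping.keys P. Poly_Mapping.keys \<alpha> \<inter> Z = {}}.
        Poly_Mapping.single \<alpha> (Poly_Mapping.lookup P \<alpha>))"

text \<open>The element $f_e$; as an element of $K\{\rho_{kl}^{-1} u_{kl}, \rho_{kl} u_{kl}^{-1} :
  kl \in I \smallsetminus J\}$ it is the series \<open>lookup (fiber_coord n i j I J e)\<close>.\<close>

definition fiber_coord ::
    "nat \<Rightarrow> nat \<Rightarrow> nat \<Rightarrow> nat set set \<Rightarrow> nat set set \<Rightarrow> nat set \<Rightarrow> 'k :: field lpoly" where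
  "fiber_coord n i j I J e = set_vars_zero (I \<inter> J) (chart_incl n i j I J (chart_coord n i j e))"

end

theory Submission
  imports Defs
begin

text \<open>The norm of \<open>A\<close> is multiplicative (Gauss' lemma), and every \<open>f\<^bsub>rs\<^esub>\<close> has Gauss norm
  \<open>\<rho>\<^bsub>rs\<^esub>\<close>: the slopes \<open>u\<^bsub>ik\<^esub> / u\<^bsub>jk\<^esub>\<close> are sums of pairwise distinct monomials, and by the
  cherry property the four-point conditions, which survive the passage to the closure of the cone,
  select the dominant one. Hence each \<open>f\<^bsub>rs\<^esub>\<close> becomes invertible in \<open>B\<close> with the inverse of its
  norm. The fractions of elements of \<open>A\<close> by products of the \<open>f\<^bsub>rs\<^esub>\<close> are dense in \<open>B\<close>, so the residue
  norm of \<open>B\<close> is again multiplicative. A multiplicative norm dominates every bounded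
  multiplicative seminorm, and is therefore the only point of the Shilov boundary.\<close>

section \<open>Spectra of algebras with multiplicative norm\<close>

text \<open>Two obstacles shape the proof. The residue norm of \<open>B\<close> is an infimum over a
  coset of an ideal and might drop on elements of \<open>A\<close>, and the \<open>f_rs\<close>
  cannot be inverted in \<open>A\<close> in order to evaluate series there. But a truncation at
  degree \<open>N\<close> takes values in \<open>A\<close> after multiplication by the
  \<open>N\<close>-th power of the product of the \<open>f_rs\<close>. On a multiple of a generator
  of the ideal this evaluation leaves only terms of degree exactly \<open>N\<close>, which are small
  compared with the \<open>N\<close>-th power of the norm of the product; so \<open>A\<close> embeds
  isometrically. On the combinatorial side, let \<open>p\<close> be that of \<open>i\<close>,
  \<open>j\<close> for which all \<open>{p, k}\<close> of a branch lie in \<open>I\<close>, let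
  \<open>o\<close> be the other one, and call \<open>u_ok / u_pk\<close> the slope of
  \<open>k\<close>. By the Pluecker relation the slopes of \<open>k\<close> and \<open>t\<close>
  differ by \<open>u_kt / (u_pk u_pt)\<close> up to sign. A slope is therefore a telescoping sum
  along leaves below \<open>k\<close>; each step brings in a variable \<open>u_kt\<close> that
  occurs in no earlier one, so nothing cancels and Gauss norms are maxima. The same formulas invert
  the substitution that defines \<open>mu\<close>, and so give its values.\<close>

lemma mult_seminorms_power:
  assumes "ring R" "\<gamma> \<in> mult_seminorms R" "f \<in> carrier R"
  shows "\<gamma> (f [^]\<^bsub>R\<^esub> (k::nat)) = \<gamma> f ^ k"
proof -
  interpret ring R by fact
  show ?thesis using assms(2,3)
    by (induction k) (auto simp: mult_seminorms_def mult.commute)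
qed

text \<open>The constant disappears on taking \<open>k\<close>-th roots; equivalently, if
  \<open>b < a\<close> then \<open>(b / a) ^ k\<close> eventually drops below
  \<open>1 / C\<close>.\<close>

lemma real_le_if_powers_le:
  fixes a b C :: real
  assumes "\<And>k. a ^ k \<le> C * b ^ k" "0 \<le> a" "0 \<le> b"
  shows "a \<le> b"
proof (rule ccontr)
  assume "\<not> a \<le> b"
  then have ab: "b < a" by simp
  then have a: "a > 0" using assms by simp
  show False
  proof (cases "C \<le> 0")
    case True
    then show False using assms(1)[of 1] assms(3) a mult_nonpos_nonneg[of C b] by simp
  next
    case False
    have "(\<lambda>k. (b / a) ^ k) \<longlonglongrightarrow> 0"
      using ab a assms by (intro LIMSEQ_power_zero) auto
    then have "\<forall>\<^sub>F k in sequentially. (b / a) ^ k < 1 / C"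
      using False by (intro order_tendstoD) auto
    then obtain k where "(b / a) ^ k < 1 / C" by (auto simp: eventually_sequentially)
    then have "C * b ^ k < a ^ k" using a False by (simp add: field_simps power_divide)
    then show False using assms(1)[of k] by simp
  qed
qed

text \<open>Applied to the powers of \<open>f\<close>, the boundedness constant of
  \<open>\<gamma>\<close> stays fixed while the two values are raised to the power
  \<open>k\<close>.\<close>

lemma berkovich_spec_le_nrm:
  assumes "ring B" "\<And>f k. f \<in> carrier B \<Longrightarrow> nrm B (f [^]\<^bsub>B\<^esub> (k::nat)) = nrm B f ^ k"
    and "\<And>f. f \<in> carrier B \<Longrightarrow> 0 \<le> nrm B f"
    and "\<gamma> \<in> berkovich_spec B" "f \<in> carrier B"
  shows "\<gamma> f \<le> nrm B f"
proof -
  interpret ring B by fact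
  obtain C where "\<And>g. g \<in> carrier B \<Longrightarrow> \<gamma> g \<le> C * nrm B g"
    and \<gamma>: "\<gamma> \<in> mult_seminorms B" using assms(4) by (auto simp: berkovich_spec_def)
  then have le: "\<gamma> f ^ k \<le> C * nrm B f ^ k" for k
    using mult_seminorms_power[OF assms(1) \<gamma> assms(5), of k] assms(2)[OF assms(5), of k] assms(5)
    by (metis nat_pow_closed)
  have "0 \<le> \<gamma> f" using \<gamma> assms(5) by (simp add: mult_seminorms_def)
  with le show ?thesis using assms(3)[OF assms(5)] by (rule real_le_if_powers_le)
qed

text \<open>If a closed set misses \<open>\<eta>\<close>, then finitely many elements separate \<open>\<eta>\<close> from it, and on their
  product no point of the set reaches the value of \<open>\<eta>\<close>.\<close>

lemma maximal_point_in_max_attaining: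
  assumes B: "cring B" and \<eta>: "\<eta> \<in> berkovich_spec B"
    and max: "\<And>\<gamma> f. \<gamma> \<in> berkovich_spec B \<Longrightarrow> f \<in> carrier B \<Longrightarrow> \<gamma> f \<le> \<eta> f"
    and \<Delta>: "max_attaining B \<Delta>"
  shows "\<eta> \<in> \<Delta>"
proof (rule ccontr)
  assume n: "\<eta> \<notin> \<Delta>"
  interpret cring B by fact
  let ?T = "product_topology (\<lambda>_. euclideanreal) (carrier B)"
  have ms: "\<gamma> \<in> mult_seminorms B" if "\<gamma> \<in> berkovich_spec B" for \<gamma>
    using that by (auto simp: berkovich_spec_def)
  have sub: "berkovich_spec B \<subseteq> topspace ?T"
    using ms by (auto simp: mult_seminorms_def PiE_def)
  have ts: "topspace (berkovich_top B) = berkovich_spec B"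
    using sub by (auto simp: berkovich_top_def)
  have cl: "closedin (berkovich_top B) \<Delta>" using \<Delta> by (auto simp: max_attaining_def)
  then have \<Delta>s: "\<Delta> \<subseteq> berkovich_spec B" using closedin_subset ts by fastforce
  have "openin (berkovich_top B) (berkovich_spec B - \<Delta>)"
    using cl ts by (auto simp: closedin_def)
  then obtain U where U: "openin ?T U" "berkovich_spec B - \<Delta> = U \<inter> berkovich_spec B"
    by (auto simp: berkovich_top_def openin_subtopology)
  then have "\<eta> \<in> U" using \<eta> n by auto
  then obtain X where X: "finite {f \<in> carrier B. X f \<noteq> UNIV}" "\<And>f. f \<in> carrier B \<Longrightarrow> open (X f)"
      "\<eta> \<in> (\<Pi>\<^sub>E f\<in>carrier B. X f)" "(\<Pi>\<^sub>E f\<in>carrier B. X f) \<subseteq> U"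
    using U(1) by (auto simp: openin_product_topology_alt)
  \<comment> \<open>Where \<open>\<eta>\<close> vanishes, so does every point of the spectrum by
    maximality; such elements separate nothing, and as factors they would make the product
    useless.\<close>
  define F where "F = {f \<in> carrier B. X f \<noteq> UNIV \<and> \<eta> f \<noteq> 0}"
  have F: "finite F" "F \<subseteq> carrier B" using finite_subset[OF _ X(1), of F] by (auto simp: F_def)
  define b where "b = finprod B (\<lambda>f. f) F"
  have b: "b \<in> carrier B" unfolding b_def using F by (intro finprod_closed) auto
  have prod: "\<gamma> (finprod B (\<lambda>f. f) G) = (\<Prod>f\<in>G. \<gamma> f)"
    if "\<gamma> \<in> berkovich_spec B" "finite G" "G \<subseteq> carrier B" for \<gamma> G
    using that(2,3)
  proof (induction G)
    case empty
    then show ?case using ms[OF that(1)] by (simp add: mult_seminorms_def)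
  next
    case (insert f G)
    have "finprod B (\<lambda>f. f) G \<in> carrier B" using insert by (intro finprod_closed) auto
    then show ?case using ms[OF that(1)] insert
      by (subst finprod_insert) (auto simp: mult_seminorms_def)
  qed
  obtain \<gamma> where \<gamma>: "\<gamma> \<in> \<Delta>" "\<eta> b \<le> \<gamma> b"
    using \<Delta> b \<eta> unfolding max_attaining_def by blast
  then have \<gamma>s: "\<gamma> \<in> berkovich_spec B" using \<Delta>s by auto
  have "\<gamma> \<notin> U" using \<gamma> U \<gamma>s by auto
  then have "\<gamma> \<notin> (\<Pi>\<^sub>E f\<in>carrier B. X f)" using X(4) by auto
  then obtain g where g: "g \<in> carrier B" "\<gamma> g \<notin> X g"
    using ms[OF \<gamma>s] by (auto simp: mult_seminorms_def PiE_def)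
  have \<eta>g: "\<eta> g \<in> X g" using X(3) g by auto
  have nn: "0 \<le> \<gamma> f" "\<gamma> f \<le> \<eta> f" if "f \<in> carrier B" for f
    using max[OF \<gamma>s that] ms[OF \<gamma>s] that by (auto simp: mult_seminorms_def)
  have lt: "\<gamma> g < \<eta> g" proof -
    have "\<gamma> g \<noteq> \<eta> g" using g(2) \<eta>g by auto
    then show ?thesis using nn(2)[OF g(1)] by simp
  qed
  have gF: "g \<in> F" using g \<eta>g lt nn[OF g(1)] by (auto simp: F_def)
  have pos: "0 < \<eta> f" if "f \<in> F" for f
    using that nn[of f] unfolding F_def by auto
  have "\<gamma> b = \<gamma> g * (\<Prod>f\<in>F - {g}. \<gamma> f)"
    using prod[OF \<gamma>s F] F gF unfolding b_def by (simp add: prod.remove)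
  also have "\<dots> \<le> \<gamma> g * (\<Prod>f\<in>F - {g}. \<eta> f)"
    using nn F gF g by (intro mult_left_mono prod_mono) auto
  also have "\<dots> < \<eta> g * (\<Prod>f\<in>F - {g}. \<eta> f)"
    using lt pos by (intro mult_strict_right_mono prod_pos) auto
  also have "\<dots> = \<eta> b"
    using prod[OF \<eta> F] F gF unfolding b_def by (simp add: prod.remove)
  finally show False using \<gamma>(2) by simp
qed

text \<open>The singleton is closed because the spectrum is Hausdorff, and it lies in every closed
  set on which all maxima are attained; so it is the least such set.\<close>

lemma is_shilov_boundary_maximal_point:
  assumes B: "cring B" and \<eta>: "\<eta> \<in> berkovich_spec B"
    and max: "\<And>\<gamma> f. \<gamma> \<in> berkovich_spec B \<Longrightarrow> f \<in> carrier B \<Longrightarrow> \<gamma> f \<le> \<eta> f"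
  shows "is_shilov_boundary B {\<eta>}"
proof -
  interpret cring B by fact
  let ?T = "product_topology (\<lambda>_. euclideanreal) (carrier B)"
  have sub: "berkovich_spec B \<subseteq> topspace ?T"
    by (auto simp: berkovich_spec_def mult_seminorms_def PiE_def)
  have "Hausdorff_space ?T"
    by (simp add: Hausdorff_space_product_topology)
  then have "Hausdorff_space (berkovich_top B)"
    unfolding berkovich_top_def by (rule Hausdorff_space_subtopology)
  then have "closedin (berkovich_top B) {\<eta>}"
    using \<eta> sub by (intro closedin_Hausdorff_singleton) (auto simp: berkovich_top_def)
  then have att: "max_attaining B {\<eta>}"
    using max by (auto simp: max_attaining_def)
  have mem: "\<eta> \<in> \<Delta>" if "max_attaining B \<Delta>" for \<Delta>
    by (rule maximal_point_in_max_attaining[OF B \<eta> _ that]) (rule max)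
  have "minimal_max_attaining B {\<eta>}"
    unfolding minimal_max_attaining_def
  proof (intro conjI att allI impI notI)
    fix \<Delta> assume "\<Delta> \<subset> {\<eta>}" "max_attaining B \<Delta>"
    then show False using mem[of \<Delta>] by auto
  qed
  moreover have "\<Delta> = {\<eta>}" if "minimal_max_attaining B \<Delta>" for \<Delta>
  proof (rule ccontr)
    assume "\<Delta> \<noteq> {\<eta>}"
    then have "{\<eta>} \<subset> \<Delta>" using that mem[of \<Delta>] by (auto simp: minimal_max_attaining_def)
    then show False using that att by (simp add: minimal_max_attaining_def)
  qed
  ultimately show ?thesis unfolding is_shilov_boundary_def by iprover
qed

lemma is_shilov_boundary_nrm:
  assumes B: "cring B"
    and nrm0: "nrm B \<zero>\<^bsub>B\<^esub> = 0" and nrm1: "nrm B \<one>\<^bsub>B\<^esub> = 1"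
    and nn: "\<And>f. f \<in> carrier B \<Longrightarrow> 0 \<le> nrm B f"
    and mult: "\<And>f g. f \<in> carrier B \<Longrightarrow> g \<in> carrier B \<Longrightarrow> nrm B (f \<otimes>\<^bsub>B\<^esub> g) = nrm B f * nrm B g"
    and add: "\<And>f g. f \<in> carrier B \<Longrightarrow> g \<in> carrier B \<Longrightarrow> nrm B (f \<oplus>\<^bsub>B\<^esub> g) \<le> nrm B f + nrm B g"
  shows "is_shilov_boundary B {restrict (nrm B) (carrier B)}"
proof (rule is_shilov_boundary_maximal_point[OF B])
  interpret cring B by fact
  show "restrict (nrm B) (carrier B) \<in> berkovich_spec B"
    using assms by (auto simp: berkovich_spec_def mult_seminorms_def intro!: exI[of _ 1])
  have "nrm B (f [^]\<^bsub>B\<^esub> (k::nat)) = nrm B f ^ k" if "f \<in> carrier B" for f k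
    using that by (induction k) (auto simp: nrm1 mult)
  then show "\<gamma> f \<le> restrict (nrm B) (carrier B) f" if "\<gamma> \<in> berkovich_spec B" "f \<in> carrier B" for \<gamma> f
    using berkovich_spec_le_nrm[OF ring_axioms _ nn that] that by auto
qed

section \<open>Ultrametric normed rings and power series\<close>

lemma finite_poly_mappings_bounded:
  assumes "finite V" "finite R"
  shows "finite {\<alpha> :: 'v \<Rightarrow>\<^sub>0 'z :: zero. Poly_Mapping.keys \<alpha> \<subseteq> V \<and> (\<forall>v\<in>V. Poly_Mapping.lookup \<alpha> v \<in> R)}"
    (is "finite ?X")
proof (rule inj_on_finite)
  show "inj_on (\<lambda>\<alpha>. restrict (Poly_Mapping.lookup \<alpha>) V) ?X"
  proof (rule inj_onI, rule poly_mapping_eqI)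
    fix \<alpha> \<beta> v assume *: "\<alpha> \<in> ?X" "\<beta> \<in> ?X"
      "restrict (Poly_Mapping.lookup \<alpha>) V = restrict (Poly_Mapping.lookup \<beta>) V"
    show "Poly_Mapping.lookup \<alpha> v = Poly_Mapping.lookup \<beta> v"
    proof (cases "v \<in> V")
      case True
      then show ?thesis using fun_cong[OF *(3), of v] by simp
    next
      case False
      then show ?thesis using * by (metis (mono_tags, lifting) in_keys_iff mem_Collect_eq subsetD)
    qed
  qed
  show "(\<lambda>\<alpha>. restrict (Poly_Mapping.lookup \<alpha>) V) ` ?X \<subseteq> V \<rightarrow>\<^sub>E R" by auto
  show "finite (V \<rightarrow>\<^sub>E R)" using assms by (intro finite_PiE) auto
qed

text \<open>Replaces convergence along the total degree, as in the definitions of the algebras, by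
  the cofinite form. There no size function occurs, and exceptional sets of sums and products are
  unions and sums of exceptional sets.\<close>

lemma tends_to_zero_iff_finite:
  fixes size :: "'x \<Rightarrow> 'n :: linordered_semidom" and g :: "'x \<Rightarrow> real"
  assumes "\<And>N. finite {\<alpha>. P \<alpha> \<and> size \<alpha> < N}"
  shows "(\<forall>\<epsilon>>0. \<exists>N. \<forall>\<alpha>. P \<alpha> \<and> N \<le> size \<alpha> \<longrightarrow> g \<alpha> < \<epsilon>) \<longleftrightarrow>
    (\<forall>\<epsilon>>0. finite {\<alpha>. P \<alpha> \<and> \<epsilon> \<le> g \<alpha>})"
proof (intro iffI allI impI)
  fix \<epsilon> :: real assume "\<epsilon> > 0" "\<forall>\<epsilon>>0. \<exists>N. \<forall>\<alpha>. P \<alpha> \<and> N \<le> size \<alpha> \<longrightarrow> g \<alpha> < \<epsilon>"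
  then obtain N where "\<And>\<alpha>. P \<alpha> \<Longrightarrow> N \<le> size \<alpha> \<Longrightarrow> g \<alpha> < \<epsilon>" by blast
  then have "{\<alpha>. P \<alpha> \<and> \<epsilon> \<le> g \<alpha>} \<subseteq> {\<alpha>. P \<alpha> \<and> size \<alpha> < N}" by fastforce
  then show "finite {\<alpha>. P \<alpha> \<and> \<epsilon> \<le> g \<alpha>}" using assms finite_subset by blast
next
  fix \<epsilon> :: real assume \<epsilon>: "\<epsilon> > 0" "\<forall>\<epsilon>>0. finite {\<alpha>. P \<alpha> \<and> \<epsilon> \<le> g \<alpha>}"
  let ?F = "{\<alpha>. P \<alpha> \<and> \<epsilon> \<le> g \<alpha>}"
  \<comment> \<open>The inserted 0 keeps \<open>Max\<close> meaningful when there is no exceptional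
    exponent.\<close>
  have fin: "finite (insert 0 (size ` ?F))" using \<epsilon> by simp
  have "g \<alpha> < \<epsilon>" if "P \<alpha>" "Max (insert 0 (size ` ?F)) + 1 \<le> size \<alpha>" for \<alpha>
  proof (rule ccontr)
    assume "\<not> g \<alpha> < \<epsilon>"
    then have "size \<alpha> \<in> insert 0 (size ` ?F)" using that by auto
    then have "size \<alpha> \<le> Max (insert 0 (size ` ?F))" using fin Max_ge by blast
    also have "\<dots> < Max (insert 0 (size ` ?F)) + 1" by simp
    finally show False using that(2) by simp
  qed
  then show "\<exists>N. \<forall>\<alpha>. P \<alpha> \<and> N \<le> size \<alpha> \<longrightarrow> g \<alpha> < \<epsilon>" by blast
qed

lemma bounded_if_finite_ge:
  fixes g :: "'x \<Rightarrow> real"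
  assumes "finite {x. 1 \<le> g x}"
  obtains M where "0 < M" "\<And>x. g x \<le> M"
proof
  let ?M = "Max (insert 1 (g ` {x. 1 \<le> g x}))"
  have fin: "finite (insert 1 (g ` {x. 1 \<le> g x}))" using assms by simp
  have "1 \<le> ?M" using fin by simp
  then show "0 < ?M" by simp
  fix x show "g x \<le> ?M"
  proof (cases "1 \<le> g x")
    case True
    then show ?thesis using fin by (intro Max_ge) auto
  next
    case False
    then show ?thesis using \<open>1 \<le> ?M\<close> by simp
  qed
qed

lemma (in abelian_monoid) finsum_Sigma:
  assumes "finite X" "\<And>x. x \<in> X \<Longrightarrow> finite (Y x)"
    and "\<And>x y. x \<in> X \<Longrightarrow> y \<in> Y x \<Longrightarrow> f x y \<in> carrier G"
  shows "(\<Oplus>x\<in>X. \<Oplus>y\<in>Y x. f x y) = (\<Oplus>p\<in>Sigma X Y. f (fst p) (snd p))"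
  using assms
proof (induction X)
  case empty
  then show ?case by simp
next
  case (insert x X)
  have "Sigma (insert x X) Y = Pair x ` Y x \<union> Sigma X Y" by auto
  moreover have "(\<Oplus>p\<in>Pair x ` Y x \<union> Sigma X Y. f (fst p) (snd p)) =
      (\<Oplus>p\<in>Pair x ` Y x. f (fst p) (snd p)) \<oplus> (\<Oplus>p\<in>Sigma X Y. f (fst p) (snd p))"
    using insert by (intro finsum_Un_disjoint) (auto intro: finite_SigmaI)
  moreover have "(\<Oplus>p\<in>Pair x ` Y x. f (fst p) (snd p)) = (\<Oplus>y\<in>Y x. f x y)"
    using insert by (subst finsum_reindex) (auto simp: inj_on_def)
  moreover have "(\<Oplus>x\<in>insert x X. \<Oplus>y\<in>Y x. f x y) = (\<Oplus>y\<in>Y x. f x y) \<oplus> (\<Oplus>x\<in>X. \<Oplus>y\<in>Y x. f x y)"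
    using insert by (subst finsum_insert) (auto intro!: finsum_closed)
  ultimately show ?case using insert by simp
qed

text \<open>A seminorm only: \<open>nrm\<close> may vanish on nonzero elements, so that residue
  norms of quotients by arbitrary ideals are covered.\<close>

locale ultra_normed_cring = cring A for A :: "('a, 'b) normed_ring_scheme" (structure) +
  assumes nrm_nonneg: "f \<in> carrier A \<Longrightarrow> 0 \<le> nrm A f"
    and nrm_zero: "nrm A \<zero> = 0"
    and nrm_uminus: "f \<in> carrier A \<Longrightarrow> nrm A (\<ominus> f) = nrm A f"
    and nrm_submult: "f \<in> carrier A \<Longrightarrow> g \<in> carrier A \<Longrightarrow> nrm A (f \<otimes> g) \<le> nrm A f * nrm A g"
    and nrm_ultra: "f \<in> carrier A \<Longrightarrow> g \<in> carrier A \<Longrightarrow> nrm A (f \<oplus> g) \<le> max (nrm A f) (nrm A g)"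
begin

lemma nrm_finsum_le:
  assumes "finite X" "\<And>x. x \<in> X \<Longrightarrow> f x \<in> carrier A" "\<And>x. x \<in> X \<Longrightarrow> nrm A (f x) \<le> M" "0 \<le> M"
  shows "nrm A (\<Oplus>x\<in>X. f x) \<le> M"
  using assms
proof (induction X)
  case empty
  then show ?case by (simp add: nrm_zero)
next
  case (insert x X)
  have "(\<Oplus>x\<in>X. f x) \<in> carrier A" using insert by (intro finsum_closed) auto
  then have "nrm A (f x \<oplus> (\<Oplus>x\<in>X. f x)) \<le> max (nrm A (f x)) (nrm A (\<Oplus>x\<in>X. f x))"
    using insert by (intro nrm_ultra) auto
  also have "\<dots> \<le> M" using insert by simp
  finally show ?case using insert by (subst finsum_insert) auto
qed

lemma nrm_minus_le:
  assumes "f \<in> carrier A" "g \<in> carrier A"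
  shows "nrm A (f \<ominus> g) \<le> max (nrm A f) (nrm A g)"
  using nrm_ultra[of f "\<ominus> g"] nrm_uminus[of g] assms by (simp add: a_minus_def)

text \<open>The isosceles triangle principle of ultrametric norms.\<close>

lemma nrm_eq_if_close:
  assumes "f \<in> carrier A" "g \<in> carrier A" "nrm A (f \<ominus> g) < nrm A f"
  shows "nrm A g = nrm A f"
proof -
  have "f = (f \<ominus> g) \<oplus> g" "g = f \<ominus> (f \<ominus> g)" using assms by algebra+
  then have "nrm A f \<le> max (nrm A (f \<ominus> g)) (nrm A g)" "nrm A g \<le> max (nrm A f) (nrm A (f \<ominus> g))"
    using nrm_ultra[of "f \<ominus> g" g] nrm_minus_le[of f "f \<ominus> g"] assms by (metis minus_closed)+
  then show ?thesis using assms(3) by (auto simp: max_def split: if_splits)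
qed

end

section \<open>Weights and divisors of exponents\<close>

lemma power_weight_superset:
  assumes "finite X" "Poly_Mapping.keys m \<subseteq> X"
  shows "power_weight r m = (\<Prod>v\<in>X. r v ^ Poly_Mapping.lookup m v)"
  unfolding power_weight_def using assms
  by (intro prod.mono_neutral_left) (auto simp: in_keys_iff)

lemma power_weight_add: "power_weight r (p + q) = power_weight r p * power_weight r q"
proof -
  let ?X = "Poly_Mapping.keys p \<union> Poly_Mapping.keys q"
  have "power_weight r (p + q) = (\<Prod>v\<in>?X. r v ^ Poly_Mapping.lookup (p + q) v)"
    by (rule power_weight_superset) (auto simp: Poly_Mapping.keys_add)
  then show ?thesis
    by (simp add: power_weight_superset[of ?X] lookup_add power_add prod.distrib)
qed

lemma power_weight_pos:
  assumes "\<And>v. v \<in> V \<Longrightarrow> 0 < r v" "Poly_Mapping.keys m \<subseteq> V"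
  shows "0 < power_weight r m"
  unfolding power_weight_def using assms by (intro prod_pos zero_less_power) auto

lemma keys_add_nat: "Poly_Mapping.keys (p + q) = Poly_Mapping.keys p \<union> Poly_Mapping.keys (q :: 'v \<Rightarrow>\<^sub>0 nat)"
  by (auto simp: in_keys_iff lookup_add)

text \<open>The index set of the convolution in \<open>power_series_algebra\<close>. On it the
  truncated subtraction \<open>m - p\<close> really is the cofactor of \<open>p\<close>.\<close>

definition divisors :: "('v \<Rightarrow>\<^sub>0 nat) \<Rightarrow> ('v \<Rightarrow>\<^sub>0 nat) set" where
  "divisors m = {p. \<exists>q. p + q = m}"

lemma finite_divisors: "finite (divisors m)"
proof (rule finite_subset)
  let ?K = "Poly_Mapping.keys m"
  show "divisors m \<subseteq> {p. Poly_Mapping.keys p \<subseteq> ?K \<and>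
    (\<forall>v\<in>?K. Poly_Mapping.lookup p v \<in> {..Max (Poly_Mapping.lookup m ` ?K)})}"
  proof
    fix p assume "p \<in> divisors m"
    then obtain q where q: "m = p + q" by (auto simp: divisors_def)
    have "Poly_Mapping.lookup p v \<le> Max (Poly_Mapping.lookup m ` ?K)" if "v \<in> ?K" for v
      using that by (intro order_trans[OF _ Max_ge[of _ "Poly_Mapping.lookup m v"]]) (auto simp: q lookup_add)
    then show "p \<in> {p. Poly_Mapping.keys p \<subseteq> ?K \<and>
      (\<forall>v\<in>?K. Poly_Mapping.lookup p v \<in> {..Max (Poly_Mapping.lookup m ` ?K)})}"
      by (auto simp: q keys_add_nat)
  qed
  show "finite {p. Poly_Mapping.keys p \<subseteq> ?K \<and>
    (\<forall>v\<in>?K. Poly_Mapping.lookup p v \<in> {..Max (Poly_Mapping.lookup m ` ?K)})}"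
    by (rule finite_poly_mappings_bounded) auto
qed

lemma divisors_add: "p \<in> divisors (p + q)"
  by (auto simp: divisors_def)

lemma divisorsE:
  assumes "p \<in> divisors m"
  obtains q where "m = p + q" "m - p = q"
  using assms by (auto simp: divisors_def)

section \<open>The ring of power series over an ultrametric ring\<close>

locale power_series = ultra_normed_cring +
  fixes V :: "'v set" and r :: "'v \<Rightarrow> real"
  assumes fin_V: "finite V" and r_pos: "v \<in> V \<Longrightarrow> 0 < r v"
begin

definition "P = power_series_algebra A V r"

definition monom :: "('v \<Rightarrow>\<^sub>0 nat) \<Rightarrow> 'a \<Rightarrow> ('v \<Rightarrow>\<^sub>0 nat) \<Rightarrow> 'a" where
  "monom q a = (\<lambda>m. if m = q then a else \<zero>)"

abbreviation "wnrm h m \<equiv> nrm A (h m) * power_weight r m"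

lemma P_sel:
  "\<one>\<^bsub>P\<^esub> = monom 0 \<one>" "\<zero>\<^bsub>P\<^esub> = (\<lambda>m. \<zero>)" "h \<oplus>\<^bsub>P\<^esub> g = (\<lambda>m. h m \<oplus> g m)"
  "nrm P h = (SUP m. wnrm h m)"
  "h \<otimes>\<^bsub>P\<^esub> g = (\<lambda>m. \<Oplus>p\<in>divisors m. h p \<otimes> g (m - p))"
  by (simp_all add: P_def power_series_algebra_def divisors_def monom_def)

lemma finite_degree_less:
  "finite {m :: 'v \<Rightarrow>\<^sub>0 nat. Poly_Mapping.keys m \<subseteq> V \<and> (\<Sum>v\<in>V. Poly_Mapping.lookup m v) < N}"
proof (rule finite_subset)
  show "finite {m :: 'v \<Rightarrow>\<^sub>0 nat. Poly_Mapping.keys m \<subseteq> V \<and> (\<forall>v\<in>V. Poly_Mapping.lookup m v \<in> {..N})}"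
    using fin_V by (intro finite_poly_mappings_bounded) auto
  show "{m. Poly_Mapping.keys m \<subseteq> V \<and> (\<Sum>v\<in>V. Poly_Mapping.lookup m v) < N}
    \<subseteq> {m. Poly_Mapping.keys m \<subseteq> V \<and> (\<forall>v\<in>V. Poly_Mapping.lookup m v \<in> {..N})}"
  proof safe
    fix m :: "'v \<Rightarrow>\<^sub>0 nat" and v assume "v \<in> V" "(\<Sum>v\<in>V. Poly_Mapping.lookup m v) < N"
    then show "Poly_Mapping.lookup m v \<le> N"
      using member_le_sum[of v V "Poly_Mapping.lookup m"] fin_V by simp
  qed
qed

lemma carrier_P:
  "carrier P = {h. (\<forall>m. h m \<in> carrier A) \<and> (\<forall>m. h m \<noteq> \<zero> \<longrightarrow> Poly_Mapping.keys m \<subseteq> V) \<and>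
     (\<forall>\<epsilon>>0. finite {m. \<epsilon> \<le> wnrm h m})}" (is "_ = ?R")
proof -
  have eq: "{m. Poly_Mapping.keys m \<subseteq> V \<and> \<epsilon> \<le> wnrm h m} = {m. \<epsilon> \<le> wnrm h m}"
    if "\<forall>m. h m \<noteq> \<zero> \<longrightarrow> Poly_Mapping.keys m \<subseteq> V" "\<epsilon> > 0" for h \<epsilon>
    using that by (force simp: nrm_zero)
  note iff = tends_to_zero_iff_finite[of "\<lambda>m. Poly_Mapping.keys m \<subseteq> V" "\<lambda>m. \<Sum>v\<in>V. Poly_Mapping.lookup m v",
      OF finite_degree_less]
  have "carrier P = {h. (\<forall>m. h m \<in> carrier A) \<and> (\<forall>m. h m \<noteq> \<zero> \<longrightarrow> Poly_Mapping.keys m \<subseteq> V) \<and>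
      (\<forall>\<epsilon>>0. finite {m. Poly_Mapping.keys m \<subseteq> V \<and> \<epsilon> \<le> wnrm h m})}"
    by (simp add: P_def power_series_algebra_def iff)
  also have "\<dots> = ?R" using eq by (intro Collect_cong conj_cong refl) simp
  finally show ?thesis .
qed

lemma P_D:
  assumes "h \<in> carrier P"
  shows "h m \<in> carrier A" "h m \<noteq> \<zero> \<Longrightarrow> Poly_Mapping.keys m \<subseteq> V"
    "\<epsilon> > 0 \<Longrightarrow> finite {m. \<epsilon> \<le> wnrm h m}"
  using assms by (auto simp: carrier_P)

text \<open>The radii are positive only on \<open>V\<close>. At an exponent leaving \<open>V\<close>
  the weight can have either sign, and the estimate holds because the coefficient vanishes there;
  the same case distinction recurs below.\<close>

lemma wnrm_nonneg:
  assumes "h \<in> carrier P" shows "0 \<le> wnrm h m"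
proof (cases "h m = \<zero>")
  case False
  then show ?thesis using power_weight_pos[of V r m] r_pos P_D[OF assms] nrm_nonneg
    by (simp add: less_imp_le)
qed (simp add: nrm_zero)

lemma bdd_above_wnrm:
  assumes "h \<in> carrier P" shows "bdd_above (range (wnrm h))"
proof -
  obtain M where "\<And>m. wnrm h m \<le> M"
    using bounded_if_finite_ge[OF P_D(3)[OF assms, of 1]] by auto
  then show ?thesis by (intro bdd_aboveI2[of _ _ M])
qed

lemma wnrm_le:
  assumes "h \<in> carrier P" shows "wnrm h m \<le> nrm P h"
  unfolding P_sel by (rule cSUP_upper[OF _ bdd_above_wnrm[OF assms]]) auto

lemma nrm_P_le:
  assumes "\<And>m. wnrm h m \<le> M" shows "nrm P h \<le> M"
  unfolding P_sel by (rule cSUP_least) (use assms in auto)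

lemma nrm_P_nonneg:
  assumes "h \<in> carrier P" shows "0 \<le> nrm P h"
  using wnrm_nonneg[OF assms, of 0] wnrm_le[OF assms, of 0] by simp

lemma monom_carrier:
  assumes "a \<in> carrier A" "Poly_Mapping.keys q \<subseteq> V" shows "monom q a \<in> carrier P"
proof -
  have "{m. \<epsilon> \<le> wnrm (monom q a) m} \<subseteq> {q}" if "\<epsilon> > 0" for \<epsilon>
    using that by (auto simp: monom_def nrm_zero)
  then have "finite {m. \<epsilon> \<le> wnrm (monom q a) m}" if "\<epsilon> > 0" for \<epsilon>
    using that finite_subset by blast
  then show ?thesis using assms by (auto simp: carrier_P monom_def)
qed

lemma zero_P_closed: "\<zero>\<^bsub>P\<^esub> \<in> carrier P"
  by (auto simp: P_sel carrier_P nrm_zero)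

lemma add_P_bound:
  assumes "h \<in> carrier P" "g \<in> carrier P"
  shows "wnrm (h \<oplus>\<^bsub>P\<^esub> g) m \<le> max (wnrm h m) (wnrm g m)"
proof (cases "Poly_Mapping.keys m \<subseteq> V")
  case True
  then have "0 < power_weight r m" using power_weight_pos r_pos by blast
  then show ?thesis using nrm_ultra[OF P_D(1)[OF assms(1)] P_D(1)[OF assms(2)], of m m]
    by (auto simp: P_sel max_def mult_right_mono split: if_splits)
next
  case False
  then have "h m = \<zero>" "g m = \<zero>" using P_D(2) assms by blast+
  then show ?thesis by (simp add: P_sel nrm_zero)
qed

lemma add_P_closed:
  assumes "h \<in> carrier P" "g \<in> carrier P"
  shows "h \<oplus>\<^bsub>P\<^esub> g \<in> carrier P"
proof -
  have "finite {m. \<epsilon> \<le> wnrm (h \<oplus>\<^bsub>P\<^esub> g) m}" if "\<epsilon> > 0" for \<epsilon>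
  proof (rule finite_subset)
    show "{m. \<epsilon> \<le> wnrm (h \<oplus>\<^bsub>P\<^esub> g) m} \<subseteq> {m. \<epsilon> \<le> wnrm h m} \<union> {m. \<epsilon> \<le> wnrm g m}"
    proof (rule subsetI, rule ccontr)
      fix m assume "m \<in> {m. \<epsilon> \<le> wnrm (h \<oplus>\<^bsub>P\<^esub> g) m}" "m \<notin> {m. \<epsilon> \<le> wnrm h m} \<union> {m. \<epsilon> \<le> wnrm g m}"
      then show False using add_P_bound[OF assms, of m] by (auto simp: max_def split: if_splits)
    qed
  qed (use P_D(3) assms that in auto)
  moreover have "(h \<oplus>\<^bsub>P\<^esub> g) m \<in> carrier A" for m using P_D assms by (auto simp: P_sel)
  moreover have "(h \<oplus>\<^bsub>P\<^esub> g) m \<noteq> \<zero> \<longrightarrow> Poly_Mapping.keys m \<subseteq> V" for m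
    using P_D(2)[OF assms(1), of m] P_D(2)[OF assms(2), of m]
    by (cases "h m = \<zero>"; cases "g m = \<zero>") (auto simp: P_sel)
  ultimately show ?thesis by (auto simp: carrier_P)
qed

lemma uminus_P_closed:
  assumes "h \<in> carrier P" shows "(\<lambda>m. \<ominus> h m) \<in> carrier P"
  using assms P_D[OF assms] by (auto simp: carrier_P nrm_uminus)

lemma mult_P_term_bound:
  assumes "h \<in> carrier P" "g \<in> carrier P"
  shows "nrm A (h p \<otimes> g q) * power_weight r (p + q) \<le> wnrm h p * wnrm g q"
proof (cases "h p = \<zero> \<or> g q = \<zero>")
  case True
  then show ?thesis using P_D(1)[OF assms(1), of p] P_D(1)[OF assms(2), of q]
    by (auto simp: nrm_zero)
next
  case False
  then have "0 < power_weight r p" "0 < power_weight r q"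
    using power_weight_pos[of V r] r_pos P_D(2) assms by blast+
  then show ?thesis
    using nrm_submult[OF P_D(1)[OF assms(1)] P_D(1)[OF assms(2)], of p q]
    by (simp add: power_weight_add mult.commute mult.left_commute mult_left_mono)
qed

lemma mult_P_ne:
  assumes "h \<in> carrier P" "g \<in> carrier P" "(h \<otimes>\<^bsub>P\<^esub> g) m \<noteq> \<zero>"
  shows "Poly_Mapping.keys m \<subseteq> V"
proof (rule ccontr)
  assume n: "\<not> Poly_Mapping.keys m \<subseteq> V"
  have "h p \<otimes> g (m - p) = \<zero>" if p: "p \<in> divisors m" for p
  proof -
    obtain q where q: "m = p + q" "m - p = q" using divisorsE[OF p] by metis
    then have "h p = \<zero> \<or> g q = \<zero>" using n P_D(2) assms(1,2) by (metis keys_add_nat le_sup_iff)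
    then show ?thesis using P_D(1) assms q by auto
  qed
  then have "(h \<otimes>\<^bsub>P\<^esub> g) m = \<zero>" unfolding P_sel
    by (subst finsum_cong'[where g = "\<lambda>_. \<zero>"]) auto
  then show False using assms by simp
qed

text \<open>A coefficient of the product is a finite sum, so by the ultrametric inequality a bound
  on the single terms is enough. The bound \<open>M\<close> is left free because both the closure of
  the carrier under products and the estimate of the norm use it.\<close>

lemma mult_P_bound:
  assumes h: "h \<in> carrier P" and g: "g \<in> carrier P" and M: "0 \<le> M"
    and "\<And>p q. m = p + q \<Longrightarrow> wnrm h p * wnrm g q \<le> M"
  shows "wnrm (h \<otimes>\<^bsub>P\<^esub> g) m \<le> M"
proof (cases "(h \<otimes>\<^bsub>P\<^esub> g) m = \<zero>")
  case False
  then have w: "0 < power_weight r m" using mult_P_ne[OF h g] power_weight_pos r_pos by blast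
  have "nrm A ((h \<otimes>\<^bsub>P\<^esub> g) m) \<le> M / power_weight r m"
    unfolding P_sel
  proof (rule nrm_finsum_le[OF finite_divisors])
    fix p assume "p \<in> divisors m"
    then obtain q where q: "m = p + q" "m - p = q" by (rule divisorsE)
    show "h p \<otimes> g (m - p) \<in> carrier A" using P_D h g by auto
    have "nrm A (h p \<otimes> g q) * power_weight r m \<le> M"
      using mult_P_term_bound[OF h g, of p q] assms(4)[OF q(1)] q by simp
    then show "nrm A (h p \<otimes> g (m - p)) \<le> M / power_weight r m"
      using w q by (simp add: field_simps)
  qed (use M w in simp)
  then show ?thesis using w by (simp add: field_simps)
qed (use M in \<open>simp add: nrm_zero\<close>)

text \<open>Both factors are bounded, by \<open>H\<close> and \<open>G\<close>. Hence a large
  coefficient at \<open>m\<close> requires a splitting \<open>m = p + q\<close> with both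
  coefficients large, and there are finitely many such pairs.\<close>

lemma mult_P_closed:
  assumes h: "h \<in> carrier P" and g: "g \<in> carrier P"
  shows "h \<otimes>\<^bsub>P\<^esub> g \<in> carrier P"
proof -
  obtain H where H: "0 < H" "\<And>m. wnrm h m \<le> H"
    using bounded_if_finite_ge[OF P_D(3)[OF h, of 1]] by auto
  obtain G where G: "0 < G" "\<And>m. wnrm g m \<le> G"
    using bounded_if_finite_ge[OF P_D(3)[OF g, of 1]] by auto
  have "finite {m. \<epsilon> \<le> wnrm (h \<otimes>\<^bsub>P\<^esub> g) m}" if \<epsilon>: "\<epsilon> > 0" for \<epsilon>
  proof (rule finite_subset)
    let ?X = "{p. \<epsilon> / 2 / G \<le> wnrm h p}" let ?Y = "{q. \<epsilon> / 2 / H \<le> wnrm g q}"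
    show "{m. \<epsilon> \<le> wnrm (h \<otimes>\<^bsub>P\<^esub> g) m} \<subseteq> (\<lambda>(p, q). p + q) ` (?X \<times> ?Y)"
    proof (rule subsetI, rule ccontr)
      fix m assume m: "m \<in> {m. \<epsilon> \<le> wnrm (h \<otimes>\<^bsub>P\<^esub> g) m}" "m \<notin> (\<lambda>(p, q). p + q) ` (?X \<times> ?Y)"
      \<comment> \<open>Half of \<open>\<epsilon>\<close>, because \<open>mult_P_bound\<close>
        yields only a weak inequality and the contradiction needs a strict one.\<close>
      have "wnrm h p * wnrm g q \<le> \<epsilon> / 2" if "m = p + q" for p q
      proof -
        have "p \<notin> ?X \<or> q \<notin> ?Y" using m(2) that by force
        then consider "wnrm h p < \<epsilon> / 2 / G" | "wnrm g q < \<epsilon> / 2 / H" by fastforce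
        then show ?thesis
        proof cases
          case 1
          then have "wnrm h p * wnrm g q \<le> \<epsilon> / 2 / G * G"
            using G wnrm_nonneg[OF h] wnrm_nonneg[OF g] \<epsilon> by (intro mult_mono) auto
          then show ?thesis using G by simp
        next
          case 2
          then have "wnrm h p * wnrm g q \<le> H * (\<epsilon> / 2 / H)"
            using H wnrm_nonneg[OF h] wnrm_nonneg[OF g] \<epsilon> by (intro mult_mono) auto
          then show ?thesis using H by simp
        qed
      qed
      then have "wnrm (h \<otimes>\<^bsub>P\<^esub> g) m \<le> \<epsilon> / 2" using \<epsilon> by (intro mult_P_bound h g) auto
      then show False using m \<epsilon> by simp
    qed
    have "finite ?X" "finite ?Y" using \<epsilon> G H by (auto intro!: P_D(3)[OF h] P_D(3)[OF g])
    then show "finite ((\<lambda>(p, q). p + q) ` (?X \<times> ?Y))" by simp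
  qed
  moreover have "(h \<otimes>\<^bsub>P\<^esub> g) m \<in> carrier A" for m
    unfolding P_sel using P_D h g by (intro finsum_closed) auto
  ultimately show ?thesis using mult_P_ne[OF h g] by (auto simp: carrier_P)
qed

lemma mult_P_comm:
  assumes h: "h \<in> carrier P" and g: "g \<in> carrier P"
  shows "h \<otimes>\<^bsub>P\<^esub> g = g \<otimes>\<^bsub>P\<^esub> h"
proof
  fix m :: "'v \<Rightarrow>\<^sub>0 nat"
  have inv: "m - (m - p) = p" "m - p \<in> divisors m" if "p \<in> divisors m" for p
    using that by (auto simp: divisors_def add.commute)
  then have im: "(\<lambda>p. m - p) ` divisors m = divisors m" by (force simp: image_iff)
  have "(h \<otimes>\<^bsub>P\<^esub> g) m = (\<Oplus>p\<in>(\<lambda>p. m - p) ` divisors m. h p \<otimes> g (m - p))"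
    unfolding P_sel im ..
  also have "\<dots> = (\<Oplus>p\<in>divisors m. h (m - p) \<otimes> g (m - (m - p)))"
    using P_D h g inv by (subst finsum_reindex) (auto intro!: inj_on_inverseI[where g = "\<lambda>p. m - p"])
  also have "\<dots> = (\<Oplus>p\<in>divisors m. g p \<otimes> h (m - p))"
    using P_D h g inv by (intro finsum_cong') (auto simp: m_comm)
  finally show "(h \<otimes>\<^bsub>P\<^esub> g) m = (g \<otimes>\<^bsub>P\<^esub> h) m" unfolding P_sel .
qed

text \<open>Both sides run over the decompositions \<open>m = a + b + c\<close>;
  \<open>?\<tau>\<close> passes from the indexing by \<open>(a, b)\<close> to the one by
  \<open>(a + b, a)\<close>.\<close>

lemma mult_P_assoc:
  assumes h: "h \<in> carrier P" and g: "g \<in> carrier P" and k: "k \<in> carrier P"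
  shows "(h \<otimes>\<^bsub>P\<^esub> g) \<otimes>\<^bsub>P\<^esub> k = h \<otimes>\<^bsub>P\<^esub> (g \<otimes>\<^bsub>P\<^esub> k)"
proof
  fix m :: "'v \<Rightarrow>\<^sub>0 nat"
  note D = P_D(1)[OF h] P_D(1)[OF g] P_D(1)[OF k]
  let ?S1 = "SIGMA p:divisors m. divisors p"
  let ?S2 = "SIGMA a:divisors m. divisors (m - a)"
  let ?\<tau> = "\<lambda>(a, b). (a + b, a)"
  have img: "?\<tau> ` ?S2 = ?S1"
  proof (intro equalityI subsetI)
    fix z assume "z \<in> ?\<tau> ` ?S2"
    then obtain a b q c where "z = (a + b, a)" "m = a + q" "b + c = q"
      by (auto simp: divisors_def)
    then show "z \<in> ?S1" by (auto simp: divisors_def intro!: exI[of _ c] ac_simps)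
  next
    fix z assume "z \<in> ?S1"
    then obtain a b c where "z = (a + b, a)" "m = a + b + c"
      by (auto simp: divisors_def)
    then show "z \<in> ?\<tau> ` ?S2" by (intro image_eqI[of _ _ "(a, b)"]) (auto simp: divisors_def ac_simps)
  qed
  have "((h \<otimes>\<^bsub>P\<^esub> g) \<otimes>\<^bsub>P\<^esub> k) m = (\<Oplus>p\<in>divisors m. \<Oplus>a\<in>divisors p. h a \<otimes> g (p - a) \<otimes> k (m - p))"
    unfolding P_sel using D
    by (intro finsum_cong' finsum_ldistr) (auto intro!: finsum_closed simp: finite_divisors)
  also have "\<dots> = (\<Oplus>z\<in>?S1. h (snd z) \<otimes> g (fst z - snd z) \<otimes> k (m - fst z))"
    using D by (intro finsum_Sigma) (auto simp: finite_divisors)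
  also have "\<dots> = (\<Oplus>z\<in>?S2. h (snd (?\<tau> z)) \<otimes> g (fst (?\<tau> z) - snd (?\<tau> z)) \<otimes> k (m - fst (?\<tau> z)))"
    unfolding img[symmetric] using D by (intro finsum_reindex) (auto simp: inj_on_def)
  also have "\<dots> = (\<Oplus>z\<in>?S2. h (fst z) \<otimes> (g (snd z) \<otimes> k (m - fst z - snd z)))"
    using D by (intro finsum_cong') (auto simp: m_assoc diff_diff_add)
  also have "\<dots> = (\<Oplus>a\<in>divisors m. \<Oplus>b\<in>divisors (m - a). h a \<otimes> (g b \<otimes> k (m - a - b)))"
    using D by (intro finsum_Sigma[symmetric]) (auto simp: finite_divisors)
  also have "\<dots> = (h \<otimes>\<^bsub>P\<^esub> (g \<otimes>\<^bsub>P\<^esub> k)) m"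
    unfolding P_sel using D
    by (intro finsum_cong' finsum_rdistr[symmetric]) (auto intro!: finsum_closed simp: finite_divisors)
  finally show "((h \<otimes>\<^bsub>P\<^esub> g) \<otimes>\<^bsub>P\<^esub> k) m = (h \<otimes>\<^bsub>P\<^esub> (g \<otimes>\<^bsub>P\<^esub> k)) m" .
qed

lemma monom_mult:
  assumes a: "a \<in> carrier A" and h: "h \<in> carrier P"
  shows "(monom q a \<otimes>\<^bsub>P\<^esub> h) m = (if q \<in> divisors m then a \<otimes> h (m - q) else \<zero>)"
proof -
  have "(monom q a \<otimes>\<^bsub>P\<^esub> h) m = (\<Oplus>p\<in>divisors m. if q = p then a \<otimes> h (m - p) else \<zero>)"
    unfolding P_sel monom_def using P_D(1)[OF h] a by (intro finsum_cong') auto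
  also have "\<dots> = (if q \<in> divisors m then a \<otimes> h (m - q) else \<zero>)"
  proof (cases "q \<in> divisors m")
    case True
    then show ?thesis using P_D(1)[OF h] a by (subst finsum_singleton) (auto simp: finite_divisors)
  next
    case False
    then have "(\<Oplus>p\<in>divisors m. if q = p then a \<otimes> h (m - p) else \<zero>) = (\<Oplus>p\<in>divisors m. \<zero>)"
      by (intro finsum_cong') auto
    then show ?thesis using False by simp
  qed
  finally show ?thesis .
qed

lemma cring_P: "cring P"
proof (intro cringI abelian_groupI comm_monoidI)
  fix h g k assume hgk: "h \<in> carrier P" "g \<in> carrier P" "k \<in> carrier P"
  note D = P_D(1)[OF hgk(1)] P_D(1)[OF hgk(2)] P_D(1)[OF hgk(3)]
  show "h \<oplus>\<^bsub>P\<^esub> g \<oplus>\<^bsub>P\<^esub> k = h \<oplus>\<^bsub>P\<^esub> (g \<oplus>\<^bsub>P\<^esub> k)" using D by (auto simp: P_sel a_assoc)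
  show "(h \<oplus>\<^bsub>P\<^esub> g) \<otimes>\<^bsub>P\<^esub> k = h \<otimes>\<^bsub>P\<^esub> k \<oplus>\<^bsub>P\<^esub> g \<otimes>\<^bsub>P\<^esub> k"
  proof
    fix m
    have "((h \<oplus>\<^bsub>P\<^esub> g) \<otimes>\<^bsub>P\<^esub> k) m = (\<Oplus>p\<in>divisors m. h p \<otimes> k (m - p) \<oplus> g p \<otimes> k (m - p))"
      unfolding P_sel using D by (intro finsum_cong') (auto simp: l_distr)
    also have "\<dots> = (h \<otimes>\<^bsub>P\<^esub> k \<oplus>\<^bsub>P\<^esub> g \<otimes>\<^bsub>P\<^esub> k) m"
      unfolding P_sel using D by (intro finsum_addf) auto
    finally show "((h \<oplus>\<^bsub>P\<^esub> g) \<otimes>\<^bsub>P\<^esub> k) m = (h \<otimes>\<^bsub>P\<^esub> k \<oplus>\<^bsub>P\<^esub> g \<otimes>\<^bsub>P\<^esub> k) m" .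
  qed
next
  fix h g assume hg: "h \<in> carrier P" "g \<in> carrier P"
  note D = P_D(1)[OF hg(1)] P_D(1)[OF hg(2)]
  show "h \<oplus>\<^bsub>P\<^esub> g = g \<oplus>\<^bsub>P\<^esub> h" using D by (auto simp: P_sel a_comm)
next
  fix h assume h: "h \<in> carrier P"
  note D = P_D(1)[OF h]
  show "\<zero>\<^bsub>P\<^esub> \<oplus>\<^bsub>P\<^esub> h = h" using D by (auto simp: P_sel)
  show "\<exists>g\<in>carrier P. g \<oplus>\<^bsub>P\<^esub> h = \<zero>\<^bsub>P\<^esub>"
    using D uminus_P_closed[OF h] by (intro bexI[of _ "\<lambda>m. \<ominus> h m"]) (auto simp: P_sel l_neg)
  have "\<one>\<^bsub>P\<^esub> \<otimes>\<^bsub>P\<^esub> h = monom 0 \<one> \<otimes>\<^bsub>P\<^esub> h" by (simp add: P_sel(1))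
  then show "\<one>\<^bsub>P\<^esub> \<otimes>\<^bsub>P\<^esub> h = h"
    using D monom_mult[OF one_closed h, of 0] divisors_add[of 0] by (auto simp: fun_eq_iff)
next
  show "\<one>\<^bsub>P\<^esub> \<in> carrier P" unfolding P_sel(1) by (rule monom_carrier) auto
qed (simp_all only: add_P_closed zero_P_closed mult_P_closed mult_P_assoc, rule mult_P_comm)

sublocale P: cring P by (rule cring_P)

lemma uminus_P:
  assumes "h \<in> carrier P" shows "\<ominus>\<^bsub>P\<^esub> h = (\<lambda>m. \<ominus> h m)"
  by (rule P.minus_equality[OF _ assms uminus_P_closed[OF assms]])
    (use P_D(1)[OF assms] in \<open>auto simp: P_sel l_neg\<close>)

lemma ultra_normed_cring_P: "ultra_normed_cring P"
proof
  fix h g assume h: "h \<in> carrier P" and g: "g \<in> carrier P"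
  show "nrm P (h \<otimes>\<^bsub>P\<^esub> g) \<le> nrm P h * nrm P g"
    using nrm_P_nonneg[OF h] nrm_P_nonneg[OF g] wnrm_le[OF h] wnrm_le[OF g] wnrm_nonneg[OF h] wnrm_nonneg[OF g]
    by (intro nrm_P_le mult_P_bound h g) (auto intro!: mult_mono)
  show "nrm P (h \<oplus>\<^bsub>P\<^esub> g) \<le> max (nrm P h) (nrm P g)"
  proof (rule nrm_P_le)
    fix m
    have "wnrm (h \<oplus>\<^bsub>P\<^esub> g) m \<le> max (wnrm h m) (wnrm g m)" by (rule add_P_bound[OF h g])
    also have "\<dots> \<le> max (nrm P h) (nrm P g)" by (intro max.mono wnrm_le h g)
    finally show "wnrm (h \<oplus>\<^bsub>P\<^esub> g) m \<le> max (nrm P h) (nrm P g)" .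
  qed
next
  fix h assume h: "h \<in> carrier P"
  show "nrm P (\<ominus>\<^bsub>P\<^esub> h) = nrm P h" using P_D(1)[OF h] by (simp add: uminus_P[OF h] P_sel nrm_uminus)
next
  show "nrm P \<zero>\<^bsub>P\<^esub> = 0" by (simp add: P_sel nrm_zero)
qed (rule nrm_P_nonneg)

lemma nrm_monom:
  assumes "a \<in> carrier A" "Poly_Mapping.keys q \<subseteq> V"
  shows "nrm P (monom q a) = nrm A a * power_weight r q"
proof (rule antisym)
  have "0 \<le> nrm A a * power_weight r q" using wnrm_nonneg[OF monom_carrier[OF assms], of q] by (simp add: monom_def)
  then show "nrm P (monom q a) \<le> nrm A a * power_weight r q"
    by (intro nrm_P_le) (simp add: monom_def nrm_zero)
  show "nrm A a * power_weight r q \<le> nrm P (monom q a)"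
    using wnrm_le[OF monom_carrier[OF assms], of q] by (simp add: monom_def)
qed

end

section \<open>Quotients and Laurent domains\<close>

text \<open>\<open>U\<close> is the smallest set with the three closure properties. It is an ideal
  because the pullback of a closed set along multiplication by \<open>x\<close> is closed again.
  Thus \<open>Q\<close> need only be checked on multiples of generators and on sums, which suits
  asymptotic estimates.\<close>

lemma (in cring) genideal_induct:
  assumes "Z \<subseteq> carrier R" "g \<in> Idl Z" "Q \<zero>"
    and "\<And>h z. h \<in> carrier R \<Longrightarrow> z \<in> Z \<Longrightarrow> Q (h \<otimes> z)"
    and "\<And>a b. a \<in> carrier R \<Longrightarrow> b \<in> carrier R \<Longrightarrow> Q a \<Longrightarrow> Q b \<Longrightarrow> Q (a \<oplus> b)"
  shows "Q g"
proof -
  define clo where "clo T \<longleftrightarrow> \<zero> \<in> T \<and> (\<forall>h\<in>carrier R. \<forall>z\<in>Z. h \<otimes> z \<in> T) \<and>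
    (\<forall>a\<in>carrier R \<inter> T. \<forall>b\<in>carrier R \<inter> T. a \<oplus> b \<in> T)" for T
  define U where "U = {u \<in> carrier R. \<forall>T. clo T \<longrightarrow> u \<in> T}"
  have mult: "x \<otimes> u \<in> U" if u: "u \<in> U" and x: "x \<in> carrier R" for x u
  proof -
    have "x \<otimes> u \<in> T" if T: "clo T" for T
    proof -
      have "clo {a \<in> carrier R. x \<otimes> a \<in> T}"
        using T x assms(1) unfolding clo_def
        by (auto simp: r_distr m_assoc[symmetric])
      then show ?thesis using u by (auto simp: U_def)
    qed
    then show ?thesis using u x by (auto simp: U_def)
  qed
  have clo: "\<zero> \<in> T" "\<And>a b. a \<in> carrier R \<Longrightarrow> b \<in> carrier R \<Longrightarrow> a \<in> T \<Longrightarrow> b \<in> T \<Longrightarrow> a \<oplus> b \<in> T"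
    if "clo T" for T
    using that by (auto simp: clo_def)
  have "ideal U R"
  proof (rule idealI[OF ring_axioms])
    show "subgroup U (add_monoid R)"
    proof (rule group.subgroupI[OF a_group])
      show "inv\<^bsub>add_monoid R\<^esub> a \<in> U" if "a \<in> U" for a
        using mult[OF that, of "\<ominus> \<one>"] that by (simp add: a_inv_def[symmetric] l_minus U_def)
      have "\<zero> \<in> U" using clo(1) by (auto simp: U_def)
      then show "U \<noteq> {}" by auto
      show "a \<otimes>\<^bsub>add_monoid R\<^esub> b \<in> U" if "a \<in> U" "b \<in> U" for a b
        using that clo(2) by (auto simp: U_def)
    qed (auto simp: U_def)
    show "x \<otimes> a \<in> U" "a \<otimes> x \<in> U" if "a \<in> U" "x \<in> carrier R" for a x
      using mult[OF that] that by (auto simp: U_def m_comm)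
  qed
  moreover have "Z \<subseteq> U"
  proof
    fix z assume "z \<in> Z"
    then have "\<one> \<otimes> z \<in> T" if "clo T" for T using that by (auto simp: clo_def)
    then show "z \<in> U" using \<open>z \<in> Z\<close> assms(1) by (auto simp: U_def)
  qed
  ultimately have "Idl Z \<subseteq> U" by (rule genideal_minimal)
  then have "g \<in> T" if "clo T" for T using that assms(2) by (auto simp: U_def)
  moreover have "clo {a. Q a}" using assms(3-5) by (auto simp: clo_def)
  ultimately show ?thesis by blast
qed

text \<open>Residue norms are infima, so representatives give bounds only for \<open>x\<close> and
  \<open>y\<close> strictly above them. The limits are taken one factor at a time.\<close>

lemma real_le_mult_if_le_larger:
  fixes a b c :: real
  assumes "\<And>x y. a < x \<Longrightarrow> b < y \<Longrightarrow> c \<le> x * y" "0 \<le> a" "0 \<le> b"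
  shows "c \<le> a * b"
proof -
  have 1: "c \<le> a * y" if y: "b < y" for y
  proof -
    have "c / y \<le> x" if "a < x" for x
      using assms(1)[OF that y] y assms(3) by (simp add: divide_le_eq)
    then have "c / y \<le> a" by (rule dense_ge)
    then show ?thesis using y assms(3) by (simp add: divide_le_eq)
  qed
  show ?thesis
  proof (cases "a = 0")
    case True
    then show ?thesis using 1[of "b + 1"] by simp
  next
    case False
    then have a: "0 < a" using assms(2) by simp
    then have "c / a \<le> y" if "b < y" for y
      using 1[OF that] by (simp add: divide_le_eq mult.commute)
    then have "c / a \<le> b" by (rule dense_ge)
    then show ?thesis using a by (simp add: divide_le_eq mult.commute)
  qed
qed

section \<open>Residue norms\<close>

context ultra_normed_cring
begin

context
  fixes N assumes N: "ideal N A"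
begin

interpretation N: ideal N A by (rule N)

interpretation Q: cring "A Quot N" by (rule N.quotient_is_cring) (rule is_cring)

abbreviation "quo \<equiv> normed_quotient A N"

lemma quo_sel:
  "carrier quo = carrier (A Quot N)" "\<one>\<^bsub>quo\<^esub> = \<one>\<^bsub>A Quot N\<^esub>" "\<zero>\<^bsub>quo\<^esub> = \<zero>\<^bsub>A Quot N\<^esub>"
  "X \<otimes>\<^bsub>quo\<^esub> Y = X \<otimes>\<^bsub>A Quot N\<^esub> Y" "X \<oplus>\<^bsub>quo\<^esub> Y = X \<oplus>\<^bsub>A Quot N\<^esub> Y"
  "nrm quo X = (INF h\<in>X. nrm A h)"
  by (simp_all add: normed_quotient_def)

lemma cring_quo: "cring quo"
  by (intro cringI abelian_groupI comm_monoidI)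
    (auto simp: quo_sel Q.a_ac Q.m_ac Q.l_distr Q.r_distr Q.l_neg
      intro!: bexI[of _ "\<ominus>\<^bsub>A Quot N\<^esub> _"])

interpretation B: cring quo by (rule cring_quo)

lemma quo_hom: "(+>) N \<in> ring_hom A quo"
  using N.rcos_ring_hom by (simp add: ring_hom_def quo_sel)

interpretation hom: ring_hom_cring A quo "(+>) N"
  by (intro ring_hom_cringI ring_hom_ringI2 cring_quo quo_hom is_cring ring_axioms B.ring_axioms)

lemma zero_in_ideal: "\<zero> \<in> N"
  by (rule additive_subgroup.zero_closed[OF ideal.axioms(1)[OF N]])

lemma ideal_ne: "N \<noteq> {}"
  using zero_in_ideal by blast

lemma quo_carrierE:
  assumes "X \<in> carrier quo" obtains h where "h \<in> carrier A" "X = N +> h"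
proof -
  have "X \<in> a_rcosets N" using assms by (simp only: quo_sel FactRing_def partial_object.select_convs)
  then show ?thesis using that unfolding A_RCOSETS_def' by blast
qed

lemma quo_eq_zero: assumes "i \<in> N" shows "N +> i = \<zero>\<^bsub>quo\<^esub>"
proof -
  have "\<zero>\<^bsub>quo\<^esub> = N" by (simp only: quo_sel FactRing_def ring.select_convs)
  then show ?thesis by (rule trans[OF N.a_rcos_const[OF assms] sym])
qed

lemma nrm_quo: "h \<in> carrier A \<Longrightarrow> nrm quo (N +> h) = (INF i\<in>N. nrm A (i \<oplus> h))"
  by (simp add: quo_sel a_r_coset_def' image_image UNION_singleton_eq_range)

lemma bdd_below_quo: "h \<in> carrier A \<Longrightarrow> bdd_below ((\<lambda>i. nrm A (i \<oplus> h)) ` N)"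
  by (rule bdd_belowI2[of _ 0]) (simp add: nrm_nonneg N.Icarr)

lemma nrm_quo_le: "h \<in> carrier A \<Longrightarrow> i \<in> N \<Longrightarrow> nrm quo (N +> h) \<le> nrm A (i \<oplus> h)"
  by (simp add: nrm_quo cINF_lower[OF bdd_below_quo])

lemma nrm_quo_le_nrm: "h \<in> carrier A \<Longrightarrow> nrm quo (N +> h) \<le> nrm A h"
  using nrm_quo_le[of h \<zero>] zero_in_ideal by simp

lemma nrm_quo_ge: "h \<in> carrier A \<Longrightarrow> (\<And>i. i \<in> N \<Longrightarrow> M \<le> nrm A (i \<oplus> h)) \<Longrightarrow> M \<le> nrm quo (N +> h)"
  unfolding nrm_quo by (rule cINF_greatest[OF ideal_ne]) 

lemma nrm_quo_less:
  assumes "h \<in> carrier A" "nrm quo (N +> h) < M"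
  obtains g where "g \<in> carrier A" "N +> g = N +> h" "nrm A g < M"
proof -
  obtain i where i: "i \<in> N" "nrm A (i \<oplus> h) < M"
    using assms cInf_lessD[of "(\<lambda>i. nrm A (i \<oplus> h)) ` N" M] ideal_ne by (auto simp: nrm_quo)
  moreover have "N +> (i \<oplus> h) = N +> h"
    using assms i quo_eq_zero[OF i(1)] by (subst hom.hom_add) (auto simp: N.Icarr)
  ultimately show ?thesis using that[of "i \<oplus> h"] assms N.Icarr by auto
qed

lemma nrm_quo_nonneg: "X \<in> carrier quo \<Longrightarrow> 0 \<le> nrm quo X"
  using nrm_quo_ge[of _ 0] nrm_nonneg N.Icarr by (elim quo_carrierE) simp

text \<open>Each inequality is proved for representatives whose norms exceed the infima by
  arbitrarily little.\<close>

lemma ultra_normed_cring_quo: "ultra_normed_cring quo"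
proof
  fix X Y assume "X \<in> carrier quo" "Y \<in> carrier quo"
  then obtain h g where h: "h \<in> carrier A" "X = N +> h" and g: "g \<in> carrier A" "Y = N +> g"
    by (auto elim!: quo_carrierE)
  show "nrm quo (X \<otimes>\<^bsub>quo\<^esub> Y) \<le> nrm quo X * nrm quo Y"
  proof (rule real_le_mult_if_le_larger)
    fix x y assume xy: "nrm quo X < x" "nrm quo Y < y"
    obtain h' g' where h': "h' \<in> carrier A" "X = N +> h'" "nrm A h' < x"
        and g': "g' \<in> carrier A" "Y = N +> g'" "nrm A g' < y"
      using nrm_quo_less[OF h(1)] nrm_quo_less[OF g(1)] xy h g by metis
    have "nrm quo (X \<otimes>\<^bsub>quo\<^esub> Y) \<le> nrm A (h' \<otimes> g')"
      using h' g' nrm_quo_le_nrm[of "h' \<otimes> g'"] by simp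
    also have "\<dots> \<le> nrm A h' * nrm A g'" using h' g' by (intro nrm_submult)
    also have "\<dots> \<le> x * y" using h' g' nrm_nonneg[of h'] nrm_nonneg[of g'] by (intro mult_mono) auto
    finally show "nrm quo (X \<otimes>\<^bsub>quo\<^esub> Y) \<le> x * y" .
  qed (use h g nrm_quo_nonneg in auto)
  show "nrm quo (X \<oplus>\<^bsub>quo\<^esub> Y) \<le> max (nrm quo X) (nrm quo Y)"
  proof (rule dense_ge)
    fix x assume x: "max (nrm quo X) (nrm quo Y) < x"
    then have "nrm quo (N +> h) < x" "nrm quo (N +> g) < x" using h g by auto
    then obtain h' g' where h': "h' \<in> carrier A" "X = N +> h'" "nrm A h' < x"
        and g': "g' \<in> carrier A" "Y = N +> g'" "nrm A g' < x"
      using nrm_quo_less[OF h(1), of x] nrm_quo_less[OF g(1), of x] h g by metis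
    have "nrm quo (X \<oplus>\<^bsub>quo\<^esub> Y) \<le> nrm A (h' \<oplus> g')"
      using h' g' nrm_quo_le_nrm[of "h' \<oplus> g'"] by simp
    also have "\<dots> \<le> max (nrm A h') (nrm A g')" using h' g' by (intro nrm_ultra)
    also have "\<dots> \<le> x" using h' g' by simp
    finally show "nrm quo (X \<oplus>\<^bsub>quo\<^esub> Y) \<le> x" .
  qed
next
  have le: "nrm quo (\<ominus>\<^bsub>quo\<^esub> X) \<le> nrm quo X" if X: "X \<in> carrier quo" for X
  proof (rule dense_ge)
    fix x assume x: "nrm quo X < x"
    obtain h where h: "h \<in> carrier A" "X = N +> h" using X by (rule quo_carrierE)
    then obtain h' where h': "h' \<in> carrier A" "X = N +> h'" "nrm A h' < x"
      using nrm_quo_less[OF h(1)] x by metis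
    have "nrm quo (\<ominus>\<^bsub>quo\<^esub> X) \<le> nrm A (\<ominus> h')" using h' nrm_quo_le_nrm[of "\<ominus> h'"] by simp
    then show "nrm quo (\<ominus>\<^bsub>quo\<^esub> X) \<le> x" using h' nrm_uminus by simp
  qed
  show "nrm quo (\<ominus>\<^bsub>quo\<^esub> X) = nrm quo X" if "X \<in> carrier quo" for X
    using le[OF that] le[of "\<ominus>\<^bsub>quo\<^esub> X"] that by simp
next
  show "nrm quo \<zero>\<^bsub>quo\<^esub> = 0"
    using nrm_quo_le_nrm[of \<zero>] nrm_zero nrm_quo_nonneg[of "\<zero>\<^bsub>quo\<^esub>"] by simp
qed (rule nrm_quo_nonneg)

end

end

section \<open>Multiplicative norms\<close>

locale mult_normed_cring = ultra_normed_cring +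
  assumes nrm_mult: "f \<in> carrier A \<Longrightarrow> g \<in> carrier A \<Longrightarrow> nrm A (f \<otimes> g) = nrm A f * nrm A g"
    and nrm_one: "nrm A \<one> = 1"
begin

lemma nrm_power: "f \<in> carrier A \<Longrightarrow> nrm A (f [^] (k::nat)) = nrm A f ^ k"
  by (induction k) (auto simp: nrm_one nrm_mult)

lemma nrm_finprod:
  assumes "finite X" "\<And>x. x \<in> X \<Longrightarrow> f x \<in> carrier A"
  shows "nrm A (\<Otimes>x\<in>X. f x) = (\<Prod>x\<in>X. nrm A (f x))"
  using assms
proof (induction X)
  case (insert x X)
  then have "(\<Otimes>x\<in>X. f x) \<in> carrier A" by (intro finprod_closed) auto
  then show ?case using insert by (subst finprod_insert) (auto simp: nrm_mult)
qed (simp add: nrm_one)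

lemma is_shilov_boundary: "is_shilov_boundary A {restrict (nrm A) (carrier A)}"
proof (rule is_shilov_boundary_nrm[OF is_cring nrm_zero nrm_one nrm_nonneg nrm_mult])
  fix f g assume "f \<in> carrier A" "g \<in> carrier A"
  then show "nrm A (f \<oplus> g) \<le> nrm A f + nrm A g"
    using nrm_ultra[of f g] nrm_nonneg[of f] nrm_nonneg[of g] by (auto simp: max_def split: if_splits)
qed

end

text \<open>These evaluate multiples of the generators of the ideal: \<open>mult_minus_swap\<close>
  and \<open>mult_minus_mult_add\<close> serve the generators \<open>x - f\<close>,
  \<open>mult_minus_one_swap\<close> and \<open>minus_add_cancel\<close> the generators
  \<open>f y - 1\<close>.\<close>

lemma (in cring) ring_identities:
  assumes x: "x \<in> carrier R" and y: "y \<in> carrier R" and z: "z \<in> carrier R"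
  shows add_eq_imp_eq_minus: "x \<oplus> y = z \<Longrightarrow> x = z \<ominus> y"
    and mult_minus_swap: "x \<otimes> (y \<ominus> z) = y \<otimes> x \<ominus> z \<otimes> x"
    and mult_minus_mult_add: "x \<otimes> y \<ominus> x \<otimes> (y \<oplus> z) = \<ominus> (x \<otimes> z)"
    and mult_minus_one_swap: "x \<otimes> (y \<otimes> z \<ominus> \<one>) = y \<otimes> (z \<otimes> x) \<ominus> x"
    and minus_add_cancel: "y \<ominus> (y \<oplus> z) = \<ominus> (\<one> \<otimes> z)"
    and add_minus_cancel: "y = (x \<oplus> y) \<ominus> x"
proof -
  show "x = z \<ominus> y" if "x \<oplus> y = z"
    using x y by (simp add: that[symmetric] a_minus_def a_assoc r_neg)
  show "x \<otimes> (y \<ominus> z) = y \<otimes> x \<ominus> z \<otimes> x"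
    using x y z by (simp add: a_minus_def r_distr r_minus m_comm)
  show "x \<otimes> y \<ominus> x \<otimes> (y \<oplus> z) = \<ominus> (x \<otimes> z)"
    using x y z by (simp add: a_minus_def r_distr minus_add a_assoc[symmetric] r_neg)
  show "x \<otimes> (y \<otimes> z \<ominus> \<one>) = y \<otimes> (z \<otimes> x) \<ominus> x"
    using x y z by (simp add: a_minus_def r_distr r_minus m_ac)
  show "y \<ominus> (y \<oplus> z) = \<ominus> (\<one> \<otimes> z)"
    using y z by (simp add: a_minus_def minus_add a_assoc[symmetric] r_neg)
  show "y = (x \<oplus> y) \<ominus> x"
    using x y by (simp add: a_minus_def a_comm[of x y] a_assoc r_neg)
qed

text \<open>The prescribed radius of \<open>f s\<close> is its norm. The domain therefore contains
  the point of the spectrum given by the norm of \<open>A\<close>, which is why \<open>A\<close> can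
  embed isometrically.\<close>

locale laurent_domain = mult_normed_cring +
  fixes S :: "'s set" and f :: "'s \<Rightarrow> 'a" and \<rho> :: "'s \<Rightarrow> real"
  assumes fin_S: "finite S" and f_carrier: "s \<in> S \<Longrightarrow> f s \<in> carrier A"
    and nrm_f: "s \<in> S \<Longrightarrow> nrm A (f s) = \<rho> s" and \<rho>_pos: "s \<in> S \<Longrightarrow> 0 < \<rho> s"

sublocale laurent_domain \<subseteq> power_series A "S <+> S" "case_sum \<rho> (\<lambda>s. 1 / \<rho> s)"
  using fin_S \<rho>_pos by unfold_locales auto

section \<open>Evaluation of truncated series and the isometric embedding of
  \<open>A\<close>\<close>

context laurent_domain
begin

declare One_nat_def [simp del]

abbreviation "V \<equiv> S <+> S"
abbreviation "wt \<equiv> power_weight (case_sum \<rho> (\<lambda>s. 1 / \<rho> s))"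
abbreviation "deg m \<equiv> (\<Sum>v\<in>V. Poly_Mapping.lookup m v)"
abbreviation "X v \<equiv> monom (Poly_Mapping.single v 1) \<one>"
abbreviation "const \<equiv> monom 0"

text \<open>Substituting \<open>f s\<close> for \<open>x\<^sub>s\<close> and \<open>1 / f s\<close> for \<open>y\<^sub>s\<close> in a monomial whose exponents are at most \<open>N\<close>
  and multiplying by the \<open>N\<close>-th power of the product of all \<open>f s\<close> gives \<open>E N m\<close>. The functional
  \<open>L N\<close> evaluates the truncation of a series at degree \<open>N\<close> in this way; it is small on the ideal.\<close>

definition E :: "nat \<Rightarrow> ('s + 's \<Rightarrow>\<^sub>0 nat) \<Rightarrow> 'a" where
  "E N m = (\<Otimes>s\<in>S. f s [^] (Poly_Mapping.lookup m (Inl s) + N - Poly_Mapping.lookup m (Inr s)))"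

definition low :: "nat \<Rightarrow> ('s + 's \<Rightarrow>\<^sub>0 nat) set" where
  "low N = {m. Poly_Mapping.keys m \<subseteq> V \<and> deg m < N}"

definition L :: "nat \<Rightarrow> (('s + 's \<Rightarrow>\<^sub>0 nat) \<Rightarrow> 'a) \<Rightarrow> 'a" where
  "L N g = (\<Oplus>m\<in>low (Suc N). g m \<otimes> E N m)"

lemma finite_low: "finite (low N)"
  unfolding low_def by (rule finite_degree_less)

lemma low_lookup_le:
  assumes "m \<in> low (Suc N)" "v \<in> V" shows "Poly_Mapping.lookup m v \<le> N"
  using member_le_sum[of v V "Poly_Mapping.lookup m"] assms fin_V by (simp add: low_def)

lemma E_closed: "E N m \<in> carrier A"
  unfolding E_def using f_carrier by (intro finprod_closed) auto

lemma L_closed: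
  assumes "g \<in> carrier P" shows "L N g \<in> carrier A"
  unfolding L_def using P_D(1)[OF assms] E_closed by (intro finsum_closed) auto

text \<open>The norm being multiplicative, \<open>E N m\<close> has the norm of a monomial in the
  \<open>\<rho> s\<close>. Since \<open>y_s\<close> has weight \<open>1 / \<rho> s\<close>, this is
  the weight of \<open>m\<close> times the cleared denominator; the degree bound makes the
  subtraction in the exponents exact.\<close>

lemma nrm_E:
  assumes "m \<in> low (Suc N)"
  shows "nrm A (E N m) = (\<Prod>s\<in>S. \<rho> s) ^ N * wt m"
proof -
  have "nrm A (E N m) = (\<Prod>s\<in>S. \<rho> s ^ (Poly_Mapping.lookup m (Inl s) + N - Poly_Mapping.lookup m (Inr s)))"
    unfolding E_def using f_carrier fin_S
    by (subst nrm_finprod) (auto simp: nrm_power nrm_f intro!: prod.cong)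
  also have "\<dots> = (\<Prod>s\<in>S. \<rho> s ^ N * (\<rho> s ^ Poly_Mapping.lookup m (Inl s) * (1 / \<rho> s) ^ Poly_Mapping.lookup m (Inr s)))"
  proof (rule prod.cong[OF refl])
    fix s assume s: "s \<in> S"
    have "\<rho> s \<noteq> 0" using \<rho>_pos[OF s] by simp
    moreover have "Poly_Mapping.lookup m (Inr s) \<le> N" using low_lookup_le[OF assms] s by blast
    ultimately show "\<rho> s ^ (Poly_Mapping.lookup m (Inl s) + N - Poly_Mapping.lookup m (Inr s)) =
        \<rho> s ^ N * (\<rho> s ^ Poly_Mapping.lookup m (Inl s) * (1 / \<rho> s) ^ Poly_Mapping.lookup m (Inr s))"
      by (simp add: power_diff power_add power_one_over)
  qed
  also have "\<dots> = (\<Prod>s\<in>S. \<rho> s) ^ N * wt m"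
    using fin_S assms power_weight_superset[of V m]
    by (simp add: low_def prod.distrib prod_power_distrib prod.Plus)
  finally show ?thesis .
qed

lemma R_pos: "0 < (\<Prod>s\<in>S. \<rho> s) ^ N"
  using \<rho>_pos by (intro zero_less_power prod_pos) auto

text \<open>Formulated for a subset \<open>Y\<close> because it is applied both to the whole
  truncation and to its part of top degree.\<close>

lemma nrm_sum_E_le:
  assumes g: "g \<in> carrier P" and "Y \<subseteq> low (Suc N)" "\<And>m. m \<in> Y \<Longrightarrow> wnrm g m \<le> M" "0 \<le> M"
  shows "nrm A (\<Oplus>m\<in>Y. g m \<otimes> E N m) \<le> M * (\<Prod>s\<in>S. \<rho> s) ^ N"
proof (rule nrm_finsum_le)
  show "finite Y" using assms(2) finite_low finite_subset by blast
  show "0 \<le> M * (\<Prod>s\<in>S. \<rho> s) ^ N" using assms R_pos[of N] by simp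
  fix m assume m: "m \<in> Y"
  show "g m \<otimes> E N m \<in> carrier A" using P_D(1)[OF g] E_closed by simp
  have "nrm A (g m \<otimes> E N m) = wnrm g m * (\<Prod>s\<in>S. \<rho> s) ^ N"
    using nrm_E m assms(2) P_D(1)[OF g] E_closed by (simp add: nrm_mult subset_iff)
  then show "nrm A (g m \<otimes> E N m) \<le> M * (\<Prod>s\<in>S. \<rho> s) ^ N"
    using assms(3)[OF m] R_pos[of N] by (simp add: mult_right_mono)
qed

lemma nrm_L_le:
  assumes "g \<in> carrier P"
  shows "nrm A (L N g) \<le> nrm P g * (\<Prod>s\<in>S. \<rho> s) ^ N"
  unfolding L_def
  by (rule nrm_sum_E_le) (use assms wnrm_le nrm_P_nonneg in auto)

lemma L_add:
  assumes "g \<in> carrier P" "h \<in> carrier P"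
  shows "L N (g \<oplus>\<^bsub>P\<^esub> h) = L N g \<oplus> L N h"
  unfolding L_def P_sel using P_D(1)[OF assms(1)] P_D(1)[OF assms(2)] E_closed
  by (subst finsum_addf[symmetric]) (auto simp: l_distr intro!: finsum_cong')

lemma L_const_mult:
  assumes a: "a \<in> carrier A" and g: "g \<in> carrier P"
  shows "L N (const a \<otimes>\<^bsub>P\<^esub> g) = a \<otimes> L N g"
proof -
  have "0 \<in> divisors m" for m :: "'s + 's \<Rightarrow>\<^sub>0 nat" by (auto simp: divisors_def)
  then show ?thesis
    unfolding L_def using a P_D(1)[OF g] E_closed
    by (subst finsum_rdistr) (auto simp: monom_mult[OF a g] finite_low m_assoc intro!: finsum_cong')
qed

lemma zero_in_low: "0 \<in> low (Suc N)"
  by (simp add: low_def)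

lemma L_const:
  assumes a: "a \<in> carrier A"
  shows "L N (const a) = a \<otimes> E N 0"
proof -
  have "L N (const a) = (\<Oplus>m\<in>low (Suc N). if 0 = m then a \<otimes> E N m else \<zero>)"
    unfolding L_def monom_def using a E_closed by (intro finsum_cong') auto
  also have "\<dots> = a \<otimes> E N 0"
    using a E_closed zero_in_low by (subst finsum_singleton) (auto simp: finite_low)
  finally show ?thesis .
qed

lemma lookup_shift:
  "Poly_Mapping.lookup (m + Poly_Mapping.single v (1::nat)) w = Poly_Mapping.lookup m w + (if w = v then 1 else 0)"
  by (simp add: lookup_add lookup_single when_def)

lemma deg_shift:
  assumes "v \<in> V" shows "deg (m + Poly_Mapping.single v (1::nat)) = deg m + 1"
proof -
  have "deg (m + Poly_Mapping.single v 1) = (\<Sum>w\<in>V. Poly_Mapping.lookup m w + (if w = v then 1 else 0))"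
    by (rule sum.cong[OF refl]) (rule lookup_shift)
  then show ?thesis using assms fin_V by (simp add: sum.distrib)
qed

lemma shift_in_low:
  assumes "v \<in> V" shows "m + Poly_Mapping.single v 1 \<in> low (Suc N) \<longleftrightarrow> m \<in> low N"
  unfolding low_def mem_Collect_eq deg_shift[OF assms] keys_add_nat using assms by simp

text \<open>Multiplication by a variable raises the degree by one, so only terms of \<open>g\<close>
  of degree below \<open>N\<close> survive the truncation. The missing terms of degree exactly
  \<open>N\<close> are the origin of \<open>tail\<close>.\<close>

lemma L_X_mult:
  assumes v: "v \<in> V" and g: "g \<in> carrier P"
  shows "L N (X v \<otimes>\<^bsub>P\<^esub> g) = (\<Oplus>m\<in>low N. g m \<otimes> E N (m + Poly_Mapping.single v 1))"
proof -
  let ?\<sigma> = "Poly_Mapping.single v (1::nat)"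
  let ?t = "\<lambda>m. m + ?\<sigma>"
  have sub: "?t ` low N \<subseteq> low (Suc N)"
    using shift_in_low[OF v] by blast
  have zero: "(X v \<otimes>\<^bsub>P\<^esub> g) m = \<zero>" if "m \<in> low (Suc N) - ?t ` low N" for m
  proof -
    have "?\<sigma> \<notin> divisors m"
    proof
      assume "?\<sigma> \<in> divisors m"
      then obtain q where q: "m = q + ?\<sigma>" by (auto simp: divisors_def add.commute)
      then have "q \<in> low N" using that shift_in_low[OF v] by blast
      then show False using that q by blast
    qed
    then show ?thesis using monom_mult[OF one_closed g] by simp
  qed
  have coeff: "(X v \<otimes>\<^bsub>P\<^esub> g) (?t m) = g m" for m
    using monom_mult[OF one_closed g, of ?\<sigma> "?t m"] divisors_add[of ?\<sigma> m] P_D(1)[OF g]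
    by (simp add: add.commute)
  have Xg: "X v \<otimes>\<^bsub>P\<^esub> g \<in> carrier P" using g v by (intro mult_P_closed monom_carrier) auto
  have "L N (X v \<otimes>\<^bsub>P\<^esub> g) = (\<Oplus>m\<in>?t ` low N. (X v \<otimes>\<^bsub>P\<^esub> g) m \<otimes> E N m)"
    unfolding L_def using P_D(1)[OF Xg] E_closed sub zero
    by (intro add.finprod_mono_neutral_cong_right) (auto simp: finite_low)
  also have "\<dots> = (\<Oplus>m\<in>low N. (X v \<otimes>\<^bsub>P\<^esub> g) (?t m) \<otimes> E N (?t m))"
    using P_D(1)[OF Xg] E_closed by (intro finsum_reindex) (auto simp: inj_on_def)
  finally show ?thesis by (simp add: coeff)
qed

lemma finprod_power_Suc:
  assumes s: "s \<in> S" and e: "e' s = Suc (e s)" "\<And>t. t \<in> S - {s} \<Longrightarrow> e' t = e t"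
  shows "(\<Otimes>t\<in>S. f t [^] (e' t :: nat)) = f s \<otimes> (\<Otimes>t\<in>S. f t [^] (e t :: nat))"
proof -
  have S: "S = insert s (S - {s})" using s by auto
  have ins: "(\<Otimes>t\<in>S. f t [^] (d t :: nat)) = f s [^] d s \<otimes> (\<Otimes>t\<in>S - {s}. f t [^] d t)" for d
    using fin_S f_carrier s by (subst S, subst finprod_insert) auto
  have eq: "(\<Otimes>t\<in>S - {s}. f t [^] e' t) = (\<Otimes>t\<in>S - {s}. f t [^] e t)"
    using e f_carrier by (intro finprod_cong') auto
  have "(\<Otimes>t\<in>S - {s}. f t [^] e t) \<in> carrier A" using f_carrier by (intro finprod_closed) auto
  then show ?thesis using f_carrier[OF s] e(1) by (simp add: ins eq m_assoc m_comm[of _ "f s"])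
qed

lemma E_shift_Inl:
  assumes "m \<in> low N" "s \<in> S"
  shows "E N (m + Poly_Mapping.single (Inl s) 1) = f s \<otimes> E N m"
  unfolding E_def
proof (rule finprod_power_Suc[OF assms(2)])
  have "Poly_Mapping.lookup m (Inr s) \<le> N"
    using low_lookup_le[of m N "Inr s"] assms by (auto simp: low_def)
  then show "Poly_Mapping.lookup (m + Poly_Mapping.single (Inl s) 1) (Inl s) + N -
      Poly_Mapping.lookup (m + Poly_Mapping.single (Inl s) 1) (Inr s) =
      Suc (Poly_Mapping.lookup m (Inl s) + N - Poly_Mapping.lookup m (Inr s))"
    by (simp add: lookup_shift)
qed (simp add: lookup_shift)

text \<open>The counterpart for \<open>1 / f s\<close>, multiplied out because the inverse need not
  exist in \<open>A\<close>. After the shift the exponent of \<open>y_s\<close> is still at most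
  \<open>N\<close>, so the subtraction is not cut off at 0.\<close>

lemma E_shift_Inr:
  assumes "m \<in> low N" "s \<in> S"
  shows "f s \<otimes> E N (m + Poly_Mapping.single (Inr s) 1) = E N m"
  unfolding E_def
proof (rule finprod_power_Suc[OF assms(2), symmetric])
  have "m + Poly_Mapping.single (Inr s) 1 \<in> low (Suc N)"
    using assms shift_in_low[of "Inr s" m N] by blast
  then have "Poly_Mapping.lookup m (Inr s) + 1 \<le> N"
    using low_lookup_le[of "m + Poly_Mapping.single (Inr s) 1" N "Inr s"] assms by (auto simp: lookup_shift)
  then show "Poly_Mapping.lookup m (Inl s) + N - Poly_Mapping.lookup m (Inr s) =
      Suc (Poly_Mapping.lookup (m + Poly_Mapping.single (Inr s) 1) (Inl s) + N -
      Poly_Mapping.lookup (m + Poly_Mapping.single (Inr s) 1) (Inr s))"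
    by (simp add: lookup_shift)
qed (simp add: lookup_shift)

definition tail :: "nat \<Rightarrow> (('s + 's \<Rightarrow>\<^sub>0 nat) \<Rightarrow> 'a) \<Rightarrow> 'a" where
  "tail N g = (\<Oplus>m\<in>low (Suc N) - low N. g m \<otimes> E N m)"

lemma tail_closed: "g \<in> carrier P \<Longrightarrow> tail N g \<in> carrier A"
  unfolding tail_def using P_D(1) E_closed by (intro finsum_closed) auto

lemma L_split:
  assumes g: "g \<in> carrier P"
  shows "L N g = (\<Oplus>m\<in>low N. g m \<otimes> E N m) \<oplus> tail N g"
proof -
  have "low (Suc N) = low N \<union> (low (Suc N) - low N)" by (auto simp: low_def)
  then show ?thesis unfolding L_def tail_def
    using P_D(1)[OF g] E_closed finite_low
    by (subst finsum_Un_disjoint[symmetric]) auto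
qed

lemma low_sum_closed: "g \<in> carrier P \<Longrightarrow> (\<Oplus>m\<in>low N. g m \<otimes> E N m) \<in> carrier A"
  using P_D(1) E_closed by (intro finsum_closed) auto

definition gens :: "(('s + 's \<Rightarrow>\<^sub>0 nat) \<Rightarrow> 'a) set" where
  "gens = {X (Inl s) \<ominus>\<^bsub>P\<^esub> const (f s) | s. s \<in> S} \<union>
     {const (f s) \<otimes>\<^bsub>P\<^esub> X (Inr s) \<ominus>\<^bsub>P\<^esub> \<one>\<^bsub>P\<^esub> | s. s \<in> S}"

lemma const_closed: "a \<in> carrier A \<Longrightarrow> const a \<in> carrier P"
  by (rule monom_carrier) auto

lemma X_closed: "v \<in> V \<Longrightarrow> X v \<in> carrier P"
  by (rule monom_carrier) auto

lemma gens_subset: "gens \<subseteq> carrier P"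
  using f_carrier by (auto simp: gens_def intro!: P.minus_closed P.m_closed const_closed X_closed)

lemma L_minus:
  assumes "g \<in> carrier P" "h \<in> carrier P"
  shows "L N (g \<ominus>\<^bsub>P\<^esub> h) = L N g \<ominus> L N h"
proof -
  have "L N (g \<ominus>\<^bsub>P\<^esub> h) \<oplus> L N h = L N (g \<ominus>\<^bsub>P\<^esub> h \<oplus>\<^bsub>P\<^esub> h)" using assms by (intro L_add[symmetric]) auto
  also have "g \<ominus>\<^bsub>P\<^esub> h \<oplus>\<^bsub>P\<^esub> h = g" using assms by (simp add: P.minus_eq P.a_assoc P.l_neg)
  finally have "L N (g \<ominus>\<^bsub>P\<^esub> h) \<oplus> L N h = L N g" .
  moreover have "L N (g \<ominus>\<^bsub>P\<^esub> h) \<in> carrier A" "L N h \<in> carrier A" using assms by (auto intro: L_closed)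
  moreover have "L N g \<in> carrier A" using assms by (intro L_closed)
  ultimately show ?thesis using add_eq_imp_eq_minus by blast
qed

text \<open>Evaluation annihilates \<open>x - f\<close> and \<open>f y - 1\<close> up to one defect:
  the product with a variable is seen one degree short. What remains is the top-degree part of
  \<open>h\<close>, with a factor \<open>c\<close> that does not depend on \<open>N\<close>.\<close>

lemma L_gen_mult:
  assumes h: "h \<in> carrier P" and z: "z \<in> gens"
  obtains c where "c \<in> carrier A" "\<And>N. L N (h \<otimes>\<^bsub>P\<^esub> z) = \<ominus> (c \<otimes> tail N h)"
proof -
  consider s where "s \<in> S" "z = X (Inl s) \<ominus>\<^bsub>P\<^esub> const (f s)"
    | s where "s \<in> S" "z = const (f s) \<otimes>\<^bsub>P\<^esub> X (Inr s) \<ominus>\<^bsub>P\<^esub> \<one>\<^bsub>P\<^esub>"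
    using z by (auto simp: gens_def)
  then show ?thesis
  proof cases
    case 1
    note fs = f_carrier[OF 1(1)]
    have XC: "X (Inl s) \<in> carrier P" "const (f s) \<in> carrier P" using X_closed const_closed fs 1 by auto
    have eq: "h \<otimes>\<^bsub>P\<^esub> z = X (Inl s) \<otimes>\<^bsub>P\<^esub> h \<ominus>\<^bsub>P\<^esub> const (f s) \<otimes>\<^bsub>P\<^esub> h"
      unfolding 1(2) by (rule P.mult_minus_swap[OF h XC])
    have "L N (h \<otimes>\<^bsub>P\<^esub> z) = \<ominus> (f s \<otimes> tail N h)" for N
    proof -
      let ?l = "\<Oplus>m\<in>low N. h m \<otimes> E N m"
      have v: "Inl s \<in> V" using 1 by blast
      have "L N (X (Inl s) \<otimes>\<^bsub>P\<^esub> h) = (\<Oplus>m\<in>low N. f s \<otimes> (h m \<otimes> E N m))"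
        unfolding L_X_mult[OF v h] using 1 P_D(1)[OF h] E_closed fs
        by (auto simp: E_shift_Inl m_ac intro!: finsum_cong')
      also have "\<dots> = f s \<otimes> ?l"
        using P_D(1)[OF h] E_closed fs by (intro finsum_rdistr[symmetric]) (auto simp: finite_low)
      finally have "L N (h \<otimes>\<^bsub>P\<^esub> z) = f s \<otimes> ?l \<ominus> f s \<otimes> (?l \<oplus> tail N h)"
        unfolding eq using h XC by (simp add: L_minus L_const_mult[OF fs] L_split[OF h])
      also have "\<dots> = \<ominus> (f s \<otimes> tail N h)"
        by (rule mult_minus_mult_add[OF fs low_sum_closed[OF h] tail_closed[OF h]])
      finally show ?thesis .
    qed
    then show ?thesis using that fs by blast
  next
    case 2
    note fs = f_carrier[OF 2(1)]
    have XC: "X (Inr s) \<in> carrier P" "const (f s) \<in> carrier P" using X_closed const_closed fs 2 by auto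
    have eq: "h \<otimes>\<^bsub>P\<^esub> z = const (f s) \<otimes>\<^bsub>P\<^esub> (X (Inr s) \<otimes>\<^bsub>P\<^esub> h) \<ominus>\<^bsub>P\<^esub> h"
      unfolding 2(2) by (rule P.mult_minus_one_swap[OF h XC(2,1)])
    have "L N (h \<otimes>\<^bsub>P\<^esub> z) = \<ominus> (\<one> \<otimes> tail N h)" for N
    proof -
      let ?l = "\<Oplus>m\<in>low N. h m \<otimes> E N m"
      have v: "Inr s \<in> V" using 2 by blast
      have "L N (const (f s) \<otimes>\<^bsub>P\<^esub> (X (Inr s) \<otimes>\<^bsub>P\<^esub> h)) =
          f s \<otimes> (\<Oplus>m\<in>low N. h m \<otimes> E N (m + Poly_Mapping.single (Inr s) 1))"
        using h XC by (simp add: L_const_mult[OF fs] L_X_mult[OF v h])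
      also have "\<dots> = (\<Oplus>m\<in>low N. f s \<otimes> (h m \<otimes> E N (m + Poly_Mapping.single (Inr s) 1)))"
        using P_D(1)[OF h] E_closed fs by (intro finsum_rdistr) (auto simp: finite_low)
      also have "\<dots> = ?l"
      proof (rule finsum_cong')
        fix m assume "m \<in> low N"
        then show "f s \<otimes> (h m \<otimes> E N (m + Poly_Mapping.single (Inr s) 1)) = h m \<otimes> E N m"
          using E_shift_Inr[of m N s] 2 P_D(1)[OF h, of m] E_closed fs by (metis m_lcomm)
      qed (use P_D(1)[OF h] E_closed in auto)
      finally have "L N (h \<otimes>\<^bsub>P\<^esub> z) = ?l \<ominus> (?l \<oplus> tail N h)"
        unfolding eq using h XC by (simp add: L_minus L_split[OF h])
      also have "\<dots> = \<ominus> (\<one> \<otimes> tail N h)"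
        by (rule minus_add_cancel[OF one_closed low_sum_closed[OF h] tail_closed[OF h]])
      finally show ?thesis .
    qed
    then show ?thesis using that by blast
  qed
qed

text \<open>Finitely many terms of \<open>h\<close> have weighted size at least
  \<open>\<epsilon>\<close>; once \<open>N\<close> exceeds their degrees, none of them occurs in
  degree \<open>N\<close>.\<close>

lemma tail_small:
  assumes h: "h \<in> carrier P" and "0 < \<epsilon>"
  shows "\<exists>N0. \<forall>N\<ge>N0. nrm A (tail N h) \<le> \<epsilon> * (\<Prod>s\<in>S. \<rho> s) ^ N"
proof -
  let ?F = "{m. \<epsilon> \<le> wnrm h m}"
  have fin: "finite (deg ` ?F)" using P_D(3)[OF assms] by simp
  have "nrm A (tail N h) \<le> \<epsilon> * (\<Prod>s\<in>S. \<rho> s) ^ N" if N: "Suc (Max (insert 0 (deg ` ?F))) \<le> N" for N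
    unfolding tail_def
  proof (rule nrm_sum_E_le[OF h])
    fix m assume m: "m \<in> low (Suc N) - low N"
    then have "deg m = N" by (auto simp: low_def)
    then have "Max (insert 0 (deg ` ?F)) < deg m" using N by simp
    then have "m \<notin> ?F" using Max_ge[of "insert 0 (deg ` ?F)" "deg m"] fin by auto
    then show "wnrm h m \<le> \<epsilon>" by simp
  qed (use assms in auto)
  then show ?thesis by blast
qed

text \<open>Being small compared with the \<open>N\<close>-th power of the product of the
  \<open>\<rho> s\<close> is preserved by sums, so only multiples of a single generator have to be
  examined. For these \<open>L N\<close> is a fixed multiple of a tail.\<close>

lemma L_ideal_small:
  assumes "g \<in> Idl\<^bsub>P\<^esub> gens" "0 < \<epsilon>"
  shows "\<exists>N0. \<forall>N\<ge>N0. nrm A (L N g) \<le> \<epsilon> * (\<Prod>s\<in>S. \<rho> s) ^ N"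
proof -
  have "\<forall>\<epsilon>>0. \<exists>N0. \<forall>N\<ge>N0. nrm A (L N g) \<le> \<epsilon> * (\<Prod>s\<in>S. \<rho> s) ^ N"
  proof (rule P.genideal_induct[OF gens_subset assms(1)])
    have "L N \<zero>\<^bsub>P\<^esub> = \<zero>" for N
      unfolding L_def P_sel using E_closed by (subst finsum_cong'[where g = "\<lambda>_. \<zero>"]) auto
    then have "nrm A (L N \<zero>\<^bsub>P\<^esub>) \<le> \<epsilon> * (\<Prod>s\<in>S. \<rho> s) ^ N" if "0 < \<epsilon>" for \<epsilon> N
      using R_pos[of N] that by (simp add: nrm_zero)
    then show "\<forall>\<epsilon>>0. \<exists>N0. \<forall>N\<ge>N0. nrm A (L N \<zero>\<^bsub>P\<^esub>) \<le> \<epsilon> * (\<Prod>s\<in>S. \<rho> s) ^ N" by blast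
  next
    fix h z assume h: "h \<in> carrier P" and "z \<in> gens"
    then obtain c where c: "c \<in> carrier A" "\<And>N. L N (h \<otimes>\<^bsub>P\<^esub> z) = \<ominus> (c \<otimes> tail N h)"
      using L_gen_mult by blast
    show "\<forall>\<epsilon>>0. \<exists>N0. \<forall>N\<ge>N0. nrm A (L N (h \<otimes>\<^bsub>P\<^esub> z)) \<le> \<epsilon> * (\<Prod>s\<in>S. \<rho> s) ^ N"
    proof (intro allI impI)
      fix \<epsilon> :: real assume "0 < \<epsilon>"
      \<comment> \<open>The summand 1 makes \<open>C\<close> positive, so that dividing by it is
        possible even if \<open>nrm A c\<close> vanishes.\<close>
      define C where "C = nrm A c + 1"
      have C: "0 < C" "nrm A c \<le> C" using nrm_nonneg[OF c(1)] by (auto simp: C_def)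
      obtain N0 where N0: "\<And>N. N0 \<le> N \<Longrightarrow> nrm A (tail N h) \<le> \<epsilon> / C * (\<Prod>s\<in>S. \<rho> s) ^ N"
        using tail_small[OF h, of "\<epsilon> / C"] C \<open>0 < \<epsilon>\<close> by auto
      have "nrm A (L N (h \<otimes>\<^bsub>P\<^esub> z)) \<le> \<epsilon> * (\<Prod>s\<in>S. \<rho> s) ^ N" if "N0 \<le> N" for N
      proof -
        have "nrm A (L N (h \<otimes>\<^bsub>P\<^esub> z)) = nrm A c * nrm A (tail N h)"
          using c tail_closed[OF h] by (simp add: nrm_uminus nrm_mult)
        also have "\<dots> \<le> C * (\<epsilon> / C * (\<Prod>s\<in>S. \<rho> s) ^ N)"
          using C N0[OF that] nrm_nonneg tail_closed[OF h] by (intro mult_mono) auto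
        finally show ?thesis using C by simp
      qed
      then show "\<exists>N0. \<forall>N\<ge>N0. nrm A (L N (h \<otimes>\<^bsub>P\<^esub> z)) \<le> \<epsilon> * (\<Prod>s\<in>S. \<rho> s) ^ N" by blast
    qed
  next
    fix a b assume ab: "a \<in> carrier P" "b \<in> carrier P"
      and *: "\<forall>\<epsilon>>0. \<exists>N0. \<forall>N\<ge>N0. nrm A (L N a) \<le> \<epsilon> * (\<Prod>s\<in>S. \<rho> s) ^ N"
        "\<forall>\<epsilon>>0. \<exists>N0. \<forall>N\<ge>N0. nrm A (L N b) \<le> \<epsilon> * (\<Prod>s\<in>S. \<rho> s) ^ N"
    show "\<forall>\<epsilon>>0. \<exists>N0. \<forall>N\<ge>N0. nrm A (L N (a \<oplus>\<^bsub>P\<^esub> b)) \<le> \<epsilon> * (\<Prod>s\<in>S. \<rho> s) ^ N"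
    proof (intro allI impI)
      fix \<epsilon> :: real assume "0 < \<epsilon>"
      then obtain N1 N2 where N: "\<And>N. N1 \<le> N \<Longrightarrow> nrm A (L N a) \<le> \<epsilon> * (\<Prod>s\<in>S. \<rho> s) ^ N"
          "\<And>N. N2 \<le> N \<Longrightarrow> nrm A (L N b) \<le> \<epsilon> * (\<Prod>s\<in>S. \<rho> s) ^ N"
        using * by meson
      have "nrm A (L N (a \<oplus>\<^bsub>P\<^esub> b)) \<le> \<epsilon> * (\<Prod>s\<in>S. \<rho> s) ^ N" if "max N1 N2 \<le> N" for N
        using nrm_ultra[OF L_closed[OF ab(1), of N] L_closed[OF ab(2), of N]] N[of N] that
        by (auto simp: L_add[OF ab] max_def split: if_splits)
      then show "\<exists>N0. \<forall>N\<ge>N0. nrm A (L N (a \<oplus>\<^bsub>P\<^esub> b)) \<le> \<epsilon> * (\<Prod>s\<in>S. \<rho> s) ^ N" by blast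
    qed
  qed
  then show ?thesis using assms by blast
qed

text \<open>Apply \<open>L N\<close> to the constant, written as \<open>g + const a\<close> minus
  \<open>g\<close>. The constant gives \<open>nrm A a\<close>, the ideal element at most
  \<open>\<epsilon>\<close>, and the sum at most its norm, each times the same positive factor,
  which cancels.\<close>

lemma nrm_le_nrm_const_add_ideal:
  assumes a: "a \<in> carrier A" and g: "g \<in> Idl\<^bsub>P\<^esub> gens"
  shows "nrm A a \<le> nrm P (g \<oplus>\<^bsub>P\<^esub> const a)"
proof -
  have gc: "g \<in> carrier P"
    using g P.genideal_ideal[OF gens_subset] ideal.Icarr by metis
  have "nrm A a \<le> max (nrm P (g \<oplus>\<^bsub>P\<^esub> const a)) \<epsilon>" if \<epsilon>: "0 < \<epsilon>" for \<epsilon>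
  proof -
    obtain N where N: "nrm A (L N g) \<le> \<epsilon> * (\<Prod>s\<in>S. \<rho> s) ^ N"
      using L_ideal_small[OF g \<epsilon>] by blast
    have "nrm A (E N 0) = (\<Prod>s\<in>S. \<rho> s) ^ N"
      using nrm_E[of 0 N] by (simp add: low_def power_weight_def)
    then have "nrm A a * (\<Prod>s\<in>S. \<rho> s) ^ N = nrm A (L N (const a))"
      using a E_closed by (simp add: L_const nrm_mult)
    also have "const a = (g \<oplus>\<^bsub>P\<^esub> const a) \<ominus>\<^bsub>P\<^esub> g"
      by (rule P.add_minus_cancel[OF gc const_closed[OF a] gc])
    also have "L N \<dots> = L N (g \<oplus>\<^bsub>P\<^esub> const a) \<ominus> L N g"
      using gc const_closed[OF a] by (intro L_minus) auto
    also have "nrm A \<dots> \<le> max (nrm A (L N (g \<oplus>\<^bsub>P\<^esub> const a))) (nrm A (L N g))"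
      using gc const_closed[OF a] L_closed by (intro nrm_minus_le) auto
    also have "\<dots> \<le> max (nrm P (g \<oplus>\<^bsub>P\<^esub> const a) * (\<Prod>s\<in>S. \<rho> s) ^ N) (\<epsilon> * (\<Prod>s\<in>S. \<rho> s) ^ N)"
      using gc const_closed[OF a] N by (intro max.mono nrm_L_le) auto
    also have "\<dots> = max (nrm P (g \<oplus>\<^bsub>P\<^esub> const a)) \<epsilon> * (\<Prod>s\<in>S. \<rho> s) ^ N"
      using R_pos[of N] by (simp add: max_mult_distrib_right)
    finally show ?thesis using R_pos[of N] by simp
  qed
  note le = this
  have "0 \<le> nrm P (g \<oplus>\<^bsub>P\<^esub> const a)"
    using gc const_closed[OF a] by (intro nrm_P_nonneg) auto
  note ge0 = this
  show ?thesis
  proof (rule ccontr)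
    assume n: "\<not> ?thesis"
    \<comment> \<open>With this value of \<open>\<epsilon>\<close> the maximum in \<open>le\<close>
      can only be the norm of the sum.\<close>
    then have "0 < nrm A a / 2" using ge0 by simp
    then show False using le[of "nrm A a / 2"] n by (simp add: max_def split: if_splits)
  qed
qed

end

lemma (in abelian_group) eq_if_minus_eq_zero:
  assumes "a \<in> carrier G" "b \<in> carrier G" "a \<ominus> b = \<zero>"
  shows "a = b"
proof -
  have "a = (a \<ominus> b) \<oplus> b" using assms(1,2) by (simp add: a_minus_def a_assoc l_neg)
  then show ?thesis using assms by simp
qed

section \<open>Multiplicativity of the residue norm\<close>

context laurent_domain
begin

declare One_nat_def [simp del]

interpretation PN: ultra_normed_cring P
  by (rule ultra_normed_cring_P)

definition "J = Idl\<^bsub>P\<^esub> gens"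
definition "B = normed_quotient P J"
definition "\<pi> h = J +>\<^bsub>P\<^esub> h"
definition "\<iota> a = \<pi> (const a)"

lemma laurent_domain_algebra_eq: "laurent_domain_algebra A S \<rho> f \<rho> f = B"
  unfolding laurent_domain_algebra_def Let_def P_def[symmetric]
  by (simp add: B_def J_def gens_def series_const_def series_var_def monom_def)

lemma ideal_J: "ideal J P"
  unfolding J_def by (rule P.genideal_ideal[OF gens_subset])

lemma B_ultra: "ultra_normed_cring B"
  unfolding B_def by (rule PN.ultra_normed_cring_quo[OF ideal_J])

interpretation BN: ultra_normed_cring B by (rule B_ultra)

lemma hom_\<pi>: "ring_hom_cring P B \<pi>"
  using PN.quo_hom[OF ideal_J] BN.is_cring P.is_cring
  by (simp add: ring_hom_cring_def ring_hom_cring_axioms_def B_def \<pi>_def[abs_def])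

interpretation \<pi>: ring_hom_cring P B \<pi> by (rule hom_\<pi>)

lemma \<pi>_eq_zero: "z \<in> gens \<Longrightarrow> \<pi> z = \<zero>\<^bsub>B\<^esub>"
  unfolding \<pi>_def B_def
  by (rule PN.quo_eq_zero[OF ideal_J]) (use P.genideal_self[OF gens_subset] J_def in auto)

lemma nrm_\<pi>_le: "h \<in> carrier P \<Longrightarrow> nrm B (\<pi> h) \<le> nrm P h"
  unfolding B_def \<pi>_def by (rule PN.nrm_quo_le_nrm[OF ideal_J])

lemma \<iota>_closed: "a \<in> carrier A \<Longrightarrow> \<iota> a \<in> carrier B"
  by (simp add: \<iota>_def const_closed)

lemma const_add: "a \<in> carrier A \<Longrightarrow> b \<in> carrier A \<Longrightarrow> const (a \<oplus> b) = const a \<oplus>\<^bsub>P\<^esub> const b"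
  by (auto simp: P_sel monom_def)

lemma monom_mult_monom:
  assumes "a \<in> carrier A" "b \<in> carrier A" "Poly_Mapping.keys q \<subseteq> V"
  shows "monom p a \<otimes>\<^bsub>P\<^esub> monom q b = monom (p + q) (a \<otimes> b)"
proof
  fix m
  show "(monom p a \<otimes>\<^bsub>P\<^esub> monom q b) m = monom (p + q) (a \<otimes> b) m"
    using assms by (auto simp: monom_mult monom_carrier) (auto simp: monom_def divisors_def)
qed

lemma \<iota>_add: "a \<in> carrier A \<Longrightarrow> b \<in> carrier A \<Longrightarrow> \<iota> (a \<oplus> b) = \<iota> a \<oplus>\<^bsub>B\<^esub> \<iota> b"
  by (simp add: \<iota>_def const_add const_closed)

lemma \<iota>_mult: "a \<in> carrier A \<Longrightarrow> b \<in> carrier A \<Longrightarrow> \<iota> (a \<otimes> b) = \<iota> a \<otimes>\<^bsub>B\<^esub> \<iota> b"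
  using monom_mult_monom[of a b 0 0] by (simp add: \<iota>_def const_closed flip: \<pi>.hom_mult)

lemma \<iota>_one: "\<iota> \<one> = \<one>\<^bsub>B\<^esub>"
  using \<pi>.hom_one by (simp add: \<iota>_def P_sel(1))

lemma nrm_\<iota>:
  assumes a: "a \<in> carrier A" shows "nrm B (\<iota> a) = nrm A a"
proof (rule antisym)
  have "nrm P (const a) = nrm A a" using nrm_monom[OF a, of 0] by (simp add: power_weight_def)
  then show "nrm B (\<iota> a) \<le> nrm A a" using nrm_\<pi>_le[OF const_closed[OF a]] by (simp add: \<iota>_def)
  show "nrm A a \<le> nrm B (\<iota> a)"
    unfolding \<iota>_def \<pi>_def B_def
    by (rule PN.nrm_quo_ge[OF ideal_J const_closed[OF a] nrm_le_nrm_const_add_ideal[OF a]])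
      (simp add: J_def)
qed

text \<open>The elements of \<open>D\<close> are the fractions \<open>a / c\<close> with \<open>c \<in> U\<close>, whose norm is determined by that
  of \<open>A\<close>.\<close>

definition "U = {c \<in> carrier A. 0 < nrm A c \<and> (\<exists>z\<in>carrier B. \<iota> c \<otimes>\<^bsub>B\<^esub> z = \<one>\<^bsub>B\<^esub> \<and> nrm B z \<le> 1 / nrm A c)}"
definition "D = {b \<in> carrier B. \<exists>c\<in>U. \<exists>a\<in>carrier A. \<iota> c \<otimes>\<^bsub>B\<^esub> b = \<iota> a}"

lemma D_I: "c \<in> U \<Longrightarrow> a \<in> carrier A \<Longrightarrow> b \<in> carrier B \<Longrightarrow> \<iota> c \<otimes>\<^bsub>B\<^esub> b = \<iota> a \<Longrightarrow> b \<in> D"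
  by (auto simp: D_def)

lemma U_mult:
  assumes "c \<in> U" "d \<in> U" shows "c \<otimes> d \<in> U"
proof -
  obtain z where z: "z \<in> carrier B" "\<iota> c \<otimes>\<^bsub>B\<^esub> z = \<one>\<^bsub>B\<^esub>" "nrm B z \<le> 1 / nrm A c"
    using assms by (auto simp: U_def)
  obtain w where w: "w \<in> carrier B" "\<iota> d \<otimes>\<^bsub>B\<^esub> w = \<one>\<^bsub>B\<^esub>" "nrm B w \<le> 1 / nrm A d"
    using assms by (auto simp: U_def)
  have cd: "c \<in> carrier A" "d \<in> carrier A" "0 < nrm A c" "0 < nrm A d" using assms by (auto simp: U_def)
  have "\<iota> (c \<otimes> d) \<otimes>\<^bsub>B\<^esub> (z \<otimes>\<^bsub>B\<^esub> w) = (\<iota> c \<otimes>\<^bsub>B\<^esub> z) \<otimes>\<^bsub>B\<^esub> (\<iota> d \<otimes>\<^bsub>B\<^esub> w)"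
    using cd z(1) w(1) \<iota>_closed by (simp add: \<iota>_mult BN.m_ac)
  moreover have "nrm B (z \<otimes>\<^bsub>B\<^esub> w) \<le> 1 / nrm A (c \<otimes> d)"
  proof -
    have "nrm B (z \<otimes>\<^bsub>B\<^esub> w) \<le> nrm B z * nrm B w" using z w by (intro BN.nrm_submult)
    also have "\<dots> \<le> 1 / nrm A c * (1 / nrm A d)"
      using z w cd BN.nrm_nonneg by (intro mult_mono) auto
    finally show ?thesis using cd by (simp add: nrm_mult)
  qed
  ultimately show ?thesis using z w cd unfolding U_def by (auto simp: nrm_mult intro!: bexI[of _ "z \<otimes>\<^bsub>B\<^esub> w"])
qed

lemma one_U: "\<one> \<in> U"
  unfolding U_def using nrm_\<iota>[OF one_closed]
  by (auto simp: nrm_one \<iota>_one intro!: bexI[of _ "\<one>\<^bsub>B\<^esub>"])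

text \<open>Writing \<open>b\<close> as \<open>\<iota> a\<close> times the inverse of
  \<open>\<iota> c\<close> gives the upper bound, submultiplicativity in
  \<open>\<iota> c \<otimes> b = \<iota> a\<close> the lower one. The norm bound on inverses in the
  definition of \<open>U\<close> is what makes the two meet.\<close>

lemma nrm_fraction:
  assumes "c \<in> U" "a \<in> carrier A" "b \<in> carrier B" "\<iota> c \<otimes>\<^bsub>B\<^esub> b = \<iota> a"
  shows "nrm B b = nrm A a / nrm A c"
proof -
  obtain z where z: "z \<in> carrier B" "\<iota> c \<otimes>\<^bsub>B\<^esub> z = \<one>\<^bsub>B\<^esub>" "nrm B z \<le> 1 / nrm A c"
    using assms by (auto simp: U_def)
  have c: "c \<in> carrier A" "0 < nrm A c" using assms by (auto simp: U_def)
  have "b = (\<iota> c \<otimes>\<^bsub>B\<^esub> z) \<otimes>\<^bsub>B\<^esub> b" using z assms by simp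
  also have "\<dots> = z \<otimes>\<^bsub>B\<^esub> \<iota> a"
    using z(1) assms(3) \<iota>_closed[OF c(1)] unfolding assms(4)[symmetric] by (simp add: BN.m_ac)
  finally have "nrm B b \<le> nrm B z * nrm B (\<iota> a)"
    using z(1) assms \<iota>_closed BN.nrm_submult by metis
  also have "\<dots> \<le> 1 / nrm A c * nrm A a"
    using z assms nrm_nonneg by (simp add: nrm_\<iota>) (metis mult_right_mono times_divide_eq_left mult_1)
  finally have "nrm B b \<le> nrm A a / nrm A c" by simp
  moreover have "nrm A a \<le> nrm A c * nrm B b"
    using BN.nrm_submult[OF \<iota>_closed[OF c(1)] assms(3)] assms c by (simp add: nrm_\<iota>)
  then have "nrm A a / nrm A c \<le> nrm B b" using c by (simp add: field_simps)
  ultimately show ?thesis by simp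
qed

lemma D_\<iota>: "a \<in> carrier A \<Longrightarrow> \<iota> a \<in> D"
  by (rule D_I[OF one_U _ \<iota>_closed]) (auto simp: \<iota>_one \<iota>_closed)

lemma D_add:
  assumes "b \<in> D" "d \<in> D" shows "b \<oplus>\<^bsub>B\<^esub> d \<in> D"
proof -
  obtain c a c' a' where *: "c \<in> U" "a \<in> carrier A" "\<iota> c \<otimes>\<^bsub>B\<^esub> b = \<iota> a" "b \<in> carrier B"
      "c' \<in> U" "a' \<in> carrier A" "\<iota> c' \<otimes>\<^bsub>B\<^esub> d = \<iota> a'" "d \<in> carrier B"
    using assms by (auto simp: D_def)
  have c: "c \<in> carrier A" "c' \<in> carrier A" using * by (auto simp: U_def)
  have "\<iota> (c \<otimes> c') \<otimes>\<^bsub>B\<^esub> (b \<oplus>\<^bsub>B\<^esub> d) = \<iota> c' \<otimes>\<^bsub>B\<^esub> (\<iota> c \<otimes>\<^bsub>B\<^esub> b) \<oplus>\<^bsub>B\<^esub> \<iota> c \<otimes>\<^bsub>B\<^esub> (\<iota> c' \<otimes>\<^bsub>B\<^esub> d)"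
    using c *(4,8) \<iota>_closed by (simp add: \<iota>_mult BN.r_distr BN.m_ac)
  also have "\<dots> = \<iota> (c' \<otimes> a \<oplus> c \<otimes> a')"
    using c *(2,6) by (simp add: *(3,7) \<iota>_mult \<iota>_add)
  finally show ?thesis
    using * c by (intro D_I[OF U_mult[OF *(1,5)]]) auto
qed

lemma fraction_mult:
  assumes "c \<in> U" "a \<in> carrier A" "\<iota> c \<otimes>\<^bsub>B\<^esub> b = \<iota> a" "b \<in> carrier B"
      "c' \<in> U" "a' \<in> carrier A" "\<iota> c' \<otimes>\<^bsub>B\<^esub> d = \<iota> a'" "d \<in> carrier B"
  shows "\<iota> (c \<otimes> c') \<otimes>\<^bsub>B\<^esub> (b \<otimes>\<^bsub>B\<^esub> d) = \<iota> (a \<otimes> a')"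
proof -
  have c: "c \<in> carrier A" "c' \<in> carrier A" using assms by (auto simp: U_def)
  have "\<iota> (c \<otimes> c') \<otimes>\<^bsub>B\<^esub> (b \<otimes>\<^bsub>B\<^esub> d) = (\<iota> c \<otimes>\<^bsub>B\<^esub> b) \<otimes>\<^bsub>B\<^esub> (\<iota> c' \<otimes>\<^bsub>B\<^esub> d)"
    using c assms(4,8) \<iota>_closed by (simp add: \<iota>_mult BN.m_ac)
  then show ?thesis using assms by (simp add: \<iota>_mult)
qed

lemma D_mult:
  assumes "b \<in> D" "d \<in> D"
  shows "b \<otimes>\<^bsub>B\<^esub> d \<in> D" "nrm B (b \<otimes>\<^bsub>B\<^esub> d) = nrm B b * nrm B d"
proof -
  obtain c a c' a' where *: "c \<in> U" "a \<in> carrier A" "\<iota> c \<otimes>\<^bsub>B\<^esub> b = \<iota> a" "b \<in> carrier B"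
      "c' \<in> U" "a' \<in> carrier A" "\<iota> c' \<otimes>\<^bsub>B\<^esub> d = \<iota> a'" "d \<in> carrier B"
    using assms by (auto simp: D_def)
  note m = fraction_mult[OF *]
  have c: "c \<in> carrier A" "c' \<in> carrier A" using * by (auto simp: U_def)
  show "b \<otimes>\<^bsub>B\<^esub> d \<in> D"
    using * by (intro D_I[OF U_mult[OF *(1,5)] _ _ m]) auto
  show "nrm B (b \<otimes>\<^bsub>B\<^esub> d) = nrm B b * nrm B d"
    using nrm_fraction[OF U_mult[OF *(1,5)] _ _ m] nrm_fraction[OF *(1,2,4,3)] nrm_fraction[OF *(5,6,8,7)] * c
    by (simp add: nrm_mult)
qed

lemma nrm_X: "v \<in> V \<Longrightarrow> nrm P (X v) = case_sum \<rho> (\<lambda>s. 1 / \<rho> s) v"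
  by (subst nrm_monom) (auto simp: nrm_one power_weight_def)

text \<open>In \<open>B\<close> the variable \<open>x_s\<close> is \<open>f s\<close> and
  \<open>y_s\<close> is its inverse. The radius of \<open>y_s\<close> is the inverse of the norm of
  \<open>f s\<close>, which puts \<open>f s\<close> into \<open>U\<close>.\<close>

lemma D_X:
  assumes "v \<in> V" shows "\<pi> (X v) \<in> D"
proof -
  consider s where "s \<in> S" "v = Inl s" | s where "s \<in> S" "v = Inr s" using assms by blast
  then show ?thesis
  proof cases
    case 1
    have c: "X v \<in> carrier P" "const (f s) \<in> carrier P"
      using assms f_carrier[OF 1(1)] by (auto intro: X_closed const_closed)
    have "\<pi> (X v \<ominus>\<^bsub>P\<^esub> const (f s)) = \<zero>\<^bsub>B\<^esub>"
      using 1 by (intro \<pi>_eq_zero) (auto simp: gens_def)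
    then have zero: "\<pi> (X v) \<ominus>\<^bsub>B\<^esub> \<pi> (const (f s)) = \<zero>\<^bsub>B\<^esub>"
      using c by (simp add: P.minus_eq BN.minus_eq)
    have "\<pi> (X v) = \<iota> (f s)"
      unfolding \<iota>_def by (rule BN.eq_if_minus_eq_zero[OF \<pi>.hom_closed[OF c(1)] \<pi>.hom_closed[OF c(2)] zero])
    then show ?thesis using D_\<iota>[OF f_carrier[OF 1(1)]] by simp
  next
    case 2
    note fs = f_carrier[OF 2(1)]
    have c: "X v \<in> carrier P" "const (f s) \<in> carrier P"
      using assms fs by (auto intro: X_closed const_closed)
    have "\<pi> (const (f s) \<otimes>\<^bsub>P\<^esub> X v \<ominus>\<^bsub>P\<^esub> \<one>\<^bsub>P\<^esub>) = \<zero>\<^bsub>B\<^esub>"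
      using 2 by (intro \<pi>_eq_zero) (auto simp: gens_def)
    then have zero: "\<iota> (f s) \<otimes>\<^bsub>B\<^esub> \<pi> (X v) \<ominus>\<^bsub>B\<^esub> \<one>\<^bsub>B\<^esub> = \<zero>\<^bsub>B\<^esub>"
      using c by (simp add: P.minus_eq BN.minus_eq \<iota>_def)
    have "\<iota> (f s) \<otimes>\<^bsub>B\<^esub> \<pi> (X v) \<in> carrier B" using c \<iota>_closed[OF fs] by simp
    from BN.eq_if_minus_eq_zero[OF this BN.one_closed zero]
    have eq: "\<iota> (f s) \<otimes>\<^bsub>B\<^esub> \<pi> (X v) = \<one>\<^bsub>B\<^esub>" .
    have "nrm B (\<pi> (X v)) \<le> 1 / nrm A (f s)"
      using nrm_\<pi>_le[OF c(1)] nrm_X[OF assms] 2 nrm_f by simp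
    then have "f s \<in> U"
      using eq c fs \<rho>_pos[OF 2(1)] nrm_f[OF 2(1)] by (auto simp: U_def intro!: bexI[of _ "\<pi> (X v)"])
    then show ?thesis using eq c \<iota>_one by (intro D_I[of "f s" "\<one>"]) auto
  qed
qed

lemma D_monom:
  assumes "Poly_Mapping.keys m \<subseteq> V" "a \<in> carrier A"
  shows "\<pi> (monom m a) \<in> D"
  using assms
proof (induction "deg m" arbitrary: m)
  case 0
  then have "Poly_Mapping.lookup m v = 0" for v using fin_V by (cases "v \<in> V") (auto simp: in_keys_iff)
  then have "m = 0" by (intro poly_mapping_eqI) simp
  then show ?case using D_\<iota> 0 by (simp add: \<iota>_def)
next
  case (Suc d)
  then have "deg m \<noteq> 0" by simp
  then obtain v where v: "v \<in> V" "Poly_Mapping.lookup m v \<noteq> 0" by (rule sum.not_neutral_contains_not_neutral)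
  define m' where "m' = m - Poly_Mapping.single v 1"
  have m: "m = m' + Poly_Mapping.single v 1"
    by (rule poly_mapping_eqI) (use v in \<open>auto simp: m'_def lookup_add lookup_minus lookup_single when_def\<close>)
  have d: "d = deg m'" using Suc(2) deg_shift[OF v(1), of m'] by (simp add: m[symmetric])
  have k: "Poly_Mapping.keys m' \<subseteq> V" using Suc(3) by (simp add: m keys_add_nat)
  have "monom m a = monom m' a \<otimes>\<^bsub>P\<^esub> X v"
    using monom_mult_monom[OF Suc(4) one_closed, of "Poly_Mapping.single v 1" m'] v Suc(4) m by simp
  then have "\<pi> (monom m a) = \<pi> (monom m' a) \<otimes>\<^bsub>B\<^esub> \<pi> (X v)"
    using monom_carrier[OF Suc(4) k] X_closed[OF v(1)] by simp
  then show ?case using D_mult(1)[OF Suc(1)[OF d k Suc(4)] D_X[OF v(1)]] by simp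
qed

lemma truncation_closed:
  assumes "finite F" "F \<subseteq> {m. Poly_Mapping.keys m \<subseteq> V}" "h \<in> carrier P"
  shows "(\<lambda>m. if m \<in> F then h m else \<zero>) \<in> carrier P \<and> \<pi> (\<lambda>m. if m \<in> F then h m else \<zero>) \<in> D"
  using assms
proof (induction F)
  case empty
  have "\<iota> \<zero> = \<pi> (\<lambda>m. \<zero>)" by (simp add: \<iota>_def monom_def)
  then show ?case using D_\<iota>[OF zero_closed] zero_P_closed by (simp add: P_sel)
next
  case (insert q F)
  let ?g = "\<lambda>m. if m \<in> F then h m else \<zero>"
  note hq = P_D(1)[OF insert.prems(2)]
  have q: "monom q (h q) \<in> carrier P" using insert hq by (intro monom_carrier) auto
  have eq: "(\<lambda>m. if m \<in> insert q F then h m else \<zero>) = monom q (h q) \<oplus>\<^bsub>P\<^esub> ?g"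
    using insert hq by (auto simp: P_sel monom_def fun_eq_iff)
  have "?g \<in> carrier P" "\<pi> ?g \<in> D" using insert by auto
  moreover have "\<pi> (monom q (h q)) \<in> D" using insert hq by (intro D_monom) auto
  ultimately show ?case unfolding eq using q by (auto intro!: D_add)
qed

text \<open>A series is approximated by its finitely many terms of weighted size at least
  \<open>\<epsilon> / 2\<close>, which form a polynomial in the variables and so map into
  \<open>D\<close>.\<close>

lemma D_dense:
  assumes "b \<in> carrier B" "0 < \<epsilon>"
  obtains d where "d \<in> D" "nrm B (b \<ominus>\<^bsub>B\<^esub> d) < \<epsilon>"
proof -
  obtain h where h: "h \<in> carrier P" "b = \<pi> h"
    using PN.quo_carrierE[OF ideal_J] assms by (metis B_def \<pi>_def)
  let ?F = "{m. \<epsilon> / 2 \<le> wnrm h m}"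
  let ?g = "\<lambda>m. if m \<in> ?F then h m else \<zero>"
  have "?F \<subseteq> {m. Poly_Mapping.keys m \<subseteq> V}"
  proof safe
    fix m v assume "\<epsilon> / 2 \<le> wnrm h m" "v \<in> Poly_Mapping.keys m"
    then have "h m \<noteq> \<zero>" using assms by (auto simp: nrm_zero)
    then show "v \<in> V" using P_D(2)[OF h(1)] \<open>v \<in> Poly_Mapping.keys m\<close> by blast
  qed
  then have g: "?g \<in> carrier P" "\<pi> ?g \<in> D"
    using truncation_closed[of ?F h] P_D(3)[OF h(1), of "\<epsilon> / 2"] assms h(1) by auto
  have "nrm P (h \<ominus>\<^bsub>P\<^esub> ?g) \<le> \<epsilon> / 2"
  proof (rule nrm_P_le)
    fix m
    have "(h \<ominus>\<^bsub>P\<^esub> ?g) m = (if m \<in> ?F then \<zero> else h m)"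
      unfolding P.minus_eq uminus_P[OF g(1)] P_sel using P_D(1)[OF h(1)] by (simp add: r_neg)
    then show "wnrm (h \<ominus>\<^bsub>P\<^esub> ?g) m \<le> \<epsilon> / 2" using assms by (auto simp: nrm_zero)
  qed
  moreover have "\<pi> (h \<ominus>\<^bsub>P\<^esub> ?g) = b \<ominus>\<^bsub>B\<^esub> \<pi> ?g"
    using h g by (simp add: P.minus_eq BN.minus_eq)
  ultimately have "nrm B (b \<ominus>\<^bsub>B\<^esub> \<pi> ?g) \<le> \<epsilon> / 2"
    using nrm_\<pi>_le[of "h \<ominus>\<^bsub>P\<^esub> ?g"] h g by simp
  then show ?thesis using that[OF g(2)] assms(2) by simp
qed

text \<open>Approximate each factor by a fraction within less than its norm. The isosceles principle
  shows that neither the norms of the factors nor that of the product change, and on fractions the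
  norm is multiplicative. Elements of norm 0 are settled by submultiplicativity.\<close>

lemma nrm_B_mult:
  assumes b: "b \<in> carrier B" "b' \<in> carrier B"
  shows "nrm B (b \<otimes>\<^bsub>B\<^esub> b') = nrm B b * nrm B b'"
proof (cases "nrm B b = 0 \<or> nrm B b' = 0")
  case True
  then have "nrm B b * nrm B b' = 0" by auto
  moreover have "nrm B (b \<otimes>\<^bsub>B\<^esub> b') \<le> nrm B b * nrm B b'" by (rule BN.nrm_submult[OF b])
  moreover have "0 \<le> nrm B (b \<otimes>\<^bsub>B\<^esub> b')" using b by (intro BN.nrm_nonneg) auto
  ultimately show ?thesis by linarith
next
  case False
  then have pos: "0 < nrm B b" "0 < nrm B b'" using BN.nrm_nonneg b by (auto simp: order_less_le)
  obtain d where d: "d \<in> D" "nrm B (b \<ominus>\<^bsub>B\<^esub> d) < nrm B b" using D_dense[OF b(1) pos(1)] .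
  obtain d' where d': "d' \<in> D" "nrm B (b' \<ominus>\<^bsub>B\<^esub> d') < nrm B b'" using D_dense[OF b(2) pos(2)] .
  have dB: "d \<in> carrier B" "d' \<in> carrier B" using d d' by (auto simp: D_def)
  have eq: "nrm B d = nrm B b" "nrm B d' = nrm B b'"
    using BN.nrm_eq_if_close[OF b(1) dB(1)] BN.nrm_eq_if_close[OF b(2) dB(2)] d d' by auto
  let ?u = "(b \<ominus>\<^bsub>B\<^esub> d) \<otimes>\<^bsub>B\<^esub> b'" and ?w = "d \<otimes>\<^bsub>B\<^esub> (b' \<ominus>\<^bsub>B\<^esub> d')"
  have split: "d \<otimes>\<^bsub>B\<^esub> d' \<ominus>\<^bsub>B\<^esub> b \<otimes>\<^bsub>B\<^esub> b' = \<ominus>\<^bsub>B\<^esub> (?u \<oplus>\<^bsub>B\<^esub> ?w)"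
  proof -
    have "?u \<oplus>\<^bsub>B\<^esub> ?w = b \<otimes>\<^bsub>B\<^esub> b' \<oplus>\<^bsub>B\<^esub> \<ominus>\<^bsub>B\<^esub> (d \<otimes>\<^bsub>B\<^esub> d')"
      using b dB by (simp add: BN.minus_eq BN.l_distr BN.r_distr BN.l_minus BN.r_minus BN.a_assoc
          BN.r_neg1)
    then show ?thesis using b dB by (simp add: BN.minus_eq BN.minus_add BN.a_comm)
  qed
  have u: "nrm B ?u < nrm B b * nrm B b'"
  proof -
    have "nrm B ?u \<le> nrm B (b \<ominus>\<^bsub>B\<^esub> d) * nrm B b'" using b dB by (intro BN.nrm_submult) auto
    also have "\<dots> < nrm B b * nrm B b'" using d pos by (intro mult_strict_right_mono) auto
    finally show ?thesis .
  qed
  have w: "nrm B ?w < nrm B b * nrm B b'"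
  proof -
    have "nrm B ?w \<le> nrm B d * nrm B (b' \<ominus>\<^bsub>B\<^esub> d')" using b dB by (intro BN.nrm_submult) auto
    also have "\<dots> < nrm B b * nrm B b'" using d' pos eq by (simp add: mult_strict_left_mono)
    finally show ?thesis .
  qed
  have "nrm B (d \<otimes>\<^bsub>B\<^esub> d' \<ominus>\<^bsub>B\<^esub> b \<otimes>\<^bsub>B\<^esub> b') = nrm B (?u \<oplus>\<^bsub>B\<^esub> ?w)"
    unfolding split using b dB by (intro BN.nrm_uminus) auto
  also have "\<dots> \<le> max (nrm B ?u) (nrm B ?w)" using b dB by (intro BN.nrm_ultra) auto
  also have "\<dots> < nrm B b * nrm B b'" using u w by simp
  also have "\<dots> = nrm B (d \<otimes>\<^bsub>B\<^esub> d')" using D_mult(2)[OF d(1) d'(1)] eq by simp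
  finally have "nrm B (b \<otimes>\<^bsub>B\<^esub> b') = nrm B (d \<otimes>\<^bsub>B\<^esub> d')"
    using b dB by (intro BN.nrm_eq_if_close) auto
  then show ?thesis using D_mult(2)[OF d(1) d'(1)] eq by simp
qed

theorem laurent_domain_is_shilov_boundary:
  "\<exists>\<eta>. is_shilov_boundary (laurent_domain_algebra A S \<rho> f \<rho> f) {\<eta>}"
proof -
  have "nrm B \<one>\<^bsub>B\<^esub> = 1" using nrm_\<iota>[OF one_closed] by (simp add: \<iota>_one nrm_one)
  then interpret BM: mult_normed_cring B
    by unfold_locales (auto simp: nrm_B_mult)
  show ?thesis unfolding laurent_domain_algebra_eq using BM.is_shilov_boundary by blast
qed

end

section \<open>Null families in complete non-Archimedean fields\<close>

context nonarch_field
begin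

lemma absval_zero [simp]: "absval 0 = 0"
  using dist_absval[of 0 0] by simp

lemma absval_eq_zero_iff [simp]: "absval x = 0 \<longleftrightarrow> x = 0"
  by (metis diff_0_right dist_absval dist_eq_0_iff)

lemma absval_one [simp]: "absval 1 = 1"
  using absval_mult[of 1 1] absval_eq_zero_iff[of 1] by simp

lemma absval_add_eq:
  assumes "absval y < absval x" shows "absval (x + y) = absval x"
proof (rule antisym)
  show "absval (x + y) \<le> absval x" using absval_ultra[of x y] assms by simp
  have "absval x \<le> max (absval (x + y)) (absval y)" using absval_ultra[of "x + y" "- y"] by (simp add: absval_minus)
  then show "absval x \<le> absval (x + y)" using assms by (auto simp: max_def split: if_splits)
qed

lemma absval_sum_le:
  assumes "\<And>b. b \<in> X \<Longrightarrow> absval (f b) \<le> M" "0 \<le> M"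
  shows "absval (sum f X) \<le> M"
  using assms
proof (induction X rule: infinite_finite_induct)
  case (insert x F)
  then have "max (absval (f x)) (absval (sum f F)) \<le> M" by simp
  with absval_ultra have "absval (f x + sum f F) \<le> M" by (rule order_trans)
  then show ?case using insert by simp
qed auto

end

text \<open>Convergence to 0 along the cofinite filter, the ultrametric criterion for
  summability.\<close>

definition null_on :: "'b set \<Rightarrow> ('b \<Rightarrow> 'k :: nonarch_field) \<Rightarrow> bool" where
  "null_on X f \<longleftrightarrow> (\<forall>\<epsilon>>0. finite {b \<in> X. \<epsilon> \<le> absval (f b)})"

text \<open>Enlarging \<open>F n\<close> only adds terms smaller than
  \<open>inverse (Suc n)\<close>, and by the ultrametric inequality their sum is no larger. So the
  sums over \<open>F n\<close> form a Cauchy sequence, and its limit is the limit over all finite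
  subsets.\<close>

lemma null_on_summable:
  fixes f :: "'b \<Rightarrow> 'k :: nonarch_field"
  assumes "null_on X f" shows "f summable_on X"
proof -
  define F where "F n = {b \<in> X. inverse (real (Suc n)) \<le> absval (f b)}" for n
  have F: "finite (F n)" "F n \<subseteq> X" for n using assms by (auto simp: F_def null_on_def)
  have close: "dist (sum f G) (sum f (F n)) \<le> inverse (real (Suc n))"
    if "finite G" "G \<subseteq> X" "F n \<subseteq> G" for G n
  proof -
    have "sum f G - sum f (F n) = sum f (G - F n)" using that F by (simp add: sum_diff)
    moreover have "absval (sum f (G - F n)) \<le> inverse (real (Suc n))"
      using that by (intro absval_sum_le) (auto simp: F_def)
    ultimately show ?thesis by (simp add: dist_absval)
  qed
  have sub: "F m \<subseteq> F n" if "m \<le> n" for m n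
  proof -
    have "inverse (real (Suc n)) \<le> inverse (real (Suc m))" using that by simp
    then show ?thesis unfolding F_def by (smt (verit) Collect_mono)
  qed
  have "Cauchy (\<lambda>n. sum f (F n))"
  proof (rule metric_CauchyI)
    fix e :: real assume "e > 0"
    then obtain N where N: "inverse (real (Suc N)) < e / 2" using reals_Archimedean[of "e / 2"] by auto
    have "dist (sum f (F m)) (sum f (F n)) < e" if "N \<le> m" "N \<le> n" for m n
      using dist_triangle2[of "sum f (F m)" "sum f (F n)" "sum f (F N)"]
        close[OF F(1,2) sub[OF that(1)]] close[OF F(1,2) sub[OF that(2)]] N by simp
    then show "\<exists>N. \<forall>m\<ge>N. \<forall>n\<ge>N. dist (sum f (F m)) (sum f (F n)) < e" by blast
  qed
  then obtain L where L: "(\<lambda>n. sum f (F n)) \<longlonglongrightarrow> L" using Cauchy_convergent convergent_def by blast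
  have "(f has_sum L) X"
    unfolding has_sum_def
  proof (rule tendstoI)
    fix e :: real assume e: "e > 0"
    have "\<forall>\<^sub>F n in sequentially. inverse (real (Suc n)) < e / 2"
      using LIMSEQ_inverse_real_of_nat e by (auto intro!: order_tendstoD(2))
    moreover have "\<forall>\<^sub>F n in sequentially. dist (sum f (F n)) L < e / 2"
      using L e by (intro tendstoD) auto
    ultimately have "\<forall>\<^sub>F n in sequentially. inverse (real (Suc n)) < e / 2 \<and> dist (sum f (F n)) L < e / 2"
      by (rule eventually_conj)
    then obtain n where n: "inverse (real (Suc n)) < e / 2" "dist (sum f (F n)) L < e / 2"
      using eventually_happens'[OF sequentially_bot] by blast
    have "dist (sum f G) L < e" if "finite G" "G \<subseteq> X" "F n \<subseteq> G" for G
      using dist_triangle[of "sum f G" L "sum f (F n)"] close[OF that] n by simp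
    then show "\<forall>\<^sub>F G in finite_subsets_at_top X. dist (sum f G) L < e"
      unfolding eventually_finite_subsets_at_top using F by (intro exI[of _ "F n"]) blast
  qed
  then show ?thesis by (auto simp: summable_on_def)
qed

text \<open>A finite sum of absolute value below that of \<open>L\<close> has distance exactly
  \<open>absval L\<close> from \<open>L\<close>, so such sums cannot converge to
  \<open>L\<close>.\<close>

lemma has_sum_absval_le:
  fixes f :: "'b \<Rightarrow> 'k :: nonarch_field"
  assumes "(f has_sum L) X" "\<And>b. b \<in> X \<Longrightarrow> absval (f b) \<le> M" "0 \<le> M"
  shows "absval L \<le> M"
proof (rule ccontr)
  assume n: "\<not> absval L \<le> M"
  then have "0 < absval L" using assms by simp
  then have "\<forall>\<^sub>F G in finite_subsets_at_top X. dist (sum f G) L < absval L"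
    using assms(1) unfolding has_sum_def by (intro tendstoD)
  then obtain G where G: "G \<subseteq> X" "dist (sum f G) L < absval L"
    by (auto simp: eventually_finite_subsets_at_top)
  have "absval (sum f G) \<le> M" using assms G by (intro absval_sum_le) auto
  then have "absval (sum f G) < absval L" using n by simp
  then have "absval (L - sum f G) = absval L"
    using absval_add_eq[of "- sum f G" L] by (simp add: absval_minus)
  moreover have "dist (sum f G) L = absval (L - sum f G)" by (metis dist_absval dist_commute)
  ultimately show False using G(2) by simp
qed

lemma infsum_absval_le:
  fixes f :: "'b \<Rightarrow> 'k :: nonarch_field"
  assumes "\<And>b. b \<in> X \<Longrightarrow> absval (f b) \<le> M" "0 \<le> M"
  shows "absval (infsum f X) \<le> M"
proof (cases "f summable_on X")
  case True
  show ?thesis by (rule has_sum_absval_le[OF has_sum_infsum[OF True]]) (use assms in auto)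
next
  case False
  then show ?thesis using assms(2) by (simp add: infsum_not_exists)
qed

text \<open>Gives access to the rules for multiplying an infinite sum by a constant, on which
  associativity of the convolution rests.\<close>

instance nonarch_field \<subseteq> topological_semigroup_mult
proof
  fix a b :: 'a
  show "((\<lambda>x. fst x * snd x) \<longlongrightarrow> a * b) (nhds a \<times>\<^sub>F nhds b)"
  proof (rule tendstoI)
    fix e :: real assume "e > 0"
    define C where "C = absval a + absval b + 1"
    have C: "1 \<le> C" "absval a \<le> C" "absval b \<le> C"
      using absval_nonneg[of a] absval_nonneg[of b] by (auto simp: C_def)
    \<comment> \<open>The bound 1 keeps \<open>absval y\<close> below \<open>C\<close>; the bound
      \<open>e / C\<close> controls both summands in the splitting of
      \<open>x * y - a * b\<close>.\<close>
    define d where "d = min 1 (e / C)"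
    have d: "0 < d" "d \<le> 1" "C * d \<le> e" using C \<open>e > 0\<close> by (auto simp: d_def min_def field_simps)
    have "\<forall>\<^sub>F x in nhds a. dist x a < d" "\<forall>\<^sub>F y in nhds b. dist y b < d"
      using d by (auto simp: eventually_nhds_metric intro!: exI[of _ d])
    then show "\<forall>\<^sub>F p in nhds a \<times>\<^sub>F nhds b. dist (fst p * snd p) (a * b) < e"
      unfolding eventually_prod_filter
    proof (intro exI conjI allI impI)
      fix x y assume xy: "dist x a < d" "dist y b < d"
      have "absval y \<le> max (absval (y - b)) (absval b)" using absval_ultra[of "y - b" b] by simp
      then have y: "absval y \<le> C" using xy d C by (auto simp: dist_absval)
      have "x * y - a * b = (x - a) * y + a * (y - b)" by (simp add: algebra_simps)
      then have "absval (x * y - a * b) \<le> max (absval ((x - a) * y)) (absval (a * (y - b)))"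
        using absval_ultra by metis
      also have "\<dots> < C * d"
      proof -
        have "absval (x - a) * absval y \<le> absval (x - a) * C"
          using y absval_nonneg by (intro mult_left_mono)
        also have "\<dots> < d * C" using xy C by (intro mult_strict_right_mono) (auto simp: dist_absval)
        finally have 1: "absval ((x - a) * y) < C * d" by (simp add: absval_mult mult.commute)
        have "absval a * absval (y - b) \<le> C * absval (y - b)"
          using C absval_nonneg by (intro mult_right_mono)
        also have "\<dots> < C * d" using xy C by (intro mult_strict_left_mono) (auto simp: dist_absval)
        finally show ?thesis using 1 by (simp add: absval_mult)
      qed
      finally show "dist (fst (x, y) * snd (x, y)) (a * b) < e" using d by (simp add: dist_absval)
    qed
  qed
qed

text \<open>The family is summable over the product, and its rows and columns are null as
  projections of finite sets are finite. Both iterated sums therefore equal the sum over all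
  pairs.\<close>

lemma infsum_swap_null:
  fixes f :: "'a \<Rightarrow> 'b \<Rightarrow> 'k :: nonarch_field"
  assumes "null_on UNIV (\<lambda>p. f (fst p) (snd p))"
  shows "(\<Sum>\<^sub>\<infinity>x. \<Sum>\<^sub>\<infinity>y. f x y) = (\<Sum>\<^sub>\<infinity>y. \<Sum>\<^sub>\<infinity>x. f x y)"
proof -
  have fin: "finite {p. \<epsilon> \<le> absval (f (fst p) (snd p))}" if "\<epsilon> > 0" for \<epsilon>
    using assms that by (auto simp: null_on_def)
  have "null_on UNIV (\<lambda>y. f x y)" for x
    unfolding null_on_def
  proof (intro allI impI)
    fix \<epsilon> :: real assume "\<epsilon> > 0"
    have "{b \<in> UNIV. \<epsilon> \<le> absval (f x b)} \<subseteq> snd ` {p. \<epsilon> \<le> absval (f (fst p) (snd p))}"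
      by (rule subsetI, rule image_eqI[of _ _ "(x, _)"]) auto
    then show "finite {b \<in> UNIV. \<epsilon> \<le> absval (f x b)}" using fin[OF \<open>\<epsilon> > 0\<close>] finite_surj by blast
  qed
  then have s1: "((\<lambda>y. f x y) has_sum (\<Sum>\<^sub>\<infinity>y. f x y)) UNIV" for x
    using null_on_summable by (intro has_sum_infsum) blast
  have "null_on UNIV (\<lambda>x. f x y)" for y
    unfolding null_on_def
  proof (intro allI impI)
    fix \<epsilon> :: real assume "\<epsilon> > 0"
    have "{b \<in> UNIV. \<epsilon> \<le> absval (f b y)} \<subseteq> fst ` {p. \<epsilon> \<le> absval (f (fst p) (snd p))}"
      by (rule subsetI, rule image_eqI[of _ _ "(_, y)"]) auto
    then show "finite {b \<in> UNIV. \<epsilon> \<le> absval (f b y)}" using fin[OF \<open>\<epsilon> > 0\<close>] finite_surj by blast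
  qed
  then have s2: "((\<lambda>x. f x y) has_sum (\<Sum>\<^sub>\<infinity>x. f x y)) UNIV" for y
    using null_on_summable by (intro has_sum_infsum) blast
  obtain s where s: "((\<lambda>p. f (fst p) (snd p)) has_sum s) (UNIV \<times> UNIV)"
    using null_on_summable[OF assms] by (auto simp: summable_on_def)
  have "((\<lambda>x. \<Sum>\<^sub>\<infinity>y. f x y) has_sum s) UNIV"
    by (rule has_sum_SigmaD[OF s]) (use s1 in simp)
  moreover have "((\<lambda>y. \<Sum>\<^sub>\<infinity>x. f x y) has_sum s) UNIV"
  proof (rule has_sum_SigmaD)
    show "((\<lambda>(x, y). f (fst (y, x)) (snd (y, x))) has_sum s) (UNIV \<times> UNIV)"
      by (rule has_sum_swap[THEN iffD1, OF s])
  qed (use s2 in simp)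
  ultimately show ?thesis by (simp add: infsumI)
qed

section \<open>The Gauss norm on Laurent series\<close>

locale laurent_series =
  fixes V :: "'v set" and r :: "'v \<Rightarrow> real"
  assumes fin_V: "finite V" and r_pos: "v \<in> V \<Longrightarrow> 0 < r v"
begin

abbreviation "lw \<equiv> laurent_weight r"

abbreviation supp :: "('v \<Rightarrow>\<^sub>0 int) \<Rightarrow> bool" where "supp \<alpha> \<equiv> Poly_Mapping.keys \<alpha> \<subseteq> V"

abbreviation wabs :: "(('v \<Rightarrow>\<^sub>0 int) \<Rightarrow> 'k :: nonarch_field) \<Rightarrow> ('v \<Rightarrow>\<^sub>0 int) \<Rightarrow> real" where
  "wabs c \<alpha> \<equiv> absval (c \<alpha>) * lw \<alpha>"

abbreviation Ls :: "(('v \<Rightarrow>\<^sub>0 int) \<Rightarrow> 'k :: nonarch_field) normed_ring" where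
  "Ls \<equiv> laurent_algebra V r"

lemma lw_eq: "supp \<alpha> \<Longrightarrow> lw \<alpha> = (\<Prod>v\<in>V. r v powi Poly_Mapping.lookup \<alpha> v)"
  unfolding laurent_weight_def using fin_V
  by (intro prod.mono_neutral_left) (auto simp: in_keys_iff)

lemma supp_add: "supp \<alpha> \<Longrightarrow> supp \<beta> \<Longrightarrow> supp (\<alpha> + \<beta>)"
  using Poly_Mapping.keys_add[of \<alpha> \<beta>] by blast

lemma supp_minus: "supp \<alpha> \<Longrightarrow> supp \<beta> \<Longrightarrow> supp (\<alpha> - \<beta>)"
  by (auto simp: in_keys_iff lookup_minus subset_iff) metis

lemma lw_add: "supp \<alpha> \<Longrightarrow> supp \<beta> \<Longrightarrow> lw (\<alpha> + \<beta>) = lw \<alpha> * lw \<beta>"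
  using r_pos supp_add[of \<alpha> \<beta>]
  by (subst (1 2 3) lw_eq) (auto simp: lookup_add power_int_add prod.distrib[symmetric] less_imp_neq[symmetric]
      intro!: prod.cong power_int_add)

lemma lw_pos: "supp \<alpha> \<Longrightarrow> 0 < lw \<alpha>"
  using r_pos by (subst lw_eq) (auto intro!: prod_pos)

lemma lw_zero: "lw 0 = 1"
  by (simp add: laurent_weight_def)

lemma Ls_sel:
  "\<one>\<^bsub>Ls\<^esub> = (\<lambda>\<alpha>. if \<alpha> = 0 then 1 else 0)" "\<zero>\<^bsub>Ls\<^esub> = (\<lambda>\<alpha>. 0)" "c \<oplus>\<^bsub>Ls\<^esub> d = (\<lambda>\<alpha>. c \<alpha> + d \<alpha>)"
  "nrm Ls c = (SUP \<alpha>. wabs c \<alpha>)" "c \<otimes>\<^bsub>Ls\<^esub> d = (\<lambda>\<alpha>. \<Sum>\<^sub>\<infinity>\<beta>. c \<beta> * d (\<alpha> - \<beta>))"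
  by (simp_all add: laurent_algebra_def)

lemma finite_degree_less:
  "finite {\<alpha> :: 'v \<Rightarrow>\<^sub>0 int. supp \<alpha> \<and> (\<Sum>v\<in>V. \<bar>Poly_Mapping.lookup \<alpha> v\<bar>) < N}"
proof (rule finite_subset)
  show "finite {\<alpha> :: 'v \<Rightarrow>\<^sub>0 int. supp \<alpha> \<and> (\<forall>v\<in>V. Poly_Mapping.lookup \<alpha> v \<in> {-N..N})}"
    using fin_V by (intro finite_poly_mappings_bounded) auto
  show "{\<alpha>. supp \<alpha> \<and> (\<Sum>v\<in>V. \<bar>Poly_Mapping.lookup \<alpha> v\<bar>) < N}
    \<subseteq> {\<alpha>. supp \<alpha> \<and> (\<forall>v\<in>V. Poly_Mapping.lookup \<alpha> v \<in> {-N..N})}"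
  proof clarify
    fix \<alpha> :: "'v \<Rightarrow>\<^sub>0 int" and v assume "v \<in> V" "(\<Sum>v\<in>V. \<bar>Poly_Mapping.lookup \<alpha> v\<bar>) < N"
    then have "\<bar>Poly_Mapping.lookup \<alpha> v\<bar> < N"
      using member_le_sum[of v V "\<lambda>v. \<bar>Poly_Mapping.lookup \<alpha> v\<bar>"] fin_V by simp
    then show "Poly_Mapping.lookup \<alpha> v \<in> {-N..N}" by auto
  qed
qed

lemma carrier_Ls:
  "carrier Ls = {c :: ('v \<Rightarrow>\<^sub>0 int) \<Rightarrow> 'k :: nonarch_field. (\<forall>\<alpha>. c \<alpha> \<noteq> 0 \<longrightarrow> supp \<alpha>) \<and>
     (\<forall>\<epsilon>>0. finite {\<alpha>. \<epsilon> \<le> wabs c \<alpha>})}" (is "_ = ?R")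
proof -
  have eq: "{\<alpha>. supp \<alpha> \<and> \<epsilon> \<le> wabs c \<alpha>} = {\<alpha>. \<epsilon> \<le> wabs c \<alpha>}"
    if "\<forall>\<alpha>. c \<alpha> \<noteq> 0 \<longrightarrow> supp \<alpha>" "\<epsilon> > 0" for c :: "('v \<Rightarrow>\<^sub>0 int) \<Rightarrow> 'k :: nonarch_field" and \<epsilon>
    using that by force
  note iff = tends_to_zero_iff_finite[of supp "\<lambda>\<alpha>. \<Sum>v\<in>V. \<bar>Poly_Mapping.lookup \<alpha> v\<bar>", OF finite_degree_less]
  have "carrier Ls = {c :: ('v \<Rightarrow>\<^sub>0 int) \<Rightarrow> 'k. (\<forall>\<alpha>. c \<alpha> \<noteq> 0 \<longrightarrow> supp \<alpha>) \<and>
      (\<forall>\<epsilon>>0. finite {\<alpha>. supp \<alpha> \<and> \<epsilon> \<le> wabs c \<alpha>})}"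
    by (simp add: laurent_algebra_def iff)
  also have "\<dots> = ?R" using eq by (intro Collect_cong conj_cong refl) simp
  finally show ?thesis .
qed

lemma Ls_D:
  assumes "c \<in> carrier Ls"
  shows "c \<alpha> \<noteq> 0 \<Longrightarrow> supp \<alpha>" "\<epsilon> > 0 \<Longrightarrow> finite {\<alpha>. \<epsilon> \<le> wabs c \<alpha>}"
  using assms by (auto simp: carrier_Ls)

lemma wabs_nonneg: assumes "c \<in> carrier Ls" shows "0 \<le> wabs c \<alpha>"
  using Ls_D(1)[OF assms, of \<alpha>] lw_pos[of \<alpha>] absval_nonneg[of "c \<alpha>"] by (cases "c \<alpha> = 0") auto

lemma Ls_bound:
  assumes "c \<in> carrier Ls" obtains M where "0 < M" "\<And>\<alpha>. wabs c \<alpha> \<le> M"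
  using bounded_if_finite_ge[OF Ls_D(2)[OF assms, of 1]] by auto

lemma bdd_above_wabs: assumes "c \<in> carrier Ls" shows "bdd_above (range (wabs c))"
proof -
  obtain M where "\<And>\<alpha>. wabs c \<alpha> \<le> M" using Ls_bound[OF assms] by blast
  then show ?thesis by (intro bdd_aboveI2[of _ _ M])
qed

lemma wabs_le: assumes "c \<in> carrier Ls" shows "wabs c \<alpha> \<le> nrm Ls c"
  unfolding Ls_sel by (rule cSUP_upper[OF _ bdd_above_wabs[OF assms]]) auto

lemma nrm_Ls_le: assumes "\<And>\<alpha>. wabs c \<alpha> \<le> M" shows "nrm Ls c \<le> M"
  unfolding Ls_sel by (rule cSUP_least) (use assms in auto)

lemma nrm_Ls_nonneg: assumes "c \<in> carrier Ls" shows "0 \<le> nrm Ls c"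
  using wabs_nonneg[OF assms, of 0] wabs_le[OF assms, of 0] by simp

text \<open>Only finitely many weighted coefficients reach half the norm, so the supremum is a
  maximum over a finite set.\<close>

lemma nrm_Ls_attained:
  assumes c: "c \<in> carrier Ls" and pos: "0 < nrm Ls c"
  obtains \<alpha> where "wabs c \<alpha> = nrm Ls c"
proof -
  let ?F = "{\<alpha>. nrm Ls c / 2 \<le> wabs c \<alpha>}"
  have fin: "finite ?F" by (rule Ls_D(2)[OF c]) (use pos in simp)
  obtain \<alpha>0 where "nrm Ls c / 2 < wabs c \<alpha>0"
    using less_cSUP_iff[OF _ bdd_above_wabs[OF c], of "nrm Ls c / 2"] pos by (auto simp: Ls_sel)
  then have ne: "\<alpha>0 \<in> ?F" by simp
  define M where "M = Max (wabs c ` ?F)"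
  have "M \<in> wabs c ` ?F" unfolding M_def using fin ne by (intro Max_in) auto
  then obtain \<alpha> where \<alpha>: "\<alpha> \<in> ?F" "wabs c \<alpha> = M" by auto
  have "wabs c \<beta> \<le> M" for \<beta>
  proof (cases "\<beta> \<in> ?F")
    case True
    then show ?thesis unfolding M_def using fin by (intro Max_ge) auto
  next
    case False
    then show ?thesis using \<alpha> by simp
  qed
  then have "nrm Ls c \<le> M" by (rule nrm_Ls_le)
  then show ?thesis using that[of \<alpha>] \<alpha>(2) wabs_le[OF c, of \<alpha>] by simp
qed

lemma Ls_add_bound:
  assumes "c \<in> carrier Ls" "d \<in> carrier Ls"
  shows "wabs (c \<oplus>\<^bsub>Ls\<^esub> d) \<alpha> \<le> max (wabs c \<alpha>) (wabs d \<alpha>)"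
proof (cases "supp \<alpha>")
  case True
  then show ?thesis using lw_pos[OF True] absval_ultra[of "c \<alpha>" "d \<alpha>"]
    by (auto simp: Ls_sel max_def mult_right_mono split: if_splits)
next
  case False
  then have "c \<alpha> = 0" "d \<alpha> = 0" using Ls_D(1) assms by blast+
  then show ?thesis by (simp add: Ls_sel)
qed

lemma Ls_add_closed:
  assumes "c \<in> carrier Ls" "d \<in> carrier Ls" shows "c \<oplus>\<^bsub>Ls\<^esub> d \<in> carrier Ls"
proof -
  have "finite {\<alpha>. \<epsilon> \<le> wabs (c \<oplus>\<^bsub>Ls\<^esub> d) \<alpha>}" if "\<epsilon> > 0" for \<epsilon>
  proof (rule finite_subset)
    show "{\<alpha>. \<epsilon> \<le> wabs (c \<oplus>\<^bsub>Ls\<^esub> d) \<alpha>} \<subseteq> {\<alpha>. \<epsilon> \<le> wabs c \<alpha>} \<union> {\<alpha>. \<epsilon> \<le> wabs d \<alpha>}"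
    proof (rule subsetI, rule ccontr)
      fix \<alpha> assume "\<alpha> \<in> {\<alpha>. \<epsilon> \<le> wabs (c \<oplus>\<^bsub>Ls\<^esub> d) \<alpha>}" "\<alpha> \<notin> {\<alpha>. \<epsilon> \<le> wabs c \<alpha>} \<union> {\<alpha>. \<epsilon> \<le> wabs d \<alpha>}"
      then show False using Ls_add_bound[OF assms, of \<alpha>] by (auto simp: max_def split: if_splits)
    qed
  qed (use Ls_D(2) assms that in auto)
  moreover have "(c \<oplus>\<^bsub>Ls\<^esub> d) \<alpha> \<noteq> 0 \<longrightarrow> supp \<alpha>" for \<alpha>
    using Ls_D(1)[OF assms(1), of \<alpha>] Ls_D(1)[OF assms(2), of \<alpha>]
    by (cases "c \<alpha> = 0"; cases "d \<alpha> = 0") (auto simp: Ls_sel)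
  ultimately show ?thesis by (auto simp: carrier_Ls)
qed

lemma product_term:
  assumes "c \<in> carrier Ls" "d \<in> carrier Ls" "c \<beta> * d \<gamma> \<noteq> 0"
  shows "supp \<beta>" "supp \<gamma>" "supp (\<beta> + \<gamma>)" "absval (c \<beta> * d \<gamma>) * lw (\<beta> + \<gamma>) = wabs c \<beta> * wabs d \<gamma>"
proof -
  show s: "supp \<beta>" "supp \<gamma>" using assms Ls_D(1) by auto
  show "supp (\<beta> + \<gamma>)" using s by (rule supp_add)
  show "absval (c \<beta> * d \<gamma>) * lw (\<beta> + \<gamma>) = wabs c \<beta> * wabs d \<gamma>"
    using s by (simp add: lw_add absval_mult)
qed

lemma product_term_le:
  assumes c: "c \<in> carrier Ls" and d: "d \<in> carrier Ls"
  shows "absval (c \<beta> * d \<gamma>) * lw (\<beta> + \<gamma>) \<le> wabs c \<beta> * wabs d \<gamma>"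
  using product_term(4)[OF assms, of \<beta> \<gamma>] wabs_nonneg[OF c, of \<beta>] wabs_nonneg[OF d, of \<gamma>]
  by (cases "c \<beta> * d \<gamma> = 0") auto

text \<open>Both series are bounded, so a large product forces each factor to be large.\<close>

lemma finite_product_ge:
  assumes c: "c \<in> carrier Ls" and d: "d \<in> carrier Ls" and "\<epsilon> > 0"
  shows "finite {(\<beta>, \<gamma>). \<epsilon> \<le> wabs c \<beta> * wabs d \<gamma>}"
proof -
  obtain C where C: "0 < C" "\<And>\<alpha>. wabs c \<alpha> \<le> C" by (rule Ls_bound[OF c]) (rule that)
  obtain D where D: "0 < D" "\<And>\<alpha>. wabs d \<alpha> \<le> D" by (rule Ls_bound[OF d]) (rule that)
  have "{(\<beta>, \<gamma>). \<epsilon> \<le> wabs c \<beta> * wabs d \<gamma>} \<subseteq> {\<beta>. \<epsilon> / D \<le> wabs c \<beta>} \<times> {\<gamma>. \<epsilon> / C \<le> wabs d \<gamma>}"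
  proof clarify
    fix \<beta> \<gamma> assume *: "\<epsilon> \<le> wabs c \<beta> * wabs d \<gamma>"
    have "wabs c \<beta> * wabs d \<gamma> \<le> wabs c \<beta> * D" "wabs c \<beta> * wabs d \<gamma> \<le> C * wabs d \<gamma>"
      using C D wabs_nonneg[OF c] wabs_nonneg[OF d] by (auto intro: mult_left_mono mult_right_mono)
    then have "\<epsilon> \<le> wabs c \<beta> * D" "\<epsilon> \<le> wabs d \<gamma> * C" using * by (auto simp: mult.commute)
    then show "\<beta> \<in> {\<beta>. \<epsilon> / D \<le> wabs c \<beta>} \<and> \<gamma> \<in> {\<gamma>. \<epsilon> / C \<le> wabs d \<gamma>}"
      using C(1) D(1) by (simp add: pos_divide_le_eq)
  qed
  moreover have "finite ({\<beta>. \<epsilon> / D \<le> wabs c \<beta>} \<times> {\<gamma>. \<epsilon> / C \<le> wabs d \<gamma>})"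
    using C(1) D(1) assms(3) by (intro finite_cartesian_product Ls_D(2)[OF c] Ls_D(2)[OF d]) auto
  ultimately show ?thesis by (rule finite_subset)
qed

lemma null_convolution:
  assumes c: "c \<in> carrier Ls" and d: "d \<in> carrier Ls"
  shows "null_on UNIV (\<lambda>\<beta>. c \<beta> * d (\<alpha> - \<beta>))"
  unfolding null_on_def
proof (intro allI impI)
  fix \<epsilon> :: real assume \<epsilon>: "\<epsilon> > 0"
  show "finite {\<beta> \<in> UNIV. \<epsilon> \<le> absval (c \<beta> * d (\<alpha> - \<beta>))}"
  proof (cases "supp \<alpha>")
    case True
    have "{\<beta> \<in> UNIV. \<epsilon> \<le> absval (c \<beta> * d (\<alpha> - \<beta>))} \<subseteq> fst ` {(\<beta>, \<gamma>). \<epsilon> * lw \<alpha> \<le> wabs c \<beta> * wabs d \<gamma>}"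
    proof clarify
      fix \<beta> assume "\<epsilon> \<le> absval (c \<beta> * d (\<alpha> - \<beta>))"
      then have "\<epsilon> * lw \<alpha> \<le> absval (c \<beta> * d (\<alpha> - \<beta>)) * lw \<alpha>"
        using lw_pos[OF True] by (intro mult_right_mono) auto
      also have "\<dots> \<le> wabs c \<beta> * wabs d (\<alpha> - \<beta>)" using product_term_le[OF c d, of \<beta> "\<alpha> - \<beta>"] by simp
      finally show "\<beta> \<in> fst ` {(\<beta>, \<gamma>). \<epsilon> * lw \<alpha> \<le> wabs c \<beta> * wabs d \<gamma>}"
        by (intro image_eqI[of _ _ "(\<beta>, \<alpha> - \<beta>)"]) auto
    qed
    then show ?thesis using finite_product_ge[OF c d, of "\<epsilon> * lw \<alpha>"] \<epsilon> lw_pos[OF True] finite_surj by auto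
  next
    case False
    have "c \<beta> * d (\<alpha> - \<beta>) = 0" for \<beta> using product_term(3)[OF c d, of \<beta> "\<alpha> - \<beta>"] False by fastforce
    then have "absval (c \<beta> * d (\<alpha> - \<beta>)) = 0" for \<beta> by (simp only: absval_zero)
    then have "{\<beta> \<in> UNIV. \<epsilon> \<le> absval (c \<beta> * d (\<alpha> - \<beta>))} = {}" using \<epsilon> by (metis (mono_tags, lifting) empty_Collect_eq not_le)
    then show ?thesis by simp
  qed
qed

lemma Ls_mult_eq_zero:
  assumes c: "c \<in> carrier Ls" and d: "d \<in> carrier Ls" and "\<not> supp \<alpha>"
  shows "(c \<otimes>\<^bsub>Ls\<^esub> d) \<alpha> = 0"
proof -
  have "c \<beta> * d (\<alpha> - \<beta>) = 0" for \<beta> using product_term(3)[OF c d, of \<beta> "\<alpha> - \<beta>"] assms(3) by auto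
  then show ?thesis unfolding Ls_sel by (simp only: infsum_0_simp)
qed

lemma Ls_mult_bound:
  assumes c: "c \<in> carrier Ls" and d: "d \<in> carrier Ls" and M: "0 \<le> M"
    and le: "\<And>\<beta> \<gamma>. \<alpha> = \<beta> + \<gamma> \<Longrightarrow> wabs c \<beta> * wabs d \<gamma> \<le> M"
  shows "wabs (c \<otimes>\<^bsub>Ls\<^esub> d) \<alpha> \<le> M"
proof (cases "supp \<alpha>")
  case True
  have "absval (\<Sum>\<^sub>\<infinity>\<beta>. c \<beta> * d (\<alpha> - \<beta>)) \<le> M / lw \<alpha>"
  proof (rule infsum_absval_le)
    fix \<beta>
    have "absval (c \<beta> * d (\<alpha> - \<beta>)) * lw \<alpha> \<le> M"
      using product_term_le[OF c d, of \<beta> "\<alpha> - \<beta>"] le[of \<beta> "\<alpha> - \<beta>"] by simp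
    then show "absval (c \<beta> * d (\<alpha> - \<beta>)) \<le> M / lw \<alpha>" using lw_pos[OF True] by (simp add: pos_le_divide_eq)
  qed (use M lw_pos[OF True] in simp)
  then show ?thesis using lw_pos[OF True] by (simp add: Ls_sel pos_le_divide_eq)
qed (use Ls_mult_eq_zero[OF c d] M in simp)

lemma Ls_mult_closed:
  assumes c: "c \<in> carrier Ls" and d: "d \<in> carrier Ls"
  shows "c \<otimes>\<^bsub>Ls\<^esub> d \<in> carrier Ls"
proof -
  have "finite {\<alpha>. \<epsilon> \<le> wabs (c \<otimes>\<^bsub>Ls\<^esub> d) \<alpha>}" if \<epsilon>: "\<epsilon> > 0" for \<epsilon>
  proof (rule finite_subset)
    let ?X = "{(\<beta>, \<gamma>). \<epsilon> / 2 \<le> wabs c \<beta> * wabs d \<gamma>}"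
    show "{\<alpha>. \<epsilon> \<le> wabs (c \<otimes>\<^bsub>Ls\<^esub> d) \<alpha>} \<subseteq> (\<lambda>(\<beta>, \<gamma>). \<beta> + \<gamma>) ` ?X"
    proof (rule subsetI, rule ccontr)
      fix \<alpha> assume \<alpha>: "\<alpha> \<in> {\<alpha>. \<epsilon> \<le> wabs (c \<otimes>\<^bsub>Ls\<^esub> d) \<alpha>}" "\<alpha> \<notin> (\<lambda>(\<beta>, \<gamma>). \<beta> + \<gamma>) ` ?X"
      have "wabs (c \<otimes>\<^bsub>Ls\<^esub> d) \<alpha> \<le> \<epsilon> / 2"
      proof (rule Ls_mult_bound[OF c d])
        fix \<beta> \<gamma> assume "\<alpha> = \<beta> + \<gamma>"
        then have "(\<beta>, \<gamma>) \<notin> ?X" using \<alpha>(2) by blast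
        then show "wabs c \<beta> * wabs d \<gamma> \<le> \<epsilon> / 2" by simp
      qed (use \<epsilon> in simp)
      then show False using \<alpha>(1) \<epsilon> by simp
    qed
    show "finite ((\<lambda>(\<beta>, \<gamma>). \<beta> + \<gamma>) ` ?X)" using finite_product_ge[OF c d, of "\<epsilon> / 2"] \<epsilon> by simp
  qed
  then show ?thesis using Ls_mult_eq_zero[OF c d] by (auto simp: carrier_Ls)
qed

lemma Ls_mult_comm:
  "c \<otimes>\<^bsub>Ls\<^esub> d = d \<otimes>\<^bsub>Ls\<^esub> c"
proof
  fix \<alpha> :: "'v \<Rightarrow>\<^sub>0 int"
  have "bij ((-) \<alpha>)" by (rule bij_betw_byWitness[where f' = "(-) \<alpha>"]) (auto simp: diff_diff_eq2)
  from infsum_reindex_bij_betw[OF this, of "\<lambda>\<beta>. c \<beta> * d (\<alpha> - \<beta>)"]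
  show "(c \<otimes>\<^bsub>Ls\<^esub> d) \<alpha> = (d \<otimes>\<^bsub>Ls\<^esub> c) \<alpha>" by (simp add: Ls_sel mult.commute)
qed

text \<open>The point is the exchange of two infinite sums. For fixed \<open>\<alpha>\<close> a term
  is determined by the exponents taken from \<open>c\<close> and \<open>d\<close>, and
  \<open>e\<close> is bounded, so \<open>finite_product_ge\<close> leaves finitely many large
  terms.\<close>

lemma Ls_mult_assoc:
  assumes c: "c \<in> carrier Ls" and d: "d \<in> carrier Ls" and e: "e \<in> carrier Ls"
  shows "(c \<otimes>\<^bsub>Ls\<^esub> d) \<otimes>\<^bsub>Ls\<^esub> e = c \<otimes>\<^bsub>Ls\<^esub> (d \<otimes>\<^bsub>Ls\<^esub> e)"
proof
  fix \<alpha>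
  let ?F = "\<lambda>\<beta> \<gamma>. c \<gamma> * d (\<beta> - \<gamma>) * e (\<alpha> - \<beta>)"
  have null: "null_on UNIV (\<lambda>p. ?F (fst p) (snd p))"
    unfolding null_on_def
  proof (intro allI impI)
    fix \<epsilon> :: real assume \<epsilon>: "\<epsilon> > 0"
    show "finite {p \<in> UNIV. \<epsilon> \<le> absval (?F (fst p) (snd p))}"
    proof (cases "supp \<alpha>")
      case True
      obtain E where E: "0 < E" "\<And>\<alpha>. wabs e \<alpha> \<le> E" by (rule Ls_bound[OF e]) (rule that)
      let ?X = "{(\<gamma>, \<delta>). \<epsilon> * lw \<alpha> / E \<le> wabs c \<gamma> * wabs d \<delta>}"
      have "{p \<in> UNIV. \<epsilon> \<le> absval (?F (fst p) (snd p))} \<subseteq> (\<lambda>(\<gamma>, \<delta>). (\<gamma> + \<delta>, \<gamma>)) ` ?X"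
      proof clarify
        fix \<beta> \<gamma> assume *: "\<epsilon> \<le> absval (?F (fst (\<beta>, \<gamma>)) (snd (\<beta>, \<gamma>)))"
        then have ne: "c \<gamma> * d (\<beta> - \<gamma>) \<noteq> 0" "e (\<alpha> - \<beta>) \<noteq> 0" using \<epsilon> by auto
        have s: "supp \<beta>" "supp (\<alpha> - \<beta>)"
          using product_term(3)[OF c d ne(1)] Ls_D(1)[OF e ne(2)] by auto
        have "\<epsilon> * lw \<alpha> \<le> absval (c \<gamma> * d (\<beta> - \<gamma>)) * absval (e (\<alpha> - \<beta>)) * lw \<alpha>"
          using * lw_pos[OF True] by (simp add: absval_mult)
        also have "\<dots> = (wabs c \<gamma> * wabs d (\<beta> - \<gamma>)) * wabs e (\<alpha> - \<beta>)"
          using product_term(4)[OF c d ne(1)] lw_add[OF s] by (simp add: mult.commute mult.left_commute)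
        also have "\<dots> \<le> (wabs c \<gamma> * wabs d (\<beta> - \<gamma>)) * E"
          using E wabs_nonneg[OF c] wabs_nonneg[OF d] by (intro mult_left_mono mult_nonneg_nonneg[of "wabs c \<gamma>" "wabs d (\<beta> - \<gamma>)"]) auto
        finally have "\<epsilon> * lw \<alpha> / E \<le> wabs c \<gamma> * wabs d (\<beta> - \<gamma>)" using E(1) by (simp add: pos_divide_le_eq)
        then show "(\<beta>, \<gamma>) \<in> (\<lambda>(\<gamma>, \<delta>). (\<gamma> + \<delta>, \<gamma>)) ` ?X"
          by (intro image_eqI[of _ _ "(\<gamma>, \<beta> - \<gamma>)"]) auto
      qed
      moreover have "finite ?X" using \<epsilon> E(1) lw_pos[OF True] by (intro finite_product_ge[OF c d]) simp
      ultimately show ?thesis using finite_surj by blast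
    next
      case False
      have "?F \<beta> \<gamma> = 0" for \<beta> \<gamma>
      proof (rule ccontr)
        assume "?F \<beta> \<gamma> \<noteq> 0"
        then have "c \<gamma> * d (\<beta> - \<gamma>) \<noteq> 0" "e (\<alpha> - \<beta>) \<noteq> 0" by auto
        then have "supp \<beta>" "supp (\<alpha> - \<beta>)" using product_term(3)[OF c d] Ls_D(1)[OF e] by fastforce+
        then show False using supp_add[of \<beta> "\<alpha> - \<beta>"] False by simp
      qed
      then have "absval (?F \<beta> \<gamma>) = 0" for \<beta> \<gamma> by (simp only: absval_zero)
      then have "{p \<in> UNIV. \<epsilon> \<le> absval (?F (fst p) (snd p))} = {}"
        using \<epsilon> by (metis (mono_tags, lifting) empty_Collect_eq not_le)
      then show ?thesis by simp
    qed
  qed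
  have "((c \<otimes>\<^bsub>Ls\<^esub> d) \<otimes>\<^bsub>Ls\<^esub> e) \<alpha> = (\<Sum>\<^sub>\<infinity>\<beta>. (\<Sum>\<^sub>\<infinity>\<gamma>. c \<gamma> * d (\<beta> - \<gamma>)) * e (\<alpha> - \<beta>))"
    by (simp add: Ls_sel)
  also have "\<dots> = (\<Sum>\<^sub>\<infinity>\<beta>. \<Sum>\<^sub>\<infinity>\<gamma>. ?F \<beta> \<gamma>)"
    by (subst mult.commute[of _ "e _"], subst infsum_cmult_right'[symmetric]) (simp add: mult.commute)
  also have "\<dots> = (\<Sum>\<^sub>\<infinity>\<gamma>. \<Sum>\<^sub>\<infinity>\<beta>. ?F \<beta> \<gamma>)" by (rule infsum_swap_null[OF null])
  also have "\<dots> = (\<Sum>\<^sub>\<infinity>\<gamma>. c \<gamma> * (\<Sum>\<^sub>\<infinity>\<beta>. d (\<beta> - \<gamma>) * e (\<alpha> - \<beta>)))"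
    by (simp add: mult.assoc infsum_cmult_right')
  also have "\<dots> = (\<Sum>\<^sub>\<infinity>\<gamma>. c \<gamma> * (\<Sum>\<^sub>\<infinity>\<delta>. d \<delta> * e (\<alpha> - \<gamma> - \<delta>)))"
  proof -
    have "(\<Sum>\<^sub>\<infinity>\<beta>. d (\<beta> - \<gamma>) * e (\<alpha> - \<beta>)) = (\<Sum>\<^sub>\<infinity>\<delta>. d \<delta> * e (\<alpha> - \<gamma> - \<delta>))" for \<gamma>
    proof -
      have "bij ((+) \<gamma>)" by (rule bij_betw_byWitness[where f' = "\<lambda>\<beta>. \<beta> - \<gamma>"]) auto
      from infsum_reindex_bij_betw[OF this, of "\<lambda>\<beta>. d (\<beta> - \<gamma>) * e (\<alpha> - \<beta>)"]
      show ?thesis by (simp add: diff_diff_add)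
    qed
    then show ?thesis by simp
  qed
  also have "\<dots> = (c \<otimes>\<^bsub>Ls\<^esub> (d \<otimes>\<^bsub>Ls\<^esub> e)) \<alpha>" by (simp add: Ls_sel)
  finally show "((c \<otimes>\<^bsub>Ls\<^esub> d) \<otimes>\<^bsub>Ls\<^esub> e) \<alpha> = (c \<otimes>\<^bsub>Ls\<^esub> (d \<otimes>\<^bsub>Ls\<^esub> e)) \<alpha>" .
qed

lemma Ls_one_mult: "\<one>\<^bsub>Ls\<^esub> \<otimes>\<^bsub>Ls\<^esub> c = c"
proof
  fix \<alpha>
  have "(\<one>\<^bsub>Ls\<^esub> \<otimes>\<^bsub>Ls\<^esub> c) \<alpha> = (\<Sum>\<^sub>\<infinity>\<beta>\<in>{0}. c (\<alpha> - \<beta>))"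
    unfolding Ls_sel by (rule infsum_cong_neutral) auto
  then show "(\<one>\<^bsub>Ls\<^esub> \<otimes>\<^bsub>Ls\<^esub> c) \<alpha> = c \<alpha>" by simp
qed

lemma Ls_finite_support:
  assumes "finite {\<alpha>. c \<alpha> \<noteq> 0}" "\<And>\<alpha>. c \<alpha> \<noteq> 0 \<Longrightarrow> supp \<alpha>"
  shows "c \<in> carrier Ls"
proof -
  have "{\<alpha>. \<epsilon> \<le> wabs c \<alpha>} \<subseteq> {\<alpha>. c \<alpha> \<noteq> 0}" if "\<epsilon> > 0" for \<epsilon> using that by force
  then show ?thesis using assms finite_subset unfolding carrier_Ls by blast
qed

lemma Ls_uminus_closed: "c \<in> carrier Ls \<Longrightarrow> (\<lambda>\<alpha>. - c \<alpha>) \<in> carrier Ls"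
  by (simp add: carrier_Ls absval_minus)

lemma cring_Ls: "cring (Ls :: (('v \<Rightarrow>\<^sub>0 int) \<Rightarrow> 'k :: nonarch_field) normed_ring)"
proof (intro cringI abelian_groupI comm_monoidI)
  fix c d e :: "('v \<Rightarrow>\<^sub>0 int) \<Rightarrow> 'k"
  assume cde: "c \<in> carrier Ls" "d \<in> carrier Ls" "e \<in> carrier Ls"
  show "(c \<oplus>\<^bsub>Ls\<^esub> d) \<otimes>\<^bsub>Ls\<^esub> e = c \<otimes>\<^bsub>Ls\<^esub> e \<oplus>\<^bsub>Ls\<^esub> d \<otimes>\<^bsub>Ls\<^esub> e"
    using null_on_summable[OF null_convolution[OF cde(1,3)]] null_on_summable[OF null_convolution[OF cde(2,3)]]
    by (simp add: Ls_sel distrib_right infsum_add)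
  show "c \<otimes>\<^bsub>Ls\<^esub> d \<otimes>\<^bsub>Ls\<^esub> e = c \<otimes>\<^bsub>Ls\<^esub> (d \<otimes>\<^bsub>Ls\<^esub> e)" by (rule Ls_mult_assoc[OF cde])
  show "c \<oplus>\<^bsub>Ls\<^esub> d \<oplus>\<^bsub>Ls\<^esub> e = c \<oplus>\<^bsub>Ls\<^esub> (d \<oplus>\<^bsub>Ls\<^esub> e)" by (simp add: Ls_sel add.assoc)
next
  fix c d :: "('v \<Rightarrow>\<^sub>0 int) \<Rightarrow> 'k"
  assume cd: "c \<in> carrier Ls" "d \<in> carrier Ls"
  show "c \<oplus>\<^bsub>Ls\<^esub> d \<in> carrier Ls" "c \<otimes>\<^bsub>Ls\<^esub> d \<in> carrier Ls"
    using cd by (auto intro: Ls_add_closed Ls_mult_closed)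
  show "c \<oplus>\<^bsub>Ls\<^esub> d = d \<oplus>\<^bsub>Ls\<^esub> c" by (simp add: Ls_sel add.commute)
  show "c \<otimes>\<^bsub>Ls\<^esub> d = d \<otimes>\<^bsub>Ls\<^esub> c" by (rule Ls_mult_comm)
next
  fix c :: "('v \<Rightarrow>\<^sub>0 int) \<Rightarrow> 'k" assume c: "c \<in> carrier Ls"
  show "\<zero>\<^bsub>Ls\<^esub> \<oplus>\<^bsub>Ls\<^esub> c = c" by (simp add: Ls_sel)
  show "\<one>\<^bsub>Ls\<^esub> \<otimes>\<^bsub>Ls\<^esub> c = c" by (rule Ls_one_mult)
  show "\<exists>d\<in>carrier Ls. d \<oplus>\<^bsub>Ls\<^esub> c = \<zero>\<^bsub>Ls\<^esub>"
    using Ls_uminus_closed[OF c] by (intro bexI[of _ "\<lambda>\<alpha>. - c \<alpha>"]) (simp_all add: Ls_sel)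
next
  show "\<zero>\<^bsub>Ls\<^esub> \<in> carrier Ls" by (rule Ls_finite_support) (simp_all add: Ls_sel)
  show "\<one>\<^bsub>Ls\<^esub> \<in> carrier (Ls :: (('v \<Rightarrow>\<^sub>0 int) \<Rightarrow> 'k) normed_ring)"
    by (rule Ls_finite_support) (auto simp: Ls_sel split: if_splits)
qed

lemma nrm_Ls_zero: "nrm Ls \<zero>\<^bsub>Ls\<^esub> = 0"
  by (simp add: Ls_sel)

lemma nrm_Ls_submult:
  assumes "c \<in> carrier Ls" "d \<in> carrier Ls"
  shows "nrm Ls (c \<otimes>\<^bsub>Ls\<^esub> d) \<le> nrm Ls c * nrm Ls d"
  using assms
  by (intro nrm_Ls_le Ls_mult_bound)
    (auto intro!: mult_mono mult_nonneg_nonneg wabs_le nrm_Ls_nonneg wabs_nonneg)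

section \<open>Multiplicativity of the Gauss norm\<close>

text \<open>The dominant exponents \<open>\<alpha>\<close> of \<open>c\<close> and \<open>\<beta>\<close> of \<open>d\<close> for which \<open>\<alpha> + \<beta>\<close> has maximal Euclidean length
  are determined by their sum, by the parallelogram identity. Hence the coefficient of \<open>c * d\<close> at
  \<open>\<alpha> + \<beta>\<close> has a single dominant term.\<close>

lemma unique_dominant_sum:
  fixes X Y :: "('v \<Rightarrow>\<^sub>0 int) set"
  assumes "finite X" "finite Y" "X \<noteq> {}" "Y \<noteq> {}" "\<And>\<alpha>. \<alpha> \<in> X \<union> Y \<Longrightarrow> supp \<alpha>"
  obtains \<alpha> \<beta> where "\<alpha> \<in> X" "\<beta> \<in> Y" "\<And>\<gamma>. \<gamma> \<in> X \<Longrightarrow> \<alpha> + \<beta> - \<gamma> \<in> Y \<Longrightarrow> \<gamma> = \<alpha>"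
proof -
  define q where "q \<alpha> = (\<Sum>v\<in>V. (Poly_Mapping.lookup \<alpha> v)\<^sup>2)" for \<alpha> :: "'v \<Rightarrow>\<^sub>0 int"
  let ?Z = "(\<lambda>(\<alpha>, \<beta>). q (\<alpha> + \<beta>)) ` (X \<times> Y)"
  have fin: "finite ?Z" "?Z \<noteq> {}" using assms by auto
  then have "Max ?Z \<in> ?Z" by (rule Max_in)
  then obtain \<alpha> \<beta> where ab: "\<alpha> \<in> X" "\<beta> \<in> Y" "q (\<alpha> + \<beta>) = Max ?Z" by auto
  have max: "q (\<gamma> + \<delta>) \<le> q (\<alpha> + \<beta>)" if "\<gamma> \<in> X" "\<delta> \<in> Y" for \<gamma> \<delta>
    unfolding ab(3) using fin that by (intro Max_ge) auto
  have "\<gamma> = \<alpha>" if \<gamma>: "\<gamma> \<in> X" "\<alpha> + \<beta> - \<gamma> \<in> Y" for \<gamma>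
  proof (rule ccontr)
    assume "\<gamma> \<noteq> \<alpha>"
    define \<delta> where "\<delta> = \<gamma> - \<alpha>"
    have "\<delta> \<noteq> 0" using \<open>\<gamma> \<noteq> \<alpha>\<close> by (simp add: \<delta>_def)
    then obtain v where v: "Poly_Mapping.lookup \<delta> v \<noteq> 0" by (metis lookup_zero poly_mapping_eqI)
    have "supp \<delta>" unfolding \<delta>_def using assms(5) ab \<gamma> by (intro supp_minus) auto
    then have "v \<in> V" using v by (auto simp: in_keys_iff)
    then have "0 < q \<delta>" unfolding q_def using v fin_V by (intro sum_pos2[of _ v]) auto
    \<comment> \<open>The two competing sums are \<open>\<alpha> + \<beta> + \<delta>\<close> and
      \<open>\<alpha> + \<beta> - \<delta>\<close>; one of them would be longer than
      \<open>\<alpha> + \<beta>\<close>.\<close>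
    have "q (\<gamma> + \<beta>) + q (\<alpha> + (\<alpha> + \<beta> - \<gamma>)) = 2 * q (\<alpha> + \<beta>) + 2 * q \<delta>"
      unfolding q_def \<delta>_def sum_distrib_left sum.distrib[symmetric]
      by (rule sum.cong) (simp_all add: lookup_add lookup_minus power2_eq_square algebra_simps)
    then show False using \<open>0 < q \<delta>\<close> max[OF \<gamma>(1) ab(2)] max[OF ab(1) \<gamma>(2)] by simp
  qed
  then show ?thesis using that[OF ab(1,2)] by blast
qed

lemma nrm_Ls_mult:
  assumes c: "c \<in> carrier Ls" and d: "d \<in> carrier Ls"
  shows "nrm Ls (c \<otimes>\<^bsub>Ls\<^esub> d) = nrm Ls c * nrm Ls d"
proof (cases "nrm Ls c = 0 \<or> nrm Ls d = 0")
  case True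
  then have "nrm Ls c * nrm Ls d = 0" by auto
  then show ?thesis
    using nrm_Ls_submult[OF c d] nrm_Ls_nonneg[OF Ls_mult_closed[OF c d]] by linarith
next
  case False
  then have pos: "0 < nrm Ls c" "0 < nrm Ls d"
    using nrm_Ls_nonneg[OF c] nrm_Ls_nonneg[OF d] by auto
  let ?X = "{\<alpha>. wabs c \<alpha> = nrm Ls c}" and ?Y = "{\<alpha>. wabs d \<alpha> = nrm Ls d}"
  have "?X \<subseteq> {\<alpha>. nrm Ls c \<le> wabs c \<alpha>}" "?Y \<subseteq> {\<alpha>. nrm Ls d \<le> wabs d \<alpha>}" by auto
  then have fin: "finite ?X" "finite ?Y"
    using Ls_D(2)[OF c pos(1)] Ls_D(2)[OF d pos(2)] by (auto intro: finite_subset)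
  obtain \<alpha>0 where "\<alpha>0 \<in> ?X" by (rule nrm_Ls_attained[OF c pos(1)]) (rule that, simp)
  moreover obtain \<beta>0 where "\<beta>0 \<in> ?Y" by (rule nrm_Ls_attained[OF d pos(2)]) (rule that, simp)
  ultimately have ne: "?X \<noteq> {}" "?Y \<noteq> {}" by auto
  have "supp \<alpha>" if "\<alpha> \<in> ?X \<union> ?Y" for \<alpha>
    using that Ls_D(1)[OF c, of \<alpha>] Ls_D(1)[OF d, of \<alpha>] pos by (cases "c \<alpha> = 0"; cases "d \<alpha> = 0") auto
  then obtain \<alpha> \<beta> where ab: "\<alpha> \<in> ?X" "\<beta> \<in> ?Y" "\<And>\<gamma>. \<gamma> \<in> ?X \<Longrightarrow> \<alpha> + \<beta> - \<gamma> \<in> ?Y \<Longrightarrow> \<gamma> = \<alpha>"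
    using unique_dominant_sum[OF fin ne] by blast
  let ?s = "\<alpha> + \<beta>"
  let ?t = "\<lambda>\<gamma>. c \<gamma> * d (?s - \<gamma>)"
  have nz: "c \<alpha> * d \<beta> \<noteq> 0" using ab pos by auto
  have s: "supp ?s" and G: "absval (?t \<alpha>) * lw ?s = nrm Ls c * nrm Ls d"
    using product_term(3,4)[OF c d nz] ab by auto
  have lt: "absval (?t \<gamma>) < absval (?t \<alpha>)" if "\<gamma> \<noteq> \<alpha>" for \<gamma>
  proof -
    have "\<not> (wabs c \<gamma> = nrm Ls c \<and> wabs d (?s - \<gamma>) = nrm Ls d)" using ab(3)[of \<gamma>] that by auto
    then have "wabs c \<gamma> < nrm Ls c \<or> wabs d (?s - \<gamma>) < nrm Ls d"
      using wabs_le[OF c, of \<gamma>] wabs_le[OF d, of "?s - \<gamma>"] by linarith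
    then have "wabs c \<gamma> * wabs d (?s - \<gamma>) < nrm Ls c * nrm Ls d"
    proof
      assume "wabs c \<gamma> < nrm Ls c"
      then have "wabs c \<gamma> * nrm Ls d < nrm Ls c * nrm Ls d" using pos by (intro mult_strict_right_mono)
      moreover have "wabs c \<gamma> * wabs d (?s - \<gamma>) \<le> wabs c \<gamma> * nrm Ls d"
        by (intro mult_left_mono[OF wabs_le[OF d]] wabs_nonneg[OF c])
      ultimately show ?thesis by linarith
    next
      assume "wabs d (?s - \<gamma>) < nrm Ls d"
      then have "nrm Ls c * wabs d (?s - \<gamma>) < nrm Ls c * nrm Ls d" using pos by (intro mult_strict_left_mono)
      moreover have "wabs c \<gamma> * wabs d (?s - \<gamma>) \<le> nrm Ls c * wabs d (?s - \<gamma>)"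
        by (intro mult_right_mono[OF wabs_le[OF c]] wabs_nonneg[OF d])
      ultimately show ?thesis by linarith
    qed
    then have "absval (?t \<gamma>) * lw ?s < absval (?t \<alpha>) * lw ?s"
      unfolding G using product_term_le[OF c d, of \<gamma> "?s - \<gamma>"] by simp
    then show ?thesis using lw_pos[OF s] by simp
  qed
  have null: "null_on (UNIV - {\<alpha>}) ?t"
    unfolding null_on_def
  proof (intro allI impI)
    fix \<epsilon> :: real assume "\<epsilon> > 0"
    then have "finite {\<gamma> \<in> UNIV. \<epsilon> \<le> absval (?t \<gamma>)}"
      using null_convolution[OF c d, of ?s] by (simp add: null_on_def)
    then show "finite {\<gamma> \<in> UNIV - {\<alpha>}. \<epsilon> \<le> absval (?t \<gamma>)}" by (rule rev_finite_subset) auto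
  qed
  define rest where "rest = infsum ?t (UNIV - {\<alpha>})"
  have "(?t has_sum rest) (UNIV - {\<alpha>})"
    unfolding rest_def by (rule has_sum_infsum[OF null_on_summable[OF null]])
  then have "(?t has_sum (?t \<alpha> + rest)) (insert \<alpha> (UNIV - {\<alpha>}))" by (intro has_sum_insert) auto
  then have sum: "(c \<otimes>\<^bsub>Ls\<^esub> d) ?s = ?t \<alpha> + rest" by (simp add: Ls_sel insert_UNIV infsumI)
  \<comment> \<open>Strict bounds on the terms do not by themselves survive an infinite sum. But
    only finitely many terms reach half the leading one, so a common bound \<open>M\<close> strictly
    below it exists.\<close>
  have "absval rest < absval (?t \<alpha>)"
  proof -
    let ?g = "absval (?t \<alpha>)"
    let ?F = "{\<gamma> \<in> UNIV - {\<alpha>}. ?g / 2 \<le> absval (?t \<gamma>)}"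
    have g: "0 < ?g" using nz absval_nonneg[of "?t \<alpha>"] by (simp add: order_less_le)
    then have fin: "finite (insert (?g / 2) ((\<lambda>\<gamma>. absval (?t \<gamma>)) ` ?F))"
      using null[unfolded null_on_def, rule_format, of "?g / 2"] by (intro finite.insertI finite_imageI) simp
    define M where "M = Max (insert (?g / 2) ((\<lambda>\<gamma>. absval (?t \<gamma>)) ` ?F))"
    have "M < ?g" unfolding M_def using fin g lt by (subst Max_less_iff) auto
    have "?g / 2 \<le> M" unfolding M_def using fin by (intro Max_ge) auto
    have "absval (?t \<gamma>) \<le> M" if "\<gamma> \<in> UNIV - {\<alpha>}" for \<gamma>
    proof (cases "\<gamma> \<in> ?F")
      case True
      then show ?thesis unfolding M_def using fin by (intro Max_ge) auto
    next
      case False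
      then show ?thesis using \<open>?g / 2 \<le> M\<close> that by simp
    qed
    then have "absval rest \<le> M" unfolding rest_def using g \<open>?g / 2 \<le> M\<close> by (intro infsum_absval_le) auto
    then show ?thesis using \<open>M < ?g\<close> by simp
  qed
  then have "absval ((c \<otimes>\<^bsub>Ls\<^esub> d) ?s) = absval (?t \<alpha>)" unfolding sum by (rule absval_add_eq)
  then have "wabs (c \<otimes>\<^bsub>Ls\<^esub> d) ?s = nrm Ls c * nrm Ls d" using G by simp
  then show ?thesis
    using wabs_le[OF Ls_mult_closed[OF c d], of ?s] nrm_Ls_submult[OF c d] by simp
qed

lemma mult_normed_cring_Ls: "mult_normed_cring (Ls :: (('v \<Rightarrow>\<^sub>0 int) \<Rightarrow> 'k :: nonarch_field) normed_ring)"
proof -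
  interpret cring "Ls :: (('v \<Rightarrow>\<^sub>0 int) \<Rightarrow> 'k) normed_ring" by (rule cring_Ls)
  show "mult_normed_cring (Ls :: (('v \<Rightarrow>\<^sub>0 int) \<Rightarrow> 'k) normed_ring)"
  proof
    fix c d :: "('v \<Rightarrow>\<^sub>0 int) \<Rightarrow> 'k" assume c: "c \<in> carrier Ls" and d: "d \<in> carrier Ls"
    show "nrm Ls (c \<oplus>\<^bsub>Ls\<^esub> d) \<le> max (nrm Ls c) (nrm Ls d)"
    proof (rule nrm_Ls_le)
      fix \<alpha>
      have "wabs (c \<oplus>\<^bsub>Ls\<^esub> d) \<alpha> \<le> max (wabs c \<alpha>) (wabs d \<alpha>)" by (rule Ls_add_bound[OF c d])
      also have "\<dots> \<le> max (nrm Ls c) (nrm Ls d)" by (intro max.mono wabs_le c d)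
      finally show "wabs (c \<oplus>\<^bsub>Ls\<^esub> d) \<alpha> \<le> max (nrm Ls c) (nrm Ls d)" .
    qed
    show "nrm Ls (c \<otimes>\<^bsub>Ls\<^esub> d) = nrm Ls c * nrm Ls d" by (rule nrm_Ls_mult[OF c d])
    then show "nrm Ls (c \<otimes>\<^bsub>Ls\<^esub> d) \<le> nrm Ls c * nrm Ls d" by simp
  next
    fix c :: "('v \<Rightarrow>\<^sub>0 int) \<Rightarrow> 'k" assume c: "c \<in> carrier Ls"
    have "\<ominus>\<^bsub>Ls\<^esub> c = (\<lambda>\<alpha>. - c \<alpha>)"
      by (rule minus_equality[OF _ c Ls_uminus_closed[OF c]]) (simp add: Ls_sel)
    then show "nrm Ls (\<ominus>\<^bsub>Ls\<^esub> c) = nrm Ls c" by (simp add: Ls_sel absval_minus)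
    show "0 \<le> nrm Ls c" by (rule nrm_Ls_nonneg[OF c])
  next
    show "nrm Ls \<zero>\<^bsub>Ls :: (('v \<Rightarrow>\<^sub>0 int) \<Rightarrow> 'k) normed_ring\<^esub> = 0" by (rule nrm_Ls_zero)
    let ?L = "Ls :: (('v \<Rightarrow>\<^sub>0 int) \<Rightarrow> 'k) normed_ring"
    have "nrm ?L \<one>\<^bsub>?L\<^esub> \<le> 1" by (rule nrm_Ls_le) (simp add: Ls_sel lw_zero)
    moreover have "1 \<le> nrm ?L \<one>\<^bsub>?L\<^esub>" using wabs_le[OF one_closed, of 0] by (simp add: Ls_sel lw_zero)
    ultimately show "nrm ?L \<one>\<^bsub>?L\<^esub> = 1" by simp
  qed
qed

end

section \<open>Laurent polynomials and substitution\<close>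

lemma lookup_lpoly_times:
  fixes P Q :: "'k :: field lpoly"
  shows "Poly_Mapping.lookup (P * Q) \<alpha> =
    (\<Sum>\<beta>\<in>Poly_Mapping.keys P. Poly_Mapping.lookup P \<beta> * Poly_Mapping.lookup Q (\<alpha> - \<beta>))"
proof -
  have "\<alpha> = \<beta> + \<gamma> \<longleftrightarrow> \<gamma> = \<alpha> - \<beta>" for \<beta> \<gamma> by auto
  then have "Poly_Mapping.lookup (P * Q) \<alpha> =
      Sum_any (\<lambda>\<beta>. Poly_Mapping.lookup P \<beta> * Poly_Mapping.lookup Q (\<alpha> - \<beta>))"
    by (simp add: lookup_mult prod_fun_def)
  also have "\<dots> = (\<Sum>\<beta>\<in>Poly_Mapping.keys P. Poly_Mapping.lookup P \<beta> * Poly_Mapping.lookup Q (\<alpha> - \<beta>))"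
    by (rule Sum_any.expand_superset) (auto simp: in_keys_iff)
  finally show ?thesis .
qed

lemma keys_lpoly_times:
  fixes P Q :: "'k :: field lpoly"
  assumes "\<alpha> \<in> Poly_Mapping.keys (P * Q)"
  obtains \<beta> \<gamma> where "\<beta> \<in> Poly_Mapping.keys P" "\<gamma> \<in> Poly_Mapping.keys Q" "\<alpha> = \<beta> + \<gamma>"
  using assms Poly_Mapping.keys_mult[of P Q] by blast

lemma lpolys_mono: "V \<subseteq> V' \<Longrightarrow> W \<subseteq> W' \<Longrightarrow> P \<in> lpolys V W \<Longrightarrow> P \<in> lpolys V' W'"
  by (fastforce simp: lpolys_def)

lemma lpolys_zero: "0 \<in> lpolys V W"
  by (simp add: lpolys_def)

lemma lpolys_add:
  assumes "P \<in> lpolys V W" "Q \<in> lpolys V W" shows "P + Q \<in> lpolys V W"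
  using assms Poly_Mapping.keys_add[of P Q] unfolding lpolys_def by blast

lemma sum_singles_lookup:
  "(\<Sum>\<alpha>\<in>Poly_Mapping.keys P. Poly_Mapping.single \<alpha> (Poly_Mapping.lookup P \<alpha>)) = P"
  by (rule poly_mapping_eqI) (simp add: lookup_sum lookup_single when_def sum.delta' in_keys_iff)

lemma lpolys_uminus: "P \<in> lpolys V W \<Longrightarrow> - P \<in> lpolys V W"
  by (simp add: lpolys_def)

lemma lpolys_minus: "P \<in> lpolys V W \<Longrightarrow> Q \<in> lpolys V W \<Longrightarrow> P - Q \<in> lpolys V W"
  using lpolys_add[of P V W "- Q"] lpolys_uminus[of Q V W] by simp

lemma lpolys_mult:
  fixes P Q :: "'k :: field lpoly"
  assumes "P \<in> lpolys V W" "Q \<in> lpolys V W" shows "P * Q \<in> lpolys V W"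
  unfolding lpolys_def
proof (rule CollectI, rule ballI)
  fix \<alpha> assume "\<alpha> \<in> Poly_Mapping.keys (P * Q)"
  then obtain \<beta> \<gamma> where a: "\<beta> \<in> Poly_Mapping.keys P" "\<gamma> \<in> Poly_Mapping.keys Q" "\<alpha> = \<beta> + \<gamma>"
    by (rule keys_lpoly_times)
  then have k: "Poly_Mapping.keys \<beta> \<subseteq> V" "Poly_Mapping.keys \<gamma> \<subseteq> V"
    and n: "\<And>e. Poly_Mapping.lookup \<beta> e < 0 \<Longrightarrow> e \<in> W" "\<And>e. Poly_Mapping.lookup \<gamma> e < 0 \<Longrightarrow> e \<in> W"
    using assms by (auto simp: lpolys_def)
  have "Poly_Mapping.keys \<alpha> \<subseteq> V" using k Poly_Mapping.keys_add[of \<beta> \<gamma>] a by blast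
  moreover have "e \<in> W" if "Poly_Mapping.lookup \<alpha> e < 0" for e
  proof -
    have "Poly_Mapping.lookup \<beta> e < 0 \<or> Poly_Mapping.lookup \<gamma> e < 0"
      using that a(3) by (simp add: lookup_add) linarith
    then show ?thesis using n by blast
  qed
  ultimately show "Poly_Mapping.keys \<alpha> \<subseteq> V \<and> (\<forall>e. Poly_Mapping.lookup \<alpha> e < 0 \<longrightarrow> e \<in> W)" by blast
qed

lemma lpolys_single:
  assumes "Poly_Mapping.keys \<alpha> \<subseteq> V" "\<And>e. Poly_Mapping.lookup \<alpha> e < 0 \<Longrightarrow> e \<in> W"
  shows "Poly_Mapping.single \<alpha> c \<in> lpolys V W"
  using assms by (auto simp: lpolys_def)

lemma lpolys_const: "lconst c \<in> lpolys V W"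
  unfolding lconst_def by (rule lpolys_single) auto

lemma lpolys_one: "1 \<in> lpolys V W"
  using lpolys_const[of 1 V W] by (simp add: lconst_def)

lemma lpolys_power: "P \<in> lpolys V W \<Longrightarrow> P ^ m \<in> lpolys V W" for P :: "'k :: field lpoly"
  by (induction m) (auto intro: lpolys_mult lpolys_one)

lemma lpolys_sum: "(\<And>x. x \<in> X \<Longrightarrow> f x \<in> lpolys V W) \<Longrightarrow> sum f X \<in> lpolys V W"
  by (induction X rule: infinite_finite_induct) (auto intro: lpolys_add lpolys_zero)

lemma lpolys_prod: "(\<And>x. x \<in> X \<Longrightarrow> f x \<in> lpolys V W) \<Longrightarrow> prod f X \<in> lpolys V W"
  for f :: "'x \<Rightarrow> 'k :: field lpoly"
  by (induction X rule: infinite_finite_induct) (auto intro: lpolys_mult lpolys_one)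

definition vpow :: "nat set \<Rightarrow> int \<Rightarrow> 'k :: field lpoly" where
  "vpow e z = Poly_Mapping.single (Poly_Mapping.single e z) 1"

lemma lookup_single_le: "Poly_Mapping.lookup (Poly_Mapping.single e z) e' < 0 \<Longrightarrow> e' = e \<and> z < (0 :: int)"
  by (auto simp: lookup_single when_def split: if_splits)

lemma lpolys_vpow: "e \<in> V \<Longrightarrow> 0 \<le> z \<or> e \<in> W \<Longrightarrow> vpow e z \<in> lpolys V W"
  unfolding vpow_def by (rule lpolys_single) (auto dest: lookup_single_le split: if_splits)

lemma lvar_eq: "lvar e = vpow e 1"
  by (simp add: lvar_def vpow_def)

lemma lpolys_lvar: "e \<in> V \<Longrightarrow> lvar e \<in> lpolys V W"
  unfolding lvar_eq by (rule lpolys_vpow) auto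

lemma vpow_zero [simp]: "vpow e 0 = 1"
  by (simp add: vpow_def)

lemma vpow_add: "vpow e (a + b) = vpow e a * vpow e b"
  by (simp add: vpow_def mult_single single_add)

lemma lvar_vpow_inverse [simp]: "lvar e * vpow e (- 1) = 1" "vpow e (- 1) * lvar e = 1"
  using vpow_add[of e 1 "-1"] vpow_add[of e "-1" 1] by (simp_all add: lvar_eq)

lemma lvar_power: "lvar e ^ m = vpow e (int m)"
  by (induction m) (simp_all add: lvar_eq vpow_add)

lemma single_eq_prod_vpow:
  "Poly_Mapping.single \<alpha> (1 :: 'k :: field) = (\<Prod>e\<in>Poly_Mapping.keys \<alpha>. vpow e (Poly_Mapping.lookup \<alpha> e))"
proof -
  have "(\<Prod>e\<in>X. vpow e (Poly_Mapping.lookup \<alpha> e)) =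
      Poly_Mapping.single (\<Sum>e\<in>X. Poly_Mapping.single e (Poly_Mapping.lookup \<alpha> e)) (1 :: 'k)"
    if "finite X" for X
    using that by (induction X) (simp_all add: vpow_def mult_single)
  then show ?thesis by (simp add: sum_singles_lookup[of \<alpha>])
qed

text \<open>The common form of \<open>coord_subst\<close>, \<open>set_vars_zero\<close> and the
  inverse substitution \<open>inv_power\<close>. The images of powers are given as a function of the
  exponent because the image of a variable is in general not a unit.\<close>

definition lsubst :: "(nat set \<Rightarrow> int \<Rightarrow> 'k :: field lpoly) \<Rightarrow> 'k lpoly \<Rightarrow> 'k lpoly" where
  "lsubst pw P = (\<Sum>\<alpha>\<in>Poly_Mapping.keys P. lconst (Poly_Mapping.lookup P \<alpha>) *
     (\<Prod>e\<in>Poly_Mapping.keys \<alpha>. pw e (Poly_Mapping.lookup \<alpha> e)))"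

lemma lconst_zero: "lconst 0 = 0"
  by (simp add: lconst_def)

lemma lconst_add: "lconst (a + b) = lconst a + lconst b"
  by (simp add: lconst_def single_add)

lemma lconst_mult: "lconst (a * b) = lconst a * lconst b"
  by (simp add: lconst_def mult_single)

lemma lconst_mult_single: "lconst c * Poly_Mapping.single \<alpha> d = Poly_Mapping.single \<alpha> (c * d)"
  by (simp add: lconst_def mult_single)

lemma lsubst_superset:
  assumes "finite X" "Poly_Mapping.keys P \<subseteq> X"
  shows "lsubst pw P = (\<Sum>\<alpha>\<in>X. lconst (Poly_Mapping.lookup P \<alpha>) *
     (\<Prod>e\<in>Poly_Mapping.keys \<alpha>. pw e (Poly_Mapping.lookup \<alpha> e)))"
  unfolding lsubst_def using assms
  by (intro sum.mono_neutral_left) (auto simp: in_keys_iff lconst_zero)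

lemma lsubst_add: "lsubst pw (P + Q) = lsubst pw P + lsubst pw Q"
proof -
  let ?X = "Poly_Mapping.keys P \<union> Poly_Mapping.keys Q"
  show ?thesis
    using Poly_Mapping.keys_add[of P Q]
    by (simp add: lsubst_superset[of ?X] lookup_add lconst_add distrib_right sum.distrib)
qed

lemma lsubst_zero [simp]: "lsubst pw 0 = 0"
  by (simp add: lsubst_def)

lemma lsubst_uminus: "lsubst pw (- P) = - lsubst pw P"
  using lsubst_add[of pw P "- P"] by (simp add: eq_neg_iff_add_eq_0 add.commute)

lemma lsubst_minus: "lsubst pw (P - Q) = lsubst pw P - lsubst pw Q"
  using lsubst_add[of pw P "- Q"] by (simp add: lsubst_uminus)

lemma lsubst_sum: "lsubst pw (sum f X) = (\<Sum>x\<in>X. lsubst pw (f x))"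
  by (induction X rule: infinite_finite_induct) (simp_all add: lsubst_add)

lemma lsubst_single:
  "lsubst pw (Poly_Mapping.single \<alpha> c) = lconst c * (\<Prod>e\<in>Poly_Mapping.keys \<alpha>. pw e (Poly_Mapping.lookup \<alpha> e))"
  by (cases "c = 0") (simp_all add: lsubst_def lconst_zero)

lemma coord_subst_eq: "coord_subst n i j = lsubst (coord_power n i j)"
  by (simp add: fun_eq_iff coord_subst_def lsubst_def)

text \<open>\<open>W\<close> is the set of variables that may be inverted. On Laurent polynomials
  with negative exponents only there, substitution is a ring homomorphism.\<close>

locale lsubst_hom =
  fixes pw :: "nat set \<Rightarrow> int \<Rightarrow> 'k :: field lpoly" and W :: "nat set set"
  assumes pw_zero: "pw e 0 = 1"
    and pw_add: "0 \<le> a \<and> 0 \<le> b \<or> e \<in> W \<Longrightarrow> pw e (a + b) = pw e a * pw e b"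
begin

lemma lsubst_one: "lsubst pw 1 = 1"
  by (simp add: lsubst_def lconst_def)

lemma prod_pw_add:
  assumes "\<And>e. Poly_Mapping.lookup \<alpha> e < 0 \<Longrightarrow> e \<in> W" "\<And>e. Poly_Mapping.lookup \<beta> e < 0 \<Longrightarrow> e \<in> W"
  shows "(\<Prod>e\<in>Poly_Mapping.keys (\<alpha> + \<beta>). pw e (Poly_Mapping.lookup (\<alpha> + \<beta>) e)) =
    (\<Prod>e\<in>Poly_Mapping.keys \<alpha>. pw e (Poly_Mapping.lookup \<alpha> e)) *
    (\<Prod>e\<in>Poly_Mapping.keys \<beta>. pw e (Poly_Mapping.lookup \<beta> e))"
proof -
  let ?X = "Poly_Mapping.keys \<alpha> \<union> Poly_Mapping.keys \<beta>"
  have sup: "(\<Prod>e\<in>Poly_Mapping.keys \<gamma>. pw e (Poly_Mapping.lookup \<gamma> e)) = (\<Prod>e\<in>?X. pw e (Poly_Mapping.lookup \<gamma> e))"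
    if "Poly_Mapping.keys \<gamma> \<subseteq> ?X" for \<gamma>
    using that by (intro prod.mono_neutral_left) (auto simp: in_keys_iff pw_zero)
  have "(\<Prod>e\<in>?X. pw e (Poly_Mapping.lookup (\<alpha> + \<beta>) e)) =
      (\<Prod>e\<in>?X. pw e (Poly_Mapping.lookup \<alpha> e) * pw e (Poly_Mapping.lookup \<beta> e))"
    by (rule prod.cong[OF refl]) (use assms not_le in \<open>simp add: lookup_add, intro pw_add, blast\<close>)
  then show ?thesis
    using Poly_Mapping.keys_add[of \<alpha> \<beta>] by (simp add: sup prod.distrib)
qed

lemma lsubst_mult:
  assumes "P \<in> lpolys V W" "Q \<in> lpolys V' W"
  shows "lsubst pw (P * Q) = lsubst pw P * lsubst pw Q"
proof -
  let ?p = "Poly_Mapping.lookup P" and ?q = "Poly_Mapping.lookup Q"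
  let ?m = "\<lambda>\<alpha>. \<Prod>e\<in>Poly_Mapping.keys \<alpha>. pw e (Poly_Mapping.lookup \<alpha> e)"
  have "P * Q = (\<Sum>\<alpha>\<in>Poly_Mapping.keys P. Poly_Mapping.single \<alpha> (?p \<alpha>)) *
      (\<Sum>\<beta>\<in>Poly_Mapping.keys Q. Poly_Mapping.single \<beta> (?q \<beta>))"
    by (simp only: sum_singles_lookup)
  also have "\<dots> = (\<Sum>\<alpha>\<in>Poly_Mapping.keys P. \<Sum>\<beta>\<in>Poly_Mapping.keys Q. Poly_Mapping.single (\<alpha> + \<beta>) (?p \<alpha> * ?q \<beta>))"
    by (simp add: sum_product mult_single)
  finally have "lsubst pw (P * Q) =
      (\<Sum>\<alpha>\<in>Poly_Mapping.keys P. \<Sum>\<beta>\<in>Poly_Mapping.keys Q. lconst (?p \<alpha> * ?q \<beta>) * ?m (\<alpha> + \<beta>))"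
    by (simp add: lsubst_sum lsubst_single)
  also have "\<dots> = (\<Sum>\<alpha>\<in>Poly_Mapping.keys P. \<Sum>\<beta>\<in>Poly_Mapping.keys Q.
      (lconst (?p \<alpha>) * ?m \<alpha>) * (lconst (?q \<beta>) * ?m \<beta>))"
  proof (intro sum.cong refl)
    fix \<alpha> \<beta> assume "\<alpha> \<in> Poly_Mapping.keys P" "\<beta> \<in> Poly_Mapping.keys Q"
    then have "?m (\<alpha> + \<beta>) = ?m \<alpha> * ?m \<beta>"
      using assms by (intro prod_pw_add) (auto simp: lpolys_def)
    then show "lconst (?p \<alpha> * ?q \<beta>) * ?m (\<alpha> + \<beta>) = (lconst (?p \<alpha>) * ?m \<alpha>) * (lconst (?q \<beta>) * ?m \<beta>)"
      by (simp add: lconst_mult mult_ac)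
  qed
  also have "\<dots> = lsubst pw P * lsubst pw Q"
    by (simp add: lsubst_def sum_product)
  finally show ?thesis .
qed

lemma lsubst_power:
  assumes "P \<in> lpolys V W" shows "lsubst pw (P ^ m) = lsubst pw P ^ m"
proof (induction m)
  case (Suc m)
  then show ?case using lsubst_mult[OF assms lpolys_power[OF assms]] by simp
qed (simp add: lsubst_one)

lemma lsubst_prod:
  assumes "\<And>x. x \<in> X \<Longrightarrow> f x \<in> lpolys V W"
  shows "lsubst pw (prod f X) = (\<Prod>x\<in>X. lsubst pw (f x))"
  using assms
proof (induction X rule: infinite_finite_induct)
  case (insert x X)
  then have "f x \<in> lpolys V W" "prod f X \<in> lpolys V W" by (auto intro: lpolys_prod)
  then show ?case using insert lsubst_mult[of "f x" V "prod f X" V] by simp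
qed (simp_all add: lsubst_one)

lemma lsubst_lconst: "lsubst pw (lconst c) = lconst c"
  by (simp add: lconst_def lsubst_single)

lemma lsubst_vpow: "lsubst pw (vpow e z) = pw e z"
  by (cases "z = 0") (simp_all add: vpow_def lsubst_single lconst_def lsubst_one pw_zero)

lemma lsubst_lvar: "lsubst pw (lvar e) = pw e 1"
  by (simp add: lvar_eq lsubst_vpow)

text \<open>A composite of two homomorphisms is the identity once it fixes the powers of the
  variables. It serves to exhibit a left inverse of \<open>coord_subst\<close>.\<close>

lemma lsubst_lsubst_eq:
  assumes P: "P \<in> lpolys V W'"
    and pw': "\<And>e z. e \<in> V \<Longrightarrow> 0 \<le> z \<or> e \<in> W' \<Longrightarrow> pw' e z \<in> lpolys V' W"
    and inv: "\<And>e z. e \<in> V \<Longrightarrow> 0 \<le> z \<or> e \<in> W' \<Longrightarrow> lsubst pw (pw' e z) = vpow e z"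
  shows "lsubst pw (lsubst pw' P) = P"
proof -
  have "lsubst pw (lsubst pw' P) = (\<Sum>\<alpha>\<in>Poly_Mapping.keys P. lconst (Poly_Mapping.lookup P \<alpha>) *
      (\<Prod>e\<in>Poly_Mapping.keys \<alpha>. vpow e (Poly_Mapping.lookup \<alpha> e)))"
    unfolding lsubst_def[of pw'] lsubst_sum
  proof (rule sum.cong[OF refl])
    fix \<alpha> assume "\<alpha> \<in> Poly_Mapping.keys P"
    then have a: "e \<in> V \<and> (0 \<le> Poly_Mapping.lookup \<alpha> e \<or> e \<in> W')" if "e \<in> Poly_Mapping.keys \<alpha>" for e
      using P that not_le unfolding lpolys_def by fastforce
    let ?f = "\<lambda>e. pw' e (Poly_Mapping.lookup \<alpha> e)"
    have mem: "?f e \<in> lpolys V' W" if "e \<in> Poly_Mapping.keys \<alpha>" for e using a[OF that] pw' by blast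
    have "lsubst pw (lconst (Poly_Mapping.lookup P \<alpha>) * prod ?f (Poly_Mapping.keys \<alpha>)) =
        lsubst pw (lconst (Poly_Mapping.lookup P \<alpha>)) * lsubst pw (prod ?f (Poly_Mapping.keys \<alpha>))"
      by (rule lsubst_mult[OF lpolys_const[of _ V'] lpolys_prod[OF mem]])
    also have "lsubst pw (prod ?f (Poly_Mapping.keys \<alpha>)) = (\<Prod>e\<in>Poly_Mapping.keys \<alpha>. lsubst pw (?f e))"
      by (rule lsubst_prod[OF mem])
    also have "\<dots> = (\<Prod>e\<in>Poly_Mapping.keys \<alpha>. vpow e (Poly_Mapping.lookup \<alpha> e))"
      by (rule prod.cong[OF refl]) (use a inv in blast)
    finally show "lsubst pw (lconst (Poly_Mapping.lookup P \<alpha>) * prod ?f (Poly_Mapping.keys \<alpha>)) =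
        lconst (Poly_Mapping.lookup P \<alpha>) * (\<Prod>e\<in>Poly_Mapping.keys \<alpha>. vpow e (Poly_Mapping.lookup \<alpha> e))"
      by (simp add: lsubst_lconst)
  qed
  also have "\<dots> = P"
    by (simp add: single_eq_prod_vpow[symmetric] lconst_mult_single sum_singles_lookup)
  finally show ?thesis .
qed

end

text \<open>Exponent 0 is kept apart since the empty power is 1. The value 0 at negative exponents
  is a default: variables in \<open>Z\<close> are never inverted.\<close>

definition zpow :: "nat set set \<Rightarrow> nat set \<Rightarrow> int \<Rightarrow> 'k :: field lpoly" where
  "zpow Z e z = (if e \<in> Z \<and> z \<noteq> 0 then 0 else vpow e z)"

lemma set_vars_zero_eq: "set_vars_zero Z P = lsubst (zpow Z) P"
proof -
  have prod: "(\<Prod>e\<in>Poly_Mapping.keys \<alpha>. zpow Z e (Poly_Mapping.lookup \<alpha> e)) =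
      (if Poly_Mapping.keys \<alpha> \<inter> Z = {} then Poly_Mapping.single \<alpha> 1 else (0 :: 'a lpoly))" for \<alpha>
  proof (cases "Poly_Mapping.keys \<alpha> \<inter> Z = {}")
    case True
    then show ?thesis unfolding single_eq_prod_vpow by (auto simp: zpow_def intro!: prod.cong)
  next
    case False
    then show ?thesis by (auto simp: zpow_def in_keys_iff intro!: prod_zero)
  qed
  have "lsubst (zpow Z) P = (\<Sum>\<alpha>\<in>Poly_Mapping.keys P. if Poly_Mapping.keys \<alpha> \<inter> Z = {}
      then Poly_Mapping.single \<alpha> (Poly_Mapping.lookup P \<alpha>) else 0)"
    unfolding lsubst_def prod by (intro sum.cong) (auto simp: lconst_mult_single)
  also have "\<dots> = set_vars_zero Z P"
    unfolding set_vars_zero_def by (subst sum.inter_filter) auto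
  finally show ?thesis ..
qed

lemma lsubst_hom_zpow:
  assumes "W \<inter> Z = {}" shows "lsubst_hom (zpow Z) W"
proof
  fix a b :: int and e assume "0 \<le> a \<and> 0 \<le> b \<or> e \<in> W"
  then show "zpow Z e (a + b) = zpow Z e a * zpow Z e b"
    using assms by (auto simp: zpow_def vpow_add)
qed (simp add: zpow_def)

lemma set_vars_zero_lpolys:
  assumes "P \<in> lpolys V W" shows "set_vars_zero Z P \<in> lpolys (V - Z) W"
  unfolding set_vars_zero_def using assms
  by (intro lpolys_sum lpolys_single) (auto simp: lpolys_def)

section \<open>The Gauss norm of a Laurent polynomial\<close>

definition gnorm :: "(nat set \<Rightarrow> real) \<Rightarrow> 'k :: nonarch_field lpoly \<Rightarrow> real" where
  "gnorm r P = (SUP \<alpha>. absval (Poly_Mapping.lookup P \<alpha>) * laurent_weight r \<alpha>)"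

lemma gnorm_zero [simp]: "gnorm r 0 = 0"
  by (simp add: gnorm_def)

lemma gnorm_uminus [simp]: "gnorm r (- P) = gnorm r P"
  by (simp add: gnorm_def absval_minus)

locale gauss_norm = laurent_series V r for V :: "nat set set" and r
begin

lemma nrm_lookup: "nrm (laurent_algebra V r) (Poly_Mapping.lookup P) = gnorm r P"
  by (simp add: gnorm_def laurent_algebra_def)

lemma lookup_in_carrier:
  assumes "P \<in> lpolys V W" shows "Poly_Mapping.lookup P \<in> carrier (laurent_algebra V r)"
proof (rule Ls_finite_support)
  show "finite {\<alpha>. Poly_Mapping.lookup P \<alpha> \<noteq> 0}" by simp
  show "Poly_Mapping.keys \<alpha> \<subseteq> V" if "Poly_Mapping.lookup P \<alpha> \<noteq> 0" for \<alpha>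
    using assms that by (auto simp: lpolys_def in_keys_iff)
qed

lemma lookup_times_eq:
  "Poly_Mapping.lookup (P * Q) = Poly_Mapping.lookup P \<otimes>\<^bsub>laurent_algebra V r\<^esub> Poly_Mapping.lookup Q"
proof
  fix \<alpha>
  have "(\<Sum>\<^sub>\<infinity>\<beta>. Poly_Mapping.lookup P \<beta> * Poly_Mapping.lookup Q (\<alpha> - \<beta>)) =
      (\<Sum>\<^sub>\<infinity>\<beta>\<in>Poly_Mapping.keys P. Poly_Mapping.lookup P \<beta> * Poly_Mapping.lookup Q (\<alpha> - \<beta>))"
    by (rule infsum_cong_neutral) (auto simp: in_keys_iff)
  then show "Poly_Mapping.lookup (P * Q) \<alpha> =
      (Poly_Mapping.lookup P \<otimes>\<^bsub>laurent_algebra V r\<^esub> Poly_Mapping.lookup Q) \<alpha>"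
    by (simp add: Ls_sel lookup_lpoly_times)
qed

lemma gnorm_mult:
  assumes "P \<in> lpolys V W" "Q \<in> lpolys V W'"
  shows "gnorm r (P * Q) = gnorm r P * gnorm r Q"
  using nrm_Ls_mult[OF lookup_in_carrier[OF assms(1)] lookup_in_carrier[OF assms(2)]]
  by (simp add: nrm_lookup flip: lookup_times_eq)

lemma gnorm_nonneg: "P \<in> lpolys V W \<Longrightarrow> 0 \<le> gnorm r P"
  using nrm_Ls_nonneg[OF lookup_in_carrier] by (simp add: nrm_lookup)

lemma gnorm_ge:
  assumes "P \<in> lpolys V W"
  shows "absval (Poly_Mapping.lookup P \<alpha>) * laurent_weight r \<alpha> \<le> gnorm r P"
  using wabs_le[OF lookup_in_carrier[OF assms]] by (simp add: nrm_lookup)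

text \<open>Each exponent occurs in at most one summand, so no coefficient cancels. The Gauss norms
  of sums below are computed in this way.\<close>

lemma gnorm_add_disjoint:
  assumes P: "P \<in> lpolys V W" and Q: "Q \<in> lpolys V W'"
    and disj: "Poly_Mapping.keys P \<inter> Poly_Mapping.keys Q = {}"
  shows "gnorm r (P + Q) = max (gnorm r P) (gnorm r Q)"
proof -
  have PQ: "P + Q \<in> lpolys V UNIV"
    by (rule lpolys_add) (use P Q lpolys_mono in blast)+
  have cases: "Poly_Mapping.lookup P \<alpha> = 0 \<or> Poly_Mapping.lookup Q \<alpha> = 0" for \<alpha>
    using disj by (auto simp: in_keys_iff)
  show ?thesis
  proof (rule antisym)
    show "gnorm r (P + Q) \<le> max (gnorm r P) (gnorm r Q)"
      unfolding gnorm_def[of r "P + Q"]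
    proof (rule cSUP_least)
      fix \<alpha>
      show "absval (Poly_Mapping.lookup (P + Q) \<alpha>) * laurent_weight r \<alpha> \<le> max (gnorm r P) (gnorm r Q)"
        using cases[of \<alpha>] gnorm_ge[OF P, of \<alpha>] gnorm_ge[OF Q, of \<alpha>] by (auto simp: lookup_add)
    qed simp
    have "gnorm r P \<le> gnorm r (P + Q)"
      unfolding gnorm_def[of r P]
    proof (rule cSUP_least)
      fix \<alpha>
      show "absval (Poly_Mapping.lookup P \<alpha>) * laurent_weight r \<alpha> \<le> gnorm r (P + Q)"
        using cases[of \<alpha>] gnorm_ge[OF PQ, of \<alpha>] gnorm_nonneg[OF PQ] by (auto simp: lookup_add)
    qed simp
    moreover have "gnorm r Q \<le> gnorm r (P + Q)"
      unfolding gnorm_def[of r Q]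
    proof (rule cSUP_least)
      fix \<alpha>
      show "absval (Poly_Mapping.lookup Q \<alpha>) * laurent_weight r \<alpha> \<le> gnorm r (P + Q)"
        using cases[of \<alpha>] gnorm_ge[OF PQ, of \<alpha>] gnorm_nonneg[OF PQ] by (auto simp: lookup_add)
    qed simp
    ultimately show "max (gnorm r P) (gnorm r Q) \<le> gnorm r (P + Q)" by simp
  qed
qed

lemma gnorm_minus_disjoint:
  assumes "P \<in> lpolys V W" "Q \<in> lpolys V W'" "Poly_Mapping.keys P \<inter> Poly_Mapping.keys Q = {}"
  shows "gnorm r (P - Q) = max (gnorm r P) (gnorm r Q)"
  using gnorm_add_disjoint[OF assms(1) lpolys_uminus[OF assms(2)]] assms(3) by simp

lemma gnorm_vpow:
  assumes "e \<in> V" shows "gnorm r (vpow e z :: 'k :: nonarch_field lpoly) = r e powi z"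
proof -
  have w: "laurent_weight r (Poly_Mapping.single e z) = r e powi z"
    by (cases "z = 0") (simp_all add: laurent_weight_def)
  have pos: "0 < r e powi z" using r_pos[OF assms] by simp
  have mem: "(vpow e z :: 'k lpoly) \<in> lpolys V UNIV" using assms by (intro lpolys_vpow) auto
  show ?thesis
  proof (rule antisym)
    show "gnorm r (vpow e z :: 'k lpoly) \<le> r e powi z"
      unfolding gnorm_def using pos by (intro cSUP_least) (auto simp: vpow_def lookup_single when_def w)
    show "r e powi z \<le> gnorm r (vpow e z :: 'k lpoly)"
      using gnorm_ge[OF mem, of "Poly_Mapping.single e z"] by (simp add: vpow_def lookup_single w)
  qed
qed

lemma gnorm_lvar: "e \<in> V \<Longrightarrow> gnorm r (lvar e) = r e"
  by (simp add: lvar_eq gnorm_vpow)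

end

section \<open>The coordinate functions on a fiber\<close>

lemma chart_coord_lpolys: "chart_coord n i j e \<in> lpolys UNIV {}"
  by (auto simp: chart_coord_def Let_def intro!: lpolys_minus lpolys_mult lpolys_lvar lpolys_one)

lemma chart_coord_chart_index:
  assumes "e \<in> chart_index n i j" "i \<noteq> j" shows "chart_coord n i j e = lvar e"
  using assms by (auto simp: chart_coord_def chart_index_def doubleton_eq_iff)

lemma coord_power_chart_index:
  assumes "e \<in> chart_index n i j" "i \<noteq> j" shows "coord_power n i j e z = vpow e z"
  unfolding coord_power_def chart_coord_chart_index[OF assms] by (simp add: lvar_power) (simp add: vpow_def)

text \<open>Inverted variables belong to the chart, and for these \<open>u_e\<close> is itself a
  variable and hence a unit among Laurent polynomials.\<close>

lemma lsubst_hom_coord_power: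
  assumes "W \<subseteq> chart_index n i j" "i \<noteq> j"
  shows "lsubst_hom (coord_power n i j) W"
proof
  fix a b :: int and e assume ab: "0 \<le> a \<and> 0 \<le> b \<or> e \<in> W"
  show "coord_power n i j e (a + b) = coord_power n i j e a * coord_power n i j e b"
  proof (cases "e \<in> W")
    case True
    then have e: "e \<in> chart_index n i j" using assms by blast
    show ?thesis by (simp add: coord_power_chart_index[OF e assms(2)] vpow_add)
  next
    case False
    then show ?thesis using ab by (simp add: coord_power_def nat_add_distrib power_add)
  qed
qed (simp add: coord_power_def)

lemma lpolys_coord_power:
  assumes "0 \<le> z \<or> e \<in> W" "W \<subseteq> chart_index n i j" "i \<noteq> j"
  shows "coord_power n i j e z \<in> lpolys UNIV W"
proof (cases "0 \<le> z")
  case True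
  have "chart_coord n i j e ^ nat z \<in> lpolys UNIV W"
    by (rule lpolys_power, rule lpolys_mono[OF _ _ chart_coord_lpolys]) auto
  then show ?thesis using True by (simp add: coord_power_def)
next
  case False
  then have e: "e \<in> chart_index n i j" "e \<in> W" using assms by auto
  show ?thesis unfolding coord_power_chart_index[OF e(1) assms(3)] using e by (intro lpolys_vpow) auto
qed

text \<open>The tree enters only here: \<open>br\<close> names the branch of a leaf, and
  \<open>same_branch\<close>, \<open>diff_branch\<close> and \<open>cherry\<close> are exponentiated
  four-point conditions for \<open>i, j, r, s\<close> and \<open>i, k, l, v\<close>, normalised so
  that \<open>p_ij\<close> has size 1. The parameter \<open>kt\<close> fixes the coefficient
  field.\<close>

locale fiber_setup =
  fixes n i j :: nat and br :: "nat \<Rightarrow> 'v" and ord :: "nat rel" and I J :: "nat set set"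
    and \<rho> :: "nat set \<Rightarrow> real" and N :: "nat set" and kt :: "'k :: nonarch_field itself"
  defines "N \<equiv> {1..n} - {i, j}"
  assumes ij: "i \<in> {1..n}" "j \<in> {1..n}" "i \<noteq> j"
    and ord: "partial_order_on N ord" "\<And>k l. (k, l) \<in> ord \<Longrightarrow> br k = br l"
      "\<And>k l. k \<in> N \<Longrightarrow> l \<in> N \<Longrightarrow> br k = br l \<Longrightarrow> k \<noteq> l \<Longrightarrow> (k, l) \<in> ord \<or> (l, k) \<in> ord"
    and I: "I \<subseteq> pairs n" "card I = 2 * (n - 2)" "{i, j} \<notin> I"
    and compat: "\<And>k. k \<in> N \<Longrightarrow>
       (let L = {l \<in> N. br l = br k};
            c1 = compat_both ord L (J \<inter> chart_index n i j) i j I k;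
            c2 = compat_one ord L (J \<inter> chart_index n i j) i j I k;
            c3 = compat_one ord L (J \<inter> chart_index n i j) j i I k
        in (c1 \<and> \<not> c2 \<and> \<not> c3) \<or> (\<not> c1 \<and> c2 \<and> \<not> c3) \<or> (\<not> c1 \<and> \<not> c2 \<and> c3))"
    and \<rho>_nonneg: "\<And>e. e \<in> pairs n \<Longrightarrow> e \<noteq> {i, j} \<Longrightarrow> 0 \<le> \<rho> e"
    and \<rho>_zero_iff: "\<And>e. e \<in> pairs n \<Longrightarrow> e \<noteq> {i, j} \<Longrightarrow> \<rho> e = 0 \<longleftrightarrow> e \<in> J"
    and same_branch: "\<And>r s. r \<in> N \<Longrightarrow> s \<in> N \<Longrightarrow> r \<noteq> s \<Longrightarrow> br r = br s \<Longrightarrow>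
       \<rho> {i, r} * \<rho> {j, s} = \<rho> {i, s} * \<rho> {j, r} \<and> \<rho> {r, s} \<le> \<rho> {i, r} * \<rho> {j, s}"
    and diff_branch: "\<And>r s. r \<in> N \<Longrightarrow> s \<in> N \<Longrightarrow> br r \<noteq> br s \<Longrightarrow>
       \<rho> {r, s} = max (\<rho> {i, r} * \<rho> {j, s}) (\<rho> {i, s} * \<rho> {j, r})"
    and cherry: "\<And>k l v. strictly_below ord k l \<Longrightarrow> strictly_below ord l v \<Longrightarrow>
       \<rho> {k, v} * \<rho> {i, l} = max (\<rho> {k, l} * \<rho> {i, v}) (\<rho> {l, v} * \<rho> {i, k})"
begin

text \<open>For such a leaf both coordinates are nonzero on the fiber, so that its slope is defined
  and nonzero.\<close>

definition good :: "nat \<Rightarrow> bool" where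
  "good k \<longleftrightarrow> {i, k} \<notin> J \<and> {j, k} \<notin> J"

text \<open>On a branch, either all \<open>{i, k}\<close> or all \<open>{j, k}\<close> belong to \<open>I\<close>. Accordingly \<open>pv k\<close> is \<open>i\<close> or
  \<open>j\<close>, and \<open>ot k\<close> is the other one.\<close>

definition pv :: "nat \<Rightarrow> nat" where
  "pv k = (if \<exists>l\<in>N. br l = br k \<and> {i, l} \<notin> I then j else i)"

definition ot :: "nat \<Rightarrow> nat" where
  "ot k = (if \<exists>l\<in>N. br l = br k \<and> {i, l} \<notin> I then i else j)"

text \<open>The leaf \<open>t\<close> of the second and third compatibility conditions;
  \<open>{k, t}\<close> takes the place of the pair of \<open>k\<close> that is missing from
  \<open>I\<close>.\<close>

definition is_par :: "nat \<Rightarrow> nat \<Rightarrow> bool" where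
  "is_par k t \<longleftrightarrow> t \<in> N \<and> br t = br k \<and> strictly_below ord t k \<and> good t \<and>
     (\<forall>s\<in>N. strictly_below ord s k \<and> good s \<longrightarrow> (s, t) \<in> ord) \<and> {k, t} \<in> I"

definition par :: "nat \<Rightarrow> nat" where
  "par k = (SOME t. is_par k t)"

lemma in_chart_index: "k \<in> N \<Longrightarrow> {i, k} \<in> chart_index n i j" "k \<in> N \<Longrightarrow> {j, k} \<in> chart_index n i j"
  by (auto simp: chart_index_def N_def)

lemma not_in_chart_index: "k \<in> N \<Longrightarrow> l \<in> N \<Longrightarrow> {k, l} \<notin> chart_index n i j"
  by (auto simp: chart_index_def N_def doubleton_eq_iff)

lemma pv_ot_cases: obtains "pv k = i" "ot k = j" | "pv k = j" "ot k = i"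
  unfolding pv_def ot_def by (cases "\<exists>l\<in>N. br l = br k \<and> {i, l} \<notin> I") auto

lemma pv_cong: "br k = br l \<Longrightarrow> pv k = pv l" and ot_cong: "br k = br l \<Longrightarrow> ot k = ot l"
  by (simp_all add: pv_def ot_def)

lemma pv_ot_chart: "k \<in> N \<Longrightarrow> {pv l, k} \<in> chart_index n i j" "k \<in> N \<Longrightarrow> {ot l, k} \<in> chart_index n i j"
  by (cases l rule: pv_ot_cases; simp add: in_chart_index)+

lemma pv_ot_ne: "k \<in> N \<Longrightarrow> pv l \<noteq> k" "k \<in> N \<Longrightarrow> ot l \<noteq> k" "pv l \<noteq> ot l"
  using ij by (cases l rule: pv_ot_cases; auto simp: N_def)+

lemma ord_in_N: "(k, l) \<in> ord \<Longrightarrow> k \<in> N \<and> l \<in> N"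
  using ord(1) by (auto simp: partial_order_on_def preorder_on_def refl_on_def)

lemma ord_trans: "(k, l) \<in> ord \<Longrightarrow> (l, m) \<in> ord \<Longrightarrow> (k, m) \<in> ord"
  using ord(1) by (auto simp: partial_order_on_def preorder_on_def dest: transD)

lemma ord_antisym: "(k, l) \<in> ord \<Longrightarrow> (l, k) \<in> ord \<Longrightarrow> k = l"
  using ord(1) by (auto simp: partial_order_on_def dest: antisymD)

lemma ord_refl: "k \<in> N \<Longrightarrow> (k, k) \<in> ord"
  using ord(1) by (auto simp: partial_order_on_def preorder_on_def refl_on_def)

section \<open>Structure of the compatible index set\<close>

lemma compat_cases:
  assumes k: "k \<in> N"
  obtains "{i, k} \<in> I" "{j, k} \<in> I" "\<And>l. strictly_below ord l k \<Longrightarrow> \<not> good l"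
  | t where "{i, k} \<notin> I" "\<And>l. l \<in> N \<Longrightarrow> br l = br k \<Longrightarrow> {j, l} \<in> I" "is_par k t"
  | t where "{j, k} \<notin> I" "\<And>l. l \<in> N \<Longrightarrow> br l = br k \<Longrightarrow> {i, l} \<in> I" "is_par k t"
proof -
  let ?L = "{l \<in> N. br l = br k}" and ?J = "J \<inter> chart_index n i j"
  have good: "({i, l} \<notin> ?J \<and> {j, l} \<notin> ?J) = good l" if "l \<in> N" for l
    using in_chart_index[OF that] by (auto simp: good_def)
  have par: "\<exists>t. is_par k t"
    if "t \<in> ?L" "strictly_below ord t k" "good t" "{k, t} \<in> I"
      "\<And>s. s \<in> ?L \<Longrightarrow> strictly_below ord s k \<Longrightarrow> good s \<Longrightarrow> (s, t) \<in> ord" for t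
    using that ord(2) by (auto simp: is_par_def strictly_below_def intro!: exI[of _ t])
  consider "compat_both ord ?L ?J i j I k" | "compat_one ord ?L ?J i j I k" | "compat_one ord ?L ?J j i I k"
    using compat[OF k] by (auto simp: Let_def)
  then show ?thesis
  proof cases
    case 1
    have "\<not> good l" if "strictly_below ord l k" for l
    proof -
      have "l \<in> ?L" using that ord_in_N ord(2) by (auto simp: strictly_below_def)
      then show ?thesis using 1 that good[of l] unfolding compat_both_def by blast
    qed
    then show ?thesis using 1 by (intro that(1)) (auto simp: compat_both_def)
  next
    case 2
    then obtain t where t: "t \<in> ?L" "strictly_below ord t k" "good t" "{k, t} \<in> I"
      "\<And>s. s \<in> ?L \<Longrightarrow> strictly_below ord s k \<Longrightarrow> good s \<Longrightarrow> (s, t) \<in> ord"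
      using good unfolding compat_one_def Let_def by blast
    then obtain t where "is_par k t" using par by blast
    then show ?thesis using 2 by (intro that(2)) (auto simp: compat_one_def)
  next
    case 3
    then obtain t where t: "t \<in> ?L" "strictly_below ord t k" "good t" "{k, t} \<in> I"
      "\<And>s. s \<in> ?L \<Longrightarrow> strictly_below ord s k \<Longrightarrow> good s \<Longrightarrow> (s, t) \<in> ord"
      using good unfolding compat_one_def Let_def by blast
    then obtain t where "is_par k t" using par by blast
    then show ?thesis using 3 by (intro that(3)) (auto simp: compat_one_def)
  qed
qed

text \<open>If \<open>{i, l}\<close> is missing for one leaf \<open>l\<close> of the branch, then
  \<open>l\<close> satisfies the second condition, which puts \<open>{j, k}\<close> into
  \<open>I\<close> for all \<open>k\<close> of the branch.\<close>

lemma pv_in_I: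
  assumes k: "k \<in> N" shows "{pv k, k} \<in> I"
proof (cases "\<exists>l\<in>N. br l = br k \<and> {i, l} \<notin> I")
  case True
  then obtain l where l: "l \<in> N" "br l = br k" "{i, l} \<notin> I" by blast
  from l(1) have "{j, k} \<in> I"
    by (cases rule: compat_cases) (use l k in auto)
  then show ?thesis using True by (simp add: pv_def)
next
  case False
  then show ?thesis using k by (auto simp: pv_def)
qed

lemma is_par_par:
  assumes k: "k \<in> N" "{ot k, k} \<notin> I" shows "is_par k (par k)"
proof -
  have "\<exists>t. is_par k t"
    using k(1)
  proof (cases rule: compat_cases)
    case 1
    then show ?thesis using k(2) by (cases k rule: pv_ot_cases) auto
  qed auto
  then show ?thesis unfolding par_def by (rule someI_ex)
qed

lemma par_D:
  assumes "k \<in> N" "{ot k, k} \<notin> I"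
  shows "par k \<in> N" "br (par k) = br k" "(par k, k) \<in> ord" "par k \<noteq> k" "good (par k)" "{k, par k} \<in> I"
    "\<And>s. (s, k) \<in> ord \<Longrightarrow> s \<noteq> k \<Longrightarrow> good s \<Longrightarrow> (s, par k) \<in> ord"
  using is_par_par[OF assms] ord_in_N by (auto simp: is_par_def strictly_below_def)

text \<open>With both pairs of \<open>k\<close> in \<open>I\<close>, only the first compatibility
  condition is possible.\<close>

lemma not_good_below_root:
  assumes k: "k \<in> N" "{ot k, k} \<in> I" and "(l, k) \<in> ord" "l \<noteq> k"
  shows "\<not> good l"
  using k(1)
proof (cases rule: compat_cases)
  case 1
  then show ?thesis using assms by (auto simp: strictly_below_def)
qed (use pv_in_I[OF k(1)] k in \<open>cases k rule: pv_ot_cases; auto\<close>)+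

definition cell :: "nat \<Rightarrow> nat set set" where
  "cell k = {{pv k, k}, if {ot k, k} \<in> I then {ot k, k} else {k, par k}}"

lemma finite_pairs: "finite (pairs n)"
proof -
  have "pairs n \<subseteq> Pow {1..n}" by (auto simp: pairs_def)
  then show ?thesis by (rule finite_subset) simp
qed

text \<open>A counting argument: the cells are two-element subsets of \<open>I\<close>, and they are
  disjoint because \<open>{k, par k}\<close> is assigned to its upper leaf only. Their union has
  \<open>2 * (n - 2)\<close> elements, which is the size of \<open>I\<close>.\<close>

lemma I_eq: "I = (\<Union>k\<in>N. cell k)"
proof (rule sym, rule card_subset_eq)
  show "finite I" using I(1) finite_pairs finite_subset by blast
  show "(\<Union>k\<in>N. cell k) \<subseteq> I"
    using pv_in_I par_D(6) by (auto simp: cell_def)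
  have fin: "finite N" by (simp add: N_def)
  have "card (cell k) = 2" if "k \<in> N" for k
    using that pv_ot_ne(1)[of k k] pv_ot_ne(2)[of k k] pv_ot_ne(3)[of k] pv_ot_ne(1)[OF par_D(1)[OF that], of k]
    by (auto simp: cell_def card_2_iff doubleton_eq_iff)
  moreover have "cell k \<inter> cell l = {}" if kl: "k \<in> N" "l \<in> N" "k \<noteq> l" for k l
  proof -
    have x: "{x, a} \<noteq> {y, b}" if "x \<in> {i, j}" "y \<in> {i, j}" "a \<in> N" "b \<in> N" "a \<noteq> b" for x y a b
      using that by (auto simp: N_def doubleton_eq_iff)
    have y: "{x, a} \<noteq> {b, c}" if "x \<in> {i, j}" "a \<in> N" "b \<in> N" "c \<in> N" for x a b c
      using that by (auto simp: N_def doubleton_eq_iff)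
    have pvij: "pv m \<in> {i, j}" "ot m \<in> {i, j}" for m by (cases m rule: pv_ot_cases; simp)+
    have z: "{k, par k} \<noteq> {l, par l}" if "{ot k, k} \<notin> I" "{ot l, l} \<notin> I"
      using par_D(3,4)[OF kl(1) that(1)] par_D(3,4)[OF kl(2) that(2)] kl(3) ord_antisym
      by (auto simp: doubleton_eq_iff)
    have elem: "(\<exists>x\<in>{i, j}. e = {x, m}) \<or> ({ot m, m} \<notin> I \<and> e = {m, par m})" if "e \<in> cell m" for e m
      using that pvij[of m] by (auto simp: cell_def split: if_splits)
    show ?thesis
    proof (rule equals0I)
      fix e assume "e \<in> cell k \<inter> cell l"
      then consider a b where "a \<in> {i, j}" "b \<in> {i, j}" "{a, k} = {b, l}"
        | a where "a \<in> {i, j}" "{ot l, l} \<notin> I" "{a, k} = {l, par l}"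
        | a where "a \<in> {i, j}" "{ot k, k} \<notin> I" "{a, l} = {k, par k}"
        | "{ot k, k} \<notin> I" "{ot l, l} \<notin> I" "{k, par k} = {l, par l}"
        using elem[of e k] elem[of e l] by (elim IntE) metis
      then show False
      proof cases
        case 1
        then show ?thesis using x kl by blast
      next
        case 2
        then show ?thesis using y par_D(1)[OF kl(2)] kl by blast
      next
        case 3
        then show ?thesis using y par_D(1)[OF kl(1)] kl by blast
      qed (use z in blast)
    qed
  qed
  ultimately have "card (\<Union>k\<in>N. cell k) = (\<Sum>k\<in>N. 2)"
    using fin by (subst card_UN_disjoint) (auto simp: cell_def)
  also have "\<dots> = 2 * (n - 2)" using ij by (simp add: N_def card_Diff_subset)
  finally show "card (\<Union>k\<in>N. cell k) = card I" using I(2) by simp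
qed

lemma I_cases:
  assumes "e \<in> I"
  obtains "e \<in> chart_index n i j"
  | k where "k \<in> N" "{ot k, k} \<notin> I" "e = {k, par k}"
proof -
  obtain k where k: "k \<in> N" "e \<in> cell k" using assms by (subst (asm) I_eq) blast
  then consider "e = {pv k, k}" | "e = {ot k, k}" | "{ot k, k} \<notin> I" "e = {k, par k}"
    by (auto simp: cell_def split: if_splits)
  then show ?thesis
  proof cases
    case 1
    then show ?thesis using that(1) pv_ot_chart(1)[OF k(1)] by simp
  next
    case 2
    then show ?thesis using that(1) pv_ot_chart(2)[OF k(1)] by simp
  next
    case 3
    then show ?thesis using that(2) k(1) by simp
  qed
qed

text \<open>For good \<open>z\<close> these are \<open>z\<close>, \<open>par z\<close>,
  \<open>par (par z)\<close> and so on, down to a leaf with both of its pairs in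
  \<open>I\<close>.\<close>

definition chain :: "nat \<Rightarrow> nat set" where
  "chain z = {s \<in> N. (s, z) \<in> ord \<and> good s}"

lemma chain_root:
  assumes "z \<in> N" "good z" "{ot z, z} \<in> I" shows "chain z = {z}"
  using assms not_good_below_root[OF assms(1,3)] ord_refl by (auto simp: chain_def)

lemma chain_par:
  assumes "z \<in> N" "good z" "{ot z, z} \<notin> I"
  shows "chain z = insert z (chain (par z))" "z \<notin> chain (par z)"
proof -
  note p = par_D[OF assms(1,3)]
  show "chain z = insert z (chain (par z))"
    using p(7) ord_trans[OF _ p(3)] ord_refl[OF assms(1)] assms(1,2) unfolding chain_def by blast
  show "z \<notin> chain (par z)" using ord_antisym[OF p(3)] p(4) unfolding chain_def by blast
qed

lemma finite_chain: "finite (chain z)"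
  by (simp add: chain_def N_def)

text \<open>Induction along parents; it terminates because the chain of the parent lacks
  \<open>z\<close>.\<close>

lemma good_induct [consumes 2, case_names root par]:
  assumes "z \<in> N" "good z"
    and "\<And>z. z \<in> N \<Longrightarrow> good z \<Longrightarrow> {ot z, z} \<in> I \<Longrightarrow> Q z"
    and "\<And>z. z \<in> N \<Longrightarrow> good z \<Longrightarrow> {ot z, z} \<notin> I \<Longrightarrow> Q (par z) \<Longrightarrow> Q z"
  shows "Q z"
  using assms(1,2)
proof (induction "card (chain z)" arbitrary: z rule: less_induct)
  case less
  show ?case
  proof (cases "{ot z, z} \<in> I")
    case True
    then show ?thesis using less assms by blast
  next
    case False
    note c = chain_par[OF less(2,3) False] and p = par_D[OF less(2) False]
    have "card (chain (par z)) < card (chain z)" using c finite_chain by simp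
    then have "Q (par z)" using less(1) p by blast
    then show ?thesis using less assms(4) False by blast
  qed
qed

text \<open>\<open>chart_coord\<close> writes \<open>i\<close> before \<open>j\<close> and the
  smaller leaf first, while the slopes treat \<open>ot k\<close> and \<open>k\<close> as the first
  entries. This is the sign between the two conventions.\<close>

definition sign :: "nat \<Rightarrow> nat \<Rightarrow> 'k lpoly" where
  "sign k t = (if (k < t) = (ot k = i) then 1 else - 1)"

lemma sign_square [simp]: "sign k t * sign k t = 1"
  by (simp add: sign_def)

lemma sign_chart_coord:
  assumes "k \<in> N" "t \<in> N" "k \<noteq> t"
  shows "lvar {ot k, k} * lvar {pv k, t} - lvar {ot k, t} * lvar {pv k, k} = sign k t * chart_coord n i j {k, t}"
proof -
  have ne: "{k, t} \<noteq> {i, j}" "{k, t} \<notin> chart_index n i j"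
    using assms not_in_chart_index by (auto simp: N_def doubleton_eq_iff)
  show ?thesis
  proof (cases "k < t")
    case True
    then show ?thesis using ij(3)
      by (cases k rule: pv_ot_cases) (simp_all add: chart_coord_def ne sign_def algebra_simps Let_def)
  next
    case False
    then show ?thesis using ij(3) assms(3)
      by (cases k rule: pv_ot_cases) (simp_all add: chart_coord_def ne sign_def algebra_simps Let_def)
  qed
qed

text \<open>The Pluecker relation for \<open>s\<close> and \<open>par s\<close>, divided by the two
  pivot coordinates: the difference of the two slopes.\<close>

definition incr :: "nat \<Rightarrow> 'k lpoly" where
  "incr s = sign s (par s) * (lvar {s, par s} * (vpow {pv s, s} (- 1) * vpow {pv s, par s} (- 1)))"

text \<open>The slope \<open>u / u'\<close> of a leaf \<open>z\<close>, with \<open>u = u\<^bsub>ot z, z\<^esub>\<close> and \<open>u' = u\<^bsub>pv z, z\<^esub>\<close>, in terms of the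
  variables in \<open>I\<close>. It grows along the chain of good leaves below \<open>z\<close> by the terms \<open>incr\<close>.\<close>

definition slope :: "nat \<Rightarrow> 'k lpoly" where
  "slope z = (\<Sum>s\<in>chain z. if {ot s, s} \<in> I then lvar {ot s, s} * vpow {pv s, s} (- 1) else incr s)"

lemma slope_root:
  "z \<in> N \<Longrightarrow> good z \<Longrightarrow> {ot z, z} \<in> I \<Longrightarrow> slope z = lvar {ot z, z} * vpow {pv z, z} (- 1)"
  by (simp add: slope_def chain_root)

lemma slope_par:
  "z \<in> N \<Longrightarrow> good z \<Longrightarrow> {ot z, z} \<notin> I \<Longrightarrow> slope z = slope (par z) + incr z"
  using chain_par finite_chain by (simp add: slope_def add.commute)

text \<open>The expression of \<open>u_e\<close>, \<open>e = {ot k, k}\<close>, in the variables of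
  \<open>I\<close>. For good \<open>k\<close> it is the slope times the pivot coordinate; in
  multiplied-out form it does not invert the pivot coordinate of \<open>k\<close>, which may vanish
  on the fiber.\<close>

definition G :: "nat \<Rightarrow> 'k lpoly" where
  "G k = (if {ot k, k} \<in> I then lvar {ot k, k}
     else slope (par k) * lvar {pv k, k} + sign k (par k) * (lvar {k, par k} * vpow {pv k, par k} (- 1)))"

lemma incr_mult_lvar:
  "incr k * lvar {pv k, k} = sign k (par k) * (lvar {k, par k} * vpow {pv k, par k} (- 1))"
proof -
  have "incr k * lvar {pv k, k} = sign k (par k) * (lvar {k, par k} * vpow {pv k, par k} (- 1)) *
      (vpow {pv k, k} (- 1) * lvar {pv k, k})"
    unfolding incr_def by (simp only: mult_ac)
  then show ?thesis by simp
qed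

lemma G_good:
  assumes "k \<in> N" "good k" shows "G k = slope k * lvar {pv k, k}"
proof (cases "{ot k, k} \<in> I")
  case True
  then show ?thesis by (simp add: slope_root[OF assms True] G_def mult.assoc)
next
  case False
  then show ?thesis by (simp add: slope_par[OF assms False] G_def distrib_right incr_mult_lvar)
qed

definition W :: "nat set set" where
  "W = I \<inter> chart_index n i j - J"

lemma W_sub: "W \<subseteq> chart_index n i j" "W \<subseteq> I" "W \<inter> (I \<inter> J) = {}"
  by (auto simp: W_def)

lemma pv_not_in_J: "good k \<Longrightarrow> {pv l, k} \<notin> J" and ot_not_in_J: "good k \<Longrightarrow> {ot l, k} \<notin> J"
  by (cases l rule: pv_ot_cases; simp add: good_def)+

lemma pv_in_W: "k \<in> N \<Longrightarrow> good k \<Longrightarrow> {pv k, k} \<in> W"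
  using pv_in_I pv_ot_chart pv_not_in_J by (auto simp: W_def)

text \<open>The variables that expressions attached to \<open>z\<close> can involve. This record of
  supports shows that a step of a chain brings in a new variable, and that different branches share
  none.\<close>

definition below :: "nat \<Rightarrow> nat set set" where
  "below z = {e \<in> I. e \<inter> N \<noteq> {} \<and> (\<forall>l\<in>e \<inter> N. (l, z) \<in> ord)}"

lemma below_D: "e \<in> below z \<Longrightarrow> e \<in> I"
  by (simp add: below_def)

lemma below_mono: "(y, z) \<in> ord \<Longrightarrow> below y \<subseteq> below z"
  using ord_trans by (auto simp: below_def)

lemma pv_ot_inter_N: "k \<in> N \<Longrightarrow> {pv l, k} \<inter> N = {k}" "k \<in> N \<Longrightarrow> {ot l, k} \<inter> N = {k}"
  by (cases l rule: pv_ot_cases; auto simp: N_def)+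

lemma below_pv: "k \<in> N \<Longrightarrow> (k, z) \<in> ord \<Longrightarrow> {pv k, k} \<in> below z"
  using pv_in_I[of k] by (simp add: below_def pv_ot_inter_N)

lemma below_ot: "k \<in> N \<Longrightarrow> (k, z) \<in> ord \<Longrightarrow> {ot k, k} \<in> I \<Longrightarrow> {ot k, k} \<in> below z"
  by (simp add: below_def pv_ot_inter_N)

lemma below_par:
  assumes "k \<in> N" "{ot k, k} \<notin> I" "(k, z) \<in> ord" shows "{k, par k} \<in> below z"
  using par_D[OF assms(1,2)] assms ord_trans[OF _ assms(3)] by (auto simp: below_def)

lemma sign_lpolys: "sign k t \<in> lpolys V X"
  by (auto simp: sign_def intro: lpolys_one lpolys_uminus)

lemma incr_lpolys:
  assumes k: "k \<in> N" "good k" "{ot k, k} \<notin> I"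
  shows "incr k \<in> lpolys (below k) W"
proof -
  note p = par_D[OF k(1,3)]
  have "{pv k, par k} \<in> below k" "{pv k, par k} \<in> W"
    using below_pv[OF p(1,3)] pv_in_W[OF p(1,5)] pv_cong[OF p(2)] by auto
  then show ?thesis unfolding incr_def
    using below_pv[OF k(1) ord_refl[OF k(1)]] below_par[OF k(1,3) ord_refl[OF k(1)]] pv_in_W[OF k(1,2)]
    by (intro lpolys_mult sign_lpolys lpolys_lvar lpolys_vpow) auto
qed

lemma slope_lpolys:
  assumes "z \<in> N" "good z" shows "slope z \<in> lpolys (below z) W"
  using assms
proof (induction rule: good_induct)
  case (root z)
  then show ?case unfolding slope_root[OF root]
    using below_pv[OF root(1) ord_refl[OF root(1)]] below_ot[OF root(1) ord_refl[OF root(1)] root(3)] pv_in_W[OF root(1,2)]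
    by (intro lpolys_mult lpolys_lvar lpolys_vpow) auto
next
  case (par z)
  have "slope (par z) \<in> lpolys (below z) W"
    by (rule lpolys_mono[OF below_mono[OF par_D(3)[OF par(1,3)]] subset_refl par(4)])
  then show ?case unfolding slope_par[OF par(1-3)]
    using incr_lpolys[OF par(1-3)] by (rule lpolys_add)
qed

lemma G_lpolys:
  assumes k: "k \<in> N" shows "G k \<in> lpolys (below k) W"
proof (cases "{ot k, k} \<in> I")
  case True
  then show ?thesis using below_ot[OF k ord_refl[OF k]] by (simp add: G_def lpolys_lvar)
next
  case False
  note p = par_D[OF k False]
  have "{pv k, par k} \<in> below k" "{pv k, par k} \<in> W"
    using below_pv[OF p(1,3)] pv_in_W[OF p(1,5)] pv_cong[OF p(2)] by auto
  moreover have "slope (par k) \<in> lpolys (below k) W"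
    by (rule lpolys_mono[OF below_mono[OF p(3)] subset_refl slope_lpolys[OF p(1,5)]])
  ultimately show ?thesis
    using False below_pv[OF k ord_refl[OF k]] below_par[OF k False ord_refl[OF k]]
    by (simp add: G_def) (intro lpolys_add lpolys_mult sign_lpolys lpolys_lvar lpolys_vpow; simp)
qed

lemma lpolys_below: "P \<in> lpolys (below z) W \<Longrightarrow> P \<in> lpolys I W"
  by (rule lpolys_mono[of "below z" I W W]) (auto dest: below_D)

section \<open>The inclusion \<open>mu\<close>, computed with an explicit inverse\<close>

interpretation cs: lsubst_hom "coord_power n i j :: nat set \<Rightarrow> int \<Rightarrow> 'k lpoly" W
  by (rule lsubst_hom_coord_power[OF W_sub(1) ij(3)])

abbreviation cs :: "'k lpoly \<Rightarrow> 'k lpoly" where "cs \<equiv> lsubst (coord_power n i j)"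

lemma cs_vpow: "e \<in> chart_index n i j \<Longrightarrow> cs (vpow e z) = vpow e z"
  by (simp add: cs.lsubst_vpow coord_power_chart_index ij(3))

lemma cs_lvar: "e \<in> chart_index n i j \<Longrightarrow> cs (lvar e) = lvar e"
  by (simp add: lvar_eq cs_vpow)

lemma cs_lvar_coord: "cs (lvar e) = chart_coord n i j e"
  by (simp add: cs.lsubst_lvar coord_power_def)

lemma cs_sign_mult: "cs (sign k t * P) = sign k t * cs P"
  by (simp add: sign_def lsubst_uminus)

lemma cs_par_mult:
  assumes k: "k \<in> N" "{ot k, k} \<notin> I" and Q: "Q \<in> lpolys I W"
  shows "cs (sign k (par k) * (lvar {k, par k} * Q)) =
    (lvar {ot k, k} * lvar {pv k, par k} - lvar {ot k, par k} * lvar {pv k, k}) * cs Q"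
proof -
  note p = par_D[OF k]
  have "cs (lvar {k, par k} * Q) = chart_coord n i j {k, par k} * cs Q"
    using cs.lsubst_mult[OF lpolys_lvar[OF p(6)] Q] by (simp add: cs_lvar_coord)
  then show ?thesis unfolding sign_chart_coord[OF k(1) p(1) p(4)[symmetric]]
    by (simp add: cs_sign_mult mult.assoc)
qed

text \<open>The increments telescope, each being the difference of two successive quotients by the
  Pluecker relation.\<close>

lemma cs_slope:
  assumes "z \<in> N" "good z" shows "cs (slope z) = lvar {ot z, z} * vpow {pv z, z} (- 1)"
  using assms
proof (induction rule: good_induct)
  case (root z)
  have "lvar {ot z, z} \<in> lpolys I W" "vpow {pv z, z} (- 1) \<in> lpolys I W"
    using root pv_in_I[OF root(1)] pv_in_W[OF root(1,2)] by (auto intro: lpolys_lvar lpolys_vpow)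
  then show ?case unfolding slope_root[OF root]
    using cs.lsubst_mult cs_lvar cs_vpow pv_ot_chart[OF root(1), of z] by metis
next
  case (par z)
  note p = par_D[OF par(1,3)]
  let ?t = "par z" let ?a = "vpow {pv z, z} (- 1)" and ?b = "vpow {pv z, ?t} (- 1)"
  have W: "{pv z, z} \<in> W" "{pv z, ?t} \<in> W" using pv_in_W[OF par(1,2)] pv_in_W[OF p(1,5)] pv_cong[OF p(2)] by auto
  then have mem: "?a \<in> lpolys I W" "?b \<in> lpolys I W" using W_sub by (auto intro!: lpolys_vpow)
  have "cs (?a * ?b) = ?a * ?b"
    by (simp add: cs.lsubst_mult[OF mem] cs_vpow pv_ot_chart(1)[OF par(1)] pv_ot_chart(1)[OF p(1)])
  then have "cs (incr z) = (lvar {ot z, z} * lvar {pv z, ?t} - lvar {ot z, ?t} * lvar {pv z, z}) * (?a * ?b)"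
    unfolding incr_def using cs_par_mult[OF par(1,3) lpolys_mult[OF mem]] by simp
  also have "\<dots> = lvar {ot z, z} * ?a * (lvar {pv z, ?t} * ?b) - lvar {ot z, ?t} * ?b * (lvar {pv z, z} * ?a)"
  proof -
    have "(x * y - u * v) * (a * b) = x * a * (y * b) - u * b * (v * a)" for x y u v a b :: "'k lpoly"
      by (simp add: algebra_simps)
    then show ?thesis .
  qed
  also have "\<dots> = lvar {ot z, z} * ?a - lvar {ot z, ?t} * ?b"
    by (simp only: lvar_vpow_inverse mult_1_right)
  finally show ?case unfolding slope_par[OF par(1-3)] lsubst_add par(4)
    using pv_cong[OF p(2)] ot_cong[OF p(2)] by simp
qed

lemma cs_G:
  assumes k: "k \<in> N" shows "cs (G k) = lvar {ot k, k}"
proof (cases "{ot k, k} \<in> I")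
  case True
  then show ?thesis using k by (simp add: G_def cs_lvar pv_ot_chart)
next
  case False
  note p = par_D[OF k False]
  let ?t = "par k" let ?b = "vpow {pv k, ?t} (- 1)"
  have pv: "pv ?t = pv k" "ot ?t = ot k" using pv_cong[OF p(2)] ot_cong[OF p(2)] by auto
  have "{pv k, ?t} \<in> W" using pv_in_W[OF p(1,5)] pv by simp
  then have mem: "?b \<in> lpolys I W" using W_sub by (auto intro!: lpolys_vpow)
  have 1: "cs (slope ?t * lvar {pv k, k}) = lvar {ot k, ?t} * ?b * lvar {pv k, k}"
    using cs.lsubst_mult[OF slope_lpolys[OF p(1,5)] lpolys_lvar[OF pv_in_I[OF k]]]
    by (simp add: cs_slope[OF p(1,5)] cs_lvar[OF pv_ot_chart(1)[OF k]] pv)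
  have 2: "cs (sign k ?t * (lvar {k, ?t} * ?b)) =
      (lvar {ot k, k} * lvar {pv k, ?t} - lvar {ot k, ?t} * lvar {pv k, k}) * ?b"
    by (simp add: cs_par_mult[OF k False mem] cs_vpow[OF pv_ot_chart(1)[OF p(1)]])
  have "cs (G k) = lvar {ot k, ?t} * ?b * lvar {pv k, k} +
      (lvar {ot k, k} * lvar {pv k, ?t} - lvar {ot k, ?t} * lvar {pv k, k}) * ?b"
    using False by (simp add: G_def lsubst_add 1 2)
  also have "\<dots> = lvar {ot k, k} * (lvar {pv k, ?t} * ?b)" by (simp add: algebra_simps)
  finally show ?thesis by simp
qed

text \<open>The candidate for the inverse of \<open>cs\<close>: variables in \<open>I\<close> are
  fixed, and a chart variable \<open>{ot k, k}\<close> outside \<open>I\<close> goes to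
  \<open>G k\<close>, where \<open>k\<close> is recovered as the only leaf of the pair in
  \<open>N\<close>. The value 0 at negative powers outside \<open>I\<close> is a default.\<close>

definition inv_power :: "nat set \<Rightarrow> int \<Rightarrow> 'k lpoly" where
  "inv_power e z = (if e \<in> I then vpow e z else if 0 \<le> z then G (the_elem (e \<inter> N)) ^ nat z else 0)"

interpretation iv: lsubst_hom inv_power W
proof
  fix a b :: int and e assume "0 \<le> a \<and> 0 \<le> b \<or> e \<in> W"
  then show "inv_power e (a + b) = inv_power e a * inv_power e b"
    using W_sub by (auto simp: inv_power_def vpow_add nat_add_distrib power_add)
qed (simp add: inv_power_def)

lemma inv_ot:
  assumes k: "k \<in> N" shows "lsubst inv_power (lvar {ot k, k}) = G k"
proof -
  have "inv_power {ot k, k} 1 = G k"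
    using pv_ot_inter_N(2)[OF k, of k] by (simp add: inv_power_def G_def lvar_eq)
  then show ?thesis by (simp add: iv.lsubst_lvar)
qed

lemma inv_lvar: "e \<in> I \<Longrightarrow> lsubst inv_power (lvar e) = lvar e"
  unfolding iv.lsubst_lvar by (simp add: inv_power_def lvar_eq)

text \<open>As the parent is good, \<open>G (par k)\<close> is its slope times its pivot coordinate.
  The slope then cancels in the Pluecker expression, and only the term of \<open>G k\<close> with
  \<open>{k, par k}\<close> is left.\<close>

lemma inv_par:
  assumes k: "k \<in> N" "{ot k, k} \<notin> I"
  shows "lsubst inv_power (chart_coord n i j {k, par k}) = lvar {k, par k}"
proof -
  note p = par_D[OF k]
  let ?t = "par k"
  have pv: "pv ?t = pv k" "ot ?t = ot k" using pv_cong[OF p(2)] ot_cong[OF p(2)] by auto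
  have "lsubst inv_power (sign k ?t * chart_coord n i j {k, ?t}) =
      lsubst inv_power (lvar {ot k, k} * lvar {pv k, ?t} - lvar {ot k, ?t} * lvar {pv k, k})"
    unfolding sign_chart_coord[OF k(1) p(1) p(4)[symmetric]] ..
  also have "\<dots> = G k * lvar {pv k, ?t} - G ?t * lvar {pv k, k}"
    using iv.lsubst_mult[OF lpolys_lvar[of "{ot k, k}" UNIV] lpolys_lvar[of "{pv k, ?t}" UNIV]]
      iv.lsubst_mult[OF lpolys_lvar[of "{ot k, ?t}" UNIV] lpolys_lvar[of "{pv k, k}" UNIV]]
      inv_ot[OF k(1)] inv_ot[OF p(1)] inv_lvar[OF pv_in_I[OF k(1)]] inv_lvar[OF pv_in_I[OF p(1)]] pv
    by (simp add: lsubst_minus)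
  also have "\<dots> = sign k ?t * (lvar {k, ?t} * (vpow {pv k, ?t} (- 1) * lvar {pv k, ?t}))"
    unfolding G_good[OF p(1,5)] using k(2) pv by (simp add: G_def algebra_simps)
  finally have eq: "sign k ?t * lsubst inv_power (chart_coord n i j {k, ?t}) = sign k ?t * lvar {k, ?t}"
    by (simp add: sign_def lsubst_uminus split: if_splits)
  have "sign k ?t * (sign k ?t * lsubst inv_power (chart_coord n i j {k, ?t})) =
      sign k ?t * (sign k ?t * lvar {k, ?t})"
    by (simp only: eq)
  then show ?thesis by (simp add: mult.assoc[symmetric])
qed

text \<open>This left inverse proves the algebraic independence of the \<open>u_e\<close>,
  \<open>e \<in> I\<close>, and so the uniqueness on which \<open>chart_incl\<close>
  depends.\<close>

lemma inv_cs:
  assumes P: "P \<in> lpolys I W" shows "lsubst inv_power (cs P) = P"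
proof (rule iv.lsubst_lsubst_eq[OF P])
  fix e and z :: int assume e: "e \<in> I" "0 \<le> z \<or> e \<in> W"
  show "coord_power n i j e z \<in> lpolys UNIV W" by (rule lpolys_coord_power[OF e(2) W_sub(1) ij(3)])
  from e(1) show "lsubst inv_power (coord_power n i j e z) = vpow e z"
  proof (cases rule: I_cases)
    case 1
    then show ?thesis using e(1) by (simp add: coord_power_chart_index[OF 1 ij(3)] iv.lsubst_vpow inv_power_def)
  next
    case (2 k)
    have "e \<notin> chart_index n i j" using not_in_chart_index[OF 2(1) par_D(1)[OF 2(1,2)]] 2(3) by simp
    then have z: "0 \<le> z" using e(2) by (auto simp: W_def)
    have "chart_coord n i j e \<in> lpolys UNIV W" by (rule lpolys_mono[OF _ _ chart_coord_lpolys]) auto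
    from iv.lsubst_power[OF this, of "nat z"] show ?thesis
      using z inv_par[OF 2(1,2)] 2(3) by (simp add: coord_power_def lvar_power)
  qed
qed

lemma chart_incl_eq:
  assumes "Q \<in> lpolys I W" "cs Q = g" shows "chart_incl n i j I J g = Q"
  unfolding chart_incl_def coord_subst_eq W_def[symmetric]
proof (rule the_equality)
  show "Q \<in> lpolys I W \<and> cs Q = g" using assms by simp
  show "P = Q" if "P \<in> lpolys I W \<and> cs P = g" for P
    using inv_cs[of P] inv_cs[OF assms(1)] that assms(2) by simp
qed

end

section \<open>Gauss norms of the coordinate functions\<close>

context fiber_setup
begin

definition Zv :: "'k lpoly \<Rightarrow> 'k lpoly" where
  "Zv = lsubst (zpow (I \<inter> J))"

interpretation zv: lsubst_hom "zpow (I \<inter> J) :: nat set \<Rightarrow> int \<Rightarrow> 'k lpoly" W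
  by (rule lsubst_hom_zpow[OF W_sub(3)])

lemma Zv_add: "Zv (P + Q) = Zv P + Zv Q" and Zv_minus: "Zv (P - Q) = Zv P - Zv Q"
  by (simp_all add: Zv_def lsubst_add lsubst_minus)

lemma Zv_sign: "Zv (sign k t * P) = sign k t * Zv P"
  by (simp add: Zv_def sign_def lsubst_uminus)

lemma Zv_mult: "P \<in> lpolys V W \<Longrightarrow> Q \<in> lpolys V' W \<Longrightarrow> Zv (P * Q) = Zv P * Zv Q"
  unfolding Zv_def by (rule zv.lsubst_mult)

lemma Zv_lvar: "Zv (lvar e) = (if e \<in> I \<inter> J then 0 else lvar e)"
  unfolding Zv_def zv.lsubst_lvar by (simp add: zpow_def lvar_eq)

lemma Zv_vpow: "e \<notin> J \<Longrightarrow> Zv (vpow e z) = vpow e z"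
  by (simp add: Zv_def zv.lsubst_vpow zpow_def)

lemma Zv_lpolys: "P \<in> lpolys V W \<Longrightarrow> Zv P \<in> lpolys (V - I \<inter> J) W"
  unfolding Zv_def set_vars_zero_eq[symmetric] by (rule set_vars_zero_lpolys)

lemma pairs_memb:
  "k \<in> N \<Longrightarrow> {i, k} \<in> pairs n \<and> {i, k} \<noteq> {i, j}" "k \<in> N \<Longrightarrow> {j, k} \<in> pairs n \<and> {j, k} \<noteq> {i, j}"
  "k \<in> N \<Longrightarrow> l \<in> N \<Longrightarrow> k \<noteq> l \<Longrightarrow> {k, l} \<in> pairs n \<and> {k, l} \<noteq> {i, j}"
  using ij by (auto simp: pairs_def N_def doubleton_eq_iff)

lemma pv_ot_pairs:
  "k \<in> N \<Longrightarrow> {pv l, k} \<in> pairs n \<and> {pv l, k} \<noteq> {i, j}" "k \<in> N \<Longrightarrow> {ot l, k} \<in> pairs n \<and> {ot l, k} \<noteq> {i, j}"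
  by (cases l rule: pv_ot_cases; simp add: pairs_memb)+

lemma \<rho>_pos: "e \<in> pairs n \<Longrightarrow> e \<noteq> {i, j} \<Longrightarrow> e \<notin> J \<Longrightarrow> 0 < \<rho> e"
  using \<rho>_nonneg[of e] \<rho>_zero_iff[of e] by simp

interpretation gn: gauss_norm "I - J" \<rho>
proof
  show "finite (I - J)" using I(1) finite_pairs finite_subset by blast
  show "0 < \<rho> e" if "e \<in> I - J" for e using that I by (intro \<rho>_pos) auto
qed

lemma below_sub: "below z - I \<inter> J \<subseteq> I - J"
  by (auto simp: below_def)

lemma Zv_below: "P \<in> lpolys (below z) W \<Longrightarrow> Zv P \<in> lpolys (I - J) W"
  by (rule lpolys_mono[OF below_sub subset_refl Zv_lpolys])

lemma gnorm_sign: "gnorm \<rho> (sign k t * P) = gnorm \<rho> P"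
  by (simp add: sign_def)

lemma same_branch_pv:
  assumes "r \<in> N" "s \<in> N" "r \<noteq> s" "br r = br s"
  shows "\<rho> {ot s, s} * \<rho> {pv s, r} = \<rho> {ot s, r} * \<rho> {pv s, s}" "\<rho> {s, r} \<le> \<rho> {ot s, s} * \<rho> {pv s, r}"
proof -
  have "{s, r} = {r, s}" by auto
  then show "\<rho> {ot s, s} * \<rho> {pv s, r} = \<rho> {ot s, r} * \<rho> {pv s, s}" "\<rho> {s, r} \<le> \<rho> {ot s, s} * \<rho> {pv s, r}"
    using same_branch[OF assms] by (cases s rule: pv_ot_cases; simp add: mult.commute)+
qed

text \<open>\<open>cherry\<close> speaks of quartets containing \<open>i\<close>. By
  \<open>same_branch\<close> the ratio of \<open>\<rho> {j, m}\<close> and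
  \<open>\<rho> {i, m}\<close> is the same constant for all good leaves of a branch, so the relation
  may be rescaled to one for \<open>j\<close>.\<close>

lemma cherry_pv:
  assumes "strictly_below ord k l" "strictly_below ord l v" "good k" "good l" "good v"
  shows "\<rho> {k, v} * \<rho> {pv v, l} = max (\<rho> {k, l} * \<rho> {pv v, v}) (\<rho> {l, v} * \<rho> {pv v, k})"
proof (cases v rule: pv_ot_cases)
  case 1
  then show ?thesis using cherry[OF assms(1,2)] by simp
next
  case 2
  have N: "k \<in> N" "l \<in> N" "v \<in> N" and ne: "k \<noteq> l" "l \<noteq> v" and br: "br k = br l" "br l = br v"
    using assms ord_in_N ord(2) by (auto simp: strictly_below_def)
  define c where "c = \<rho> {j, v} / \<rho> {i, v}"
  have pos: "0 < \<rho> {i, m}" "0 < \<rho> {j, m}" if "m \<in> N" "good m" for m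
    using that pairs_memb by (auto simp: good_def intro!: \<rho>_pos)
  have c: "\<rho> {j, m} = c * \<rho> {i, m}" if "m \<in> N" "good m" "br m = br v" for m
  proof (cases "m = v")
    case False
    then have "\<rho> {i, m} * \<rho> {j, v} = \<rho> {i, v} * \<rho> {j, m}" using same_branch that N by blast
    then show ?thesis using pos[OF N(3) assms(5)] by (simp add: c_def field_simps)
  qed (use pos[OF N(3) assms(5)] in \<open>simp add: c_def\<close>)
  have "0 < c" using pos[OF N(3) assms(5)] by (simp add: c_def)
  have "\<rho> {k, v} * \<rho> {pv v, l} = c * (\<rho> {k, v} * \<rho> {i, l})"
    using 2 c[OF N(2) assms(4)] br by simp
  also have "\<dots> = max (c * (\<rho> {k, l} * \<rho> {i, v})) (c * (\<rho> {l, v} * \<rho> {i, k}))"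
    unfolding cherry[OF assms(1,2)] using \<open>0 < c\<close> by (simp add: max_mult_distrib_left)
  also have "\<dots> = max (\<rho> {k, l} * \<rho> {pv v, v}) (\<rho> {l, v} * \<rho> {pv v, k})"
    using 2 c[OF N(1) assms(3)] c[OF N(3) assms(5)] br by (simp add: mult.left_commute)
  finally show ?thesis .
qed

lemma pos_pv_ot:
  assumes "k \<in> N" "good k" shows "0 < \<rho> {pv l, k}" "0 < \<rho> {ot l, k}"
  using pv_ot_pairs[OF assms(1), of l] pv_not_in_J[OF assms(2)] ot_not_in_J[OF assms(2)] by (auto intro: \<rho>_pos)

lemma below_par_not: "k \<in> N \<Longrightarrow> {ot k, k} \<notin> I \<Longrightarrow> {k, par k} \<notin> below (par k)"
  using par_D[of k] ord_antisym[of "par k" k] by (auto simp: below_def)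

context
  fixes z
  assumes z: "z \<in> N" "good z" "{ot z, z} \<notin> I"
begin

lemma Zv_incr: "Zv (incr z) = (if {z, par z} \<in> J then 0 else incr z)"
proof -
  note p = par_D[OF z(1,3)]
  have W: "{pv z, z} \<in> W" "{pv z, par z} \<in> W" using pv_in_W[OF z(1,2)] pv_in_W[OF p(1,5)] pv_cong[OF p(2)] by auto
  have 1: "(vpow {pv z, z} (- 1) :: 'k lpoly) \<in> lpolys UNIV W" "(vpow {pv z, par z} (- 1) :: 'k lpoly) \<in> lpolys UNIV W"
    using W by (auto intro: lpolys_vpow)
  have 2: "(lvar {z, par z} :: 'k lpoly) \<in> lpolys UNIV W" by (simp add: lpolys_lvar)
  show ?thesis
    unfolding incr_def using pv_not_in_J[OF z(2)] pv_not_in_J[OF p(5)] p(6)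
    by (simp add: Zv_sign Zv_mult[OF 2 lpolys_mult[OF 1]] Zv_mult[OF 1] Zv_lvar Zv_vpow)
qed

lemma gnorm_Zv_incr: "gnorm \<rho> (Zv (incr z)) = \<rho> {z, par z} / (\<rho> {pv z, z} * \<rho> {pv z, par z})"
proof (cases "{z, par z} \<in> J")
  case True
  then have "\<rho> {z, par z} = 0" using \<rho>_zero_iff pairs_memb(3) z(1) par_D(1,4)[OF z(1,3)] by metis
  then show ?thesis using True by (simp add: Zv_incr)
next
  case False
  note p = par_D[OF z(1,3)]
  have W: "{pv z, z} \<in> I - J" "{pv z, par z} \<in> I - J" "{z, par z} \<in> I - J"
    using pv_in_W[OF z(1,2)] pv_in_W[OF p(1,5)] pv_cong[OF p(2)] p(6) False by (auto simp: W_def)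
  have 1: "(vpow {pv z, z} (- 1) :: 'k lpoly) \<in> lpolys (I - J) UNIV"
      "(vpow {pv z, par z} (- 1) :: 'k lpoly) \<in> lpolys (I - J) UNIV"
    using W by (auto intro: lpolys_vpow)
  have 2: "(lvar {z, par z} :: 'k lpoly) \<in> lpolys (I - J) UNIV" by (rule lpolys_lvar[OF W(3)])
  have "Zv (incr z) = incr z" using False by (simp add: Zv_incr)
  then have "gnorm \<rho> (Zv (incr z)) = \<rho> {z, par z} * (\<rho> {pv z, z} powi (- 1) * \<rho> {pv z, par z} powi (- 1))"
    unfolding incr_def
    by (simp only: gnorm_sign gn.gnorm_mult[OF 2 lpolys_mult[OF 1]] gn.gnorm_mult[OF 1] gn.gnorm_lvar[OF W(3)]
        gn.gnorm_vpow[OF W(1)] gn.gnorm_vpow[OF W(2)])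
  then show ?thesis by (simp add: power_int_minus divide_inverse)
qed

lemma keys_Zv_incr:
  assumes "\<alpha> \<in> Poly_Mapping.keys (Zv (incr z))" shows "Poly_Mapping.lookup \<alpha> {z, par z} = 1"
proof -
  note p = par_D[OF z(1,3)]
  let ?\<mu> = "Poly_Mapping.single {z, par z} (1 :: int) + (Poly_Mapping.single {pv z, z} (- 1) + Poly_Mapping.single {pv z, par z} (- 1))"
  have "(incr z :: 'k lpoly) = sign z (par z) * Poly_Mapping.single ?\<mu> 1"
    unfolding incr_def lvar_eq vpow_def by (simp add: mult_single)
  then have "Poly_Mapping.keys (incr z :: 'k lpoly) \<subseteq> {?\<mu>}"
    by (simp add: sign_def)
  then have "\<alpha> = ?\<mu>" using assms by (auto simp: Zv_incr split: if_splits)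
  moreover have "{pv z, z} \<noteq> {z, par z}" "{pv z, par z} \<noteq> {z, par z}"
    using pv_ot_ne(1)[of z z] pv_ot_ne(1)[of "par z" z] z p by (auto simp: doubleton_eq_iff)
  ultimately show ?thesis by (simp add: lookup_add lookup_single)
qed

text \<open>The variable \<open>{z, par z}\<close> occurs in the increment, but in nothing supported
  below \<open>par z\<close>, since \<open>z\<close> is not below its parent.\<close>

lemma disjoint_incr:
  assumes "P \<in> lpolys (below (par z)) W"
  shows "Poly_Mapping.keys P \<inter> Poly_Mapping.keys (Zv (incr z)) = {}"
proof (rule equals0I)
  fix \<alpha> assume a: "\<alpha> \<in> Poly_Mapping.keys P \<inter> Poly_Mapping.keys (Zv (incr z))"
  then have "Poly_Mapping.lookup \<alpha> {z, par z} = 1" using keys_Zv_incr by blast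
  then have "{z, par z} \<in> Poly_Mapping.keys \<alpha>" by (simp add: in_keys_iff)
  then show False using a assms below_par_not[OF z(1,3)] by (auto simp: lpolys_def)
qed

lemma Zv_incr_lpolys: "Zv (incr z) \<in> lpolys (I - J) W"
  by (rule Zv_below[OF incr_lpolys[OF z]])

end

lemma Zv_slope_below: "z \<in> N \<Longrightarrow> good z \<Longrightarrow> Zv (slope z) \<in> lpolys (below z) W"
  by (rule lpolys_mono[OF Diff_subset subset_refl Zv_lpolys[OF slope_lpolys]])

text \<open>The norm of the telescoping sum is a maximum. By the four-point condition the slope of
  the parent already has the size of the slope of \<open>z\<close>, and the increment is no
  larger.\<close>

lemma gnorm_Zv_slope:
  assumes "z \<in> N" "good z" shows "gnorm \<rho> (Zv (slope z)) = \<rho> {ot z, z} / \<rho> {pv z, z}"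
  using assms
proof (induction rule: good_induct)
  case (root z)
  have W: "{pv z, z} \<in> I - J" "{ot z, z} \<in> I - J"
    using pv_in_W[OF root(1,2)] root(3) ot_not_in_J[OF root(2)] by (auto simp: W_def)
  have a: "(lvar {ot z, z} :: 'k lpoly) \<in> lpolys UNIV W" "(vpow {pv z, z} (- 1) :: 'k lpoly) \<in> lpolys UNIV W"
    using pv_in_W[OF root(1,2)] by (auto intro: lpolys_lvar lpolys_vpow)
  have b: "(lvar {ot z, z} :: 'k lpoly) \<in> lpolys (I - J) UNIV" "(vpow {pv z, z} (- 1) :: 'k lpoly) \<in> lpolys (I - J) UNIV"
    using W by (auto intro: lpolys_lvar lpolys_vpow)
  show ?case
    unfolding slope_root[OF root] using W
    by (simp add: Zv_mult[OF a] Zv_lvar Zv_vpow gn.gnorm_mult[OF b] gn.gnorm_lvar gn.gnorm_vpow power_int_minus field_simps)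
next
  case (par z)
  note p = par_D[OF par(1,3)]
  have pv: "pv (par z) = pv z" "ot (par z) = ot z" using pv_cong[OF p(2)] ot_cong[OF p(2)] by auto
  have "gnorm \<rho> (Zv (slope z)) = max (gnorm \<rho> (Zv (slope (par z)))) (gnorm \<rho> (Zv (incr z)))"
    unfolding slope_par[OF par(1-3)] Zv_add
    by (rule gn.gnorm_add_disjoint[OF Zv_below[OF slope_lpolys[OF p(1,5)]] Zv_incr_lpolys[OF par(1-3)]
          disjoint_incr[OF par(1-3) Zv_slope_below[OF p(1,5)]]])
  also have "\<dots> = max (\<rho> {ot z, par z} / \<rho> {pv z, par z}) (\<rho> {z, par z} / (\<rho> {pv z, z} * \<rho> {pv z, par z}))"
    using par(4) pv by (simp add: gnorm_Zv_incr[OF par(1-3)])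
  also have "\<dots> = \<rho> {ot z, z} / \<rho> {pv z, z}"
  proof -
    note s = same_branch_pv[OF p(1) par(1) p(4,2)]
    have pos: "0 < \<rho> {pv z, z}" "0 < \<rho> {pv z, par z}"
      using pos_pv_ot[OF par(1,2)] pos_pv_ot[OF p(1,5)] by auto
    have eq: "\<rho> {ot z, par z} / \<rho> {pv z, par z} = \<rho> {ot z, z} / \<rho> {pv z, z}"
      using s(1) pos by (simp add: field_simps)
    have "\<rho> {z, par z} / (\<rho> {pv z, z} * \<rho> {pv z, par z}) \<le> \<rho> {ot z, z} / \<rho> {pv z, z}"
      using s(2) pos by (simp add: field_simps)
    then show ?thesis unfolding eq by simp
  qed
  finally show ?case .
qed

text \<open>Excludes a constant term, which would give \<open>G k\<close> a monomial equal to the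
  pivot coordinate of \<open>k\<close>.\<close>

lemma keys_Zv_slope:
  assumes "z \<in> N" "good z" shows "0 \<notin> Poly_Mapping.keys (Zv (slope z))"
  using assms
proof (induction rule: good_induct)
  case (root z)
  have a: "(lvar {ot z, z} :: 'k lpoly) \<in> lpolys UNIV W" "(vpow {pv z, z} (- 1) :: 'k lpoly) \<in> lpolys UNIV W"
    using pv_in_W[OF root(1,2)] by (auto intro: lpolys_lvar lpolys_vpow)
  let ?\<mu> = "Poly_Mapping.single {ot z, z} (1 :: int) + Poly_Mapping.single {pv z, z} (- 1)"
  have eq: "Zv (slope z) = Poly_Mapping.single ?\<mu> 1"
    unfolding slope_root[OF root] using ot_not_in_J[OF root(2)] pv_not_in_J[OF root(2)]
    by (simp add: Zv_mult[OF a] Zv_lvar Zv_vpow) (simp add: lvar_eq vpow_def mult_single)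
  have "{pv z, z} \<noteq> {ot z, z}" using pv_ot_ne(3)[of z] by (auto simp: doubleton_eq_iff)
  then have "Poly_Mapping.lookup ?\<mu> {ot z, z} = 1" by (simp add: lookup_add lookup_single)
  then have "?\<mu> \<noteq> 0" by (metis lookup_zero zero_neq_one)
  then show ?case by (simp add: eq)
next
  case (par z)
  have "0 \<notin> Poly_Mapping.keys (Zv (incr z))" using keys_Zv_incr[OF par(1-3), of 0] by auto
  then show ?case unfolding slope_par[OF par(1-3)] Zv_add
    using par(4) Poly_Mapping.keys_add[of "Zv (slope (par z))" "Zv (incr z)"] by blast
qed

text \<open>Here the cherry property enters: along a chain of good leaves the distances are determined by
  those of neighbours.\<close>

lemma gnorm_Zv_slope_diff:
  assumes "s \<in> N" "good s" "r \<in> N" "good r" "(r, s) \<in> ord" "r \<noteq> s"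
  shows "gnorm \<rho> (Zv (slope s) - Zv (slope r)) = \<rho> {r, s} / (\<rho> {pv s, r} * \<rho> {pv s, s})"
  using assms(1,2,5,6)
proof (induction rule: good_induct)
  case (root s)
  then show ?case using not_good_below_root assms(4) by blast
next
  case (par s)
  note p = par_D[OF par(1,3)]
  let ?t = "par s"
  have pv: "pv ?t = pv s" using pv_cong[OF p(2)] .
  have eq: "Zv (slope s) - Zv (slope r) = (Zv (slope ?t) - Zv (slope r)) + Zv (incr s)"
    by (simp add: slope_par[OF par(1-3)] Zv_add)
  show ?case
  proof (cases "r = ?t")
    case True
    then show ?thesis unfolding eq
      by (simp add: gnorm_Zv_incr[OF par(1-3)] insert_commute mult.commute)
  next
    case False
    have rt: "(r, ?t) \<in> ord" using p(7) par(5,6) assms(4) by blast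
    have mem: "Zv (slope ?t) - Zv (slope r) \<in> lpolys (below ?t) W"
      by (intro lpolys_minus Zv_slope_below[OF p(1,5)]
          lpolys_mono[OF below_mono[OF rt] subset_refl Zv_slope_below[OF assms(3,4)]])
    have mem': "Zv (slope ?t) - Zv (slope r) \<in> lpolys (I - J) W"
      by (intro lpolys_minus Zv_below slope_lpolys p(1,5) assms(3,4))
        (use slope_lpolys[OF p(1,5)] slope_lpolys[OF assms(3,4)] in auto)
    have "gnorm \<rho> (Zv (slope s) - Zv (slope r)) = max (gnorm \<rho> (Zv (slope ?t) - Zv (slope r))) (gnorm \<rho> (Zv (incr s)))"
      unfolding eq
      by (rule gn.gnorm_add_disjoint[OF mem' Zv_incr_lpolys[OF par(1-3)] disjoint_incr[OF par(1-3) mem]])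
    also have "\<dots> = max (\<rho> {r, ?t} / (\<rho> {pv s, r} * \<rho> {pv s, ?t})) (\<rho> {s, ?t} / (\<rho> {pv s, s} * \<rho> {pv s, ?t}))"
      using par(4)[OF rt False] pv by (simp add: gnorm_Zv_incr[OF par(1-3)])
    also have "\<dots> = \<rho> {r, s} / (\<rho> {pv s, r} * \<rho> {pv s, s})"
    proof -
      have "\<rho> {r, s} * \<rho> {pv s, ?t} = max (\<rho> {r, ?t} * \<rho> {pv s, s}) (\<rho> {?t, s} * \<rho> {pv s, r})"
        using False rt p par assms(4) by (intro cherry_pv) (auto simp: strictly_below_def)
      moreover have "{s, ?t} = {?t, s}" by auto
      moreover have pos: "0 < \<rho> {pv s, r}" "0 < \<rho> {pv s, ?t}" "0 < \<rho> {pv s, s}"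
        using pos_pv_ot par(1,2) p(1,5) assms(3,4) by blast+
      ultimately show ?thesis by (auto simp: max_def field_simps split: if_splits)
    qed
    finally show ?thesis .
  qed
qed

text \<open>For \<open>x\<close> equal to \<open>i\<close> or \<open>j\<close>, the expression of
  \<open>u_xk\<close> in the variables of \<open>I\<close>, whichever of the two is the
  pivot.\<close>

definition F :: "nat \<Rightarrow> nat \<Rightarrow> 'k lpoly" where
  "F x k = (if x = pv k then lvar {x, k} else G k)"

lemma F_lpolys: "k \<in> N \<Longrightarrow> F x k \<in> lpolys (below k) W"
  using below_pv[OF _ ord_refl] by (simp add: F_def lpolys_lvar G_lpolys)

lemma cs_F: "x \<in> {i, j} \<Longrightarrow> k \<in> N \<Longrightarrow> cs (F x k) = lvar {x, k}"
  using cs_G[of k] cs_lvar[OF pv_ot_chart(1)[of k k]] by (cases k rule: pv_ot_cases) (auto simp: F_def)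

text \<open>The parent is good, so the equality in \<open>same_branch\<close> makes both coordinates
  of \<open>k\<close> vanish together; the inequality then forces \<open>{k, par k}\<close> to
  vanish too.\<close>

lemma not_good_J:
  assumes k: "k \<in> N" "{ot k, k} \<notin> I" "\<not> good k"
  shows "{pv k, k} \<in> J" "{ot k, k} \<in> J" "{k, par k} \<in> J"
proof -
  note p = par_D[OF k(1,2)] and s = same_branch_pv[OF par_D(1)[OF k(1,2)] k(1) par_D(4,2)[OF k(1,2)]]
  have pos: "0 < \<rho> {pv k, par k}" "0 < \<rho> {ot k, par k}" using pos_pv_ot[OF p(1,5)] by auto
  have "{pv k, k} \<in> J \<or> {ot k, k} \<in> J" using k(3) by (cases k rule: pv_ot_cases) (auto simp: good_def)
  then have "\<rho> {pv k, k} = 0 \<or> \<rho> {ot k, k} = 0" using \<rho>_zero_iff pv_ot_pairs[OF k(1), of k] by blast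
  then have 0: "\<rho> {pv k, k} = 0" "\<rho> {ot k, k} = 0" using s(1) pos by auto
  then have "\<rho> {k, par k} = 0"
    using s(2) \<rho>_nonneg[of "{k, par k}"] pairs_memb(3)[OF k(1) p(1) p(4)[symmetric]] by simp
  then show "{pv k, k} \<in> J" "{ot k, k} \<in> J" "{k, par k} \<in> J"
    using 0 \<rho>_zero_iff pv_ot_pairs[OF k(1), of k] pairs_memb(3)[OF k(1) p(1) p(4)[symmetric]] by auto
qed

lemma Zv_G_not_good:
  assumes k: "k \<in> N" "{ot k, k} \<notin> I" "\<not> good k" shows "Zv (G k) = 0"
proof -
  note p = par_D[OF k(1,2)] and J = not_good_J[OF k]
  have "{pv k, par k} \<in> W" using pv_in_W[OF p(1,5)] pv_cong[OF p(2)] by simp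
  then have 1: "(vpow {pv k, par k} (- 1) :: 'k lpoly) \<in> lpolys UNIV W" by (intro lpolys_vpow) auto
  have 2: "(lvar {k, par k} :: 'k lpoly) \<in> lpolys UNIV W" "(lvar {pv k, k} :: 'k lpoly) \<in> lpolys UNIV W"
    by (simp_all add: lpolys_lvar)
  show ?thesis using J k(2) p(6) pv_in_I[OF k(1)]
    by (simp add: G_def Zv_add Zv_sign Zv_mult[OF 2(1) 1] Zv_mult[OF slope_lpolys[OF p(1,5)] 2(2)] Zv_lvar)
qed

lemma Zv_G_good:
  assumes k: "k \<in> N" "good k" shows "Zv (G k) = Zv (slope k) * lvar {pv k, k}"
proof -
  have 2: "(lvar {pv k, k} :: 'k lpoly) \<in> lpolys UNIV W" by (simp add: lpolys_lvar)
  show ?thesis using pv_not_in_J[OF k(2)]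
    by (simp add: G_good[OF k] Zv_mult[OF slope_lpolys[OF k] 2] Zv_lvar)
qed

lemma gnorm_Zv_lvar:
  assumes "e \<in> I" shows "gnorm \<rho> (Zv (lvar e)) = \<rho> e"
proof (cases "e \<in> J")
  case True
  then have "\<rho> e = 0" using assms \<rho>_zero_iff I(1,3) by blast
  then show ?thesis using True assms by (simp add: Zv_lvar)
qed (use assms in \<open>simp add: Zv_lvar gn.gnorm_lvar\<close>)

lemma lvar_pv_mem: "k \<in> N \<Longrightarrow> good k \<Longrightarrow> (lvar {pv k, k} :: 'k lpoly) \<in> lpolys (I - J) W"
  using pv_in_W by (intro lpolys_lvar) (auto simp: W_def)

lemma gnorm_Zv_G:
  assumes k: "k \<in> N" shows "gnorm \<rho> (Zv (G k)) = \<rho> {ot k, k}"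
proof -
  consider "{ot k, k} \<in> I" | "{ot k, k} \<notin> I" "good k" | "{ot k, k} \<notin> I" "\<not> good k" by blast
  then show ?thesis
  proof cases
    case 1
    then show ?thesis using gnorm_Zv_lvar by (simp add: G_def)
  next
    case 2
    have "{pv k, k} \<in> I - J" using pv_in_W[OF k 2(2)] by (auto simp: W_def)
    then show ?thesis using pos_pv_ot[OF k 2(2), of k]
      by (simp add: Zv_G_good[OF k 2(2)] gn.gnorm_mult[OF Zv_below[OF slope_lpolys[OF k 2(2)]] lvar_pv_mem[OF k 2(2)]]
          gnorm_Zv_slope[OF k 2(2)] gn.gnorm_lvar)
  next
    case 3
    have "\<rho> {ot k, k} = 0" using not_good_J[OF k 3] \<rho>_zero_iff pv_ot_pairs[OF k, of k] by blast
    then show ?thesis using Zv_G_not_good[OF k 3] by simp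
  qed
qed

lemma gnorm_Zv_F:
  assumes "x \<in> {i, j}" "k \<in> N" shows "gnorm \<rho> (Zv (F x k)) = \<rho> {x, k}"
proof (cases "x = pv k")
  case True
  then show ?thesis using gnorm_Zv_lvar[OF pv_in_I[OF assms(2)]] by (simp add: F_def)
next
  case False
  then have "x = ot k" using assms by (cases k rule: pv_ot_cases) auto
  then show ?thesis using False gnorm_Zv_G[OF assms(2)] by (simp add: F_def)
qed

text \<open>A common monomial could only be the pivot coordinate. In slope times pivot coordinate it
  would come from a constant term of the slope, which does not exist.\<close>

lemma keys_Zv_lvar_G:
  assumes k: "k \<in> N"
  shows "Poly_Mapping.keys (Zv (lvar {pv k, k})) \<inter> Poly_Mapping.keys (Zv (G k)) = {}"
proof -
  let ?s = "Poly_Mapping.single {pv k, k} (1 :: int)"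
  have pvk: "Poly_Mapping.keys (Zv (lvar {pv k, k})) \<subseteq> {?s}"
    unfolding Zv_lvar by (simp add: lvar_def)
  consider "{ot k, k} \<in> I" | "{ot k, k} \<notin> I" "good k" | "{ot k, k} \<notin> I" "\<not> good k" by blast
  then have "?s \<notin> Poly_Mapping.keys (Zv (G k))"
  proof cases
    case 1
    have "{pv k, k} \<noteq> {ot k, k}" using pv_ot_ne(3)[of k] by (auto simp: doubleton_eq_iff)
    then have "?s \<noteq> Poly_Mapping.single {ot k, k} 1"
      by (metis lookup_single_eq lookup_single_not_eq zero_neq_one)
    moreover have "Zv (G k) = (if {ot k, k} \<in> I \<inter> J then 0 else lvar {ot k, k})"
      using 1 unfolding G_def by (simp add: Zv_lvar)
    ultimately show ?thesis by (simp add: lvar_def)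
  next
    case 2
    show ?thesis
    proof
      assume "?s \<in> Poly_Mapping.keys (Zv (G k))"
      then obtain \<alpha> \<beta> where "\<alpha> \<in> Poly_Mapping.keys (Zv (slope k))" "\<beta> \<in> Poly_Mapping.keys (lvar {pv k, k} :: 'k lpoly)"
          "?s = \<alpha> + \<beta>"
        unfolding Zv_G_good[OF k 2(2)] by (rule keys_lpoly_times)
      then show False using keys_Zv_slope[OF k 2(2)] by (simp add: lvar_def)
    qed
  next
    case 3
    then show ?thesis using Zv_G_not_good[OF k] by simp
  qed
  then show ?thesis using pvk by blast
qed

lemma keys_Zv_F:
  assumes "k \<in> N" shows "Poly_Mapping.keys (Zv (F i k)) \<inter> Poly_Mapping.keys (Zv (F j k)) = {}"
  using keys_Zv_lvar_G[OF assms] ij(3) by (cases k rule: pv_ot_cases) (auto simp: F_def)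

lemma Zv_F_lpolys: "k \<in> N \<Longrightarrow> Zv (F x k) \<in> lpolys (I - J) W"
  by (rule Zv_below[OF F_lpolys])

lemma Zv_F_keys:
  assumes "k \<in> N" "\<alpha> \<in> Poly_Mapping.keys (Zv (F x k))" "e \<in> Poly_Mapping.keys \<alpha>"
  shows "e \<inter> N \<noteq> {}" "l \<in> e \<inter> N \<Longrightarrow> br l = br k"
proof -
  have "e \<in> below k" using Zv_lpolys[OF F_lpolys[OF assms(1), of x]] assms(2,3) by (auto simp: lpolys_def)
  then show "e \<inter> N \<noteq> {}" "l \<in> e \<inter> N \<Longrightarrow> br l = br k" using ord(2) by (auto simp: below_def)
qed

definition D :: "nat \<Rightarrow> nat \<Rightarrow> 'k lpoly" where
  "D r s = F i r * F j s - F i s * F j r"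

lemma D_lpolys: "r \<in> N \<Longrightarrow> s \<in> N \<Longrightarrow> D r s \<in> lpolys I W"
  unfolding D_def by (intro lpolys_minus lpolys_mult lpolys_below[OF F_lpolys])

lemma cs_D:
  assumes "r \<in> N" "s \<in> N"
  shows "cs (D r s) = lvar {i, r} * lvar {j, s} - lvar {i, s} * lvar {j, r}"
proof -
  note F = F_lpolys[OF assms(1)] F_lpolys[OF assms(2)]
  interpret cs: lsubst_hom "coord_power n i j :: nat set \<Rightarrow> int \<Rightarrow> 'k lpoly" W
    by (rule lsubst_hom_coord_power[OF W_sub(1) ij(3)])
  show ?thesis
    by (simp add: D_def lsubst_minus cs.lsubst_mult[OF F(1,2)] cs.lsubst_mult[OF F(2,1)] cs_F assms)
qed

lemma Zv_D:
  assumes "r \<in> N" "s \<in> N"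
  shows "Zv (D r s) = Zv (F i r) * Zv (F j s) - Zv (F i s) * Zv (F j r)"
  by (simp add: D_def Zv_minus Zv_mult[OF F_lpolys[OF assms(1)] F_lpolys[OF assms(2)]]
      Zv_mult[OF F_lpolys[OF assms(2)] F_lpolys[OF assms(1)]])

text \<open>For leaves in different branches the two products involve the same disjoint sets of variables,
  so that a common monomial would give a common monomial of \<open>F i r\<close> and \<open>F j r\<close>.\<close>

lemma gnorm_D_diff_branch:
  assumes rs: "r \<in> N" "s \<in> N" "br r \<noteq> br s"
  shows "gnorm \<rho> (Zv (D r s)) = \<rho> {r, s}"
proof -
  note F = Zv_F_lpolys[OF rs(1)] Zv_F_lpolys[OF rs(2)]
  have "Poly_Mapping.keys (Zv (F i r) * Zv (F j s)) \<inter> Poly_Mapping.keys (Zv (F i s) * Zv (F j r)) = {}"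
  proof (rule equals0I)
    fix \<gamma> assume \<gamma>: "\<gamma> \<in> Poly_Mapping.keys (Zv (F i r) * Zv (F j s)) \<inter> Poly_Mapping.keys (Zv (F i s) * Zv (F j r))"
    from \<gamma> have "\<gamma> \<in> Poly_Mapping.keys (Zv (F i r) * Zv (F j s))" by blast
    then obtain \<alpha> \<beta> where ab: "\<alpha> \<in> Poly_Mapping.keys (Zv (F i r))" "\<beta> \<in> Poly_Mapping.keys (Zv (F j s))" "\<gamma> = \<alpha> + \<beta>"
      by (rule keys_lpoly_times)
    from \<gamma> have "\<gamma> \<in> Poly_Mapping.keys (Zv (F i s) * Zv (F j r))" by blast
    then obtain \<alpha>' \<beta>' where ab': "\<beta>' \<in> Poly_Mapping.keys (Zv (F i s))" "\<alpha>' \<in> Poly_Mapping.keys (Zv (F j r))" "\<gamma> = \<beta>' + \<alpha>'"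
      by (rule keys_lpoly_times)
    have "Poly_Mapping.lookup \<alpha> e = Poly_Mapping.lookup \<alpha>' e" for e
    proof (cases "\<exists>l\<in>e \<inter> N. br l = br r")
      case True
      then have "e \<notin> Poly_Mapping.keys \<beta>" "e \<notin> Poly_Mapping.keys \<beta>'"
        using Zv_F_keys(2)[OF rs(2) ab(2)] Zv_F_keys(2)[OF rs(2) ab'(1)] rs(3) by metis+
      then have 0: "Poly_Mapping.lookup \<beta> e = 0" "Poly_Mapping.lookup \<beta>' e = 0" by (simp_all add: in_keys_iff)
      have "Poly_Mapping.lookup (\<alpha> + \<beta>) e = Poly_Mapping.lookup (\<beta>' + \<alpha>') e"
        using ab(3) ab'(3) by simp
      then show ?thesis by (simp add: lookup_add 0)
    next
      case False
      then have "e \<notin> Poly_Mapping.keys \<alpha>" "e \<notin> Poly_Mapping.keys \<alpha>'"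
        using Zv_F_keys[OF rs(1) ab(1), of e] Zv_F_keys[OF rs(1) ab'(2), of e] by blast+
      then show ?thesis by (simp add: in_keys_iff)
    qed
    then have "\<alpha> = \<alpha>'" by (rule poly_mapping_eqI)
    then show False using keys_Zv_F[OF rs(1)] ab(1) ab'(2) by blast
  qed
  then have "gnorm \<rho> (Zv (D r s)) = max (gnorm \<rho> (Zv (F i r) * Zv (F j s))) (gnorm \<rho> (Zv (F i s) * Zv (F j r)))"
    unfolding Zv_D[OF rs(1,2)] by (rule gn.gnorm_minus_disjoint[OF lpolys_mult[OF F] lpolys_mult[OF F(2,1)]])
  also have "\<dots> = max (\<rho> {i, r} * \<rho> {j, s}) (\<rho> {i, s} * \<rho> {j, r})"
    using rs by (simp add: gn.gnorm_mult[OF F(1,2)] gn.gnorm_mult[OF F(2,1)] gnorm_Zv_F)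
  also have "\<dots> = \<rho> {r, s}" using diff_branch[OF rs] by simp
  finally show ?thesis .
qed

text \<open>Since \<open>\<rho> {r, s}\<close> is positive, the inequality in
  \<open>same_branch\<close> makes both leaves good. Up to sign \<open>D r s\<close> is then the
  difference of their slopes times the two pivot coordinates.\<close>

lemma gnorm_D_same_branch:
  assumes rs: "r \<in> N" "s \<in> N" "br r = br s" "r \<noteq> s" "{r, s} \<notin> J"
  shows "gnorm \<rho> (Zv (D r s)) = \<rho> {r, s}"
proof -
  have "0 < \<rho> {r, s}" using \<rho>_pos pairs_memb(3) rs by blast
  then have "\<rho> {i, r} * \<rho> {j, s} \<noteq> 0" "\<rho> {i, s} * \<rho> {j, r} \<noteq> 0"
    using same_branch[OF rs(1,2,4,3)] by auto
  then have g: "good r" "good s"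
    using \<rho>_zero_iff pairs_memb(1,2) rs(1,2) by (auto simp: good_def)
  have pv: "pv r = pv s" "ot r = ot s" using pv_cong[OF rs(3)] ot_cong[OF rs(3)] by auto
  have Zpv: "Zv (lvar {pv s, s}) = lvar {pv s, s}" "Zv (lvar {pv s, r}) = lvar {pv s, r}"
    using pv_not_in_J g by (simp_all add: Zv_lvar)
  have ZG: "Zv (G s) = Zv (slope s) * lvar {pv s, s}" "Zv (G r) = Zv (slope r) * lvar {pv s, r}"
    using Zv_G_good[OF rs(2) g(2)] Zv_G_good[OF rs(1) g(1)] pv by auto
  have "Zv (D r s) = (Zv (slope s) - Zv (slope r)) * (lvar {pv s, r} * lvar {pv s, s}) \<or>
      Zv (D r s) = - ((Zv (slope s) - Zv (slope r)) * (lvar {pv s, r} * lvar {pv s, s}))"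
  proof (cases s rule: pv_ot_cases)
    case 1
    then have "F i r = lvar {pv s, r}" "F i s = lvar {pv s, s}" "F j r = G r" "F j s = G s"
      using pv ij(3) by (auto simp: F_def)
    then show ?thesis unfolding Zv_D[OF rs(1,2)] by (intro disjI1) (simp add: Zpv ZG algebra_simps)
  next
    case 2
    then have "F j r = lvar {pv s, r}" "F j s = lvar {pv s, s}" "F i r = G r" "F i s = G s"
      using pv ij(3) by (auto simp: F_def)
    then show ?thesis unfolding Zv_D[OF rs(1,2)] by (intro disjI2) (simp add: Zpv ZG algebra_simps)
  qed
  then have "gnorm \<rho> (Zv (D r s)) = gnorm \<rho> ((Zv (slope s) - Zv (slope r)) * (lvar {pv s, r} * lvar {pv s, s}))"
    by auto
  also have "\<dots> = gnorm \<rho> (Zv (slope s) - Zv (slope r)) * (\<rho> {pv s, r} * \<rho> {pv s, s})"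
  proof -
    have 1: "Zv (slope s) - Zv (slope r) \<in> lpolys (I - J) W"
      by (intro lpolys_minus Zv_below[OF slope_lpolys[OF rs(2) g(2)]] Zv_below[OF slope_lpolys[OF rs(1) g(1)]])
    have 2: "(lvar {pv s, r} :: 'k lpoly) \<in> lpolys (I - J) W" "(lvar {pv s, s} :: 'k lpoly) \<in> lpolys (I - J) W"
      using lvar_pv_mem[OF rs(1) g(1)] lvar_pv_mem[OF rs(2) g(2)] pv by auto
    have "{pv s, r} \<in> I - J" "{pv s, s} \<in> I - J"
      using pv_in_W[OF rs(1) g(1)] pv_in_W[OF rs(2) g(2)] pv by (auto simp: W_def)
    then show ?thesis by (simp add: gn.gnorm_mult[OF 1 lpolys_mult[OF 2]] gn.gnorm_mult[OF 2] gn.gnorm_lvar)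
  qed
  also have "\<dots> = \<rho> {r, s}"
  proof -
    have pos: "0 < \<rho> {pv s, r}" "0 < \<rho> {pv s, s}" using pos_pv_ot rs(1,2) g by blast+
    consider "(r, s) \<in> ord" | "(s, r) \<in> ord" using ord(3)[OF rs(1-4)] by blast
    then show ?thesis
    proof cases
      case 1
      then show ?thesis using gnorm_Zv_slope_diff[OF rs(2) g(2) rs(1) g(1) 1 rs(4)] pos by simp
    next
      case 2
      have "gnorm \<rho> (Zv (slope s) - Zv (slope r)) = gnorm \<rho> (Zv (slope r) - Zv (slope s))"
        using gnorm_uminus[of \<rho> "Zv (slope r) - Zv (slope s)"] by simp
      also have "\<dots> = \<rho> {s, r} / (\<rho> {pv s, s} * \<rho> {pv s, r})"
        using gnorm_Zv_slope_diff[OF rs(1) g(1) rs(2) g(2) 2] rs(4) pv by simp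
      also have "{s, r} = {r, s}" by auto
      finally show ?thesis using pos by simp
    qed
  qed
  finally show ?thesis .
qed

text \<open>A pair of leaves in \<open>N\<close> is handled by \<open>D\<close>. Any other pair
  outside \<open>I\<close> contains \<open>i\<close> or \<open>j\<close> and is some
  \<open>{ot k, k}\<close>, because all \<open>{pv k, k}\<close> lie in \<open>I\<close>; it is
  handled by \<open>G\<close>.\<close>

theorem gnorm_fiber_coord:
  assumes e: "e \<in> pairs n - (I \<union> J \<union> {{i, j}})"
  shows "(fiber_coord n i j I J e :: 'k lpoly) \<in> lpolys (I - J) W"
    "gnorm \<rho> (fiber_coord n i j I J e :: 'k lpoly) = \<rho> e"
proof -
  have "(fiber_coord n i j I J e :: 'k lpoly) \<in> lpolys (I - J) W \<and>
    gnorm \<rho> (fiber_coord n i j I J e :: 'k lpoly) = \<rho> e"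
  proof (cases "e \<subseteq> N")
    case True
    then obtain a b where ab: "a \<in> N" "b \<in> N" "a \<noteq> b" "e = {a, b}"
      using e by (auto simp: pairs_def)
    \<comment> \<open>This order agrees with the sign convention of
      \<open>chart_coord\<close>.\<close>
    define r s where "r = Min e" and "s = Max e"
    have rs: "r \<in> N" "s \<in> N" "r \<noteq> s" "e = {r, s}"
      using ab by (auto simp: r_def s_def min_def max_def)
    have "(chart_coord n i j e :: 'k lpoly) = lvar {i, r} * lvar {j, s} - lvar {i, s} * lvar {j, r}"
    proof -
      have "e \<notin> chart_index n i j" by (subst rs(4)) (rule not_in_chart_index[OF rs(1,2)])
      then show ?thesis using e by (simp add: chart_coord_def Let_def flip: r_def s_def)
    qed
    then have "fiber_coord n i j I J e = Zv (D r s)"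
      using chart_incl_eq[OF D_lpolys[OF rs(1,2)] cs_D[OF rs(1,2)]]
      by (simp add: fiber_coord_def Zv_def set_vars_zero_eq)
    moreover have "Zv (D r s) \<in> lpolys (I - J) W"
      unfolding Zv_D[OF rs(1,2)] using rs by (intro lpolys_minus lpolys_mult Zv_F_lpolys)
    moreover have "gnorm \<rho> (Zv (D r s)) = \<rho> e"
    proof (cases "br r = br s")
      case True
      then show ?thesis using gnorm_D_same_branch[OF rs(1,2) True rs(3)] e rs(4) by simp
    next
      case False
      then show ?thesis using gnorm_D_diff_branch[OF rs(1,2)] rs(4) by simp
    qed
    ultimately show ?thesis by simp
  next
    case False
    obtain a b where ab: "a \<in> {1..n}" "b \<in> {1..n}" "a \<noteq> b" "e = {a, b}" using e by (auto simp: pairs_def)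
    have "\<exists>x k. x \<in> {i, j} \<and> k \<in> N \<and> e = {x, k}"
    proof (cases "a \<in> N")
      case True
      then have "b \<in> {i, j}" using False ab by (auto simp: N_def)
      then show ?thesis using True ab(4) by (intro exI[of _ b] exI[of _ a]) auto
    next
      case False
      then have "a \<in> {i, j}" using ab by (auto simp: N_def)
      moreover have "b \<in> N" using e ab calculation by (auto simp: N_def)
      ultimately show ?thesis using ab(4) by blast
    qed
    then obtain x k where xk: "x \<in> {i, j}" "k \<in> N" "e = {x, k}" by blast
    have "x \<noteq> pv k" using e xk pv_in_I by auto
    then have x: "x = ot k" using xk(1) by (cases k rule: pv_ot_cases) auto
    have ch: "e \<in> chart_index n i j" using xk in_chart_index by auto
    have "cs (G k) = chart_coord n i j e"
      unfolding chart_coord_chart_index[OF ch ij(3)] using cs_G[OF xk(2)] x xk(3) by simp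
    then have "chart_incl n i j I J (chart_coord n i j e) = G k"
      by (rule chart_incl_eq[OF lpolys_below[OF G_lpolys[OF xk(2)]]])
    then have "fiber_coord n i j I J e = Zv (G k)"
      by (simp add: fiber_coord_def Zv_def set_vars_zero_eq)
    then show ?thesis using Zv_below[OF G_lpolys[OF xk(2)]] gnorm_Zv_G[OF xk(2)] x xk(3) by simp
  qed
  then show "(fiber_coord n i j I J e :: 'k lpoly) \<in> lpolys (I - J) W"
    "gnorm \<rho> (fiber_coord n i j I J e :: 'k lpoly) = \<rho> e" by auto
qed

end

section \<open>Paths in trees\<close>

lemma path_edges_singleton [simp]: "path_edges [v] = {}"
  by (simp add: path_edges_def)

lemma path_edges_Cons:
  assumes "p \<noteq> []" shows "path_edges (v # p) = insert {v, hd p} (path_edges p)"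
proof (intro equalityI subsetI)
  fix e assume "e \<in> path_edges (v # p)"
  then obtain k where k: "e = {(v # p) ! k, (v # p) ! Suc k}" "Suc k < length (v # p)"
    by (auto simp: path_edges_def)
  then show "e \<in> insert {v, hd p} (path_edges p)"
    using assms by (cases k) (auto simp: path_edges_def hd_conv_nth)
next
  fix e assume "e \<in> insert {v, hd p} (path_edges p)"
  then consider "e = {v, hd p}" | k where "e = {p ! k, p ! Suc k}" "Suc k < length p"
    by (auto simp: path_edges_def)
  then show "e \<in> path_edges (v # p)"
  proof cases
    case 1
    then show ?thesis using assms by (auto simp: path_edges_def hd_conv_nth intro!: exI[of _ 0])
  next
    case 2
    then show ?thesis by (auto simp: path_edges_def intro!: exI[of _ "Suc k"])
  qed
qed

lemma path_edges_append:
  "path_edges (p @ v # q) = path_edges (p @ [v]) \<union> path_edges (v # q)"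
proof (induction p)
  case (Cons a p)
  have "hd (p @ v # q) = hd (p @ [v])" by (cases p) auto
  then show ?case using Cons by (simp add: path_edges_Cons)
qed simp

lemma path_edges_snoc: "p \<noteq> [] \<Longrightarrow> path_edges (p @ [v]) = insert {last p, v} (path_edges p)"
proof -
  assume "p \<noteq> []"
  then obtain q x where p: "p = q @ [x]" by (cases p rule: rev_cases) auto
  show ?thesis using path_edges_append[of q x "[v]"] by (simp add: p path_edges_Cons)
qed

lemma path_edges_subset: "e \<in> path_edges p \<Longrightarrow> e \<subseteq> set p"
  by (auto simp: path_edges_def)

lemma path_edges_snoc_meets: "e \<in> path_edges (p @ [v]) \<Longrightarrow> e \<inter> set p \<noteq> {}"
proof (induction p)
  case (Cons a p)
  then show ?case by (auto simp: path_edges_Cons)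
qed simp

lemma path_edges_rev: "path_edges (rev p) = path_edges p"
proof (induction p)
  case (Cons a p)
  show ?case
  proof (cases "p = []")
    case False
    then show ?thesis using Cons by (simp add: path_edges_snoc path_edges_Cons last_rev insert_commute)
  qed simp
qed simp

lemma is_path_appendD:
  assumes "is_path G (p @ v # q)"
  shows "is_path G (p @ [v])" "is_path G (v # q)"
  using assms by (auto simp: is_path_def successively_append_iff)

lemma is_path_edges: "is_path G p \<Longrightarrow> path_edges p \<subseteq> edges G"
proof (induction p)
  case (Cons a p)
  show ?case
  proof (cases "p = []")
    case False
    then have "is_path G p" "{a, hd p} \<in> edges G" using Cons(2) by (auto simp: is_path_def successively_Cons)
    then show ?thesis using Cons False by (simp add: path_edges_Cons)
  qed simp
qed (simp add: path_edges_def)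

lemma is_path_rev: "is_path G (rev p) \<longleftrightarrow> is_path G p"
  by (simp add: is_path_def successively_rev insert_commute)

locale tree =
  fixes G :: "'v graph"
  assumes tree: "is_tree G"
begin

lemma finite_verts: "finite (verts G)"
  using tree by (simp add: is_tree_def)

lemma edge_D: "{a, b} \<in> edges G \<Longrightarrow> a \<in> verts G \<and> b \<in> verts G \<and> a \<noteq> b"
  using tree by (auto simp: is_tree_def doubleton_eq_iff dest!: subsetD)

lemma edgeE:
  assumes "e \<in> edges G" obtains a b where "e = {a, b}" "a \<in> verts G" "b \<in> verts G" "a \<noteq> b"
  using tree assms by (auto simp: is_tree_def dest!: subsetD)

lemma finite_edges: "finite (edges G)"
proof -
  have "edges G \<subseteq> Pow (verts G)" by (auto elim!: edgeE)
  then show ?thesis using finite_verts finite_subset by blast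
qed

text \<open>If \<open>c\<close> is already on the path, the part from \<open>c\<close> on is closed
  up by the new edge. Without cycles it has only two vertices, so \<open>c\<close> is the last but
  one.\<close>

lemma path_snoc_cases:
  assumes p: "is_path G p" and e: "{last p, c} \<in> edges G"
  obtains "c \<notin> set p" "is_path G (p @ [c])" | p1 where "p = p1 @ [c, last p]"
proof (cases "c \<in> set p")
  case False
  then have "is_path G (p @ [c])"
    using p edge_D[OF e] e by (auto simp: is_path_def successively_append_iff)
  then show ?thesis using that(1) False by blast
next
  case True
  then obtain p1 p2 where sp: "p = p1 @ c # p2" by (meson split_list)
  have ne: "p2 \<noteq> []" using sp edge_D[OF e] by auto
  have cyc: "is_path G (c # p2)" using is_path_appendD(2) p sp by metis
  have "\<not> 3 \<le> length (c # p2)"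
  proof
    assume "3 \<le> length (c # p2)"
    moreover have "{last (c # p2), hd (c # p2)} \<in> edges G" using e sp ne by simp
    ultimately show False using tree cyc unfolding is_tree_def by blast
  qed
  then have "length p2 < 2" by simp
  moreover have "0 < length p2" using ne by simp
  ultimately have "length p2 = Suc 0" by linarith
  then have "p2 = [last p]" using sp by (auto simp: length_Suc_conv)
  then show ?thesis using that(2) sp by metis
qed

text \<open>Extend \<open>q\<close> by the last but one vertex of the first path. If this is a path,
  induction identifies it with \<open>p\<close>, which then contains \<open>b\<close>, a
  contradiction; otherwise \<open>q\<close> itself ends with the same edge, and induction applies to
  the rest.\<close>

lemma path_unique:
  "is_path G p \<Longrightarrow> is_path G q \<Longrightarrow> hd p = hd q \<Longrightarrow> last p = last q \<Longrightarrow> p = q"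
proof (induction p arbitrary: q rule: rev_induct)
  case Nil
  then show ?case by (simp add: is_path_def)
next
  case (snoc b p)
  show ?case
  proof (cases "p = []")
    case True
    then have "hd q = last q" "distinct q" "q \<noteq> []" using snoc by (auto simp: is_path_def)
    then obtain q' where q': "q = b # q'" using snoc(5) by (cases q) auto
    have "q' = []"
    proof (rule ccontr)
      assume "q' \<noteq> []"
      then have "b \<in> set q'" using q' snoc(5) last_in_set[of q'] by simp
      then show False using \<open>distinct q\<close> q' by simp
    qed
    then have "q = [b]" using q' by simp
    then show ?thesis using True by simp
  next
    case False
    have p: "is_path G p" "{last p, b} \<in> edges G" "b \<notin> set p"
      using snoc(2) False by (auto simp: is_path_def successively_append_iff)
    have e: "{last q, last p} \<in> edges G" using p(2) snoc(5) by (simp add: insert_commute)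
    have qne: "q \<noteq> []" using snoc(3) by (simp add: is_path_def)
    from snoc(3) e show ?thesis
    proof (cases rule: path_snoc_cases)
      case 1
      then have "p = q @ [last p]" using snoc(1)[OF p(1) 1(2)] snoc(4) False qne by simp
      then have "last q \<in> set p" using qne by (metis Un_iff last_in_set set_append)
      then show ?thesis using p(3) snoc(5) by simp
    next
      case (2 q1)
      have "is_path G (q1 @ [last p])" using is_path_appendD(1)[of G q1 "last p" "[last q]"] 2 snoc(3) by simp
      moreover have "hd p = hd (q1 @ [last p])" using snoc(4) 2 False by (metis append_Cons append_assoc hd_append2 hd_append list.sel(1) self_append_conv2)
      ultimately have "p = q1 @ [last p]" using snoc(1)[OF p(1)] by simp
      then show ?thesis using 2 snoc(5) by (metis append_Cons append_assoc append_Nil last_snoc)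
    qed
  qed
qed

abbreviation "tp \<equiv> tree_path G"
abbreviation "E a b \<equiv> path_edges (tp a b)"

lemma tp_eq: "is_path G p \<Longrightarrow> hd p = a \<Longrightarrow> last p = b \<Longrightarrow> tp a b = p"
  unfolding tree_path_def by (rule the_equality) (auto intro: path_unique)

lemma tp:
  assumes "a \<in> verts G" "b \<in> verts G"
  shows "is_path G (tp a b)" "hd (tp a b) = a" "last (tp a b) = b"
proof -
  have "\<forall>a\<in>verts G. \<forall>b\<in>verts G. \<exists>p. is_path G p \<and> hd p = a \<and> last p = b"
    using tree by (simp add: is_tree_def)
  then obtain p where p: "is_path G p" "hd p = a" "last p = b" using assms by blast
  then show "is_path G (tp a b)" "hd (tp a b) = a" "last (tp a b) = b" using tp_eq[OF p] by auto
qed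

lemma tp_ne: "a \<in> verts G \<Longrightarrow> b \<in> verts G \<Longrightarrow> tp a b \<noteq> []"
  using tp(1) by (auto simp: is_path_def)

lemma tp_verts: "a \<in> verts G \<Longrightarrow> b \<in> verts G \<Longrightarrow> set (tp a b) \<subseteq> verts G"
  using tp(1) by (auto simp: is_path_def)

lemma tp_ends: "a \<in> verts G \<Longrightarrow> b \<in> verts G \<Longrightarrow> a \<in> set (tp a b) \<and> b \<in> set (tp a b)"
  using tp(2,3) tp_ne by (metis hd_in_set last_in_set)

lemma E_self: "a \<in> verts G \<Longrightarrow> E a a = {}"
  using tp_eq[of "[a]" a a] by (simp add: is_path_def)

lemma E_sub: "a \<in> verts G \<Longrightarrow> b \<in> verts G \<Longrightarrow> E a b \<subseteq> edges G"
  using is_path_edges tp(1) by blast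

lemma tp_sym:
  assumes "a \<in> verts G" "b \<in> verts G" shows "tp b a = rev (tp a b)"
  using tp[OF assms] tp_ne[OF assms] by (intro tp_eq) (auto simp: is_path_rev hd_rev last_rev)

lemma E_sym:
  assumes "a \<in> verts G" "b \<in> verts G" shows "E b a = E a b"
  unfolding tp_sym[OF assms] by (rule path_edges_rev)

lemma tp_split:
  assumes "a \<in> verts G" "b \<in> verts G" "tp a b = p @ v # q"
  shows "tp a v = p @ [v]" "tp v b = v # q"
proof -
  have path: "is_path G (p @ v # q)" using tp[OF assms(1,2)] assms(3) by simp
  have "hd (p @ [v]) = a" using tp(2)[OF assms(1,2)] assms(3) by (cases p) auto
  then show "tp a v = p @ [v]" using is_path_appendD(1)[OF path] by (intro tp_eq) auto
  have "last (v # q) = b" using tp(3)[OF assms(1,2)] assms(3) by simp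
  then show "tp v b = v # q" using is_path_appendD(2)[OF path] by (intro tp_eq) auto
qed

text \<open>The path either continues along the edge or retraces its last edge; both toggle exactly
  that edge.\<close>

lemma E_step:
  assumes a: "a \<in> verts G" and bc: "{b, c} \<in> edges G"
  shows "e \<in> E a c \<longleftrightarrow> (e \<in> E a b) \<noteq> (e = {b, c})"
proof -
  have v: "b \<in> verts G" "c \<in> verts G" using edge_D[OF bc] by auto
  note t = tp[OF a v(1)] tp_ne[OF a v(1)]
  have "{last (tp a b), c} \<in> edges G" using t bc by simp
  with t(1) show ?thesis
  proof (cases rule: path_snoc_cases)
    case 1
    then have "tp a c = tp a b @ [c]" using t by (intro tp_eq) auto
    then have "E a c = insert {b, c} (E a b)" using t by (simp add: path_edges_snoc)
    moreover have "{b, c} \<notin> E a b" using 1 path_edges_subset by fastforce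
    ultimately show ?thesis by auto
  next
    case (2 p1)
    then have eq: "tp a b = p1 @ c # [b]" using t by simp
    then have ac: "tp a c = p1 @ [c]" using tp_split[OF a v(1)] by blast
    have "E a b = insert {b, c} (E a c)" unfolding eq ac path_edges_append[of p1 c "[b]"]
      by (simp add: path_edges_Cons insert_commute)
    moreover have "b \<notin> set (p1 @ [c])" using t(1) unfolding eq by (auto simp: is_path_def)
    then have "{b, c} \<notin> E a c" unfolding ac using path_edges_subset by fastforce
    ultimately show ?thesis by auto
  qed
qed

text \<open>Removing an edge \<open>e\<close> divides the vertices into the two fibers of \<open>s\<close>.\<close>

lemma sides:
  "\<exists>s :: 'v \<Rightarrow> bool. \<forall>a\<in>verts G. \<forall>b\<in>verts G. e \<in> E a b \<longleftrightarrow> s a \<noteq> s b"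
proof -
  obtain r where r: "r \<in> verts G" using tree by (auto simp: is_tree_def)
  define s where "s a = (e \<in> E r a)" for a
  have *: "is_path G p \<Longrightarrow> e \<in> E (hd p) (last p) \<longleftrightarrow> s (hd p) \<noteq> s (last p)" for p
  proof (induction p rule: rev_induct)
    case Nil
    then show ?case by (simp add: is_path_def)
  next
    case (snoc b p)
    show ?case
    proof (cases "p = []")
      case True
      then show ?thesis using snoc(2) by (simp add: E_self is_path_def)
    next
      case False
      have p: "is_path G p" "{last p, b} \<in> edges G"
        using snoc(2) False by (auto simp: is_path_def successively_append_iff)
      have "hd p \<in> verts G" using p(1) False by (auto simp: is_path_def)
      then show ?thesis
        using E_step[OF _ p(2), of "hd p" e] E_step[OF r p(2), of e] snoc(1)[OF p(1)] False
        by (auto simp: s_def)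
    qed
  qed
  show ?thesis
  proof (intro exI[of _ s] ballI)
    fix a b assume "a \<in> verts G" "b \<in> verts G"
    then show "e \<in> E a b \<longleftrightarrow> s a \<noteq> s b" using *[of "tp a b"] tp[of a b] by simp
  qed
qed

text \<open>Through \<open>sides\<close>, inclusions between edge sets of paths become propositional
  facts about the sides of the vertices. The same device is used repeatedly below.\<close>

lemma E_triangle:
  assumes "a \<in> verts G" "b \<in> verts G" "c \<in> verts G" shows "E a c \<subseteq> E a b \<union> E b c"
proof
  fix e assume "e \<in> E a c"
  from sides[of e] obtain s :: "'v \<Rightarrow> bool" where "\<forall>a\<in>verts G. \<forall>b\<in>verts G. e \<in> E a b \<longleftrightarrow> s a \<noteq> s b" ..
  note s = this[rule_format]
  from \<open>e \<in> E a c\<close> show "e \<in> E a b \<union> E b c"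
    unfolding Un_iff s[OF assms(1,2)] s[OF assms(2,3)] s[OF assms(1,3)] by blast
qed

lemma E_on_path:
  assumes "a \<in> verts G" "b \<in> verts G" "v \<in> set (tp a b)"
  shows "E a b = E a v \<union> E v b" "E a v \<inter> E v b = {}"
proof -
  obtain p q where pq: "tp a b = p @ v # q" using assms(3) by (meson split_list)
  show "E a b = E a v \<union> E v b"
    unfolding tp_split[OF assms(1,2) pq] pq by (rule path_edges_append)
  have v: "v \<in> verts G" using tp_verts assms by blast
  show "E a v \<inter> E v b = {}"
  proof (rule equals0I)
    fix e assume e: "e \<in> E a v \<inter> E v b"
    then have "e \<in> E a b" using \<open>E a b = E a v \<union> E v b\<close> by blast
    from sides[of e] obtain s :: "'v \<Rightarrow> bool" where "\<forall>a\<in>verts G. \<forall>b\<in>verts G. e \<in> E a b \<longleftrightarrow> s a \<noteq> s b" ..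
    note s = this[rule_format]
    show False using e \<open>e \<in> E a b\<close>
      unfolding Int_iff s[OF assms(1) v] s[OF v assms(2)] s[OF assms(1,2)] by blast
  qed
qed

lemma E_ne:
  assumes "a \<in> verts G" "b \<in> verts G" "a \<noteq> b" shows "E a b \<noteq> {}"
proof -
  obtain p where "tp a b = a # p" using tp[OF assms(1,2)] tp_ne[OF assms(1,2)] by (metis list.collapse)
  moreover have "p \<noteq> []" using tp(3)[OF assms(1,2)] assms(3) calculation by auto
  ultimately show ?thesis by (simp add: path_edges_Cons)
qed

lemma first_on_path:
  assumes "l \<in> verts G" "i \<in> verts G" "i \<in> S"
  obtains q1 v q2 where "tp l i = q1 @ v # q2" "v \<in> S" "set q1 \<inter> S = {}" "tp l v = q1 @ [v]"
    "hd (filter (\<lambda>v. v \<in> S) (tp l i)) = v"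
proof -
  have "\<exists>x\<in>set (tp l i). x \<in> S" using tp_ends assms by blast
  then obtain q1 v q2 where q: "tp l i = q1 @ v # q2" "v \<in> S" "\<forall>y\<in>set q1. y \<notin> S"
    using split_list_first_prop[of "tp l i" "\<lambda>x. x \<in> S"] by blast
  moreover have "filter (\<lambda>v. v \<in> S) q1 = []" using q(3) by (simp add: filter_empty_conv)
  ultimately show ?thesis using that[of q1 v q2] tp_split(1)[OF assms(1,2)] by auto
qed

section \<open>Leaves and distances\<close>

lemma leaf_D: "z \<in> leaves G \<Longrightarrow> z \<in> verts G"
  by (simp add: leaves_def)

lemma leaf_edge_unique:
  assumes "z \<in> leaves G" "e \<in> edges G" "e' \<in> edges G" "z \<in> e" "z \<in> e'" shows "e = e'"
proof -
  have "card {e \<in> edges G. z \<in> e} = 1" using assms(1) by (simp add: leaves_def vdegree_def)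
  then obtain e0 where "{e \<in> edges G. z \<in> e} = {e0}" by (auto simp: card_1_singleton_iff)
  moreover have "e \<in> {e \<in> edges G. z \<in> e}" "e' \<in> {e \<in> edges G. z \<in> e}" using assms by auto
  ultimately show ?thesis by simp
qed

lemma leaf_neighbour_unique:
  assumes "z \<in> leaves G" "{z, b} \<in> edges G" "{z, c} \<in> edges G" shows "b = c"
  using leaf_edge_unique[OF assms(1-3)] by (auto simp: doubleton_eq_iff)

lemma path_inner_neighbours:
  assumes "is_path G (p @ z # q)" "p \<noteq> []" "q \<noteq> []"
  shows "{last p, z} \<in> edges G" "{z, hd q} \<in> edges G" "last p \<noteq> hd q"
proof -
  show "{last p, z} \<in> edges G" "{z, hd q} \<in> edges G"
    using assms by (auto simp: is_path_def successively_append_iff successively_Cons)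
  have "last p \<in> set p" "hd q \<in> set q" using assms by auto
  then show "last p \<noteq> hd q" using assms(1) by (auto simp: is_path_def)
qed

lemma leaf_not_inner:
  assumes "is_path G (p @ z # q)" "z \<in> leaves G" shows "p = [] \<or> q = []"
  using path_inner_neighbours[OF assms(1)] leaf_neighbour_unique[OF assms(2), of "last p" "hd q"]
  by (auto simp: insert_commute)

lemma leaf_edge_separates:
  assumes z: "z \<in> leaves G" and e: "e \<in> edges G" "z \<in> e" and ab: "a \<in> verts G" "b \<in> verts G"
  shows "e \<in> E a b \<longleftrightarrow> (a = z) \<noteq> (b = z)"
proof -
  have zv: "z \<in> verts G" using leaf_D[OF z] .
  have sep: "e \<in> E z b" if "b \<in> verts G" "b \<noteq> z" for b
  proof -
    note t = tp[OF zv that(1)] tp_ne[OF zv that(1)]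
    obtain p where p: "tp z b = z # p" using t by (metis list.collapse)
    have pne: "p \<noteq> []" using p t(3) that(2) by auto
    then have "{z, hd p} \<in> E z b" by (simp add: p path_edges_Cons)
    moreover have "{z, hd p} = e" using leaf_edge_unique[OF z _ e(1) _ e(2)] calculation E_sub[OF zv that(1)] by blast
    ultimately show ?thesis by simp
  qed
  from sides[of e] obtain s :: "'v \<Rightarrow> bool" where "\<forall>a\<in>verts G. \<forall>b\<in>verts G. e \<in> E a b \<longleftrightarrow> s a \<noteq> s b" ..
  note s = this[rule_format]
  show ?thesis using sep[OF ab(1)] sep[OF ab(2)] s[OF zv ab(1)] s[OF zv ab(2)] s[OF ab] by auto
qed

definition dst :: "('v set \<Rightarrow> real) \<Rightarrow> 'v \<Rightarrow> 'v \<Rightarrow> real" where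
  "dst \<omega> a b = (\<Sum>e\<in>E a b. \<omega> e)"

lemma dst_eq:
  assumes "a \<in> verts G" "b \<in> verts G"
  shows "dst \<omega> a b = (\<Sum>e\<in>edges G. if e \<in> E a b then \<omega> e else 0)"
proof -
  have "E a b = edges G \<inter> E a b" using E_sub[OF assms] by blast
  then show ?thesis unfolding dst_def using sum.inter_restrict[OF finite_edges, of \<omega> "E a b"] by simp
qed

text \<open>Compare the contributions edge by edge. By disjointness no edge separates both pairs.
  The inequality is strict only at edges between \<open>{a, b}\<close> and \<open>{c, d}\<close>; an
  edge at a leaf cuts off a single vertex, so these are inner and have nonnegative weight.\<close>

lemma four_point:
  assumes v: "a \<in> verts G" "b \<in> verts G" "c \<in> verts G" "d \<in> verts G" and ne: "a \<noteq> b" "c \<noteq> d"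
    and disj: "E a b \<inter> E c d = {}" and \<omega>: "\<And>e. e \<in> inner_edges G \<Longrightarrow> 0 \<le> \<omega> e"
  shows "dst \<omega> a c + dst \<omega> b d = dst \<omega> a d + dst \<omega> b c" "dst \<omega> a b + dst \<omega> c d \<le> dst \<omega> a c + dst \<omega> b d"
proof -
  let ?t = "\<lambda>a b e. if e \<in> E a b then \<omega> e else 0"
  have "?t a c e + ?t b d e = ?t a d e + ?t b c e \<and> ?t a b e + ?t c d e \<le> ?t a c e + ?t b d e"
    if e: "e \<in> edges G" for e
  proof -
    from sides[of e] obtain s :: "'v \<Rightarrow> bool" where "\<forall>a\<in>verts G. \<forall>b\<in>verts G. e \<in> E a b \<longleftrightarrow> s a \<noteq> s b" ..
    note s = this[rule_format]
    have n: "\<not> (s a \<noteq> s b \<and> s c \<noteq> s d)" using disj s v by blast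
    have "0 \<le> \<omega> e" if "s a = s b" "s c = s d" "s a \<noteq> s c"
    proof (rule \<omega>)
      have "e \<inter> leaves G = {}"
      proof (rule equals0I)
        fix z assume z: "z \<in> e \<inter> leaves G"
        have L: "e \<in> E x y \<longleftrightarrow> (x = z) \<noteq> (y = z)" if "x \<in> verts G" "y \<in> verts G" for x y
          using leaf_edge_separates[of z e x y] z e that by blast
        show False using L[OF v(1,2)] L[OF v(3,4)] L[OF v(1,3)] s[OF v(1,2)] s[OF v(3,4)] s[OF v(1,3)] that ne by auto
      qed
      then show "e \<in> inner_edges G" using e by (simp add: inner_edges_def)
    qed
    then show ?thesis using n s v by auto
  qed
  then have *: "\<And>e. e \<in> edges G \<Longrightarrow> ?t a c e + ?t b d e = ?t a d e + ?t b c e"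
      "\<And>e. e \<in> edges G \<Longrightarrow> ?t a b e + ?t c d e \<le> ?t a c e + ?t b d e" by blast+
  show "dst \<omega> a c + dst \<omega> b d = dst \<omega> a d + dst \<omega> b c"
    unfolding dst_eq[OF v(1,3)] dst_eq[OF v(2,4)] dst_eq[OF v(1,4)] dst_eq[OF v(2,3)] sum.distrib[symmetric]
    by (rule sum.cong[OF refl *(1)])
  show "dst \<omega> a b + dst \<omega> c d \<le> dst \<omega> a c + dst \<omega> b d"
    unfolding dst_eq[OF v(1,3)] dst_eq[OF v(2,4)] dst_eq[OF v(1,2)] dst_eq[OF v(3,4)] sum.distrib[symmetric]
    by (rule sum_mono[OF *(2)])
qed

section \<open>Branches and cherries\<close>

context
  fixes i j assumes i: "i \<in> leaves G" and j: "j \<in> leaves G" and ij: "i \<noteq> j"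
begin

definition att :: "'v \<Rightarrow> 'v" where
  "att l = hd (filter (\<lambda>v. v \<in> set (tp i j)) (tp l i))"

lemma ijv: "i \<in> verts G" "j \<in> verts G"
  using i j leaf_D by auto

text \<open>The path from \<open>l\<close> cannot first meet the \<open>i\<close>-\<open>j\<close>
  path at \<open>i\<close>, whose only neighbour already lies on that path, nor at \<open>j\<close>,
  which as a leaf is no inner vertex of the path from \<open>l\<close> to \<open>i\<close>.\<close>

lemma att_facts:
  assumes l: "l \<in> leaves G" "l \<noteq> i" "l \<noteq> j"
  shows "att l \<in> set (tp i j)" "E l (att l) \<inter> E i j = {}" "att l \<noteq> i" "att l \<noteq> j"
proof -
  have lv: "l \<in> verts G" using leaf_D[OF l(1)] .
  have ii: "i \<in> set (tp i j)" using tp_ends ijv by blast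
  obtain q1 v q2 where q: "tp l i = q1 @ v # q2" "v \<in> set (tp i j)" "set q1 \<inter> set (tp i j) = {}" "tp l v = q1 @ [v]"
      "att l = v"
    using first_on_path[OF lv ijv(1) ii] unfolding att_def by metis
  show "att l \<in> set (tp i j)" using q by simp
  show "E l (att l) \<inter> E i j = {}"
  proof (rule equals0I)
    fix e assume e: "e \<in> E l (att l) \<inter> E i j"
    then have "e \<inter> set q1 \<noteq> {}" using path_edges_snoc_meets[of e q1 v] q by simp
    moreover have "e \<subseteq> set (tp i j)" using e path_edges_subset by blast
    ultimately show False using q(3) by blast
  qed
  have path: "is_path G (q1 @ v # q2)" using tp(1)[OF lv ijv(1)] q(1) by simp
  have q1: "q1 \<noteq> []" if "v \<noteq> l" using tp(2)[OF lv ijv(1)] q(1) that by auto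
  show "att l \<noteq> i"
  proof
    assume "att l = i"
    then have v: "v = i" using q by simp
    then have ne: "q1 \<noteq> []" using q1 l by simp
    have 1: "{i, last q1} \<in> edges G"
      using path ne v by (auto simp: is_path_def successively_append_iff insert_commute)
    obtain p where p: "tp i j = i # p" using tp(2)[OF ijv] tp_ne[OF ijv] by (metis list.collapse)
    have pne: "p \<noteq> []" using p tp(3)[OF ijv] ij by auto
    then have "{i, hd p} \<in> edges G" using tp(1)[OF ijv] p by (auto simp: is_path_def successively_Cons)
    then have "last q1 = hd p" using leaf_neighbour_unique[OF i 1] by simp
    then have "last q1 \<in> set (tp i j)" using p pne by simp
    then show False using q(3) ne by (meson disjoint_iff last_in_set)
  qed
  show "att l \<noteq> j"
  proof
    assume "att l = j"
    then have v: "v = j" using q by simp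
    have "q2 \<noteq> []" using tp(3)[OF lv ijv(1)] q(1) v ij by auto
    moreover have "q1 \<noteq> []" using q1 v l by simp
    ultimately show False using leaf_not_inner[OF path] v j by simp
  qed
qed

lemma same_branch_disjoint:
  assumes r: "r \<in> leaves G" "r \<noteq> i" "r \<noteq> j" and s: "s \<in> leaves G" "s \<noteq> i" "s \<noteq> j" and "att r = att s"
  shows "E r s \<inter> E i j = {}"
proof -
  have v: "r \<in> verts G" "s \<in> verts G" "att r \<in> verts G"
    using leaf_D r s att_facts(1)[OF r] tp_verts[OF ijv] by auto
  have "E r s \<subseteq> E r (att r) \<union> E (att r) s" by (rule E_triangle[OF v(1,3,2)])
  also have "E (att r) s = E s (att s)" using E_sym[OF v(2,3)] assms(7) by simp
  finally show ?thesis using att_facts(2)[OF r] att_facts(2)[OF s] by blast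
qed

text \<open>If the attaching vertex of \<open>r\<close> comes first, the path to \<open>r\<close>
  leaves the \<open>i\<close>-\<open>j\<close> path before the path from \<open>j\<close> to
  \<open>s\<close> reaches that point.\<close>

lemma diff_branch_disjoint_aux:
  assumes r: "r \<in> leaves G" "r \<noteq> i" "r \<noteq> j" and s: "s \<in> leaves G" "s \<noteq> i" "s \<noteq> j" and ne: "att r \<noteq> att s"
    and before: "att s \<in> set (tp (att r) j)"
  shows "E i r \<inter> E j s = {}"
proof -
  let ?v = "att r" and ?w = "att s"
  have v: "r \<in> verts G" "s \<in> verts G" "?v \<in> verts G" "?w \<in> verts G"
    using leaf_D r s att_facts(1)[OF r] att_facts(1)[OF s] tp_verts[OF ijv] by auto
  note vp = E_on_path[OF ijv att_facts(1)[OF r]] and wp = E_on_path[OF ijv att_facts(1)[OF s]]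
    and bp = E_on_path[OF v(3) ijv(2) before]
  have 1: "E i r \<subseteq> E i ?v \<union> E r ?v" using E_triangle[OF ijv(1) v(3,1)] E_sym[OF v(1,3)] by simp
  have 2: "E j s \<subseteq> E ?w j \<union> E s ?w"
    using E_triangle[OF ijv(2) v(4,2)] E_sym[OF v(2,4)] E_sym[OF v(4) ijv(2)] by simp
  have 3: "E i ?v \<inter> E ?w j = {}" using vp(2) bp(1) by blast
  have 4: "E i ?v \<inter> E s ?w = {}" using vp(1) att_facts(2)[OF s] by blast
  have 5: "E r ?v \<inter> E ?w j = {}" using wp(1) att_facts(2)[OF r] by blast
  \<comment> \<open>A vertex \<open>y\<close> of a common edge would connect the two attaching
    vertices by edges off the \<open>i\<close>-\<open>j\<close> path, whereas the edges between them
    lie on it.\<close>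
  have 6: "E r ?v \<inter> E s ?w = {}"
  proof (rule equals0I)
    fix e assume e: "e \<in> E r ?v \<inter> E s ?w"
    have "e \<in> edges G" using e E_sub[OF v(1,3)] by blast
    then obtain y where y: "y \<in> e" "y \<in> verts G" by (auto elim!: edgeE)
    have yp: "y \<in> set (tp r ?v)" "y \<in> set (tp s ?w)" using e y path_edges_subset by blast+
    obtain e0 where e0: "e0 \<in> E ?v ?w" using E_ne[OF v(3,4) ne] by blast
    then have "e0 \<in> E i j" using bp(1) vp(1) by blast
    then have "e0 \<notin> E r ?v" "e0 \<notin> E s ?w" using att_facts(2)[OF r] att_facts(2)[OF s] by blast+
    then have "e0 \<notin> E y ?v" "e0 \<notin> E y ?w" using E_on_path(1)[OF v(1,3) yp(1)] E_on_path(1)[OF v(2,4) yp(2)] by blast+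
    then show False using E_triangle[OF v(3) y(2) v(4)] E_sym[OF y(2) v(3)] e0 by blast
  qed
  show ?thesis using 1 2 3 4 5 6 by blast
qed

lemma diff_branch_disjoint:
  assumes r: "r \<in> leaves G" "r \<noteq> i" "r \<noteq> j" and s: "s \<in> leaves G" "s \<noteq> i" "s \<noteq> j" and ne: "att r \<noteq> att s"
  shows "E i r \<inter> E j s = {} \<or> E i s \<inter> E j r = {}"
proof -
  obtain p q where pq: "tp i j = p @ att r # q" using att_facts(1)[OF r] by (meson split_list)
  note t = tp_split[OF ijv pq]
  have "att s \<in> set p \<or> att s \<in> set q" using att_facts(1)[OF s] pq ne by auto
  then show ?thesis
  proof
    assume "att s \<in> set q"
    then show ?thesis using diff_branch_disjoint_aux[OF r s ne] t by simp
  next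
    assume "att s \<in> set p"
    then obtain p1 p2 where p: "p = p1 @ att s # p2" by (meson split_list)
    then have "tp i j = p1 @ att s # (p2 @ att r # q)" using pq by simp
    from tp_split(2)[OF ijv this] have "att r \<in> set (tp (att s) j)" by simp
    then show ?thesis using diff_branch_disjoint_aux[OF s r] ne by simp
  qed
qed

end

text \<open>A third edge would leave an inner vertex of a path between suppressed vertices.\<close>

lemma suppressed_edge_separates:
  assumes k: "k \<in> leaves G" and a: "a \<in> leaves G" "a \<noteq> k" and S: "S = spanned_subtree G L" "L \<subseteq> leaves G"
    and kaL: "k \<in> L" "a \<in> L" and w: "{k, w} \<in> edges (suppress_deg2 S)" and e: "e \<in> E k w"
  shows "e \<in> E k a"
proof (rule ccontr)
  assume eka: "e \<notin> E k a"
  have LV: "L \<subseteq> verts G" using S(2) leaf_D by blast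
  have Se: "edges S \<subseteq> edges G" unfolding S(1) spanned_subtree_def using E_sub LV by fastforce
  have Sv: "verts S \<subseteq> verts G" unfolding S(1) spanned_subtree_def using tp_verts LV by fastforce
  obtain p' where p': "is_path S p'" "{k, w} = {hd p', last p'}" "2 \<le> length p'"
      "\<forall>v\<in>set p' - {hd p', last p'}. vdegree S v = 2"
    using w by (auto simp: suppress_deg2_def)
  have "\<exists>p. is_path S p \<and> hd p = k \<and> last p = w \<and> 2 \<le> length p \<and> (\<forall>v\<in>set p - {k, w}. vdegree S v = 2)"
  proof (cases "hd p' = k")
    case True
    then have "last p' = w" using p'(2) by (auto simp: doubleton_eq_iff)
    then show ?thesis using p' True by blast
  next
    case False
    then have "hd p' = w" "last p' = k" using p'(2) by (auto simp: doubleton_eq_iff)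
    moreover have "p' \<noteq> []" using p'(3) by auto
    ultimately show ?thesis using p'
      by (intro exI[of _ "rev p'"]) (auto simp: is_path_rev hd_rev last_rev)
  qed
  then obtain p where p: "is_path S p" "hd p = k" "last p = w" "2 \<le> length p" "\<And>v. v \<in> set p \<Longrightarrow> v \<noteq> k \<Longrightarrow> v \<noteq> w \<Longrightarrow> vdegree S v = 2"
    by blast
  have pG: "is_path G p" using p(1) Se Sv by (auto simp: is_path_def elim!: successively_mono)
  then have tpp: "tp k w = p" using p by (intro tp_eq) auto
  have pne: "p \<noteq> []" using p(4) by auto
  have kv: "k \<in> verts G" "a \<in> verts G" using k a leaf_D by auto
  have kp: "k \<in> set p" using p(2) pne hd_in_set by blast
  have wv: "w \<in> verts G" using pG p(3) pne last_in_set by (auto simp: is_path_def)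
  \<comment> \<open>\<open>b\<close> is where the path from \<open>a\<close> first meets
    \<open>p\<close>. It is not \<open>k\<close>, which has only one neighbour, and not
    \<open>w\<close>, since then all of \<open>p\<close> and with it \<open>e\<close> would lie on
    the path between \<open>a\<close> and \<open>k\<close>.\<close>
  obtain q1 b q2 where q: "tp a k = q1 @ b # q2" "b \<in> set p" "set q1 \<inter> set p = {}"
    using first_on_path[OF kv(2,1) kp] by metis
  have qpath: "is_path G (q1 @ b # q2)" using tp(1)[OF kv(2,1)] q(1) by simp
  obtain p1 p2 where ps: "p = p1 @ b # p2" using q(2) by (meson split_list)
  have bk: "b \<noteq> k"
  proof
    assume b: "b = k"
    then have "q1 \<noteq> []" using q(1) tp(2)[OF kv(2,1)] a(2) by auto
    then have 1: "{k, last q1} \<in> edges G" "last q1 \<in> set q1"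
      using qpath b by (auto simp: is_path_def successively_append_iff insert_commute)
    obtain p3 where p3: "p = k # p3" using p(2) pne by (metis list.collapse)
    then have p3ne: "p3 \<noteq> []" using p(4) by auto
    then have "hd p3 \<in> set p" by (simp add: p3)
    moreover have "{k, hd p3} \<in> edges G"
      using is_path_edges[OF pG] path_edges_Cons[OF p3ne, of k] by (simp add: p3)
    ultimately have "last q1 \<in> set p" using leaf_neighbour_unique[OF k 1(1), of "hd p3"] by simp
    then show False using 1(2) q(3) by (meson disjoint_iff)
  qed
  have bw: "b \<noteq> w"
  proof
    assume "b = w"
    then have "w \<in> set (tp a k)" using q(1) by simp
    then have "E w k \<subseteq> E a k" using E_on_path(1)[OF kv(2,1)] by blast
    then show False using e eka E_sym[OF kv(1) wv] E_sym[OF kv] by blast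
  qed
  have ne: "p1 \<noteq> []" "p2 \<noteq> []" using ps bk bw p(2,3) by auto
  have q1ne: "q1 \<noteq> []"
  proof
    assume "q1 = []"
    then have "b = a" using q(1) tp(2)[OF kv(2,1)] by simp
    then show False using leaf_not_inner[of p1 b p2] pG ps ne a(1) by simp
  qed
  have inS: "path_edges p \<subseteq> edges S" by (rule is_path_edges[OF p(1)])
  have "path_edges p = path_edges (p1 @ [b]) \<union> path_edges (b # p2)"
    unfolding ps by (rule path_edges_append)
  then have "{last p1, b} \<in> path_edges p" "{b, hd p2} \<in> path_edges p"
    using ne by (simp_all add: path_edges_snoc path_edges_Cons)
  moreover have "E a k = path_edges (q1 @ [b]) \<union> path_edges (b # q2)"
    unfolding q(1) by (rule path_edges_append)
  then have "{last q1, b} \<in> E a k" using q1ne by (simp add: path_edges_snoc)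
  then have "{last q1, b} \<in> edges S" unfolding S(1) spanned_subtree_def using kaL by auto
  ultimately have sub: "{{last p1, b}, {b, hd p2}, {last q1, b}} \<subseteq> {e \<in> edges S. b \<in> e}" using inS by auto
  have "last p1 \<in> set p" "hd p2 \<in> set p" "last q1 \<notin> set p"
    using ne q1ne q(3) by (auto simp: ps disjoint_iff)
  moreover have "last p1 \<noteq> hd p2" using path_inner_neighbours(3)[of p1 b p2] pG ps ne by simp
  ultimately have "card {{last p1, b}, {b, hd p2}, {last q1, b}} = 3"
    using pG ne q1ne q(2) by (auto simp: card_insert_if doubleton_eq_iff)
  moreover have "finite {e \<in> edges S. b \<in> e}" using Se finite_edges by (auto intro: finite_subset)
  ultimately have "3 \<le> vdegree S b" unfolding vdegree_def using card_mono[OF _ sub] by simp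
  then show False using p(5)[OF q(2) bk bw] by simp
qed

text \<open>A common edge has \<open>k\<close>, \<open>l\<close> on different sides and also
  \<open>a\<close>, \<open>c\<close>. It therefore lies between the common neighbour
  \<open>w\<close> and one of \<open>k\<close>, \<open>l\<close>, and so separates that leaf from
  both \<open>a\<close> and \<open>c\<close>, which would put these on the same side.\<close>

lemma cherry_disjoint:
  assumes L: "{a, k, l, c} \<subseteq> leaves G" "distinct [a, k, l, c]"
    and ch: "is_cherry (suppress_deg2 (spanned_subtree G {a, k, l, c})) k l"
  shows "E k l \<inter> E a c = {}"
proof (rule equals0I)
  fix e assume e: "e \<in> E k l \<inter> E a c"
  let ?S = "spanned_subtree G {a, k, l, c}"
  obtain w where w: "{k, w} \<in> edges (suppress_deg2 ?S)" "{l, w} \<in> edges (suppress_deg2 ?S)" "w \<in> verts (suppress_deg2 ?S)"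
    using ch by (auto simp: is_cherry_def)
  have v: "a \<in> verts G" "k \<in> verts G" "l \<in> verts G" "c \<in> verts G" using L(1) leaf_D by auto
  have "w \<in> verts ?S" using w(3) by (simp add: suppress_deg2_def)
  then obtain x y where "x \<in> {a, k, l, c}" "y \<in> {a, k, l, c}" "w \<in> set (tp x y)"
    unfolding spanned_subtree_def graph.select_convs by blast
  then have wv: "w \<in> verts G" using tp_verts v by blast
  from sides[of e] obtain s :: "'v \<Rightarrow> bool" where "\<forall>a\<in>verts G. \<forall>b\<in>verts G. e \<in> E a b \<longleftrightarrow> s a \<noteq> s b" ..
  note s = this[rule_format]
  have sp: "s k \<noteq> s l" "s a \<noteq> s c" using e s v by blast+
  have "e \<in> E k w \<or> e \<in> E l w" using sp s v wv by blast
  then show False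
  proof
    assume "e \<in> E k w"
    then have "e \<in> E k x" if "x \<in> {a, c}" for x
      using suppressed_edge_separates[of k x ?S "{a, k, l, c}" w e] L w that by auto
    then show False using sp s v by blast
  next
    assume "e \<in> E l w"
    then have "e \<in> E l x" if "x \<in> {a, c}" for x
      using suppressed_edge_separates[of l x ?S "{a, k, l, c}" w e] L w that by auto
    then show False using sp s v by blast
  qed
qed

end

section \<open>Tree metrics and their limits\<close>

lemma tp_class_self: "x \<in> tvecs n \<Longrightarrow> x \<in> tp_class n x"
  unfolding tp_class_def tvecs_def by (auto intro!: exI[of _ 0] simp: restrict_PiE_iff)

lemma tp_class_eqE:
  assumes "x \<in> tvecs n" "y \<in> tvecs n" "tp_class n x = tp_class n y"
  obtains t where "\<And>e. e \<in> pairs n \<Longrightarrow> y e = x e + ereal t"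
proof -
  have "y \<in> tp_class n x" using tp_class_self[OF assms(2)] assms(3) by simp
  then obtain t where "y = restrict (\<lambda>e. x e + ereal t) (pairs n)" by (auto simp: tp_class_def)
  then show ?thesis using that[of t] by simp
qed

lemma ereal_shift_le_iff:
  "u + ereal t + (v + ereal t) \<le> w + ereal t + (z + ereal t) \<longleftrightarrow> u + v \<le> w + z"
  by (cases u; cases v; cases w; cases z) auto

text \<open>There are two terms on each side, so the common shift cancels.\<close>

lemma tp_class_le_cong:
  assumes "x \<in> tvecs n" "y \<in> tvecs n" "tp_class n x = tp_class n y"
    and "a \<in> pairs n" "b \<in> pairs n" "c \<in> pairs n" "d \<in> pairs n"
  shows "y a + y b \<le> y c + y d \<longleftrightarrow> x a + x b \<le> x c + x d"
proof -
  obtain t where "\<And>e. e \<in> pairs n \<Longrightarrow> y e = x e + ereal t" using tp_class_eqE[OF assms(1-3)] by metis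
  then show ?thesis using assms(4-7) by (simp add: ereal_shift_le_iff)
qed

lemma openin_tp_top:
  "openin (tp_top n) U \<longleftrightarrow> U \<subseteq> tp_class n ` tvecs n \<and> openin (tvec_top n) {x \<in> tvecs n. tp_class n x \<in> U}"
proof -
  have int: "{x \<in> tvecs n. tp_class n x \<in> U \<inter> V} = {x \<in> tvecs n. tp_class n x \<in> U} \<inter> {x \<in> tvecs n. tp_class n x \<in> V}" for U V
    by auto
  have un: "{x \<in> tvecs n. tp_class n x \<in> \<Union>K} = \<Union>((\<lambda>U. {x \<in> tvecs n. tp_class n x \<in> U}) ` K)" for K
    by auto
  have "istopology (\<lambda>U. U \<subseteq> tp_class n ` tvecs n \<and> openin (tvec_top n) {x \<in> tvecs n. tp_class n x \<in> U})"
    unfolding istopology_def int un by (auto intro!: openin_Int openin_Union)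
  then show ?thesis by (simp add: tp_top_def)
qed

lemma topspace_tvec_top: "topspace (tvec_top n) = tvecs n"
  by (auto simp: tvec_top_def tvecs_def)

text \<open>Addition of extended reals is discontinuous only where opposite infinities meet, and the
  coordinates of vectors in \<open>tvecs n\<close> are never \<open>\<infinity>\<close>.\<close>

lemma continuous_map_coordinate_sum:
  assumes "a \<in> pairs n" "b \<in> pairs n"
  shows "continuous_map (tvec_top n) euclidean (\<lambda>y. y a + y b)"
proof -
  have proj: "continuous_map (tvec_top n) euclidean (\<lambda>y. y e)" if "e \<in> pairs n" for e
  proof -
    have "continuous_map (tvec_top n) (top_of_set {..<\<infinity>}) (\<lambda>y. y e)"
      unfolding tvec_top_def
      by (rule continuous_map_from_subtopology) (rule continuous_map_product_projection[OF that])
    then show ?thesis by (simp add: continuous_map_in_subtopology)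
  qed
  show ?thesis
    unfolding continuous_map_atin limitin_canonical_iff
  proof
    fix y assume y: "y \<in> topspace (tvec_top n)"
    then have "y a \<noteq> \<infinity>" "y b \<noteq> \<infinity>" using assms by (force simp: topspace_tvec_top tvecs_def)+
    moreover have "((\<lambda>y. y e) \<longlongrightarrow> y e) (atin (tvec_top n) y)" if "e \<in> pairs n" for e
      using proj[OF that] y unfolding continuous_map_atin limitin_canonical_iff by blast
    ultimately show "((\<lambda>y. y a + y b) \<longlongrightarrow> y a + y b) (atin (tvec_top n) y)"
      using assms by (intro tendsto_add_ereal_general) auto
  qed
qed

lemma openin_less:
  fixes g h :: "'a \<Rightarrow> ereal"
  assumes g: "continuous_map X euclidean g" and h: "continuous_map X euclidean h"
  shows "openin X {y \<in> topspace X. h y < g y}"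
proof -
  have eq: "{y \<in> topspace X. h y < g y} = (\<Union>m. {y \<in> topspace X. h y \<in> {..<m}} \<inter> {y \<in> topspace X. g y \<in> {m<..}})"
    using dense by fastforce
  have "openin X ({y \<in> topspace X. h y \<in> {..<m}} \<inter> {y \<in> topspace X. g y \<in> {m<..}})" for m
    by (intro openin_Int openin_continuous_map_preimage[OF g] openin_continuous_map_preimage[OF h]) auto
  then show ?thesis unfolding eq by (intro openin_Union) blast
qed

text \<open>The failure of the inequality is an open condition on vectors and is invariant under
  shifts, so it defines an open set of classes. A closure point in it would produce a point of
  \<open>K\<close> violating the inequality.\<close>

lemma closure_le:
  assumes cl: "tp_class n x \<in> tp_top n closure_of K" and x: "x \<in> tvecs n"
    and e: "a \<in> pairs n" "b \<in> pairs n" "c \<in> pairs n" "d \<in> pairs n"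
    and K: "\<And>y. y \<in> tvecs n \<Longrightarrow> tp_class n y \<in> K \<Longrightarrow> y a + y b \<le> y c + y d"
  shows "x a + x b \<le> x c + x d"
proof (rule ccontr)
  assume n: "\<not> x a + x b \<le> x c + x d"
  define Y where "Y = {y \<in> tvecs n. \<not> y a + y b \<le> y c + y d}"
  have "Y = {y \<in> topspace (tvec_top n). y c + y d < y a + y b}"
    by (auto simp: Y_def topspace_tvec_top)
  then have Y: "openin (tvec_top n) Y"
    using openin_less[OF continuous_map_coordinate_sum[OF e(1,2)] continuous_map_coordinate_sum[OF e(3,4)]] by simp
  have "{y \<in> tvecs n. tp_class n y \<in> tp_class n ` Y} = Y"
  proof (intro equalityI subsetI)
    fix y assume "y \<in> {y \<in> tvecs n. tp_class n y \<in> tp_class n ` Y}"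
    then obtain z where z: "y \<in> tvecs n" "z \<in> Y" "tp_class n y = tp_class n z" by auto
    have "y a + y b \<le> y c + y d \<longleftrightarrow> z a + z b \<le> z c + z d"
      by (rule tp_class_le_cong[OF _ z(1) z(3)[symmetric] e]) (use z(2) in \<open>simp add: Y_def\<close>)
    then show "y \<in> Y" using z by (simp add: Y_def)
  qed (auto simp: Y_def)
  then have "openin (tp_top n) (tp_class n ` Y)"
    unfolding openin_tp_top using Y by (auto simp: Y_def)
  moreover have "tp_class n x \<in> tp_class n ` Y" using n x by (auto simp: Y_def)
  moreover have "\<forall>U. tp_class n x \<in> U \<and> openin (tp_top n) U \<longrightarrow> (\<exists>y. y \<in> K \<and> y \<in> U)"
    using cl by (simp add: in_closure_of)
  ultimately obtain y where "y \<in> Y" "tp_class n y \<in> K" by (metis imageE)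
  then show False using K[of y] by (simp add: Y_def)
qed

lemma trop_exp_mono:
  assumes "u + v \<le> w + z" "u < \<infinity>" "v < \<infinity>" "w < \<infinity>" "z < \<infinity>"
  shows "trop_exp (u - ereal t) * trop_exp (v - ereal t) \<le> trop_exp (w - ereal t) * trop_exp (z - ereal t)"
  using assms
  by (cases u; cases v; cases w; cases z) (auto simp: trop_exp_def exp_add[symmetric])

section \<open>Four-point conditions on the closure of the cone of a tree\<close>

locale tree_limit = tree T for T :: "'v graph" +
  fixes n :: nat and lab :: "nat \<Rightarrow> 'v" and x :: "nat set \<Rightarrow> ereal"
  assumes lab: "bij_betw lab {1..n} (leaves T)"
    and x: "x \<in> tvecs n" "tp_class n x \<in> tp_top n closure_of tree_cone n T lab"
begin

lemma lab_leaf: "k \<in> {1..n} \<Longrightarrow> lab k \<in> leaves T"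
  using lab by (auto simp: bij_betw_def)

lemma lab_eq: "k \<in> {1..n} \<Longrightarrow> l \<in> {1..n} \<Longrightarrow> lab k = lab l \<longleftrightarrow> k = l"
  using lab by (auto simp: bij_betw_def dest: inj_onD)

lemma pair: "k \<in> {1..n} \<Longrightarrow> l \<in> {1..n} \<Longrightarrow> k \<noteq> l \<Longrightarrow> {k, l} \<in> pairs n"
  by (auto simp: pairs_def)

lemma cone_le:
  assumes k: "a \<in> {1..n}" "b \<in> {1..n}" "a \<noteq> b" "c \<in> {1..n}" "d \<in> {1..n}" "c \<noteq> d"
      "a' \<in> {1..n}" "b' \<in> {1..n}" "a' \<noteq> b'" "c' \<in> {1..n}" "d' \<in> {1..n}" "c' \<noteq> d'"
    and le: "\<And>\<omega>. (\<And>e. e \<in> inner_edges T \<Longrightarrow> 0 \<le> \<omega> e) \<Longrightarrow>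
      dst \<omega> (lab a) (lab b) + dst \<omega> (lab c) (lab d) \<le> dst \<omega> (lab a') (lab b') + dst \<omega> (lab c') (lab d')"
  shows "x {a, b} + x {c, d} \<le> x {a', b'} + x {c', d'}"
proof (rule closure_le[OF x(2,1)])
  fix y assume y: "y \<in> tvecs n" "tp_class n y \<in> tree_cone n T lab"
  from y(2)[unfolded tree_cone_def mem_Collect_eq]
  obtain z where zz: "tp_class n y = tp_class n z \<and> z \<in> tvecs n \<and>
    (\<exists>\<omega> :: 'v set \<Rightarrow> real. (\<forall>e\<in>inner_edges T. 0 \<le> \<omega> e) \<and> (\<forall>k\<in>{1..n}. \<forall>l\<in>{1..n}. k \<noteq> l \<longrightarrow>
      z {k, l} = ereal (\<Sum>e\<in>path_edges (tree_path T (lab k) (lab l)). \<omega> e)))" ..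
  then have z': "z \<in> tvecs n" "tp_class n y = tp_class n z" by simp_all
  from zz obtain \<omega> :: "'v set \<Rightarrow> real" where \<omega>: "\<forall>e\<in>inner_edges T. 0 \<le> \<omega> e"
      "\<forall>k\<in>{1..n}. \<forall>l\<in>{1..n}. k \<noteq> l \<longrightarrow> z {k, l} = ereal (dst \<omega> (lab k) (lab l))"
    unfolding dst_def by (elim exE conjE)
  note z = z' \<omega>(1) \<omega>(2)[rule_format]
  have "z {a, b} + z {c, d} \<le> z {a', b'} + z {c', d'}"
    using le[of \<omega>] z(3) k by (simp add: z(4))
  then show "y {a, b} + y {c, d} \<le> y {a', b'} + y {c', d'}"
    using tp_class_le_cong[OF z(1) y(1) z(2)[symmetric]] pair k by blast
qed (use pair k in auto)

lemma four_point_limit: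
  assumes k: "a \<in> {1..n}" "b \<in> {1..n}" "c \<in> {1..n}" "d \<in> {1..n}" "distinct [a, b, c, d]"
    and disj: "E (lab a) (lab b) \<inter> E (lab c) (lab d) = {}"
  shows "x {a, c} + x {b, d} = x {a, d} + x {b, c}" "x {a, b} + x {c, d} \<le> x {a, c} + x {b, d}"
proof -
  have v: "lab a \<in> verts T" "lab b \<in> verts T" "lab c \<in> verts T" "lab d \<in> verts T"
    using k lab_leaf leaf_D by auto
  have ne: "lab a \<noteq> lab b" "lab c \<noteq> lab d" using k lab_eq by auto
  show "x {a, b} + x {c, d} \<le> x {a, c} + x {b, d}"
    by (rule cone_le) (use four_point(2)[OF v ne disj] k in auto)
  have "x {a, c} + x {b, d} \<le> x {a, d} + x {b, c}"
    by (rule cone_le) (use four_point(1)[OF v ne disj] k in auto)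
  moreover have "x {a, d} + x {b, c} \<le> x {a, c} + x {b, d}"
    by (rule cone_le) (use four_point(1)[OF v ne disj] k in auto)
  ultimately show "x {a, c} + x {b, d} = x {a, d} + x {b, c}" by (rule antisym)
qed

text \<open>For \<open>t = x {i, j}\<close> this extends \<open>\<rho>\<close> by the value 1 at
  \<open>{i, j}\<close>, so that four-point conditions involving \<open>{i, j}\<close> have the same
  form as the others.\<close>

definition R :: "real \<Rightarrow> nat set \<Rightarrow> real" where
  "R t e = trop_exp (x e - ereal t)"

lemma R_four_point:
  assumes k: "a \<in> {1..n}" "b \<in> {1..n}" "c \<in> {1..n}" "d \<in> {1..n}" "distinct [a, b, c, d]"
    and disj: "E (lab a) (lab b) \<inter> E (lab c) (lab d) = {}"
  shows "R t {a, c} * R t {b, d} = R t {a, d} * R t {b, c}" "R t {a, b} * R t {c, d} \<le> R t {a, c} * R t {b, d}"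
proof -
  have fin: "x e < \<infinity>" if "e \<in> pairs n" for e using x(1) that by (auto simp: tvecs_def)
  have p: "{a, b} \<in> pairs n" "{c, d} \<in> pairs n" "{a, c} \<in> pairs n" "{b, d} \<in> pairs n" "{a, d} \<in> pairs n" "{b, c} \<in> pairs n"
    using k pair by auto
  note f = four_point_limit[OF k disj]
  show "R t {a, b} * R t {c, d} \<le> R t {a, c} * R t {b, d}"
    unfolding R_def by (rule trop_exp_mono[OF f(2)]) (use fin p in auto)
  have "R t {a, c} * R t {b, d} \<le> R t {a, d} * R t {b, c}"
    unfolding R_def by (rule trop_exp_mono[OF eq_refl[OF f(1)]]) (use fin p in auto)
  moreover have "R t {a, d} * R t {b, c} \<le> R t {a, c} * R t {b, d}"
    unfolding R_def by (rule trop_exp_mono[OF eq_refl[OF f(1)[symmetric]]]) (use fin p in auto)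
  ultimately show "R t {a, c} * R t {b, d} = R t {a, d} * R t {b, c}" by (rule antisym)
qed

end

theorem corollary5p9:
  fixes n i j :: nat
    and x :: "nat set \<Rightarrow> ereal"
    and T :: "'v graph" and lab :: "nat \<Rightarrow> 'v"
    and ord :: "nat rel"
    and I J :: "nat set set"
    and \<rho> :: "nat set \<Rightarrow> real"
    and f :: "nat set \<Rightarrow> 'k :: nonarch_field lpoly"
  assumes x: "x \<in> tvecs n" "tp_class n x \<in> trop_Gr TYPE('k) n"
    and J: "J = vanishing_set n x"
    and ij: "i \<in> {1..n}" "j \<in> {1..n}" "i \<noteq> j" "{i, j} \<notin> J"
    and T: "leaf_labelled_tree n T lab" "tp_class n x \<in> tp_top n closure_of tree_cone n T lab"
    and ord: "partial_order_on ({1..n} - {i, j}) ord" "cherry_property n T lab i j ord"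
    and I: "compatible n T lab i j ord (J \<inter> chart_index n i j) I"
    and \<rho>: "\<And>e. e \<in> pairs n \<Longrightarrow> e \<noteq> {i, j} \<Longrightarrow> \<rho> e = trop_exp (x e - x {i, j})"
    and f: "\<And>e. f e = fiber_coord n i j I J e"
    and A: "A = laurent_algebra (I - J) \<rho>"
    and B: "B = laurent_domain_algebra A (pairs n - (I \<union> J \<union> {{i, j}}))
                  \<rho> (\<lambda>e. Poly_Mapping.lookup (f e)) \<rho> (\<lambda>e. Poly_Mapping.lookup (f e))"
  shows "\<exists>\<eta>. is_shilov_boundary B {\<eta>}"

proof -
  interpret tree_limit T n lab x
    using T x(1) by unfold_locales (auto simp: leaf_labelled_tree_def)
  let ?N = "{1..n} - {i, j}"
  let ?br = "attach_vertex T lab i j"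
  have ijp: "{i, j} \<in> pairs n" using ij pair by blast
  have fin: "x e < \<infinity>" if "e \<in> pairs n" for e using x(1) that by (auto simp: tvecs_def)
  have "x {i, j} \<noteq> - \<infinity>" "x {i, j} \<noteq> \<infinity>" using ij ijp J fin[OF ijp] by (auto simp: vanishing_set_def)
  \<comment> \<open>Finite because \<open>{i, j}\<close> is outside \<open>J\<close>; subtracting it
    normalises the representative of the class.\<close>
  then obtain t where t: "x {i, j} = ereal t" by (cases "x {i, j}") auto
  have \<rho>R: "\<rho> e = R t e" if "e \<in> pairs n" "e \<noteq> {i, j}" for e using \<rho>[OF that] t by (simp add: R_def)
  have Rij: "R t {i, j} = 1" by (simp add: R_def t trop_exp_def)
  have pairs: "{i, k} \<in> pairs n" "{j, k} \<in> pairs n" "{i, k} \<noteq> {i, j}" "{j, k} \<noteq> {i, j}" if "k \<in> ?N" for k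
    using that ij pair by (auto simp: doubleton_eq_iff)
  have pairs2: "{k, l} \<in> pairs n" "{k, l} \<noteq> {i, j}" if "k \<in> ?N" "l \<in> ?N" "k \<noteq> l" for k l
    using that pair by (auto simp: doubleton_eq_iff)
  have \<rho>1: "\<rho> {i, k} = R t {i, k}" "\<rho> {j, k} = R t {j, k}" if "k \<in> ?N" for k
    using \<rho>R pairs[OF that] by blast+
  have \<rho>2: "\<rho> {k, l} = R t {k, l}" if "k \<in> ?N" "l \<in> ?N" "k \<noteq> l" for k l
    using \<rho>R pairs2[OF that] by blast
  have li: "lab i \<in> leaves T" "lab j \<in> leaves T" "lab i \<noteq> lab j" using ij lab_leaf lab_eq by auto
  have lab_ne: "lab k \<noteq> lab l" if "k \<in> ?N" "l \<in> ?N" "k \<noteq> l" for k l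
    using that lab_eq[of k l] by simp
  have lk: "lab k \<in> leaves T" "lab k \<noteq> lab i" "lab k \<noteq> lab j" if "k \<in> ?N" for k
    using that ij lab_leaf lab_eq by auto
  have br: "?br k = att (lab i) (lab j) (lab k)" for k
    by (simp add: attach_vertex_def att_def[OF li])
  have interior: "?br k \<in> path_interior T lab i j" if "k \<in> ?N" for k
    unfolding br path_interior_def using att_facts[OF li lk[OF that]] by blast
  have branch: "branch n T lab i j (?br k) = {l \<in> ?N. ?br l = ?br k}" for k
    by (auto simp: branch_def)
  have ordN: "k \<in> ?N \<and> l \<in> ?N" if "(k, l) \<in> ord" for k l
    using ord(1) that by (auto simp: partial_order_on_def preorder_on_def)
  have ord_br: "?br k = ?br l" if kl: "(k, l) \<in> ord" for k l
  proof (rule ccontr)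
    assume "?br k \<noteq> ?br l"
    moreover have "k \<in> branch n T lab i j (?br k)" "l \<in> branch n T lab i j (?br l)"
      using ordN[OF kl] by (auto simp: branch_def)
    ultimately show False
      using ord(2) interior ordN[OF kl] kl unfolding cherry_property_def by blast
  qed
  interpret fs: fiber_setup n i j ?br ord I J \<rho> ?N "TYPE('k)"
  proof unfold_locales
    show "partial_order_on ?N ord" "i \<in> {1..n}" "j \<in> {1..n}" "i \<noteq> j" using ord ij by auto
    show "I \<subseteq> pairs n" "card I = 2 * (n - 2)" "{i, j} \<notin> I" using I by (auto simp: compatible_def)
    show "?br k = ?br l" if "(k, l) \<in> ord" for k l by (rule ord_br[OF that])
    show "(k, l) \<in> ord \<or> (l, k) \<in> ord" if "k \<in> ?N" "l \<in> ?N" "?br k = ?br l" "k \<noteq> l" for k l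
    proof -
      have "total_on (branch n T lab i j (?br k)) ord"
        using ord(2) interior[OF that(1)] unfolding cherry_property_def by blast
      then show ?thesis using that unfolding branch total_on_def by auto
    qed
    show "let L = {l \<in> ?N. ?br l = ?br k};
            c1 = compat_both ord L (J \<inter> chart_index n i j) i j I k;
            c2 = compat_one ord L (J \<inter> chart_index n i j) i j I k;
            c3 = compat_one ord L (J \<inter> chart_index n i j) j i I k
        in (c1 \<and> \<not> c2 \<and> \<not> c3) \<or> (\<not> c1 \<and> c2 \<and> \<not> c3) \<or> (\<not> c1 \<and> \<not> c2 \<and> c3)"
      if "k \<in> ?N" for k
    proof -
      have "k \<in> branch n T lab i j (?br k)" using that by (auto simp: branch_def)
      with I interior[OF that] show ?thesis unfolding compatible_def branch[symmetric] by blast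
    qed
    show "0 \<le> \<rho> e" if "e \<in> pairs n" "e \<noteq> {i, j}" for e
      using \<rho>R[OF that] by (simp add: R_def trop_exp_def)
    show "\<rho> e = 0 \<longleftrightarrow> e \<in> J" if "e \<in> pairs n" "e \<noteq> {i, j}" for e
      using \<rho>R[OF that] fin[OF that(1)] that(1) unfolding J vanishing_set_def
      by (cases "x e") (auto simp: R_def trop_exp_def)
    show "\<rho> {i, r} * \<rho> {j, s} = \<rho> {i, s} * \<rho> {j, r} \<and> \<rho> {r, s} \<le> \<rho> {i, r} * \<rho> {j, s}"
      if rs: "r \<in> ?N" "s \<in> ?N" "r \<noteq> s" "?br r = ?br s" for r s
    proof -
      \<comment> \<open>In one branch the quartet splits as \<open>rs|ij\<close>, so the two mixed
        products agree and dominate.\<close>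
      have "E (lab r) (lab s) \<inter> E (lab i) (lab j) = {}"
        using same_branch_disjoint[OF li lk[OF rs(1)] lk[OF rs(2)]] rs(4) br by simp
      then have "R t {r, i} * R t {s, j} = R t {r, j} * R t {s, i}" "R t {r, s} * R t {i, j} \<le> R t {r, i} * R t {s, j}"
        using R_four_point[of r s i j t] rs ij by auto
      then show ?thesis
        unfolding \<rho>1(1)[OF rs(1)] \<rho>1(1)[OF rs(2)] \<rho>1(2)[OF rs(1)] \<rho>1(2)[OF rs(2)] \<rho>2[OF rs(1-3)]
        by (simp add: Rij insert_commute mult.commute)
    qed
    show "\<rho> {r, s} = max (\<rho> {i, r} * \<rho> {j, s}) (\<rho> {i, s} * \<rho> {j, r})"
      if rs: "r \<in> ?N" "s \<in> ?N" "?br r \<noteq> ?br s" for r s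
    proof -
      have ne: "r \<noteq> s" using rs by auto
      \<comment> \<open>The case of the split \<open>ir|js\<close>; the split \<open>is|jr\<close>
        follows by exchanging \<open>r\<close> and \<open>s\<close>.\<close>
      have aux: "\<rho> {r, s} = \<rho> {i, s} * \<rho> {j, r} \<and> \<rho> {i, r} * \<rho> {j, s} \<le> \<rho> {r, s}"
        if rs: "r \<in> ?N" "s \<in> ?N" "r \<noteq> s" and d: "E (lab i) (lab r) \<inter> E (lab j) (lab s) = {}" for r s
      proof -
        have "R t {i, j} * R t {r, s} = R t {i, s} * R t {r, j}" "R t {i, r} * R t {j, s} \<le> R t {i, j} * R t {r, s}"
          using R_four_point[of i r j s t] rs ij d by auto
        then show ?thesis
          unfolding \<rho>1(1)[OF rs(1)] \<rho>1(1)[OF rs(2)] \<rho>1(2)[OF rs(1)] \<rho>1(2)[OF rs(2)] \<rho>2[OF rs(1-3)]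
          by (simp add: Rij insert_commute)
      qed
      have "E (lab i) (lab r) \<inter> E (lab j) (lab s) = {} \<or> E (lab i) (lab s) \<inter> E (lab j) (lab r) = {}"
        using diff_branch_disjoint[OF li lk[OF rs(1)] lk[OF rs(2)]] rs(3) br by simp
      then show ?thesis
      proof
        assume "E (lab i) (lab r) \<inter> E (lab j) (lab s) = {}"
        then show ?thesis using aux[OF rs(1,2) ne] by simp
      next
        assume "E (lab i) (lab s) \<inter> E (lab j) (lab r) = {}"
        then show ?thesis using aux[OF rs(2,1) ne[symmetric]] by (simp add: insert_commute)
      qed
    qed
    show "\<rho> {k, v} * \<rho> {i, l} = max (\<rho> {k, l} * \<rho> {i, v}) (\<rho> {l, v} * \<rho> {i, k})"
      if klv: "strictly_below ord k l" "strictly_below ord l v" for k l v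
    proof -
      have N: "k \<in> ?N" "l \<in> ?N" "v \<in> ?N" and ne: "k \<noteq> l" "l \<noteq> v" and o: "(k, l) \<in> ord" "(l, v) \<in> ord"
        using klv ordN by (auto simp: strictly_below_def)
      have kv: "k \<noteq> v" using o ne ord(1) by (auto simp: partial_order_on_def dest: antisymD)
      note \<rho>kl = \<rho>1(1)[OF N(1)] \<rho>1(1)[OF N(2)] \<rho>1(1)[OF N(3)] \<rho>2[OF N(1,2) ne(1)]
        \<rho>2[OF N(2,3) ne(2)] \<rho>2[OF N(1,3) kv]
      have img: "lab ` {i, k, l, v} = {lab i, lab k, lab l, lab v}" by simp
      have dist: "distinct [lab i, lab k, lab l, lab v]" "{lab i, lab k, lab l, lab v} \<subseteq> leaves T"
        using lk[OF N(1)] lk[OF N(2)] lk[OF N(3)] li lab_ne[OF N(1,2) ne(1)] lab_ne[OF N(2,3) ne(2)]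
          lab_ne[OF N(1,3) kv] by (simp_all add: eq_commute[of "lab i"])
      \<comment> \<open>The split is \<open>kl|iv\<close> or \<open>lv|ik\<close>. In both cases the
        product for \<open>kv\<close> and \<open>il\<close> is one of the two equal larger ones,
        hence the maximum of the other two.\<close>
      have "is_cherry (quartet T lab {i, k, l, v}) (lab k) (lab l) \<or> is_cherry (quartet T lab {i, k, l, v}) (lab l) (lab v)"
        using ord(2) klv unfolding cherry_property_def by blast
      then show ?thesis
      proof
        assume "is_cherry (quartet T lab {i, k, l, v}) (lab k) (lab l)"
        then have "E (lab k) (lab l) \<inter> E (lab i) (lab v) = {}"
          using dist by (intro cherry_disjoint) (simp_all add: quartet_def img)
        then have "R t {k, i} * R t {l, v} = R t {k, v} * R t {l, i}" "R t {k, l} * R t {i, v} \<le> R t {k, i} * R t {l, v}"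
          using R_four_point[of k l i v t] N ne kv ij by auto
        then show ?thesis unfolding \<rho>kl by (simp add: insert_commute mult.commute)
      next
        assume ch: "is_cherry (quartet T lab {i, k, l, v}) (lab l) (lab v)"
        have "{lab i, lab k, lab l, lab v} = {lab i, lab l, lab v, lab k}" by auto
        then have "E (lab l) (lab v) \<inter> E (lab i) (lab k) = {}"
          using dist ch by (intro cherry_disjoint) (auto simp: quartet_def img)
        then have "R t {l, i} * R t {v, k} = R t {l, k} * R t {v, i}" "R t {l, v} * R t {i, k} \<le> R t {l, i} * R t {v, k}"
          using R_four_point[of l v i k t] N ne kv ij by auto
        then show ?thesis unfolding \<rho>kl by (simp add: insert_commute mult.commute)
      qed
    qed
  qed
  let ?S = "pairs n - (I \<union> J \<union> {{i, j}})"
  have finI: "finite (I - J)" using fs.finite_pairs fs.I(1) finite_subset by blast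
  have pos: "0 < \<rho> e" if "e \<in> pairs n" "e \<noteq> {i, j}" "e \<notin> J" for e using fs.\<rho>_pos that by blast
  interpret gn: gauss_norm "I - J" \<rho>
    using finI pos fs.I(1,3) by unfold_locales auto
  have L: "mult_normed_cring (laurent_algebra (I - J) \<rho> :: ((nat set \<Rightarrow>\<^sub>0 int) \<Rightarrow> 'k) normed_ring)"
    by (rule gn.mult_normed_cring_Ls)
  have "laurent_domain A ?S (\<lambda>e. Poly_Mapping.lookup (f e)) \<rho>"
  proof (intro laurent_domain.intro laurent_domain_axioms.intro)
    show "mult_normed_cring A" unfolding A by (rule L)
    show "finite ?S" using fs.finite_pairs by simp
    fix e assume e: "e \<in> ?S"
    show "0 < \<rho> e" using e pos by blast
    show "Poly_Mapping.lookup (f e) \<in> carrier A"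
      unfolding A f by (rule gn.lookup_in_carrier[OF fs.gnorm_fiber_coord(1)[OF e]])
    show "nrm A (Poly_Mapping.lookup (f e)) = \<rho> e"
      unfolding A f gn.nrm_lookup by (rule fs.gnorm_fiber_coord(2)[OF e])
  qed
  then show ?thesis unfolding B by (rule laurent_domain.laurent_domain_is_shilov_boundary)
qed

end
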